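(* Let $\mathcal E$ be a complex Hilbert space and let $\mu$ be an $\mathcal L_+(\mathcal E)$-valued measure on $\mathbb T$. For $t\ge0$ let $\phi_t(z)=\exp\left(t\frac{z+1}{z-1}\right)$, $z\in\mathbb D$. Then the following are equivalent: (i) For every $t\ge0$, the multiplication operator $M_{\phi_t}$ is a bounded operator on $\mathcal D_\mu^2(\mathcal E)$, and the family $(M_{\phi_t})_{t\ge0}$ is a $C_0$-semigroup on $\mathcal D_\mu^2(\mathcal E)$. (ii) There exists $w_1\ge0$ such that $$\frac1{2\pi}\int_{\mathbb T}\langle d\mu\,f,f\rangle\le w_1\|(I-M_z)f\|^2_{\mathcal D_\mu^2(\mathcal E)},\quad f\in\mathcal P_a(\mathcal E).$$ (iii) The set function $\tilde\mu:E\mapsto\int_E\frac{d\mu(\zeta)}{|1-\zeta|^2}$ is an $\mathcal L_+(\mathcal E)$-valued measure, and there exists $w_2\ge0$ such that $$\frac1{2\pi}\int_{\mathbb T}\langle d\tilde\mu\,f,f\rangle\le w_2\|f\|^2_{\mathcal D_\mu^2(\mathcal E)},\quad f\in\mathcal P_a(\mathcal E).$$ If any of the conditions (i), (ii), (iii) is satisfied, then the semigroup $(M_{\phi_t})_{t\ge0}$ is $2$-isometric, has cogenerator $M_z$, and is quasicontractive with some parameter $w\ge0$. The optimal (smallest possible) nonnegative values for $w$, $w_1$ and $w_2$ coincide.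
   Context: $\mathbb D$ is the open unit disc, $\mathbb T$ the unit circle, $\lambda$ arc length on $\mathbb T$, $dA$ area measure. $\mathcal L_+(\mathcal E)$ is the cone of positive bounded operators on $\mathcal E$. $\mathcal P_a(\mathcal E)$ is the space of analytic polynomials $\sum_{k=0}^N a_kz^k$, $a_k\in\mathcal E$. $M_\phi$ denotes multiplication by the scalar function $\phi$; $M_z$ is multiplication by $z\mapsto z$. An $\mathcal L_+(\mathcal E)$-valued measure is a finitely additive set function $\mu$ from the Borel sets of $\mathbb T$ to $\mathcal L_+(\mathcal E)$ such that for all $x,y\in\mathcal E$, $\mu_{x,y}:E\mapsto\langle\mu(E)x,y\rangle$ is a complex regular Borel measure. For bounded Borel $f:\mathbb T\to\mathbb C$, $\int_{\mathbb T}f\,d\mu$ is the bounded operator with $\langle\int f\,d\mu\,x,y\rangle=\int f\,d\mu_{x,y}$. Fourier coefficients: $\hat\mu(n)=\frac1{2\pi}\int_{\mathbb T}\overline{\zeta^n}\,d\mu(\zeta)$, $n\in\mathbb Z$. Poisson extension: $P_\mu(z)=\frac1{2\pi}\int_{\mathbb T}\frac{1-|z|^2}{|\zeta-z|^2}\,d\mu(\zeta)$, $z\in\mathbb D$. For $f,g\in\mathcal P_a(\mathcal E)$ with coefficients $\hat f(k),\hat g(k)$, $$\frac1{2\pi}\int_{\mathbb T}\langle d\mu\,f,g\rangle:=\sum_{k,l\ge0}\langle\hat\mu(l-k)\hat f(k),\hat g(l)\rangle.$$ That $\tilde\mu$ is an $\mathcal L_+(\mathcal E)$-valued measure means that it is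 a well-defined such measure with $\langle\tilde\mu(E)x,x\rangle=\int_E|1-\zeta|^{-2}\,d\mu_{x,x}(\zeta)<\infty$ for all Borel $E$ and $x\in\mathcal E$, with the convention $|1-\zeta|^{-2}=\infty$ at $\zeta=1$. $H^2(\mathcal E)$ is the Hardy space of functions $f(z)=\sum_{k\ge0}\hat f(k)z^k$ with $\hat f(k)\in\mathcal E$, $\|f\|^2_{H^2(\mathcal E)}=\sum_k\|\hat f(k)\|^2<\infty$. For analytic $f:\mathbb D\to\mathcal E$ let $\mathcal D_\mu(f)=\frac1\pi\int_{\mathbb D}\langle P_\mu(z)f'(z),f'(z)\rangle\,dA(z)$. The harmonically weighted Dirichlet space $\mathcal D_\mu^2(\mathcal E)$ is the space of $f\in H^2(\mathcal E)$ with $\mathcal D_\mu(f)<\infty$, with norm $\|f\|^2_{\mathcal D_\mu^2(\mathcal E)}=\|f\|^2_{H^2(\mathcal E)}+\mathcal D_\mu(f)$. A bounded operator $T$ is a $2$-isometry if $\|T^2x\|^2-2\|Tx\|^2+\|x\|^2=0$ for all $x$; a $C_0$-semigroup is $2$-isometric if all its members are. If $A$ is the generator of a $C_0$-semigroup and $1$ is in its resolvent set, the cogenerator is $(A+I)(A-I)^{-1}$. A $C_0$-semigroup $(T_t)$ is quasicontractive with parameter $w$ if $\|T_t\|\le e^{wt}$ for all $t\ge0$. *)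

theory Defs
  imports
    "HOL-Analysis.Analysis"
    "HOL-Computational_Algebra.Polynomial"
    "HOL-Library.Function_Algebras"
begin

section \<open>Complex vector spaces and complex Hilbert spaces\<close>

class complex_vector = ab_group_add +
  fixes scaleC :: "complex \<Rightarrow> 'a \<Rightarrow> 'a" (infixr "*\<^sub>C" 75)
  assumes scaleC_add_right: "a *\<^sub>C (x + y) = a *\<^sub>C x + a *\<^sub>C y"
    and scaleC_add_left: "(a + b) *\<^sub>C x = a *\<^sub>C x + b *\<^sub>C x"
    and scaleC_scaleC: "a *\<^sub>C (b *\<^sub>C x) = (a * b) *\<^sub>C x"
    and scaleC_one: "1 *\<^sub>C x = x"

instantiation "fun" :: (type, complex_vector) complex_vector
begin

definition scaleC_fun_def: "a *\<^sub>C f = (\<lambda>x. a *\<^sub>C f x)"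

instance
  by standard
    (simp_all add: scaleC_fun_def fun_eq_iff scaleC_add_right scaleC_add_left
      scaleC_scaleC scaleC_one)

end

text \<open>The inner product is linear in its first argument. Its real part is the underlying real
  inner product, so that the norm and the metric of the class are those induced by \<open>cinner\<close>.\<close>

class complex_hilbert_space = complex_vector + real_inner + complete_space +
  fixes cinner :: "'a \<Rightarrow> 'a \<Rightarrow> complex"
  assumes scaleR_scaleC: "r *\<^sub>R x = complex_of_real r *\<^sub>C x"
    and cinner_commute: "cinner x y = cnj (cinner y x)"
    and cinner_add_left: "cinner (x + y) z = cinner x z + cinner y z"
    and cinner_scaleC_left: "cinner (a *\<^sub>C x) y = a * cinner x y"
    and Re_cinner: "Re (cinner x y) = x \<bullet> y"

instantiation complex :: complex_hilbert_space
begin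

definition scaleC_complex_def: "a *\<^sub>C (z :: complex) = a * z"
definition cinner_complex_def: "cinner (z :: complex) w = z * cnj w"

instance
  by standard
    (simp_all add: scaleC_complex_def cinner_complex_def algebra_simps inner_complex_def
      scaleR_conv_of_real)

end

definition bounded_clinear :: "('e::complex_hilbert_space \<Rightarrow> 'e) \<Rightarrow> bool" where
  "bounded_clinear T \<longleftrightarrow> bounded_linear T \<and> (\<forall>a x. T (a *\<^sub>C x) = a *\<^sub>C T x)"

definition positive_operator :: "('e::complex_hilbert_space \<Rightarrow> 'e) \<Rightarrow> bool" where
  "positive_operator T \<longleftrightarrow>
     bounded_clinear T \<and> (\<forall>x. Im (cinner (T x) x) = 0 \<and> 0 \<le> Re (cinner (T x) x))"

section \<open>Operator-valued measures on the unit circle\<close>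

abbreviation circle :: "complex set" where
  "circle \<equiv> sphere 0 1"

abbreviation disc :: "complex set" where
  "disc \<equiv> ball 0 1"

text \<open>The $\sigma$-algebra of Borel subsets of the circle; set functions on it are modelled as
  functions on all sets, of which only the values on \<open>circle_borel\<close> matter.\<close>

definition circle_borel :: "complex set set" where
  "circle_borel = sets (restrict_space borel circle)"

text \<open>Regularity is stated with \<open>\<bar>\<nu> A\<bar>\<close> for all Borel \<open>A \<subseteq> U - K\<close> in place of the total
  variation of \<open>U - K\<close>; the supremum of the former and the latter differ at most by a factor 4.\<close>

definition complex_regular_measure :: "(complex set \<Rightarrow> complex) \<Rightarrow> bool" where
  "complex_regular_measure \<nu> \<longleftrightarrow>
     (\<forall>A :: nat \<Rightarrow> complex set. range A \<subseteq> circle_borel \<longrightarrow> disjoint_family A \<longrightarrow>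
        (\<lambda>n. \<nu> (A n)) sums \<nu> (\<Union>n. A n)) \<and>
     (\<forall>E\<in>circle_borel. \<forall>\<epsilon>>0. \<exists>K U. compact K \<and> openin (top_of_set circle) U \<and>
        K \<subseteq> E \<and> E \<subseteq> U \<and> (\<forall>A\<in>circle_borel. A \<subseteq> U - K \<longrightarrow> cmod (\<nu> A) < \<epsilon>))"

definition operator_measure :: "(complex set \<Rightarrow> 'e::complex_hilbert_space \<Rightarrow> 'e) \<Rightarrow> bool" where
  "operator_measure \<mu> \<longleftrightarrow>
     (\<forall>E\<in>circle_borel. positive_operator (\<mu> E)) \<and>
     (\<forall>E\<in>circle_borel. \<forall>F\<in>circle_borel. E \<inter> F = {} \<longrightarrow> \<mu> (E \<union> F) = \<mu> E + \<mu> F) \<and>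
     (\<forall>x y. complex_regular_measure (\<lambda>E. cinner (\<mu> E x) y))"

text \<open>Integration against a complex measure \<open>\<nu> = m\<^sub>1 - m\<^sub>2 + \<i> (m\<^sub>3 - m\<^sub>4)\<close> with finite positive
  \<open>m\<^sub>i\<close>. Such a representation exists (Jordan decomposition), and the value does not depend on
  it when the integrand is a bounded Borel function.\<close>

definition complex_measure_integral ::
    "(complex set \<Rightarrow> complex) \<Rightarrow> (complex \<Rightarrow> complex) \<Rightarrow> complex" where
  "complex_measure_integral \<nu> f = (THE I. \<exists>m1 m2 m3 m4 :: complex measure.
     (\<forall>m\<in>{m1, m2, m3, m4}. finite_measure m \<and> sets m = circle_borel) \<and>
     (\<forall>E\<in>circle_borel. \<nu> E = of_real (measure m1 E - measure m2 E)
                              + \<i> * of_real (measure m3 E - measure m4 E)) \<and>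
     I = ((\<integral>\<zeta>. f \<zeta> \<partial>m1) - (\<integral>\<zeta>. f \<zeta> \<partial>m2)) + \<i> * ((\<integral>\<zeta>. f \<zeta> \<partial>m3) - (\<integral>\<zeta>. f \<zeta> \<partial>m4)))"

definition operator_integral ::
    "(complex set \<Rightarrow> 'e::complex_hilbert_space \<Rightarrow> 'e) \<Rightarrow> (complex \<Rightarrow> complex) \<Rightarrow> 'e \<Rightarrow> 'e" where
  "operator_integral \<mu> f = (THE T. bounded_clinear T \<and>
     (\<forall>x y. cinner (T x) y = complex_measure_integral (\<lambda>E. cinner (\<mu> E x) y) f))"

definition fourier_coeff ::
    "(complex set \<Rightarrow> 'e::complex_hilbert_space \<Rightarrow> 'e) \<Rightarrow> int \<Rightarrow> 'e \<Rightarrow> 'e" where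
  "fourier_coeff \<mu> n =
     complex_of_real (1 / (2 * pi)) *\<^sub>C operator_integral \<mu> (\<lambda>\<zeta>. cnj (\<zeta> powi n))"

definition poisson_ext ::
    "(complex set \<Rightarrow> 'e::complex_hilbert_space \<Rightarrow> 'e) \<Rightarrow> complex \<Rightarrow> 'e \<Rightarrow> 'e" where
  "poisson_ext \<mu> z =
     complex_of_real (1 / (2 * pi)) *\<^sub>C
       operator_integral \<mu> (\<lambda>\<zeta>. complex_of_real ((1 - (cmod z)\<^sup>2) / (cmod (\<zeta> - z))\<^sup>2))"

text \<open>The form $\frac{1}{2\pi}\int_{\mathbb T}\langle d\mu\, f, g\rangle$ on analytic polynomials.
  An analytic polynomial with coefficients in \<open>'e\<close> is an element of \<open>'e poly\<close>.\<close>

definition measure_form ::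
    "(complex set \<Rightarrow> 'e::complex_hilbert_space \<Rightarrow> 'e) \<Rightarrow> 'e poly \<Rightarrow> 'e poly \<Rightarrow> complex" where
  "measure_form \<mu> f g =
     (\<Sum>k\<le>degree f. \<Sum>l\<le>degree g.
        cinner (fourier_coeff \<mu> (int l - int k) (coeff f k)) (coeff g l))"

text \<open>The positive measure \<open>\<mu>\<^bsub>x,x\<^esub>\<close>.\<close>

definition diag_measure ::
    "(complex set \<Rightarrow> 'e::complex_hilbert_space \<Rightarrow> 'e) \<Rightarrow> 'e \<Rightarrow> complex measure" where
  "diag_measure \<mu> x = measure_of circle circle_borel (\<lambda>E. ennreal (Re (cinner (\<mu> E x) x)))"

text \<open>\<open>tilde_measure_spec \<mu> E T\<close> states that \<open>T\<close> is the operator $\tilde\mu(E)$; the equation with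
  a value of \<open>ennreal\<close> in particular forces the integral to be finite.\<close>

definition tilde_measure_spec ::
    "(complex set \<Rightarrow> 'e::complex_hilbert_space \<Rightarrow> 'e) \<Rightarrow> complex set \<Rightarrow> ('e \<Rightarrow> 'e) \<Rightarrow> bool" where
  "tilde_measure_spec \<mu> E T \<longleftrightarrow> positive_operator T \<and>
     (\<forall>x. ennreal (Re (cinner (T x) x)) =
        (\<integral>\<^sup>+\<zeta>\<in>E. (if \<zeta> = 1 then \<infinity> else ennreal (1 / (cmod (1 - \<zeta>))\<^sup>2)) \<partial>diag_measure \<mu> x))"

definition tilde_measure ::
    "(complex set \<Rightarrow> 'e::complex_hilbert_space \<Rightarrow> 'e) \<Rightarrow> complex set \<Rightarrow> 'e \<Rightarrow> 'e" where
  "tilde_measure \<mu> E = (THE T. tilde_measure_spec \<mu> E T)"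

definition tilde_is_operator_measure ::
    "(complex set \<Rightarrow> 'e::complex_hilbert_space \<Rightarrow> 'e) \<Rightarrow> bool" where
  "tilde_is_operator_measure \<mu> \<longleftrightarrow>
     operator_measure (tilde_measure \<mu>) \<and>
     (\<forall>E\<in>circle_borel. tilde_measure_spec \<mu> E (tilde_measure \<mu> E))"

section \<open>Hardy space and harmonically weighted Dirichlet space\<close>

text \<open>Functions on the disc are modelled as functions on the complex plane vanishing off the disc,
  so that equality of functions on the disc is equality in HOL.\<close>

definition has_taylor :: "(complex \<Rightarrow> 'e::complex_hilbert_space) \<Rightarrow> (nat \<Rightarrow> 'e) \<Rightarrow> bool" where
  "has_taylor f a \<longleftrightarrow> (\<forall>z\<in>disc. (\<lambda>k. z ^ k *\<^sub>C a k) sums f z)"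

definition taylor_coeff :: "(complex \<Rightarrow> 'e::complex_hilbert_space) \<Rightarrow> nat \<Rightarrow> 'e" where
  "taylor_coeff f = (THE a. has_taylor f a)"

definition hardy :: "(complex \<Rightarrow> 'e::complex_hilbert_space) set" where
  "hardy = {f. (\<forall>z. z \<notin> disc \<longrightarrow> f z = 0) \<and>
               (\<exists>a. has_taylor f a \<and> summable (\<lambda>k. (norm (a k))\<^sup>2))}"

definition hardy_norm :: "(complex \<Rightarrow> 'e::complex_hilbert_space) \<Rightarrow> real" where
  "hardy_norm f = sqrt (\<Sum>k. (norm (taylor_coeff f k))\<^sup>2)"

definition poly_fun :: "'e::complex_hilbert_space poly \<Rightarrow> complex \<Rightarrow> 'e" where
  "poly_fun p z = (if z \<in> disc then \<Sum>k\<le>degree p. z ^ k *\<^sub>C coeff p k else 0)"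

definition cderiv :: "(complex \<Rightarrow> 'e::complex_hilbert_space) \<Rightarrow> complex \<Rightarrow> 'e" where
  "cderiv f z = Lim (at z) (\<lambda>w. inverse (w - z) *\<^sub>C (f w - f z))"

definition dirichlet_integral ::
    "(complex set \<Rightarrow> 'e::complex_hilbert_space \<Rightarrow> 'e) \<Rightarrow> (complex \<Rightarrow> 'e) \<Rightarrow> ennreal" where
  "dirichlet_integral \<mu> f = ennreal (1 / pi) *
     (\<integral>\<^sup>+z\<in>disc. ennreal (Re (cinner (poisson_ext \<mu> z (cderiv f z)) (cderiv f z))) \<partial>lborel)"

definition dirichlet_space ::
    "(complex set \<Rightarrow> 'e::complex_hilbert_space \<Rightarrow> 'e) \<Rightarrow> (complex \<Rightarrow> 'e) set" where
  "dirichlet_space \<mu> = {f \<in> hardy. dirichlet_integral \<mu> f < \<infinity>}"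

definition dirichlet_norm ::
    "(complex set \<Rightarrow> 'e::complex_hilbert_space \<Rightarrow> 'e) \<Rightarrow> (complex \<Rightarrow> 'e) \<Rightarrow> real" where
  "dirichlet_norm \<mu> f = sqrt ((hardy_norm f)\<^sup>2 + enn2real (dirichlet_integral \<mu> f))"

definition mult_op ::
    "(complex \<Rightarrow> complex) \<Rightarrow> (complex \<Rightarrow> 'e::complex_hilbert_space) \<Rightarrow> complex \<Rightarrow> 'e" where
  "mult_op \<phi> f = (\<lambda>z. \<phi> z *\<^sub>C f z)"

definition phi :: "real \<Rightarrow> complex \<Rightarrow> complex" where
  "phi t z = exp (of_real t * ((z + 1) / (z - 1)))"

section \<open>Operators and semigroups on a normed space given by a carrier and a norm\<close>

text \<open>Throughout, \<open>X\<close> is a linear subspace of the ambient vector space \<open>'v\<close>, \<open>N\<close> is a norm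
  on \<open>X\<close>, and an operator on \<open>X\<close> is a function on \<open>'v\<close> of which only the values on \<open>X\<close> matter.\<close>

definition bounded_operator_on ::
    "'v::complex_vector set \<Rightarrow> ('v \<Rightarrow> real) \<Rightarrow> ('v \<Rightarrow> 'v) \<Rightarrow> bool" where
  "bounded_operator_on X N T \<longleftrightarrow>
     (\<forall>x\<in>X. T x \<in> X) \<and>
     (\<forall>x\<in>X. \<forall>y\<in>X. T (x + y) = T x + T y) \<and>
     (\<forall>a. \<forall>x\<in>X. T (a *\<^sub>C x) = a *\<^sub>C T x) \<and>
     (\<exists>C. \<forall>x\<in>X. N (T x) \<le> C * N x)"

definition op_norm_on :: "'v::complex_vector set \<Rightarrow> ('v \<Rightarrow> real) \<Rightarrow> ('v \<Rightarrow> 'v) \<Rightarrow> real" where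
  "op_norm_on X N T = (SUP x\<in>X. N (T x) / N x)"

definition two_isometry_on ::
    "'v::complex_vector set \<Rightarrow> ('v \<Rightarrow> real) \<Rightarrow> ('v \<Rightarrow> 'v) \<Rightarrow> bool" where
  "two_isometry_on X N T \<longleftrightarrow> bounded_operator_on X N T \<and>
     (\<forall>x\<in>X. (N (T (T x)))\<^sup>2 - 2 * (N (T x))\<^sup>2 + (N x)\<^sup>2 = 0)"

definition C0_semigroup_on ::
    "'v::complex_vector set \<Rightarrow> ('v \<Rightarrow> real) \<Rightarrow> (real \<Rightarrow> 'v \<Rightarrow> 'v) \<Rightarrow> bool" where
  "C0_semigroup_on X N T \<longleftrightarrow>
     (\<forall>t\<ge>0. bounded_operator_on X N (T t)) \<and>
     (\<forall>x\<in>X. T 0 x = x) \<and>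
     (\<forall>s\<ge>0. \<forall>t\<ge>0. \<forall>x\<in>X. T (s + t) x = T s (T t x)) \<and>
     (\<forall>x\<in>X. ((\<lambda>t. N (T t x - x)) \<longlongrightarrow> 0) (at_right 0))"

definition two_isometric_semigroup_on ::
    "'v::complex_vector set \<Rightarrow> ('v \<Rightarrow> real) \<Rightarrow> (real \<Rightarrow> 'v \<Rightarrow> 'v) \<Rightarrow> bool" where
  "two_isometric_semigroup_on X N T \<longleftrightarrow>
     C0_semigroup_on X N T \<and> (\<forall>t\<ge>0. two_isometry_on X N (T t))"

definition quasicontractive_on ::
    "'v::complex_vector set \<Rightarrow> ('v \<Rightarrow> real) \<Rightarrow> (real \<Rightarrow> 'v \<Rightarrow> 'v) \<Rightarrow> real \<Rightarrow> bool" where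
  "quasicontractive_on X N T w \<longleftrightarrow>
     C0_semigroup_on X N T \<and> (\<forall>t\<ge>0. op_norm_on X N (T t) \<le> exp (w * t))"

text \<open>Unbounded operators are represented by their graphs.\<close>

definition generator_on ::
    "'v::complex_vector set \<Rightarrow> ('v \<Rightarrow> real) \<Rightarrow> (real \<Rightarrow> 'v \<Rightarrow> 'v) \<Rightarrow> ('v \<times> 'v) set" where
  "generator_on X N T = {(x, y). x \<in> X \<and> y \<in> X \<and>
     ((\<lambda>t. N (complex_of_real (1 / t) *\<^sub>C (T t x - x) - y)) \<longlongrightarrow> 0) (at_right 0)}"

text \<open>\<open>R\<close> is a bounded, everywhere defined two-sided inverse of \<open>A - cI\<close>; in other words,
  \<open>c\<close> is in the resolvent set of \<open>A\<close> and \<open>R = (A - cI)\<^sup>-\<^sup>1\<close>.\<close>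

definition is_resolvent_on ::
    "'v::complex_vector set \<Rightarrow> ('v \<Rightarrow> real) \<Rightarrow> ('v \<times> 'v) set \<Rightarrow> complex \<Rightarrow> ('v \<Rightarrow> 'v) \<Rightarrow> bool"
  where
  "is_resolvent_on X N A c R \<longleftrightarrow>
     bounded_operator_on X N R \<and>
     (\<forall>y\<in>X. \<exists>z. (R y, z) \<in> A \<and> z - c *\<^sub>C R y = y) \<and>
     (\<forall>(x, z)\<in>A. R (z - c *\<^sub>C x) = x)"

definition is_cogenerator_on ::
    "'v::complex_vector set \<Rightarrow> ('v \<Rightarrow> real) \<Rightarrow> (real \<Rightarrow> 'v \<Rightarrow> 'v) \<Rightarrow> ('v \<Rightarrow> 'v) \<Rightarrow> bool" where
  "is_cogenerator_on X N T C \<longleftrightarrow>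
     (\<exists>R. is_resolvent_on X N (generator_on X N T) 1 R \<and>
       (\<forall>y\<in>X. \<exists>z. (R y, z) \<in> generator_on X N T \<and> C y = z + R y))"

definition is_least :: "(real \<Rightarrow> bool) \<Rightarrow> real \<Rightarrow> bool" where
  "is_least P w \<longleftrightarrow> P w \<and> (\<forall>v. P v \<longrightarrow> w \<le> v)"

end

theory Submission
  imports Defs
begin

text \<open>On polynomials $\frac{1}{2\pi}\int\langle d\mu\,f,f\rangle = \|M_zf\|^2-\|f\|^2 =: q(f)$, and
  $q(M_zf)=q(f)$. The generator of the semigroup maps $(I-M_z)g$ to $-(I+M_z)g$, so that
  $\frac{d}{dt}\|M_{\phi_t}f\|^2 = 2q(g)$ at $f=(I-M_z)g$; since $q$ is invariant under the semigroup,
  $\|M_{\phi_t}f\|^2=\|f\|^2+2tq(g)$. This is the $2$-isometry property, and it shows that a bound on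
  $M_{\phi_t}$ for small $t$ implies (ii), and that quasicontractivity with parameter $w$ implies (ii)
  with constant $w$. Conversely (ii) bounds $q$ at $(I-\alpha M_z)^{-1}f$, $\alpha\to1$. This controls
  powers of Blaschke factors of $M_z$ that converge to $M_{\phi_t}$. Since
  $q((I-\alpha M_z)^{-1}f)=\frac1{2\pi}\int|1-\alpha\zeta|^{-2}\langle d\mu\,f,f\rangle$, it also gives (iii) with
  the same constant by Fatou's lemma. Finally (iii) applied to $(1-z)f$ is (ii).\<close>

section \<open>Complex Hilbert spaces\<close>

text \<open>The norm is given by an area integral, while the argument needs inner products, so
  everything rests on its matrix on polynomials: orthogonality of monomials on discs turns the
  Dirichlet integral into the sum of
  \<open>real (min k l) * Re (mf (int l - int k) (a k) (a l))\<close>. Shifting the coefficients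
  raises \<open>min k l\<close> by 1, and this is how \<open>q\<close> arises. The matrix also gives
  density of polynomials: dilations contract the norm because the kernels that appear are positive.
  The operator theory takes place in an abstract space with point evaluations and a Fatou property,
  which takes over from completeness and from vector-valued integrals. Boundedness of the semigroup
  near 0 is not given and comes from uniform boundedness; differentiation needs elements (I - M_z)g,
  and these are dense because averages along orbits have this form. The optimal constants agree
  because all three conditions are proved equivalent, with unchanged constant, to the single
  predicate \<open>dominated\<close>; for quasicontractivity this uses that exp(2wt) and 1 + 2wt
  agree to first order at t = 0.\<close>

instance complex_hilbert_space \<subseteq> banach ..

lemma scaleC_zero_right [simp]: "a *\<^sub>C (0 :: 'a::complex_vector) = 0"
  using scaleC_add_right[of a "0 :: 'a" 0] by simp

lemma scaleC_zero_left [simp]: "0 *\<^sub>C (x :: 'a::complex_vector) = 0"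
  using scaleC_add_left[of 0 0 x] by simp

lemma scaleC_minus_right: "a *\<^sub>C (- x) = - (a *\<^sub>C (x :: 'a::complex_vector))"
  using scaleC_add_right[of a "- x" x] by (simp add: eq_neg_iff_add_eq_0)

lemma scaleC_minus_left: "(- a) *\<^sub>C x = - (a *\<^sub>C (x :: 'a::complex_vector))"
  using scaleC_add_left[of "- a" a x] by (simp add: eq_neg_iff_add_eq_0)

lemma scaleC_diff_right: "a *\<^sub>C (x - y) = a *\<^sub>C x - a *\<^sub>C (y :: 'a::complex_vector)"
  using scaleC_add_right[of a x "- y"] by (simp add: scaleC_minus_right)

lemma scaleC_diff_left: "(a - b) *\<^sub>C x = a *\<^sub>C x - b *\<^sub>C (x :: 'a::complex_vector)"
  using scaleC_add_left[of a "- b" x] by (simp add: scaleC_minus_left)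

lemma scaleC_one' [simp]: "1 *\<^sub>C (x :: 'a::complex_vector) = x"
  by (rule scaleC_one)

lemma scaleC_commute: "a *\<^sub>C b *\<^sub>C x = b *\<^sub>C a *\<^sub>C (x :: 'a::complex_vector)"
  by (simp add: scaleC_scaleC mult.commute)

lemma cinner_add_right:
  "cinner x (y + z) = cinner x y + cinner x (z :: 'e::complex_hilbert_space)"
  by (metis cinner_add_left cinner_commute complex_cnj_add)

lemma cinner_scaleC_right:
  "cinner x (a *\<^sub>C y) = cnj a * cinner x (y :: 'e::complex_hilbert_space)"
  by (metis cinner_scaleC_left cinner_commute complex_cnj_mult)

lemma cinner_self: "cinner x x = of_real ((norm (x :: 'e::complex_hilbert_space))\<^sup>2)"
proof -
  have "Im (cinner x x) = 0"
    using cinner_commute[of x x] by (metis cnj.simps(2) neg_equal_0_iff_equal equal_neg_zero)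
  moreover have "Re (cinner x x) = (norm x)\<^sup>2"
    by (simp add: Re_cinner power2_norm_eq_inner)
  ultimately show ?thesis by (simp add: complex_eq_iff)
qed

lemma norm_scaleC: "norm (a *\<^sub>C x) = cmod a * norm (x :: 'e::complex_hilbert_space)"
proof -
  have "complex_of_real ((norm (a *\<^sub>C x))\<^sup>2) = a * cnj a * of_real ((norm x)\<^sup>2)"
    by (simp only: cinner_self[symmetric] cinner_scaleC_left cinner_scaleC_right) (simp add: mult_ac)
  also have "\<dots> = of_real ((cmod a * norm x)\<^sup>2)"
    by (simp add: complex_norm_square[symmetric] power_mult_distrib)
  finally have "(norm (a *\<^sub>C x))\<^sup>2 = (cmod a * norm x)\<^sup>2"
    using of_real_eq_iff by blast
  then show ?thesis by (simp add: power2_eq_iff_nonneg)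
qed

lemma norm_cinner: "cmod (cinner x y) \<le> norm x * norm (y :: 'e::complex_hilbert_space)"
proof (cases "cinner x y = 0")
  case False
  \<comment> \<open>The phase \<open>u\<close> turns \<open>cinner x y\<close> into its modulus, so
    that the real Cauchy-Schwarz inequality applies to \<open>u *\<^sub>C x\<close> and
    \<open>y\<close>.\<close>
  define u where "u = cnj (cinner x y) / of_real (cmod (cinner x y))"
  have u: "cmod u = 1" "u * cinner x y = of_real (cmod (cinner x y))"
    using False by (auto simp: u_def norm_divide complex_norm_square[symmetric] mult.commute power2_eq_square)
  have "cmod (cinner x y) = Re (cinner (u *\<^sub>C x) y)"
    by (simp add: cinner_scaleC_left u)
  also have "\<dots> \<le> norm (u *\<^sub>C x) * norm y"
    unfolding Re_cinner by (rule norm_cauchy_schwarz)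
  finally show ?thesis by (simp add: norm_scaleC u)
qed auto

text \<open>Over the reals both \<open>scaleC\<close> and \<open>cinner\<close> are bounded
  bilinear; the two interpretations supply their rules for limits, sums and series.\<close>

interpretation scaleC: bounded_bilinear "scaleC :: complex \<Rightarrow> 'e::complex_hilbert_space \<Rightarrow> 'e"
proof
  show "\<exists>K. \<forall>a (b :: 'e). norm (a *\<^sub>C b) \<le> norm a * norm b * K"
    by (rule exI[of _ 1]) (simp add: norm_scaleC)
qed (simp_all add: scaleC_add_left scaleC_add_right scaleR_scaleC scaleC_scaleC mult.commute
      scaleC_complex_def)

interpretation cinner: bounded_bilinear "cinner :: 'e::complex_hilbert_space \<Rightarrow> 'e \<Rightarrow> complex"
proof
  show "\<exists>K. \<forall>a b :: 'e. norm (cinner a b) \<le> norm a * norm b * K"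
    by (rule exI[of _ 1]) (simp add: norm_cinner)
qed (simp_all add: cinner_add_left cinner_add_right scaleR_scaleC cinner_scaleC_left
      cinner_scaleC_right scaleC_complex_def)

lemma cinner_eqI: "(\<And>y. cinner x y = cinner x' y) \<Longrightarrow> x = (x' :: 'e::complex_hilbert_space)"
  by (metis Re_cinner inner_commute vector_eq_rdot)

lemma bounded_clinearD:
  assumes "bounded_clinear T"
  shows "T (x + y) = T x + T y" "T (a *\<^sub>C x) = a *\<^sub>C T x" "\<exists>K. \<forall>x. norm (T x) \<le> norm x * K"
  using assms unfolding bounded_clinear_def
  by (auto simp: linear_add bounded_linear.linear intro: bounded_linear.bounded)

text \<open>The factor 1/4 of the polarization identity sits inside the arguments as 1/2. For the
  diagonal measures of an operator measure, each of the four terms is then itself a finite positive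
  measure, which is the shape of decomposition that \<open>complex_measure_integral\<close> asks
  for.\<close>

definition polar :: "('e::complex_hilbert_space \<Rightarrow> complex) \<Rightarrow> 'e \<Rightarrow> 'e \<Rightarrow> complex" where
  "polar Q x y = (Q ((1/2) *\<^sub>C (x + y)) - Q ((1/2) *\<^sub>C (x - y)))
     + \<i> * (Q ((1/2) *\<^sub>C (x + \<i> *\<^sub>C y)) - Q ((1/2) *\<^sub>C (x - \<i> *\<^sub>C y)))"

lemma polar_sesquilinear:
  assumes addl: "\<And>x x' y. S (x + x') y = S x y + S x' y"
    and addr: "\<And>x y y'. S x (y + y') = S x y + S x y'"
    and scl: "\<And>a x y. S (a *\<^sub>C x) y = a * S x y"
    and scr: "\<And>a x y. S x (a *\<^sub>C y) = cnj a * S x y"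
  shows "S x y = polar (\<lambda>u. S u u) x y"
proof -
  have dl: "S (u - v) w = S u w - S v w" for u v w
    using addl[of "u - v" v w] by simp
  have dr: "S w (u - v) = S w u - S w v" for u v w
    using addr[of w "u - v" v] by simp
  show ?thesis
    unfolding polar_def by (simp add: addl addr dl dr scl scr) (simp add: algebra_simps add_divide_distrib diff_divide_distrib)
qed

lemma polar_form:
  assumes "bounded_clinear T"
  shows "cinner (T x) y = polar (\<lambda>u. cinner (T u) u) x y"
  by (rule polar_sesquilinear[where S = "\<lambda>x y. cinner (T x) y"])
    (simp_all add: bounded_clinearD(1,2)[OF assms] cinner_add_left cinner_add_right
      cinner_scaleC_left cinner_scaleC_right)

text \<open>Polarization recovers an operator from its quadratic form. Since
  \<open>tilde_measure_spec\<close> prescribes only such a form, this is the uniqueness behind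
  \<open>tilde_measure\<close>.\<close>

lemma bounded_clinear_eqI:
  assumes "bounded_clinear T" "bounded_clinear T'" "\<And>x. cinner (T x) x = cinner (T' x) x"
  shows "T = T'"
proof (rule ext, rule cinner_eqI)
  show "cinner (T x) y = cinner (T' x) y" for x y
  proof -
    have "(\<lambda>u. cinner (T u) u) = (\<lambda>u. cinner (T' u) u)" by (rule ext) (rule assms(3))
    then show ?thesis
      using polar_form[OF assms(1), of x y] polar_form[OF assms(2), of x y] by argo
  qed
qed

text \<open>The minimiser of \<open>J\<close> is the representing vector: the parallelogram identity
  makes a minimising sequence Cauchy, and the first variation of \<open>J\<close> vanishes at its
  limit.\<close>

lemma riesz_representation:
  fixes f :: "'a::{real_inner, complete_space} \<Rightarrow> real"
  assumes f: "bounded_linear f"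
  shows "\<exists>y. \<forall>x. f x = y \<bullet> x"
proof -
  interpret f: bounded_linear f by fact
  obtain K where K: "\<And>x. norm (f x) \<le> norm x * K"
    using f.bounded by blast
  define J where "J x = (norm x)\<^sup>2 - 2 * f x" for x
  have J_ge: "J x \<ge> - K\<^sup>2" for x
  proof -
    have "f x \<le> norm x * K" using K[of x] by auto
    moreover have "(norm x)\<^sup>2 - 2 * (norm x * K) + K\<^sup>2 = (norm x - K)\<^sup>2"
      by (simp add: power2_diff)
    ultimately show ?thesis
      unfolding J_def by (smt (verit) zero_le_power2)
  qed
  define m where "m = Inf (range J)"
  have bdd: "bdd_below (range J)" using J_ge by (auto simp: bdd_below_def)
  have m_le: "m \<le> J x" for x unfolding m_def by (rule cInf_lower[OF _ bdd]) auto
  have "\<exists>x. J x < m + 1 / real (Suc n)" for n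
    using cInf_lessD[of "range J" "m + 1 / real (Suc n)"] unfolding m_def by auto
  then obtain X where X: "\<And>n. J (X n) < m + 1 / real (Suc n)" by metis
  have par: "(dist x y)\<^sup>2 = 2 * J x + 2 * J y - 4 * J ((1/2) *\<^sub>R (x + y))" for x y
    unfolding J_def dist_norm power2_norm_eq_inner
    by (simp add: f.add f.scaleR inner_simps algebra_simps inner_commute)
  have d: "(dist (X i) (X j))\<^sup>2 \<le> 2 / real (Suc i) + 2 / real (Suc j)" for i j
    using X[of i] X[of j] m_le[of "(1/2) *\<^sub>R (X i + X j)"] unfolding par
    by (simp del: of_nat_Suc)
  have "Cauchy X"
  proof (rule metric_CauchyI)
    fix e :: real assume "e > 0"
    obtain M where M: "real (Suc M) > 4 / e\<^sup>2"
      using reals_Archimedean2[of "4 / e\<^sup>2"] by (metis less_trans lessI of_nat_less_iff)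
    have "dist (X i) (X j) < e" if "i \<ge> M" "j \<ge> M" for i j
    proof -
      have "2 / real (Suc i) \<le> 2 / real (Suc M)" "2 / real (Suc j) \<le> 2 / real (Suc M)"
        using that by (auto simp: frac_le)
      then have "(dist (X i) (X j))\<^sup>2 \<le> 4 / real (Suc M)" using d[of i j] by simp
      also have "\<dots> < e\<^sup>2" using M \<open>e > 0\<close> by (simp add: field_simps)
      finally show ?thesis using \<open>e > 0\<close> by (simp add: power_less_imp_less_base)
    qed
    then show "\<exists>M. \<forall>i\<ge>M. \<forall>j\<ge>M. dist (X i) (X j) < e" by blast
  qed
  then obtain y where y: "X \<longlonglongrightarrow> y"
    using Cauchy_convergent convergent_def by metis
  have "(\<lambda>n. J (X n)) \<longlonglongrightarrow> J y" unfolding J_def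
    by (intro tendsto_intros y f.tendsto)
  moreover have "(\<lambda>n. m + 1 / real (Suc n)) \<longlonglongrightarrow> m + 0"
    by (intro tendsto_intros LIMSEQ_Suc lim_1_over_n)
  moreover have "\<exists>N. \<forall>n\<ge>N. J (X n) \<le> m + 1 / real (Suc n)"
    by (intro exI[of _ 0] allI impI less_imp_le X)
  ultimately have Jy: "J y \<le> m"
    using LIMSEQ_le[of "\<lambda>n. J (X n)" "J y" "\<lambda>n. m + 1 / real (Suc n)" "m + 0"] by simp
  have "f v = y \<bullet> v" for v
  proof (rule ccontr)
    define d where "d = y \<bullet> v - f v"
    assume "f v \<noteq> y \<bullet> v"
    then have "d \<noteq> 0" by (simp add: d_def)
    have "J (y + t *\<^sub>R v) = J y + 2 * t * d + t\<^sup>2 * (norm v)\<^sup>2" for t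
      unfolding J_def d_def power2_norm_eq_inner
      by (simp add: f.add f.scaleR inner_simps algebra_simps inner_commute power2_eq_square)
    then have ge: "0 \<le> 2 * t * d + t\<^sup>2 * (norm v)\<^sup>2" for t
      using m_le[of "y + t *\<^sub>R v"] Jy by simp
    \<comment> \<open>Moving from \<open>y\<close> by \<open>- d / s\<close> along \<open>v\<close>
      would lower \<open>J\<close> by at least \<open>d\<^sup>2 / s\<close>; the summand 1 keeps
      \<open>s\<close> positive when \<open>v = 0\<close>.\<close>
    define s where "s = 1 + (norm v)\<^sup>2"
    have s: "s > 0" "(norm v)\<^sup>2 \<le> s" by (auto simp: s_def add_pos_nonneg)
    have "2 * (- d / s) * d + (- d / s)\<^sup>2 * (norm v)\<^sup>2 \<le> 2 * (- d / s) * d + (- d / s)\<^sup>2 * s"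
      using s by (intro add_left_mono mult_left_mono) auto
    also have "\<dots> = - (d\<^sup>2 / s)" using s by (simp add: field_simps power2_eq_square)
    also have "\<dots> < 0" using s \<open>d \<noteq> 0\<close> by simp
    finally show False using ge[of "- d / s"] by simp
  qed
  then show ?thesis by blast
qed

text \<open>Riesz representation of the real part of \<open>S x\<close> defines \<open>T x\<close>.
  Multiplying \<open>y\<close> by \<open>\<i>\<close> exposes the imaginary part, and linearity of
  \<open>T\<close> follows because inner products separate points.\<close>

lemma sesquilinear_form_operator:
  fixes S :: "'e::complex_hilbert_space \<Rightarrow> 'e \<Rightarrow> complex"
  assumes addl: "\<And>x x' y. S (x + x') y = S x y + S x' y"
    and addr: "\<And>x y y'. S x (y + y') = S x y + S x y'"
    and scl: "\<And>a x y. S (a *\<^sub>C x) y = a * S x y"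
    and scr: "\<And>a x y. S x (a *\<^sub>C y) = cnj a * S x y"
    and bnd: "\<And>x y. cmod (S x y) \<le> K * norm x * norm y"
  shows "\<exists>T. bounded_clinear T \<and> (\<forall>x y. cinner (T x) y = S x y)"
proof -
  have "\<exists>w. \<forall>y. Re (S x y) = w \<bullet> y" for x
  proof (rule riesz_representation, rule bounded_linear_intro)
    show "Re (S x (r *\<^sub>R y)) = r *\<^sub>R Re (S x y)" for r y
      by (simp add: scaleR_scaleC scr)
    show "norm (Re (S x y)) \<le> norm y * (K * norm x)" for y
      using abs_Re_le_cmod[of "S x y"] bnd[of x y] by (simp add: mult_ac)
  qed (simp add: addr)
  then obtain T where T: "\<And>x y. Re (S x y) = T x \<bullet> y" by metis
  have S: "cinner (T x) y = S x y" for x y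
  proof (rule complex_eqI)
    show "Re (cinner (T x) y) = Re (S x y)" by (simp add: T Re_cinner)
    have "Im (cinner (T x) y) = Re (cinner (T x) (\<i> *\<^sub>C y))" by (simp add: cinner_scaleC_right)
    also have "\<dots> = Re (S x (\<i> *\<^sub>C y))" by (simp add: T Re_cinner)
    also have "\<dots> = Im (S x y)" by (simp add: scr)
    finally show "Im (cinner (T x) y) = Im (S x y)" .
  qed
  have "bounded_clinear T" unfolding bounded_clinear_def
  proof (intro conjI allI bounded_linear_intro)
    show "T (x + y) = T x + T y" for x y
      by (rule cinner_eqI) (simp add: S cinner_add_left addl)
    show sc: "T (a *\<^sub>C x) = a *\<^sub>C T x" for a x
      by (rule cinner_eqI) (simp add: S cinner_scaleC_left scl)
    show "T (r *\<^sub>R x) = r *\<^sub>R T x" for r x by (simp add: scaleR_scaleC sc)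
    show "norm (T x) \<le> norm x * K" for x
    proof (cases "T x = 0")
      \<comment> \<open>Nothing can be cancelled here; instead the bound at \<open>y = x\<close>
        shows that \<open>norm x * K\<close> is nonnegative.\<close>
      case True
      have "0 \<le> norm x * K * norm x"
        using order_trans[OF norm_ge_zero bnd[of x x]] by (simp add: mult_ac)
      then show ?thesis using True
        by (metis mult_eq_0_iff norm_ge_zero norm_zero zero_le_mult_iff less_eq_real_def not_less)
    next
      case False
      have "(norm (T x))\<^sup>2 = cmod (S x (T x))" unfolding S[symmetric] by (simp add: cinner_self norm_power)
      also have "\<dots> \<le> K * norm x * norm (T x)" by (rule bnd)
      finally show ?thesis using False by (simp add: power2_eq_square mult.commute)
    qed
  qed
  then show ?thesis using S by blast
qed

section \<open>Integration against operator-valued measures\<close>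

lemma circle_borel_sigma: "sigma_algebra circle circle_borel"
  unfolding circle_borel_def
  using sets.sigma_algebra_axioms[of "restrict_space borel circle"] by (simp add: space_restrict_space)

lemma circle_borel_subset: "E \<in> circle_borel \<Longrightarrow> E \<subseteq> circle"
  using sets.sets_into_space[of E "restrict_space borel circle"]
  by (simp add: circle_borel_def space_restrict_space)

lemma circle_in_circle_borel [simp]: "circle \<in> circle_borel"
  using sets.top[of "restrict_space borel circle"] by (simp add: circle_borel_def space_restrict_space)

abbreviation CB :: "complex measure" where "CB \<equiv> restrict_space borel circle"

lemma space_eq_circle: "sets M = circle_borel \<Longrightarrow> space M = circle"
  using sets_eq_imp_space_eq[of M CB] by (simp add: circle_borel_def space_restrict_space)

lemma measurable_circle_cong:
  "sets M = circle_borel \<Longrightarrow> f \<in> borel_measurable M \<longleftrightarrow> f \<in> borel_measurable CB"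
  unfolding circle_borel_def by (rule arg_cong[of _ _ "(\<in>) f"], rule measurable_cong_sets) auto

text \<open>This is what makes integrals against complex measures independent of the chosen
  decomposition into positive measures.\<close>

lemma signed_combination_integral_zero:
  fixes f :: "complex \<Rightarrow> complex" and ms :: "(complex \<times> complex measure) list"
  assumes m: "\<And>c m. (c, m) \<in> set ms \<Longrightarrow> finite_measure m \<and> sets m = circle_borel \<and> integrable m f"
    and f: "f \<in> borel_measurable CB"
    and z: "\<And>E. E \<in> circle_borel \<Longrightarrow> (\<Sum>(c, m)\<leftarrow>ms. c * of_real (measure m E)) = 0"
  shows "(\<Sum>(c, m)\<leftarrow>ms. c * (\<integral>\<zeta>. f \<zeta> \<partial>m)) = 0"
proof -
  \<comment> \<open>A list allows the same measure to occur with several coefficients; from here on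
    it is treated as an indexed sum.\<close>
  define c where "c i = fst (ms ! i)" for i
  define m where "m i = snd (ms ! i)" for i
  define I where "I = {..<length ms}"
  have list_sum: "(\<Sum>(c, m)\<leftarrow>ms. c * g m) = (\<Sum>i\<in>I. c i * g (m i))" for g
    unfolding sum_list_sum_nth I_def c_def m_def
    by (auto intro!: sum.cong simp: case_prod_beta atLeast0LessThan)
  have mi: "finite_measure (m i)" "sets (m i) = circle_borel" "integrable (m i) f" "space (m i) = circle"
    if "i \<in> I" for i
    using that assms(1)[of "c i" "m i"] space_eq_circle[of "m i"] nth_mem[of i ms]
    by (auto simp: c_def m_def I_def)
  obtain s where s': "\<forall>n. simple_function CB (s n)"
     "\<forall>x\<in>space CB. (\<lambda>n. s n x) \<longlonglongrightarrow> f x"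
     "\<forall>n. \<forall>x\<in>space CB. dist (s n x) 0 \<le> 2 * dist (f x) 0"
    using borel_measurable_implies_sequence_metric[OF f, of 0] by metis
  have s: "simple_function CB (s n)" "x \<in> circle \<Longrightarrow> (\<lambda>n. s n x) \<longlonglongrightarrow> f x"
     "x \<in> circle \<Longrightarrow> cmod (s n x) \<le> 2 * cmod (f x)" for n x
    using s' by (simp_all add: space_restrict_space)
  have sm: "simple_function (m i) (s n)" if "i \<in> I" for i n
    using s(1)[of n] mi(2,4)[OF that] unfolding simple_function_def circle_borel_def
    by (simp add: space_restrict_space)
  have simple_int: "(\<integral>\<zeta>. s n \<zeta> \<partial>m i) = (\<Sum>y\<in>s n ` circle. y * of_real (measure (m i) {x \<in> circle. s n x = y}))"
    if "i \<in> I" for i n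
  proof -
    interpret finite_measure "m i" using mi[OF that] by simp
    have "Bochner_Integration.simple_bochner_integrable (m i) (s n)"
      by (intro simple_bochner_integrable.intros sm that) simp
    then show ?thesis
      using simple_bochner_integrable_eq_integral[of "m i" "s n"] mi(4)[OF that]
      by (simp add: simple_bochner_integral_def scaleR_conv_of_real mult.commute)
  qed
  \<comment> \<open>Grouping by the values of the simple function leaves, for each value, the given
    combination of measures on one level set.\<close>
  have zero: "(\<Sum>i\<in>I. c i * (\<integral>\<zeta>. s n \<zeta> \<partial>m i)) = 0" for n
  proof -
    have lev: "{x \<in> circle. s n x = y} \<in> circle_borel" for y
      using simple_functionD(2)[OF s(1), of n "{y}"]
      by (simp add: circle_borel_def space_restrict_space vimage_def Int_def conj_commute)
    have "(\<Sum>i\<in>I. c i * (\<integral>\<zeta>. s n \<zeta> \<partial>m i)) =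
        (\<Sum>y\<in>s n ` circle. y * (\<Sum>i\<in>I. c i * of_real (measure (m i) {x \<in> circle. s n x = y})))"
      by (simp add: simple_int sum_distrib_left mult_ac) (rule sum.swap)
    also have "\<dots> = 0"
      using z[OF lev] by (simp add: list_sum)
    finally show ?thesis .
  qed
  have "(\<lambda>n. \<Sum>i\<in>I. c i * (\<integral>\<zeta>. s n \<zeta> \<partial>m i)) \<longlonglongrightarrow> (\<Sum>i\<in>I. c i * (\<integral>\<zeta>. f \<zeta> \<partial>m i))"
  proof (intro tendsto_sum tendsto_mult_left)
    fix i assume i: "i \<in> I"
    show "(\<lambda>n. (\<integral>\<zeta>. s n \<zeta> \<partial>m i)) \<longlonglongrightarrow> (\<integral>\<zeta>. f \<zeta> \<partial>m i)"
    proof (rule integral_dominated_convergence[where w = "\<lambda>x. 2 * cmod (f x)"])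
      show "f \<in> borel_measurable (m i)" using mi[OF i] by simp
      show "s n \<in> borel_measurable (m i)" for n by (rule borel_measurable_simple_function[OF sm[OF i]])
      show "integrable (m i) (\<lambda>x. 2 * cmod (f x))" using mi[OF i] by simp
    qed (use s mi[OF i] in auto)
  qed
  then show ?thesis using zero by (simp add: list_sum LIMSEQ_const_iff)
qed

section \<open>Integrals against an operator-valued measure as sesquilinear forms\<close>

locale op_measure =
  fixes \<mu> :: "complex set \<Rightarrow> 'e::complex_hilbert_space \<Rightarrow> 'e"
  assumes om: "operator_measure \<mu>"
begin

lemma pos_op: "E \<in> circle_borel \<Longrightarrow> positive_operator (\<mu> E)"
  using om by (auto simp: operator_measure_def)

lemma clin: "E \<in> circle_borel \<Longrightarrow> bounded_clinear (\<mu> E)"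
  using pos_op by (auto simp: positive_operator_def)

lemma diag_sums:
  assumes "range A \<subseteq> circle_borel" "disjoint_family A"
  shows "(\<lambda>n. cinner (\<mu> (A n) x) y) sums cinner (\<mu> (\<Union>n. A n) x) y"
  using om assms unfolding operator_measure_def complex_regular_measure_def by blast

lemma mu_empty: "\<mu> {} x = 0"
proof -
  have e: "{} \<in> circle_borel" using sigma_algebra.axioms(1)[OF circle_borel_sigma] by (simp add: circle_borel_def)
  have "\<mu> ({} \<union> {}) = \<mu> {} + \<mu> {}" using om e unfolding operator_measure_def by blast
  then show ?thesis by (metis Un_empty add_cancel_right_right zero_fun_apply)
qed

abbreviation dm :: "'e \<Rightarrow> complex measure" where "dm x \<equiv> diag_measure \<mu> x"

lemma sets_dm [simp, measurable_cong]: "sets (dm x) = sets CB"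
  unfolding diag_measure_def
  using sigma_algebra.sets_measure_of_eq[OF circle_borel_sigma] by (simp add: circle_borel_def)

lemma sets_dm': "sets (dm x) = circle_borel" by (simp add: circle_borel_def)

lemma space_dm [simp]: "space (dm x) = circle"
  by (rule space_eq_circle) (rule sets_dm')

text \<open>\<open>measure_of\<close> yields the zero measure unless its set function is positive
  and countably additive; checking both is what makes \<open>diag_measure\<close>
  meaningful.\<close>

lemma emeasure_dm:
  assumes "E \<in> circle_borel"
  shows "emeasure (dm x) E = ennreal (Re (cinner (\<mu> E x) x))"
  unfolding diag_measure_def
proof (rule emeasure_measure_of_sigma[OF circle_borel_sigma _ _ assms])
  show "positive circle_borel (\<lambda>E. ennreal (Re (cinner (\<mu> E x) x)))"
    by (simp add: positive_def mu_empty cinner.zero_left)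
  show "countably_additive circle_borel (\<lambda>E. ennreal (Re (cinner (\<mu> E x) x)))"
    unfolding countably_additive_def
  proof safe
    fix A :: "nat \<Rightarrow> complex set"
    assume A: "range A \<subseteq> circle_borel" "disjoint_family A"
    have "(\<lambda>n. Re (cinner (\<mu> (A n) x) x)) sums Re (cinner (\<mu> (\<Union>n. A n) x) x)"
      using diag_sums[OF A] by (rule sums_Re)
    then show "(\<Sum>n. ennreal (Re (cinner (\<mu> (A n) x) x))) = ennreal (Re (cinner (\<mu> (\<Union> (range A)) x) x))"
      using A pos_op by (intro suminf_ennreal_eq) (auto simp: positive_operator_def)
  qed
qed

lemma finite_dm: "finite_measure (dm x)"
  by (rule finite_measureI) (simp add: emeasure_dm)

lemma measure_dm: "E \<in> circle_borel \<Longrightarrow> of_real (measure (dm x) E) = cinner (\<mu> E x) x"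
  using pos_op[of E] by (simp add: measure_def emeasure_dm positive_operator_def complex_eq_iff)

lemma measure_polar: "E \<in> circle_borel \<Longrightarrow> polar (\<lambda>u. of_real (measure (dm u) E)) x y = cinner (\<mu> E x) y"
  using polar_form[OF clin, of E x y] by (simp add: measure_dm)

text \<open>The last clause makes the integral a bounded operator. Bounded functions qualify, and
  later also their products with the unbounded density \<open>wt\<close>.\<close>

definition op_integrable :: "(complex \<Rightarrow> complex) \<Rightarrow> bool" where
  "op_integrable f \<longleftrightarrow> f \<in> borel_measurable CB \<and> (\<forall>x. integrable (dm x) f) \<and>
     (\<exists>K. \<forall>x. cmod (\<integral>\<zeta>. f \<zeta> \<partial>dm x) \<le> K * (norm x)\<^sup>2)"

text \<open>The form <(integral of f d\<mu>) x, y>, built from the positive diagonal measures alone.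
  That it is sesquilinear has to be proved afterwards.\<close>

definition J :: "(complex \<Rightarrow> complex) \<Rightarrow> 'e \<Rightarrow> 'e \<Rightarrow> complex" where
  "J f = polar (\<lambda>u. \<integral>\<zeta>. f \<zeta> \<partial>dm u)"

lemma signed_zero:
  assumes "op_integrable f" "\<And>E. E \<in> circle_borel \<Longrightarrow> (\<Sum>(c, u)\<leftarrow>us. c * cinner (\<mu> E u) u) = 0"
  shows "(\<Sum>(c, u)\<leftarrow>us. c * (\<integral>\<zeta>. f \<zeta> \<partial>dm u)) = 0"
proof -
  have eq: "(\<Sum>(c, m)\<leftarrow>map (\<lambda>(c, u). (c, dm u)) us. c * g m) = (\<Sum>(c, u)\<leftarrow>us. c * g (dm u))" for g
    by (induction us) (auto simp: case_prod_beta)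
  have "(\<Sum>(c, m)\<leftarrow>map (\<lambda>(c, u). (c, dm u)) us. c * (\<integral>\<zeta>. f \<zeta> \<partial>m)) = 0"
  proof (rule signed_combination_integral_zero)
    show "(\<Sum>(c, m)\<leftarrow>map (\<lambda>(c, u). (c, dm u)) us. c * of_real (measure m E)) = 0"
      if "E \<in> circle_borel" for E
      unfolding eq[of "\<lambda>m. of_real (measure m E)"] using assms(2)[OF that] that
      by (simp only: measure_dm)
  qed (use assms(1) in \<open>auto simp: op_integrable_def finite_dm sets_dm' simp del: sets_dm\<close>)
  then show ?thesis unfolding eq[of "\<lambda>m. \<integral>\<zeta>. f \<zeta> \<partial>m"] .
qed

definition polar_list :: "'e \<Rightarrow> 'e \<Rightarrow> (complex \<times> 'e) list" where
  "polar_list x y = [(1, (1/2) *\<^sub>C (x + y)), (-1, (1/2) *\<^sub>C (x - y)),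
     (\<i>, (1/2) *\<^sub>C (x + \<i> *\<^sub>C y)), (-\<i>, (1/2) *\<^sub>C (x - \<i> *\<^sub>C y))]"

lemma polar_eq_list: "polar Q x y = (\<Sum>(c, u)\<leftarrow>polar_list x y. c * Q u)"
  by (simp add: polar_def polar_list_def right_diff_distrib)

lemma J_diag:
  assumes "op_integrable f"
  shows "J f x x = (\<integral>\<zeta>. f \<zeta> \<partial>dm x)"
proof -
  have "(\<Sum>(c, u)\<leftarrow>polar_list x x @ [(-1, x)]. c * (\<integral>\<zeta>. f \<zeta> \<partial>dm u)) = 0"
  proof (rule signed_zero[OF assms])
    fix E assume "E \<in> circle_borel"
    then show "(\<Sum>(c, u)\<leftarrow>polar_list x x @ [(-1, x)]. c * cinner (\<mu> E u) u) = 0"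
      using polar_form[OF clin, of E x x] by (simp add: polar_eq_list)
  qed
  then show ?thesis
    by (simp add: J_def polar_eq_list)
qed

text \<open>Each \<open>J f x y\<close> is a combination of four integrals against diagonal
  measures, so a linear relation among the numbers \<open>cinner (\<mu> E x) y\<close>, valid for
  all \<open>E\<close>, is a vanishing signed combination of measures and survives integration. The
  sesquilinearity of \<open>J f\<close> is thereby inherited from that of the operators
  \<open>\<mu> E\<close>.\<close>

lemma J_combination:
  assumes f: "op_integrable f"
    and z: "\<And>E. E \<in> circle_borel \<Longrightarrow> (\<Sum>(a, x, y)\<leftarrow>ws. a * cinner (\<mu> E x) y) = 0"
  shows "(\<Sum>(a, x, y)\<leftarrow>ws. a * J f x y) = 0"
proof -
  define us where "us = concat (map (\<lambda>(a, x, y). map (\<lambda>(c, u). (a * c, u)) (polar_list x y)) ws)"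
  have us: "(\<Sum>(a, x, y)\<leftarrow>ws. a * polar Q x y) = (\<Sum>(c, u)\<leftarrow>us. c * Q u)" for Q
    unfolding us_def
    by (induction ws) (auto simp: polar_eq_list polar_list_def algebra_simps)
  have "(\<Sum>(a, x, y)\<leftarrow>ws. a * cinner (\<mu> E x) y) = (\<Sum>(c, u)\<leftarrow>us. c * cinner (\<mu> E u) u)"
    if "E \<in> circle_borel" for E
    using us[of "\<lambda>u. cinner (\<mu> E u) u"] by (simp only: polar_form[OF clin[OF that], symmetric])
  then have "(\<Sum>(c, u)\<leftarrow>us. c * (\<integral>\<zeta>. f \<zeta> \<partial>dm u)) = 0"
    using z by (intro signed_zero[OF f]) simp
  then show ?thesis unfolding us[symmetric, of "\<lambda>u. \<integral>\<zeta>. f \<zeta> \<partial>dm u"] by (simp add: J_def)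
qed

lemma J_add_left: "op_integrable f \<Longrightarrow> J f (x + x') y = J f x y + J f x' y"
  using J_combination[of f "[(1, x + x', y), (-1, x, y), (-1, x', y)]"]
  by (simp add: bounded_clinearD(1)[OF clin] cinner_add_left algebra_simps)

lemma J_add_right: "op_integrable f \<Longrightarrow> J f x (y + y') = J f x y + J f x y'"
  using J_combination[of f "[(1, x, y + y'), (-1, x, y), (-1, x, y')]"]
  by (simp add: cinner_add_right algebra_simps)

lemma J_scaleC_left: "op_integrable f \<Longrightarrow> J f (a *\<^sub>C x) y = a * J f x y"
  using J_combination[of f "[(1, a *\<^sub>C x, y), (-a, x, y)]"]
  by (simp add: bounded_clinearD(2)[OF clin] cinner_scaleC_left)

lemma J_scaleC_right: "op_integrable f \<Longrightarrow> J f x (a *\<^sub>C y) = cnj a * J f x y"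
  using J_combination[of f "[(1, x, a *\<^sub>C y), (- cnj a, x, y)]"]
  by (simp add: cinner_scaleC_right)

text \<open>The right side is sesquilinear in \<open>y\<close> and \<open>x\<close>, hence
  determined by its diagonal, where conjugation passes under an integral against a positive
  measure.\<close>

lemma J_cnj:
  assumes "op_integrable f" "op_integrable (\<lambda>\<zeta>. cnj (f \<zeta>))"
  shows "J (\<lambda>\<zeta>. cnj (f \<zeta>)) y x = cnj (J f x y)"
proof -
  have "cnj (J f x y) = polar (\<lambda>u. cnj (J f u u)) y x"
    by (rule polar_sesquilinear[where S = "\<lambda>y x. cnj (J f x y)"])
      (simp_all add: assms J_add_left J_add_right J_scaleC_left J_scaleC_right)
  also have "(\<lambda>u. cnj (J f u u)) = (\<lambda>u. \<integral>\<zeta>. cnj (f \<zeta>) \<partial>dm u)"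
    by (simp add: J_diag assms(1))
  finally show ?thesis by (simp add: J_def)
qed

lemma J_bound:
  assumes f: "op_integrable f" and K: "\<And>x. cmod (\<integral>\<zeta>. f \<zeta> \<partial>dm x) \<le> K * (norm x)\<^sup>2"
  shows "cmod (J f x y) \<le> 4 * K * norm x * norm y"
proof (cases "x = 0 \<or> y = 0")
  case True
  then show ?thesis
    using J_scaleC_left[OF f, of 0 x y] J_scaleC_right[OF f, of x 0 y] by auto
next
  case False
  \<comment> \<open>Polarization mixes \<open>x\<close> and \<open>y\<close>, so a bound in product
    form is obtained for unit vectors first and then by scaling. The factor 4 counts the
    polarization terms, each taken at a vector of norm at most 1.\<close>
  have unit: "cmod (J f u v) \<le> 4 * K" if "norm u = 1" "norm v = 1" for u v
  proof -
    define P where "P w = cmod (\<integral>\<zeta>. f \<zeta> \<partial>dm ((1/2) *\<^sub>C w))" for w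
    have "0 \<le> K" using order_trans[OF norm_ge_zero K[of u]] that by simp
    have le: "P w \<le> K" if "norm w \<le> 2" for w
    proof -
      have "(norm ((1/2) *\<^sub>C w))\<^sup>2 \<le> 1\<^sup>2"
        using that by (intro power_mono) (simp_all add: norm_scaleC norm_divide)
      then show ?thesis
        using K[of "(1/2) *\<^sub>C w"] mult_left_mono[of "(norm ((1/2) *\<^sub>C w))\<^sup>2" 1 K] \<open>0 \<le> K\<close>
        by (simp add: P_def)
    qed
    have "cmod (J f u v) \<le> (P (u + v) + P (u - v)) + (P (u + \<i> *\<^sub>C v) + P (u - \<i> *\<^sub>C v))"
      unfolding J_def polar_def P_def
      by (intro order_trans[OF norm_triangle_ineq] add_mono norm_triangle_ineq4)
        (simp add: norm_mult norm_triangle_ineq4)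
    also have "\<dots> \<le> (K + K) + (K + K)"
      using that
      by (intro add_mono le order_trans[OF norm_triangle_ineq] order_trans[OF norm_triangle_ineq4])
        (simp_all add: norm_scaleC)
    finally show ?thesis by simp
  qed
  define u where "u = complex_of_real (1 / norm x) *\<^sub>C x"
  define v where "v = complex_of_real (1 / norm y) *\<^sub>C y"
  have "x = complex_of_real (norm x) *\<^sub>C u" "y = complex_of_real (norm y) *\<^sub>C v"
    using False by (simp_all add: u_def v_def scaleC_scaleC)
  then have "J f x y = of_real (norm x) * (of_real (norm y) * J f u v)"
    by (metis J_scaleC_left[OF f] J_scaleC_right[OF f] complex_cnj_complex_of_real)
  moreover have "cmod (J f u v) \<le> 4 * K"
    using False by (intro unit) (simp_all add: u_def v_def norm_scaleC norm_divide)
  ultimately show ?thesis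
    using mult_left_mono[of "cmod (J f u v)" "4 * K" "norm x * norm y"]
    by (simp add: norm_mult mult_ac)
qed

lemma J_operator:
  assumes f: "op_integrable f"
  shows "\<exists>T. bounded_clinear T \<and> (\<forall>x y. cinner (T x) y = J f x y)"
proof -
  obtain K where "\<And>x. cmod (\<integral>\<zeta>. f \<zeta> \<partial>dm x) \<le> K * (norm x)\<^sup>2"
    using f by (auto simp: op_integrable_def)
  from J_bound[OF f this] show ?thesis
    by (intro sesquilinear_form_operator[where K = "4 * K"])
      (simp_all add: J_add_left J_add_right J_scaleC_left J_scaleC_right f)
qed

definition mass :: real where "mass = (SOME K. 0 \<le> K \<and> (\<forall>x. norm (\<mu> circle x) \<le> norm x * K))"

lemma mass: "0 \<le> mass" "norm (\<mu> circle x) \<le> norm x * mass"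
proof -
  obtain K where K: "\<And>x. norm (\<mu> circle x) \<le> norm x * K"
    using bounded_clinearD(3)[OF clin[OF circle_in_circle_borel]] by blast
  have "norm (\<mu> circle x) \<le> norm x * \<bar>K\<bar>" for x
    by (rule order_trans[OF K mult_left_mono]) auto
  then have "0 \<le> \<bar>K\<bar> \<and> (\<forall>x. norm (\<mu> circle x) \<le> norm x * \<bar>K\<bar>)" by simp
  then have "0 \<le> mass \<and> (\<forall>x. norm (\<mu> circle x) \<le> norm x * mass)"
    unfolding mass_def by (rule someI)
  then show "0 \<le> mass" "norm (\<mu> circle x) \<le> norm x * mass" by auto
qed

lemma measure_dm_circle: "measure (dm x) circle \<le> mass * (norm x)\<^sup>2"
proof -
  have "measure (dm x) circle = Re (cinner (\<mu> circle x) x)"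
    by (metis Re_complex_of_real circle_in_circle_borel measure_dm)
  also have "\<dots> \<le> norm (\<mu> circle x) * norm x"
    unfolding Re_cinner by (rule norm_cauchy_schwarz)
  also have "\<dots> \<le> (norm x * mass) * norm x"
    by (intro mult_right_mono mass) auto
  finally show ?thesis by (simp add: power2_eq_square mult_ac)
qed

lemma bounded_op_integrable:
  assumes f: "f \<in> borel_measurable CB" and M: "\<And>\<zeta>. \<zeta> \<in> circle \<Longrightarrow> cmod (f \<zeta>) \<le> M"
  shows "integrable (dm x) f" "cmod (\<integral>\<zeta>. f \<zeta> \<partial>dm x) \<le> (M * mass) * (norm x)\<^sup>2" "op_integrable f"
proof -
  have f': "f \<in> borel_measurable (dm x)" for x
    using f measurable_circle_cong[OF sets_dm'] by blast
  have i: "integrable (dm x) f" for x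
  proof -
    interpret finite_measure "dm x" by (rule finite_dm)
    show ?thesis using M by (intro integrable_const_bound[of _ M] f' AE_I2) auto
  qed
  have "0 \<le> M" using order_trans[OF norm_ge_zero M[of 1]] by simp
  have b: "cmod (\<integral>\<zeta>. f \<zeta> \<partial>dm x) \<le> (M * mass) * (norm x)\<^sup>2" for x
  proof -
    interpret finite_measure "dm x" by (rule finite_dm)
    have "cmod (\<integral>\<zeta>. f \<zeta> \<partial>dm x) \<le> (\<integral>\<zeta>. M \<partial>dm x)"
      using M i by (intro Bochner_Integration.integral_norm_bound_integral) auto
    also have "\<dots> = M * measure (dm x) circle" by simp
    also have "\<dots> \<le> M * (mass * (norm x)\<^sup>2)"
      using \<open>0 \<le> M\<close> measure_dm_circle by (intro mult_left_mono)
    finally show ?thesis by (simp add: mult_ac)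
  qed
  show "integrable (dm x) f" "cmod (\<integral>\<zeta>. f \<zeta> \<partial>dm x) \<le> (M * mass) * (norm x)\<^sup>2" "op_integrable f"
    using i b f unfolding op_integrable_def by blast+
qed

lemma J_bounded:
  assumes f: "f \<in> borel_measurable CB" and M: "\<And>\<zeta>. \<zeta> \<in> circle \<Longrightarrow> cmod (f \<zeta>) \<le> M"
  shows "cmod (J f x y) \<le> 4 * (M * mass) * norm x * norm y"
  using bounded_op_integrable[OF assms] by (intro J_bound) auto

text \<open>The diagonal measures at the four polarization vectors are one admissible decomposition.
  Any other one has the same integral, because the eight measures together form a signed combination
  that vanishes on every Borel set.\<close>

lemma complex_measure_integral_eq_J:
  assumes f: "f \<in> borel_measurable CB" and M: "\<And>\<zeta>. \<zeta> \<in> circle \<Longrightarrow> cmod (f \<zeta>) \<le> M"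
  shows "complex_measure_integral (\<lambda>E. cinner (\<mu> E x) y) f = J f x y"
  unfolding complex_measure_integral_def
proof (rule the_equality)
  let ?m = "\<lambda>u. dm ((1/2) *\<^sub>C u)"
  let ?is = "\<lambda>m1 m2 m3 m4. (\<forall>m\<in>{m1, m2, m3, m4}. finite_measure m \<and> sets m = circle_borel) \<and>
     (\<forall>E\<in>circle_borel. cinner (\<mu> E x) y = of_real (measure m1 E - measure m2 E)
                              + \<i> * of_real (measure m3 E - measure m4 E))"
  have ex: "?is (?m (x + y)) (?m (x - y)) (?m (x + \<i> *\<^sub>C y)) (?m (x - \<i> *\<^sub>C y))"
    using measure_polar[of _ x y] finite_dm sets_dm' by (auto simp: polar_def)
  then show "\<exists>m1 m2 m3 m4. (\<forall>m\<in>{m1, m2, m3, m4}. finite_measure m \<and> sets m = circle_borel) \<and>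
     (\<forall>E\<in>circle_borel. cinner (\<mu> E x) y = of_real (measure m1 E - measure m2 E)
                              + \<i> * of_real (measure m3 E - measure m4 E)) \<and>
     J f x y = ((\<integral>\<zeta>. f \<zeta> \<partial>m1) - (\<integral>\<zeta>. f \<zeta> \<partial>m2)) + \<i> * ((\<integral>\<zeta>. f \<zeta> \<partial>m3) - (\<integral>\<zeta>. f \<zeta> \<partial>m4))"
    unfolding J_def polar_def by blast
  fix I
  assume "\<exists>m1 m2 m3 m4. (\<forall>m\<in>{m1, m2, m3, m4}. finite_measure m \<and> sets m = circle_borel) \<and>
     (\<forall>E\<in>circle_borel. cinner (\<mu> E x) y = of_real (measure m1 E - measure m2 E)
                              + \<i> * of_real (measure m3 E - measure m4 E)) \<and>
     I = ((\<integral>\<zeta>. f \<zeta> \<partial>m1) - (\<integral>\<zeta>. f \<zeta> \<partial>m2)) + \<i> * ((\<integral>\<zeta>. f \<zeta> \<partial>m3) - (\<integral>\<zeta>. f \<zeta> \<partial>m4))"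
  then obtain m1 m2 m3 m4 where m: "?is m1 m2 m3 m4"
    and I: "I = ((\<integral>\<zeta>. f \<zeta> \<partial>m1) - (\<integral>\<zeta>. f \<zeta> \<partial>m2)) + \<i> * ((\<integral>\<zeta>. f \<zeta> \<partial>m3) - (\<integral>\<zeta>. f \<zeta> \<partial>m4))"
    by blast
  have bi: "integrable m f" if "finite_measure m" "sets m = circle_borel" for m
  proof -
    interpret finite_measure m by fact
    show ?thesis
      using M f that measurable_circle_cong[OF that(2)] space_eq_circle[OF that(2)]
      by (intro integrable_const_bound[of _ M] AE_I2) auto
  qed
  let ?ms = "[(1, m1), (-1, m2), (\<i>, m3), (-\<i>, m4), (-1, ?m (x + y)), (1, ?m (x - y)),
    (-\<i>, ?m (x + \<i> *\<^sub>C y)), (\<i>, ?m (x - \<i> *\<^sub>C y))]"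
  have "(\<Sum>(c, m)\<leftarrow>?ms. c * (\<integral>\<zeta>. f \<zeta> \<partial>m)) = 0"
  proof (rule signed_combination_integral_zero[OF _ f])
    show "finite_measure m \<and> sets m = circle_borel \<and> integrable m f" if "(c, m) \<in> set ?ms" for c m
      using that m ex bi by auto
    fix E assume E: "E \<in> circle_borel"
    have "of_real (measure m1 E - measure m2 E) + \<i> * of_real (measure m3 E - measure m4 E)
        = polar (\<lambda>u. of_real (measure (dm u) E)) x y"
      using m E measure_polar[OF E] by auto
    then show "(\<Sum>(c, m)\<leftarrow>?ms. c * of_real (measure m E)) = 0"
      unfolding polar_def by (simp add: algebra_simps)
  qed
  then show "I = J f x y" unfolding I J_def polar_def by (simp add: algebra_simps)
qed

lemma operator_integral:
  assumes f: "f \<in> borel_measurable CB" and M: "\<And>\<zeta>. \<zeta> \<in> circle \<Longrightarrow> cmod (f \<zeta>) \<le> M"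
  shows "bounded_clinear (operator_integral \<mu> f)" "cinner (operator_integral \<mu> f x) y = J f x y"
proof -
  obtain T where T: "bounded_clinear T" "\<And>x y. cinner (T x) y = J f x y"
    using J_operator[OF bounded_op_integrable(3)[OF assms]] by blast
  have cm: "complex_measure_integral (\<lambda>E. cinner (\<mu> E x) y) f = J f x y" for x y
    by (rule complex_measure_integral_eq_J[OF assms])
  have "operator_integral \<mu> f = T"
    unfolding operator_integral_def
  proof (rule the_equality)
    fix T'
    assume "bounded_clinear T' \<and>
      (\<forall>x y. cinner (T' x) y = complex_measure_integral (\<lambda>E. cinner (\<mu> E x) y) f)"
    then have "cinner (T' x) y = cinner (T x) y" for x y using T(2) cm by metis
    then show "T' = T" by (intro ext) (rule cinner_eqI)
  qed (simp add: T cm)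
  then show "bounded_clinear (operator_integral \<mu> f)" "cinner (operator_integral \<mu> f x) y = J f x y"
    using T by auto
qed

end

section \<open>Fourier coefficients and Poisson extension\<close>

context op_measure begin

definition bdd_fun :: "(complex \<Rightarrow> complex) \<Rightarrow> bool" where
  "bdd_fun f \<longleftrightarrow> f \<in> borel_measurable CB \<and> (\<exists>M. \<forall>\<zeta>\<in>circle. cmod (f \<zeta>) \<le> M)"

lemma bdd_op_integrable: "bdd_fun f \<Longrightarrow> op_integrable f"
  unfolding bdd_fun_def using bounded_op_integrable(3)[of f] by blast

lemma bdd_integrable: "bdd_fun f \<Longrightarrow> integrable (dm x) f"
  using bdd_op_integrable by (auto simp: op_integrable_def)

lemma bdd_const [intro]: "bdd_fun (\<lambda>_. c)"
  by (auto simp: bdd_fun_def)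

lemma bdd_ident [intro]: "bdd_fun (\<lambda>\<zeta>. \<zeta>)"
  by (auto simp: bdd_fun_def intro: measurable_restrict_space1)

lemma bdd_add [intro]: "bdd_fun f \<Longrightarrow> bdd_fun g \<Longrightarrow> bdd_fun (\<lambda>\<zeta>. f \<zeta> + g \<zeta>)"
  by (auto simp: bdd_fun_def) (metis norm_triangle_mono)

lemma bdd_mult [intro]: "bdd_fun f \<Longrightarrow> bdd_fun g \<Longrightarrow> bdd_fun (\<lambda>\<zeta>. f \<zeta> * g \<zeta>)"
  by (auto simp: bdd_fun_def norm_mult) (metis mult_mono' norm_ge_zero)

lemma bdd_cnj [intro]: "bdd_fun f \<Longrightarrow> bdd_fun (\<lambda>\<zeta>. cnj (f \<zeta>))"
proof -
  assume f: "bdd_fun f"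
  have "cnj \<in> borel_measurable borel"
    by (intro borel_measurable_continuous_onI continuous_intros)
  then have "(\<lambda>\<zeta>. cnj (f \<zeta>)) \<in> borel_measurable CB"
    using f measurable_compose[of f CB borel cnj borel] by (simp add: bdd_fun_def)
  then show ?thesis using f by (simp add: bdd_fun_def)
qed

lemma bdd_power [intro]: "bdd_fun f \<Longrightarrow> bdd_fun (\<lambda>\<zeta>. f \<zeta> ^ n)"
  by (induction n) auto

lemma bdd_sum [intro]: "(\<And>i. i \<in> I \<Longrightarrow> bdd_fun (f i)) \<Longrightarrow> bdd_fun (\<lambda>\<zeta>. \<Sum>i\<in>I. f i \<zeta>)"
  by (induction I rule: infinite_finite_induct) auto

lemma bdd_indicator [intro]: "E \<in> circle_borel \<Longrightarrow> bdd_fun (indicator E)"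
  unfolding bdd_fun_def circle_borel_def
  by (intro conjI exI[of _ 1]) (auto simp: indicator_def)

lemma J_cong: "(\<And>\<zeta>. \<zeta> \<in> circle \<Longrightarrow> f \<zeta> = g \<zeta>) \<Longrightarrow> J f = J g"
  unfolding J_def by (rule arg_cong[of _ _ polar], intro ext Bochner_Integration.integral_cong) auto

lemma bdd_cong: "(\<And>\<zeta>. \<zeta> \<in> circle \<Longrightarrow> f \<zeta> = g \<zeta>) \<Longrightarrow> bdd_fun f \<longleftrightarrow> bdd_fun g"
  unfolding bdd_fun_def by (subst measurable_cong[of CB f g]) (auto simp: space_restrict_space)

lemma J_add: "op_integrable f \<Longrightarrow> op_integrable g \<Longrightarrow> J (\<lambda>\<zeta>. f \<zeta> + g \<zeta>) x y = J f x y + J g x y"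
  unfolding J_def polar_def op_integrable_def by (simp add: algebra_simps)

lemma J_cmult: "op_integrable f \<Longrightarrow> J (\<lambda>\<zeta>. c * f \<zeta>) x y = c * J f x y"
  unfolding J_def polar_def op_integrable_def by (simp add: algebra_simps)

lemma J_zero: "J (\<lambda>_. 0) x y = 0"
  by (simp add: J_def polar_def)

lemma J_sum: "finite I \<Longrightarrow> (\<And>i. i \<in> I \<Longrightarrow> bdd_fun (f i)) \<Longrightarrow>
    J (\<lambda>\<zeta>. \<Sum>i\<in>I. f i \<zeta>) x y = (\<Sum>i\<in>I. J (f i) x y)"
proof (induction I rule: finite_induct)
  case (insert i I)
  then have "bdd_fun (\<lambda>\<zeta>. \<Sum>i\<in>I. f i \<zeta>)" "bdd_fun (f i)" by auto
  then show ?case using insert by (simp add: J_add bdd_op_integrable)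
qed (simp add: J_zero)

lemma J_dominated:
  assumes f: "\<And>n. f n \<in> borel_measurable CB" and g: "g \<in> borel_measurable CB"
    and w: "\<And>x. integrable (dm x) w"
    and M: "\<And>n \<zeta>. \<zeta> \<in> circle \<Longrightarrow> cmod (f n \<zeta>) \<le> w \<zeta>"
    and lim: "\<And>x. AE \<zeta> in dm x. (\<lambda>n. f n \<zeta>) \<longlonglongrightarrow> g \<zeta>"
  shows "(\<lambda>n. J (f n) x y) \<longlonglongrightarrow> J g x y"
proof -
  have "(\<lambda>n. \<integral>\<zeta>. f n \<zeta> \<partial>dm u) \<longlonglongrightarrow> (\<integral>\<zeta>. g \<zeta> \<partial>dm u)" for u
    by (rule integral_dominated_convergence[where w = w])
      (use f g w M lim measurable_circle_cong[OF sets_dm'] in auto)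
  then show ?thesis unfolding J_def polar_def by (intro tendsto_intros)
qed

lemma J_bounded_convergence:
  assumes "\<And>n. bdd_fun (f n)" "bdd_fun g" "\<And>n \<zeta>. \<zeta> \<in> circle \<Longrightarrow> cmod (f n \<zeta>) \<le> M"
    and "\<And>\<zeta>. \<zeta> \<in> circle \<Longrightarrow> (\<lambda>n. f n \<zeta>) \<longlonglongrightarrow> g \<zeta>"
  shows "(\<lambda>n. J (f n) x y) \<longlonglongrightarrow> J g x y"
proof (rule J_dominated[where w = "\<lambda>_. M"])
  show "integrable (dm x) (\<lambda>_. M)" for x
  proof -
    interpret finite_measure "dm x" by (rule finite_dm)
    show ?thesis by simp
  qed
  show "AE \<zeta> in dm x. (\<lambda>n. f n \<zeta>) \<longlonglongrightarrow> g \<zeta>" for x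
    by (rule AE_I2) (use assms(4) in simp)
qed (use assms in \<open>auto simp: bdd_fun_def\<close>)

lemma J_indicator: "E \<in> circle_borel \<Longrightarrow> J (indicator E) x y = cinner (\<mu> E x) y"
proof -
  assume E: "E \<in> circle_borel"
  have "(\<integral>\<zeta>. indicator E \<zeta> \<partial>dm u) = complex_of_real (measure (dm u) E)" for u
  proof -
    interpret finite_measure "dm u" by (rule finite_dm)
    have "(\<integral>\<zeta>. complex_of_real (indicator E \<zeta>) \<partial>dm u) = of_real (\<integral>\<zeta>. indicator E \<zeta> \<partial>dm u)"
      by (rule integral_complex_of_real)
    moreover have "(\<lambda>\<zeta>. complex_of_real (indicator E \<zeta>)) = indicator E"
      by (auto simp: indicator_def)
    ultimately show ?thesis using E circle_borel_subset[OF E] by (simp add: Int_absorb2)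
  qed
  then show ?thesis unfolding J_def by (simp only: measure_polar[OF E])
qed

text \<open>With a simple function in place of \<open>\<zeta>\<close> the double sum splits over its
  values \<open>c\<close> into terms \<open>cinner (\<mu> (L m c) (v c)) (v c)\<close>, where
  \<open>v c\<close> is the polynomial with coefficients \<open>a\<close> evaluated at
  \<open>c\<close>; these are nonnegative. Bounded convergence then reaches \<open>\<zeta>\<close>
  itself. This is positivity of the block Toeplitz matrix of \<open>\<mu>\<close>.\<close>

lemma J_psd:
  fixes a :: "nat \<Rightarrow> 'e"
  shows "0 \<le> Re (\<Sum>k<n. \<Sum>l<n. J (\<lambda>\<zeta>. \<zeta> ^ k * cnj (\<zeta> ^ l)) (a k) (a l))"
proof -
  have id: "(\<lambda>\<zeta>. \<zeta>) \<in> borel_measurable CB" using bdd_ident by (simp add: bdd_fun_def)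
  obtain s where s': "\<forall>n. simple_function CB (s n)"
     "\<forall>x\<in>space CB. (\<lambda>n. s n x) \<longlonglongrightarrow> x"
     "\<forall>n. \<forall>x\<in>space CB. dist (s n x) 0 \<le> 2 * dist x 0"
    using borel_measurable_implies_sequence_metric[OF id, of 0] by metis
  have s: "simple_function CB (s m)" "\<zeta> \<in> circle \<Longrightarrow> (\<lambda>n. s n \<zeta>) \<longlonglongrightarrow> \<zeta>"
     "\<zeta> \<in> circle \<Longrightarrow> cmod (s m \<zeta>) \<le> 2" for m \<zeta>
    using s' by (auto simp: space_restrict_space)
  define L where "L m y = {\<zeta> \<in> circle. s m \<zeta> = y}" for m y
  have L: "L m y \<in> circle_borel" for m y
    using simple_functionD(2)[OF s(1), of m "{y}"]
    by (simp add: L_def circle_borel_def space_restrict_space vimage_def Int_def conj_commute)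
  have fin: "finite (s m ` circle)" for m
    using simple_functionD(1)[OF s(1)[of m]] by (simp add: space_restrict_space)
  have rep: "s m \<zeta> ^ k * cnj (s m \<zeta> ^ l) = (\<Sum>y\<in>s m ` circle. y ^ k * cnj (y ^ l) * indicator (L m y) \<zeta>)"
    if "\<zeta> \<in> circle" for m \<zeta> k l
    using that fin[of m]
    by (subst sum.remove[of _ "s m \<zeta>"]) (auto simp: L_def indicator_def intro!: sum.neutral)
  have bs: "bdd_fun (\<lambda>\<zeta>. s m \<zeta> ^ k * cnj (s m \<zeta> ^ l))" for m k l
    by (subst bdd_cong[OF rep], assumption) (intro bdd_sum bdd_mult bdd_const bdd_indicator L)
  have bound: "cmod (s m \<zeta> ^ k * cnj (s m \<zeta> ^ l)) \<le> 2 ^ k * 2 ^ l" if "\<zeta> \<in> circle" for m \<zeta> k l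
    using s(3)[OF that] unfolding norm_mult norm_power complex_mod_cnj
    by (intro mult_mono power_mono) auto
  have Js: "J (\<lambda>\<zeta>. s m \<zeta> ^ k * cnj (s m \<zeta> ^ l)) x y
      = (\<Sum>c\<in>s m ` circle. cinner (\<mu> (L m c) (c ^ k *\<^sub>C x)) (c ^ l *\<^sub>C y))" for m k l x y
  proof -
    have "J (\<lambda>\<zeta>. s m \<zeta> ^ k * cnj (s m \<zeta> ^ l)) x y
        = J (\<lambda>\<zeta>. \<Sum>c\<in>s m ` circle. c ^ k * cnj (c ^ l) * indicator (L m c) \<zeta>) x y"
      by (rule fun_cong[OF fun_cong[OF J_cong]]) (rule rep)
    also have "\<dots> = (\<Sum>c\<in>s m ` circle. J (\<lambda>\<zeta>. c ^ k * cnj (c ^ l) * indicator (L m c) \<zeta>) x y)"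
      by (rule J_sum[OF fin]) (intro bdd_mult bdd_const bdd_indicator L)
    also have "\<dots> = (\<Sum>c\<in>s m ` circle. cinner (\<mu> (L m c) (c ^ k *\<^sub>C x)) (c ^ l *\<^sub>C y))"
    proof (rule sum.cong[OF refl])
      fix c
      have "J (\<lambda>\<zeta>. c ^ k * cnj (c ^ l) * indicator (L m c) \<zeta>) x y
          = c ^ k * cnj (c ^ l) * J (indicator (L m c)) x y"
        by (rule J_cmult[OF bdd_op_integrable[OF bdd_indicator[OF L]]])
      then show "J (\<lambda>\<zeta>. c ^ k * cnj (c ^ l) * indicator (L m c) \<zeta>) x y
          = cinner (\<mu> (L m c) (c ^ k *\<^sub>C x)) (c ^ l *\<^sub>C y)"
        by (simp add: J_indicator[OF L] bounded_clinearD(2)[OF clin[OF L]] cinner_scaleC_left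
            cinner_scaleC_right)
    qed
    finally show ?thesis .
  qed
  have pos: "0 \<le> Re (\<Sum>k<n. \<Sum>l<n. J (\<lambda>\<zeta>. s m \<zeta> ^ k * cnj (s m \<zeta> ^ l)) (a k) (a l))" for m
  proof -
    define v where "v c = (\<Sum>k<n. c ^ k *\<^sub>C a k)" for c
    have lin: "\<mu> E (\<Sum>k\<in>I. g k) = (\<Sum>k\<in>I. \<mu> E (g k))" if "E \<in> circle_borel" for E I and g :: "nat \<Rightarrow> 'e"
      using clin[OF that] by (simp add: bounded_clinear_def bounded_linear.linear linear_sum)
    have "(\<Sum>k<n. \<Sum>l<n. J (\<lambda>\<zeta>. s m \<zeta> ^ k * cnj (s m \<zeta> ^ l)) (a k) (a l)) =
      (\<Sum>c\<in>s m ` circle. cinner (\<mu> (L m c) (v c)) (v c))"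
      unfolding Js v_def lin[OF L] cinner.sum_left cinner.sum_right
      by (subst sum.swap, subst (2) sum.swap, intro sum.cong refl) (rule sum.swap)
    moreover have "0 \<le> Re (cinner (\<mu> (L m c) (v c)) (v c))" for c
      using pos_op[OF L] by (auto simp: positive_operator_def)
    ultimately show ?thesis by (simp add: sum_nonneg)
  qed
  have "(\<lambda>m. \<Sum>k<n. \<Sum>l<n. J (\<lambda>\<zeta>. s m \<zeta> ^ k * cnj (s m \<zeta> ^ l)) (a k) (a l)) \<longlonglongrightarrow>
      (\<Sum>k<n. \<Sum>l<n. J (\<lambda>\<zeta>. \<zeta> ^ k * cnj (\<zeta> ^ l)) (a k) (a l))"
    by (intro tendsto_sum J_bounded_convergence[OF bs _ bound] tendsto_intros s(2)
        bdd_mult bdd_cnj bdd_power bdd_ident)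
  then have "(\<lambda>m. Re (\<Sum>k<n. \<Sum>l<n. J (\<lambda>\<zeta>. s m \<zeta> ^ k * cnj (s m \<zeta> ^ l)) (a k) (a l))) \<longlonglongrightarrow>
      Re (\<Sum>k<n. \<Sum>l<n. J (\<lambda>\<zeta>. \<zeta> ^ k * cnj (\<zeta> ^ l)) (a k) (a l))"
    by (rule tendsto_Re)
  then show ?thesis by (rule LIMSEQ_le_const) (use pos in blast)
qed

section \<open>Matrix entries of the Fourier coefficients\<close>

definition mf :: "int \<Rightarrow> 'e \<Rightarrow> 'e \<Rightarrow> complex" where
  "mf n x y = cinner (fourier_coeff \<mu> n x) y"

lemma bdd_powi [intro]: "bdd_fun (\<lambda>\<zeta>. \<zeta> powi n)"
proof (cases "n \<ge> 0")
  case True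
  then show ?thesis by (simp add: power_int_def bdd_power bdd_ident)
next
  case False
  have "bdd_fun (\<lambda>\<zeta>. \<zeta> powi n) \<longleftrightarrow> bdd_fun (\<lambda>\<zeta>. cnj \<zeta> ^ nat (-n))"
  proof (rule bdd_cong)
    fix \<zeta> :: complex assume "\<zeta> \<in> circle"
    then have "inverse \<zeta> = cnj \<zeta>" by (simp add: inverse_complex_def complex_eq_iff cmod_def real_sqrt_eq_1_iff)
    then show "\<zeta> powi n = cnj \<zeta> ^ nat (-n)" using False by (simp add: power_int_def)
  qed
  then show ?thesis by (simp add: bdd_power bdd_ident bdd_cnj)
qed

lemma bddE:
  assumes "bdd_fun f"
  obtains M where "f \<in> borel_measurable CB" "\<And>\<zeta>. \<zeta> \<in> circle \<Longrightarrow> cmod (f \<zeta>) \<le> M"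
  using assms unfolding bdd_fun_def by blast

lemma mf_J: "mf n x y = complex_of_real (1 / (2 * pi)) * J (\<lambda>\<zeta>. cnj (\<zeta> powi n)) x y"
proof -
  obtain M where "(\<lambda>\<zeta>. cnj (\<zeta> powi n)) \<in> borel_measurable CB"
     "\<And>\<zeta>. \<zeta> \<in> circle \<Longrightarrow> cmod (cnj (\<zeta> powi n)) \<le> M"
    using bddE[OF bdd_cnj[OF bdd_powi[of n]]] by blast
  from operator_integral(2)[OF this] show ?thesis
    by (simp add: mf_def fourier_coeff_def scaleC_fun_def cinner_scaleC_left)
qed

lemma mf_add_left: "mf n (x + x') y = mf n x y + mf n x' y"
  and mf_add_right: "mf n x (y + y') = mf n x y + mf n x y'"
  and mf_scaleC_left: "mf n (a *\<^sub>C x) y = a * mf n x y"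
  and mf_scaleC_right: "mf n x (a *\<^sub>C y) = cnj a * mf n x y"
  using bdd_op_integrable[OF bdd_cnj[OF bdd_powi[of n]]]
  by (simp_all add: mf_J J_add_left J_add_right J_scaleC_left J_scaleC_right algebra_simps)

lemma circle_inverse: "\<zeta> \<in> circle \<Longrightarrow> inverse \<zeta> = cnj \<zeta>"
  by (simp add: inverse_complex_def complex_eq_iff cmod_def real_sqrt_eq_1_iff)

lemma mf_uminus: "mf (- n) y x = cnj (mf n x y)"
proof -
  have "J (\<lambda>\<zeta>. cnj (\<zeta> powi (- n))) = J (\<lambda>\<zeta>. cnj (cnj (\<zeta> powi n)))"
    by (rule J_cong) (simp add: power_int_minus circle_inverse flip: power_int_inverse complex_cnj_power_int)
  then show ?thesis
    using J_cnj[OF bdd_op_integrable[OF bdd_cnj[OF bdd_powi]]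
        bdd_op_integrable[OF bdd_cnj[OF bdd_cnj[OF bdd_powi]]], of n y x]
    by (simp add: mf_J)
qed

definition mf_const :: real where "mf_const = 4 * mass"

lemma mf_bound: "cmod (mf n x y) \<le> mf_const * norm x * norm y"
proof -
  have "cmod (J (\<lambda>\<zeta>. cnj (\<zeta> powi n)) x y) \<le> 4 * (1 * mass) * norm x * norm y"
  proof (rule J_bounded)
    show "(\<lambda>\<zeta>. cnj (\<zeta> powi n)) \<in> borel_measurable CB"
      using bdd_cnj[OF bdd_powi[of n]] by (simp add: bdd_fun_def)
  qed (simp add: norm_power_int)
  \<comment> \<open>The factor \<open>1 / (2 * pi)\<close> is estimated by 1; only finiteness of
    \<open>mf_const\<close> matters later.\<close>
  moreover have "cmod (mf n x y) \<le> cmod (J (\<lambda>\<zeta>. cnj (\<zeta> powi n)) x y)"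
  proof -
    have "cmod (complex_of_real (1 / (2 * pi))) \<le> 1" using pi_gt3 by (simp add: norm_divide)
    from mult_right_mono[OF this norm_ge_zero] show ?thesis unfolding mf_J norm_mult by simp
  qed
  ultimately show ?thesis by (simp add: mf_const_def)
qed

lemma mf_psd: "0 \<le> (\<Sum>k<n. \<Sum>l<n. Re (mf (int l - int k) (a k) (a l)))"
proof -
  have "J (\<lambda>\<zeta>. cnj (\<zeta> powi (int l - int k))) = J (\<lambda>\<zeta>. \<zeta> ^ k * cnj (\<zeta> ^ l))" for k l
  proof (rule J_cong)
    fix \<zeta> :: complex assume z: "\<zeta> \<in> circle"
    then have "\<zeta> \<noteq> 0" by auto
    then have "\<zeta> powi (int l - int k) = \<zeta> ^ l * inverse \<zeta> ^ k"
      by (simp add: power_int_diff divide_inverse power_inverse)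
    then show "cnj (\<zeta> powi (int l - int k)) = \<zeta> ^ k * cnj (\<zeta> ^ l)"
      by (simp add: circle_inverse[OF z])
  qed
  then have "(\<Sum>k<n. \<Sum>l<n. Re (mf (int l - int k) (a k) (a l)))
      = 1 / (2 * pi) * Re (\<Sum>k<n. \<Sum>l<n. J (\<lambda>\<zeta>. \<zeta> ^ k * cnj (\<zeta> ^ l)) (a k) (a l))"
    by (simp add: mf_J sum_distrib_left flip: of_real_divide)
  then show ?thesis using J_psd[where a=a and n=n] by simp
qed

end

section \<open>Area integrals over discs\<close>

text \<open>Boxes determine Lebesgue measure, and on boxes the two sides agree. This opens the
  complex plane to Fubini's theorem in real coordinates.\<close>

lemma lborel_complex_eq:
  "(lborel :: complex measure) = distr (lborel \<Otimes>\<^sub>M lborel) borel (\<lambda>(x, y). Complex x y)"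
proof (rule lborel_eqI)
  have m: "(\<lambda>(x, y). Complex x y) \<in> borel_measurable (borel \<Otimes>\<^sub>M borel)"
    unfolding borel_prod by (intro borel_measurable_continuous_onI) (auto simp: case_prod_beta Complex_eq intro!: continuous_intros)
  fix l u :: complex assume lu: "\<And>b. b \<in> Basis \<Longrightarrow> l \<bullet> b \<le> u \<bullet> b"
  have lu': "Re l \<le> Re u" "Im l \<le> Im u"
    using lu[of 1] lu[of \<i>] by (auto simp: Basis_complex_def inner_complex_def)
  have v: "(\<lambda>(x, y). Complex x y) -` box l u = {Re l<..<Re u} \<times> {Im l<..<Im u}"
    by (auto simp: in_box_complex_iff)
  have "emeasure (distr (lborel \<Otimes>\<^sub>M lborel) borel (\<lambda>(x, y). Complex x y)) (box l u)
      = emeasure (lborel \<Otimes>\<^sub>M lborel) ({Re l<..<Re u} \<times> {Im l<..<Im u})"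
    using m by (subst emeasure_distr) (auto simp: v space_pair_measure)
  also have "\<dots> = ennreal (Re u - Re l) * ennreal (Im u - Im l)"
    using lu' by (subst lborel.emeasure_pair_measure_Times) auto
  also have "\<dots> = (\<Prod>b\<in>Basis. (u - l) \<bullet> b)"
    using lu' by (simp add: Basis_complex_def inner_complex_def ennreal_mult)
  finally show "emeasure (distr (lborel \<Otimes>\<^sub>M lborel) borel (\<lambda>(x, y). Complex x y)) (box l u)
      = (\<Prod>b\<in>Basis. (u - l) \<bullet> b)" .
qed simp

lemma Complex_measurable [measurable]: "(\<lambda>p. Complex (fst p) (snd p)) \<in> borel_measurable (borel \<Otimes>\<^sub>M borel)"
  unfolding borel_prod by (intro borel_measurable_continuous_onI) (auto simp: Complex_eq intro!: continuous_intros)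

lemma nn_integral_complex:
  assumes [measurable]: "f \<in> borel_measurable borel"
  shows "(\<integral>\<^sup>+z. f z \<partial>lborel) = (\<integral>\<^sup>+x. \<integral>\<^sup>+y. f (Complex x y) \<partial>lborel \<partial>lborel)"
    "(\<integral>\<^sup>+z. f z \<partial>lborel) = (\<integral>\<^sup>+y. \<integral>\<^sup>+x. f (Complex x y) \<partial>lborel \<partial>lborel)"
proof -
  have [measurable]: "(\<lambda>p. f (Complex (fst p) (snd p))) \<in> borel_measurable (borel \<Otimes>\<^sub>M borel)"
    by (rule measurable_compose[OF Complex_measurable]) simp
  have m: "(\<lambda>p. Complex (fst p) (snd p)) \<in> measurable (lborel \<Otimes>\<^sub>M lborel) borel"
    unfolding measurable_cong_sets[OF sets_pair_measure_cong[OF sets_lborel sets_lborel] refl]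
    by (rule Complex_measurable)
  have *: "(\<integral>\<^sup>+z. f z \<partial>lborel) = (\<integral>\<^sup>+p. f (Complex (fst p) (snd p)) \<partial>(lborel \<Otimes>\<^sub>M lborel))"
    unfolding lborel_complex_eq case_prod_beta by (subst nn_integral_distr[OF m]) auto
  show "(\<integral>\<^sup>+z. f z \<partial>lborel) = (\<integral>\<^sup>+x. \<integral>\<^sup>+y. f (Complex x y) \<partial>lborel \<partial>lborel)"
    unfolding * by (subst lborel.nn_integral_fst[symmetric]) auto
  show "(\<integral>\<^sup>+z. f z \<partial>lborel) = (\<integral>\<^sup>+y. \<integral>\<^sup>+x. f (Complex x y) \<partial>lborel \<partial>lborel)"
    unfolding * by (subst lborel_pair.nn_integral_snd[symmetric]) (auto simp: case_prod_beta)
qed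

lemma nn_integral_lborel_translate:
  fixes g :: "real \<Rightarrow> ennreal"
  assumes [measurable]: "g \<in> borel_measurable borel"
  shows "(\<integral>\<^sup>+x. g (x + s) \<partial>lborel) = (\<integral>\<^sup>+x. g x \<partial>lborel)"
  using nn_integral_real_affine[of g 1 s] by (simp add: add.commute)

section \<open>Rotation invariance of area and moments of monomials\<close>

definition shear_re :: "real \<Rightarrow> complex \<Rightarrow> complex" where "shear_re s z = Complex (Re z + s * Im z) (Im z)"
definition shear_im :: "real \<Rightarrow> complex \<Rightarrow> complex" where "shear_im s z = Complex (Re z) (Im z + s * Re z)"

lemma shear_measurable [measurable]: "shear_re s \<in> borel_measurable borel" "shear_im s \<in> borel_measurable borel"
  unfolding shear_re_def shear_im_def Complex_eq
  by (auto intro!: borel_measurable_continuous_onI continuous_intros)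

text \<open>On each line parallel to the shear it acts as a translation, so Fubini's theorem reduces
  the claim to translation invariance on the real line.\<close>

lemma distr_shear: "distr lborel borel (shear_re s) = lborel" "distr lborel borel (shear_im s) = lborel"
proof -
  have 1: "(\<integral>\<^sup>+z. f (shear_re s z) \<partial>lborel) = (\<integral>\<^sup>+z. f z \<partial>lborel)"
    if [measurable]: "f \<in> borel_measurable borel" for f :: "complex \<Rightarrow> ennreal"
  proof -
    have "(\<integral>\<^sup>+x. f (Complex (x + s * y) y) \<partial>lborel) = (\<integral>\<^sup>+x. f (Complex x y) \<partial>lborel)" for y
      by (rule nn_integral_lborel_translate[of "\<lambda>x. f (Complex x y)"])
        (auto simp: Complex_eq intro!: measurable_compose[OF _ that] borel_measurable_continuous_onI continuous_intros)
    moreover have "(\<lambda>z. f (shear_re s z)) \<in> borel_measurable borel" by measurable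
    ultimately show ?thesis
      using nn_integral_complex(2)[of "\<lambda>z. f (shear_re s z)"] nn_integral_complex(2)[OF that]
      by (simp add: shear_re_def)
  qed
  have 2: "(\<integral>\<^sup>+z. f (shear_im s z) \<partial>lborel) = (\<integral>\<^sup>+z. f z \<partial>lborel)"
    if [measurable]: "f \<in> borel_measurable borel" for f :: "complex \<Rightarrow> ennreal"
  proof -
    have "(\<integral>\<^sup>+y. f (Complex x (y + s * x)) \<partial>lborel) = (\<integral>\<^sup>+y. f (Complex x y) \<partial>lborel)" for x
      by (rule nn_integral_lborel_translate[of "\<lambda>y. f (Complex x y)"])
        (auto simp: Complex_eq intro!: measurable_compose[OF _ that] borel_measurable_continuous_onI continuous_intros)
    moreover have "(\<lambda>z. f (shear_im s z)) \<in> borel_measurable borel" by measurable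
    ultimately show ?thesis
      using nn_integral_complex(1)[of "\<lambda>z. f (shear_im s z)"] nn_integral_complex(1)[OF that]
      by (simp add: shear_im_def)
  qed
  have aux: "distr lborel borel h = (lborel :: complex measure)"
    if h[measurable]: "h \<in> borel_measurable borel" and i: "\<And>f :: complex \<Rightarrow> ennreal. f \<in> borel_measurable borel \<Longrightarrow>
      (\<integral>\<^sup>+z. f (h z) \<partial>lborel) = (\<integral>\<^sup>+z. f z \<partial>lborel)" for h :: "complex \<Rightarrow> complex"
  proof (rule measure_eqI)
    fix A assume "A \<in> sets (distr lborel borel h)"
    then have [measurable]: "A \<in> sets borel" by simp
    have "emeasure (distr lborel borel h) A = (\<integral>\<^sup>+z. indicator A z \<partial>distr lborel borel h)" by simp
    also have "\<dots> = (\<integral>\<^sup>+z. indicator A (h z) \<partial>lborel)" by (subst nn_integral_distr) auto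
    also have "\<dots> = (\<integral>\<^sup>+z. indicator A z \<partial>lborel)" by (rule i) auto
    finally show "emeasure (distr lborel borel h) A = emeasure lborel A" by simp
  qed simp
  show "distr lborel borel (shear_re s) = lborel" by (rule aux) (use 1 in auto)
  show "distr lborel borel (shear_im s) = lborel" by (rule aux) (use 2 in auto)
qed

text \<open>A rotation is a composition of three shears.\<close>

lemma distr_rotation:
  assumes c: "cmod c = 1" "Im c \<noteq> 0"
  shows "distr lborel borel ((*) c) = lborel"
proof -
  \<comment> \<open>For \<open>c = cis \<theta>\<close> this is -tan(\<theta>/2): the horizontal
    shear by \<open>a\<close> is applied before and after the vertical shear by \<open>Im c\<close>,
    which is sin \<theta>.\<close>
  define a where "a = (Re c - 1) / Im c"
  have sq: "Re c * Re c + Im c * Im c = 1"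
    using c(1) by (simp add: cmod_def power2_eq_square real_sqrt_eq_1_iff)
  have 1: "1 + a * Im c = Re c" using c by (simp add: a_def)
  have "a * (2 + a * Im c) * Im c = (Re c - 1) * (Re c + 1)" using c by (simp add: a_def)
  also have "\<dots> = - (Im c * Im c)" using sq by (simp add: algebra_simps)
  finally have "a * (2 + a * Im c) * Im c = (- Im c) * Im c" by simp
  then have 2: "a * (2 + a * Im c) = - Im c" using c(2) mult_right_cancel by blast
  have "(*) c = (\<lambda>z. shear_re a (shear_im (Im c) (shear_re a z)))"
  proof
    fix z
    have "Re (c * z) = (1 + a * Im c) * Re z + a * (2 + a * Im c) * Im z" unfolding 2 1 by simp
    moreover have "Im (c * z) = Im c * Re z + (1 + a * Im c) * Im z" unfolding 1 by simp
    ultimately show "c * z = shear_re a (shear_im (Im c) (shear_re a z))"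
      by (simp add: complex_eq_iff shear_re_def shear_im_def algebra_simps)
  qed
  then have "distr lborel borel ((*) c)
     = distr (distr (distr lborel borel (shear_re a)) borel (shear_im (Im c))) borel (shear_re a)"
    by (simp add: distr_distr o_def)
  then show ?thesis by (simp add: distr_shear)
qed

text \<open>A rotation by \<open>c\<close> preserves the integral but multiplies the integrand by
  \<open>c ^ m * cnj c ^ n\<close>; if this factor differs from 1, the integral vanishes.\<close>

lemma disc_moment_off_diagonal:
  assumes "m \<noteq> n"
  shows "(LINT z|lborel. indicator (ball 0 R) z *\<^sub>R (z ^ m * cnj z ^ n)) = (0 :: complex)"
proof -
  define d where "d = (if m > n then m - n else n - m)"
  \<comment> \<open>Then \<open>c ^ d = \<i>\<close>, so the rotation factor is \<open>\<i>\<close>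
    or its conjugate, and the angle lies in (0, pi/2], so that \<open>Im c\<close> is nonzero as
    \<open>distr_rotation\<close> requires.\<close>
  define c where "c = cis (pi / (2 * real d))"
  have d: "d \<ge> 1" using assms by (auto simp: d_def)
  have "Im c = sin (pi / (2 * real d))" by (simp add: c_def)
  moreover have "\<dots> > 0" using d by (intro sin_gt_zero) (auto simp: field_simps)
  ultimately have Im: "Im c \<noteq> 0" by simp
  have "real d * (pi / (2 * real d)) = pi / 2" using d by simp
  then have "cis (real d * (pi / (2 * real d))) = \<i>" by (simp only: cis_pi_half)
  then have cd: "c ^ d = \<i>" using Complex.DeMoivre[of "pi / (2 * real d)" d] by (simp only: c_def)
  have cc: "c * cnj c = 1" "cmod c = 1" by (simp_all add: c_def cis_cnj cis_mult)
  have f: "c ^ m * cnj c ^ n \<noteq> 1"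
  proof (cases "m > n")
    case True
    then have "c ^ m * cnj c ^ n = c ^ d * (c * cnj c) ^ n"
      by (simp add: d_def power_mult_distrib flip: power_add mult.assoc)
    then show ?thesis by (simp add: cd cc complex_eq_iff)
  next
    case False
    then have "c ^ m * cnj c ^ n = cnj (c ^ d) * (c * cnj c) ^ m"
      using assms by (simp add: d_def power_mult_distrib mult_ac flip: power_add)
    then show ?thesis by (simp add: cd cc complex_eq_iff)
  qed
  define g where "g = (\<lambda>z :: complex. indicator (ball 0 R) z *\<^sub>R (z ^ m * cnj z ^ n))"
  have [measurable]: "(\<lambda>z :: complex. z ^ m * cnj z ^ n) \<in> borel_measurable borel"
    by (intro borel_measurable_continuous_onI continuous_intros)
  have g[measurable]: "g \<in> borel_measurable borel"
    unfolding g_def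
    by (intro borel_measurable_scaleR borel_measurable_indicator borel_measurable_times
        borel_measurable_power borel_measurable_continuous_onI[OF continuous_on_cnj[OF continuous_on_id]]) auto
  have "integral\<^sup>L lborel g = integral\<^sup>L (distr lborel borel ((*) c)) g"
    by (simp add: distr_rotation[OF cc(2) Im])
  also have "\<dots> = (LINT z|lborel. g (c * z))" by (rule integral_distr) auto
  also have "\<dots> = (LINT z|lborel. (c ^ m * cnj c ^ n) * g z)"
    by (rule Bochner_Integration.integral_cong) (auto simp: g_def norm_mult cc indicator_def power_mult_distrib)
  also have "\<dots> = (c ^ m * cnj c ^ n) * integral\<^sup>L lborel g" by simp
  finally have "integral\<^sup>L lborel g = 0" using f by (metis mult_cancel_right1)
  then show ?thesis by (simp add: g_def)
qed

lemma emeasure_ball_complex: "R \<ge> 0 \<Longrightarrow> emeasure lborel (ball (0::complex) R) = ennreal (pi * R\<^sup>2)"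
  by (simp add: emeasure_ball unit_ball_vol_2)

text \<open>Layer-cake formula in the variable \<open>(cmod z)\<^sup>2\<close>: writing the power as
  an integral of \<open>w\<close> and exchanging integrals leaves areas of annuli, that is,
  differences of areas of balls. Polar coordinates are thereby avoided.\<close>

lemma disc_moment_nn:
  assumes R: "R > 0"
  shows "(\<integral>\<^sup>+z\<in>ball (0::complex) R. ennreal (cmod z ^ (2 * m)) \<partial>lborel) = ennreal (pi * R ^ (2 * m + 2) / (real m + 1))"
proof (cases "m = 0")
  case True
  then show ?thesis using emeasure_ball_complex[of R] R by (simp add: power2_eq_square)
next
  case False
  \<comment> \<open>The derivative of \<open>s ^ m\<close>. For \<open>m = 0\<close> it would
    reproduce 0 instead of the constant 1, hence the separate case above.\<close>
  define w where "w s = real m * s ^ (m - 1)" for s :: real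
  have [measurable]: "w \<in> borel_measurable borel" unfolding w_def by measurable
  have layer: "ennreal (r ^ m) = (\<integral>\<^sup>+s. ennreal (w s) * indicator {0..r} s \<partial>lborel)" if "0 \<le> r" for r
  proof -
    have "(\<integral>\<^sup>+s. ennreal (w s) * indicator {0..r} s \<partial>lborel) = r ^ m - 0 ^ m"
      using that by (intro nn_integral_FTC_Icc[where F = "\<lambda>s. s ^ m"])
        (auto simp: w_def intro!: derivative_eq_intros)
    then show ?thesis using False by (simp add: zero_power)
  qed
  have meas: "emeasure lborel {z. cmod z < R \<and> s \<le> (cmod z)\<^sup>2} = ennreal (pi * (R\<^sup>2 - s))"
    if "0 \<le> s" "s \<le> R\<^sup>2" for s
  proof -
    have "{z. cmod z < R \<and> s \<le> (cmod z)\<^sup>2} = ball 0 R - ball 0 (sqrt s)"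
      by (auto simp: not_less intro: sqrt_le_D) (meson norm_ge_zero not_less real_le_lsqrt)
    moreover have "sqrt s \<le> R" using that R by (metis real_sqrt_le_iff real_sqrt_unique less_imp_le)
    then have "emeasure lborel (ball (0::complex) R - ball 0 (sqrt s)) = emeasure lborel (ball (0::complex) R) - emeasure lborel (ball (0::complex) (sqrt s))"
      using that by (intro emeasure_Diff) (auto simp: emeasure_ball_complex)
    moreover have "\<dots> = ennreal (pi * (R\<^sup>2 - s))"
      using that R by (simp add: emeasure_ball_complex ennreal_minus right_diff_distrib)
    ultimately show ?thesis by simp
  qed
  have "(\<integral>\<^sup>+z\<in>ball (0::complex) R. ennreal (cmod z ^ (2 * m)) \<partial>lborel) =
     (\<integral>\<^sup>+z. \<integral>\<^sup>+s. ennreal (w s) * indicator {(z, s). cmod z < R \<and> 0 \<le> s \<and> s \<le> (cmod z)\<^sup>2} (z, s) \<partial>lborel \<partial>lborel)"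
    by (intro nn_integral_cong) (auto simp: indicator_def power_mult layer intro!: nn_integral_cong)
  also have "\<dots> = (\<integral>\<^sup>+s. \<integral>\<^sup>+z. ennreal (w s) * indicator {(z, s). cmod z < R \<and> 0 \<le> s \<and> s \<le> (cmod z)\<^sup>2} (z, s) \<partial>lborel \<partial>lborel)"
    by (rule lborel_pair.Fubini'[symmetric]) measurable
  also have "\<dots> = (\<integral>\<^sup>+s. ennreal (w s * (pi * (R\<^sup>2 - s))) * indicator {0..R\<^sup>2} s \<partial>lborel)"
  proof (rule nn_integral_cong)
    fix s :: real
    show "(\<integral>\<^sup>+z. ennreal (w s) * indicator {(z, s). cmod z < R \<and> 0 \<le> s \<and> s \<le> (cmod z)\<^sup>2} (z, s) \<partial>lborel)
      = ennreal (w s * (pi * (R\<^sup>2 - s))) * indicator {0..R\<^sup>2} s"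
    proof (cases "0 \<le> s \<and> s \<le> R\<^sup>2")
      case True
      have "(\<integral>\<^sup>+z. ennreal (w s) * indicator {(z, s). cmod z < R \<and> 0 \<le> s \<and> s \<le> (cmod z)\<^sup>2} (z, s) \<partial>lborel)
         = (\<integral>\<^sup>+z. ennreal (w s) * indicator {z. cmod z < R \<and> s \<le> (cmod z)\<^sup>2} z \<partial>lborel)"
        using True by (intro nn_integral_cong) (auto simp: indicator_def)
      also have "\<dots> = ennreal (w s) * emeasure lborel {z. cmod z < R \<and> s \<le> (cmod z)\<^sup>2}"
        by (rule nn_integral_cmult_indicator) measurable
      finally show ?thesis using True by (simp add: meas ennreal_mult w_def)
    next
      case False
      have "(cmod z)\<^sup>2 < R\<^sup>2" if "cmod z < R" for z using that by (intro power_strict_mono) auto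
      then have "indicator {(z, s). cmod z < R \<and> 0 \<le> s \<and> s \<le> (cmod z)\<^sup>2} (z, s) = (0::ennreal)" for z
        using False by (auto simp: indicator_def) (meson less_le_not_le order_trans)
      then show ?thesis using False by simp
    qed
  qed
  also have "\<dots> = ennreal (pi * (R\<^sup>2 * (R\<^sup>2) ^ m - real m / (real m + 1) * (R\<^sup>2) ^ Suc m)
      - pi * (R\<^sup>2 * 0 ^ m - real m / (real m + 1) * 0 ^ Suc m))"
  proof (rule nn_integral_FTC_Icc[where F = "\<lambda>s. pi * (R\<^sup>2 * s ^ m - real m / (real m + 1) * s ^ Suc m)"])
    show "((\<lambda>s. pi * (R\<^sup>2 * s ^ m - real m / (real m + 1) * s ^ Suc m)) has_real_derivative w x * (pi * (R\<^sup>2 - x)))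
         (at x)" for x
    proof -
      have x: "x ^ m = x * x ^ (m - 1)" using False by (metis power_eq_if)
      have der: "((\<lambda>s. pi * (R\<^sup>2 * s ^ m - k * s ^ Suc m)) has_real_derivative
        pi * (R\<^sup>2 * (real m * x ^ (m - 1)) - k * (real (Suc m) * x ^ m))) (at x)" for k
        using DERIV_pow[of m x UNIV] DERIV_pow[of "Suc m" x UNIV]
        by (intro DERIV_cmult DERIV_diff) (simp_all only: diff_Suc_Suc diff_zero One_nat_def)
      have k: "real m / (real m + 1) * (real (Suc m) * x ^ m) = real m * (x * x ^ (m - 1))"
        unfolding x[symmetric] by (simp add: add.commute)
      have rhs: "w x * (pi * (R\<^sup>2 - x)) = pi * (R\<^sup>2 * (real m * x ^ (m - 1)) - real m * (x * x ^ (m - 1)))"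
        by (simp add: w_def algebra_simps)
      show ?thesis using der[of "real m / (real m + 1)"] unfolding k rhs .
    qed
  qed (auto simp: w_def)
  also have "pi * (R\<^sup>2 * (R\<^sup>2) ^ m - real m / (real m + 1) * (R\<^sup>2) ^ Suc m)
      - pi * (R\<^sup>2 * 0 ^ m - real m / (real m + 1) * 0 ^ Suc m) = pi * R ^ (2 * m + 2) / (real m + 1)"
    using False by (simp add: field_simps power2_eq_square power_add power_mult_distrib zero_power mult_2_right)
  finally show ?thesis .
qed

lemma disc_moment:
  assumes R: "R > 0"
  shows "(LINT z|lborel. indicator (ball 0 R) z *\<^sub>R (z ^ m * cnj z ^ n))
     = (if m = n then of_real (pi * R ^ (2 * m + 2) / (real m + 1)) else 0)"
proof (cases "m = n")
  case True
  have "(LINT z|lborel. indicator (ball 0 R) z *\<^sub>R (z ^ m * cnj z ^ m))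
      = (LINT z|lborel. complex_of_real (indicator (ball 0 R) z * cmod z ^ (2 * m)))"
    by (intro Bochner_Integration.integral_cong)
      (auto simp: indicator_def power_mult_distrib[symmetric] complex_norm_square[symmetric] power_mult)
  also have "\<dots> = of_real (LINT z|lborel. indicator (ball 0 R) z * cmod z ^ (2 * m))"
    by (rule integral_complex_of_real)
  also have "(LINT z|lborel. indicator (ball 0 R) z * cmod z ^ (2 * m)) = pi * R ^ (2 * m + 2) / (real m + 1)"
  proof -
    have "(LINT z|lborel. indicator (ball 0 R) z * cmod z ^ (2 * m))
        = enn2real (\<integral>\<^sup>+z. ennreal (indicator (ball 0 R) z * cmod z ^ (2 * m)) \<partial>lborel)"
      by (intro integral_eq_nn_integral borel_measurable_times borel_measurable_indicator
          borel_measurable_power borel_measurable_norm) auto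
    also have "(\<integral>\<^sup>+z. ennreal (indicator (ball 0 R) z * cmod z ^ (2 * m)) \<partial>lborel)
        = (\<integral>\<^sup>+z\<in>ball (0::complex) R. ennreal (cmod z ^ (2 * m)) \<partial>lborel)"
      by (intro nn_integral_cong) (auto simp: indicator_def)
    finally show ?thesis using R by (simp add: disc_moment_nn)
  qed
  finally show ?thesis using True by simp
qed (simp add: disc_moment_off_diagonal)

section \<open>Power series with coefficients in a Hilbert space\<close>

text \<open>Bounded coefficients are all that power series on the open disc require, and, unlike
  square summability of a sequence of functions, a common bound \<open>C\<close> visibly passes to
  termwise limits.\<close>

definition bdd_coeffs :: "real \<Rightarrow> (nat \<Rightarrow> 'e::complex_hilbert_space) \<Rightarrow> bool" where
  "bdd_coeffs C a \<longleftrightarrow> (\<forall>k. norm (a k) \<le> C)"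

lemma bdd_coeffs_nonneg: "bdd_coeffs C a \<Longrightarrow> 0 \<le> C"
  by (metis bdd_coeffs_def norm_ge_zero order_trans)

definition pser :: "(nat \<Rightarrow> 'e::complex_hilbert_space) \<Rightarrow> complex \<Rightarrow> 'e" where
  "pser a z = (\<Sum>k. z ^ k *\<^sub>C a k)"

definition der :: "(nat \<Rightarrow> 'e::complex_hilbert_space) \<Rightarrow> complex \<Rightarrow> 'e" where
  "der a z = (\<Sum>n. (of_nat (Suc n) * z ^ n) *\<^sub>C a (Suc n))"

lemma summable_Suc_power: "0 \<le> r \<Longrightarrow> r < 1 \<Longrightarrow> summable (\<lambda>n. real (Suc n) * r ^ n)"
  using termdiff_converges[of r 1 "\<lambda>_. 1"] by (simp add: diffs_def summable_geometric)

lemma summable_Suc_Suc_power: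
  "0 \<le> r \<Longrightarrow> r < 1 \<Longrightarrow> summable (\<lambda>n. real (Suc n) * real (Suc (Suc n)) * r ^ n)"
  using termdiff_converges[of r 1 "diffs (\<lambda>_. 1)"] termdiff_converges[of _ 1 "\<lambda>_. 1 :: real"]
  by (simp add: diffs_def summable_geometric)

lemma pser_sums:
  assumes "bdd_coeffs C a" "cmod z < 1"
  shows "(\<lambda>k. z ^ k *\<^sub>C a k) sums pser a z" "norm (pser a z) \<le> C / (1 - cmod z)"
proof -
  have le: "norm (z ^ k *\<^sub>C a k) \<le> C * cmod z ^ k" for k
    using assms(1) mult_left_mono[of "norm (a k)" C "cmod z ^ k"]
    by (simp add: bdd_coeffs_def norm_scaleC norm_power mult.commute)
  have s: "summable (\<lambda>k. C * cmod z ^ k)"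
    using assms(2) by (intro summable_mult summable_geometric) simp
  show "(\<lambda>k. z ^ k *\<^sub>C a k) sums pser a z"
    unfolding pser_def by (intro summable_sums summable_comparison_test'[OF s, of 0] le)
  have "norm (pser a z) \<le> (\<Sum>k. C * cmod z ^ k)"
    unfolding pser_def by (intro norm_suminf_le s le)
  also have "\<dots> = C / (1 - cmod z)"
    using assms(2) by (simp add: suminf_mult summable_geometric suminf_geometric)
  finally show "norm (pser a z) \<le> C / (1 - cmod z)" .
qed

lemma has_taylor_pser: "bdd_coeffs C a \<Longrightarrow> has_taylor (pser a) a"
  by (simp add: has_taylor_def pser_sums)

lemma has_taylor_eq_pser: "has_taylor f a \<Longrightarrow> z \<in> disc \<Longrightarrow> f z = pser a z"
  by (simp add: has_taylor_def pser_def sums_iff)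

lemma der_bound:
  assumes "bdd_coeffs C a" "cmod z < 1"
  shows "(\<lambda>n. (of_nat (Suc n) * z ^ n) *\<^sub>C a (Suc n)) sums der a z"
    "norm (der a z) \<le> C * (\<Sum>n. real (Suc n) * cmod z ^ n)"
proof -
  have le: "norm ((of_nat (Suc n) * z ^ n) *\<^sub>C a (Suc n)) \<le> C * (real (Suc n) * cmod z ^ n)" for n
  proof -
    have "cmod (of_nat (Suc n) * z ^ n) * norm (a (Suc n)) \<le> cmod (of_nat (Suc n) * z ^ n) * C"
      using assms(1) by (intro mult_left_mono) (auto simp: bdd_coeffs_def)
    then show ?thesis
      unfolding norm_scaleC norm_mult norm_of_nat norm_power by (simp only: mult_ac)
  qed
  have s: "summable (\<lambda>n. C * (real (Suc n) * cmod z ^ n))"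
    using assms(2) by (intro summable_mult summable_Suc_power) auto
  show "(\<lambda>n. (of_nat (Suc n) * z ^ n) *\<^sub>C a (Suc n)) sums der a z"
    unfolding der_def by (intro summable_sums summable_comparison_test'[OF s, of 0] le)
  have "norm (der a z) \<le> (\<Sum>n. C * (real (Suc n) * cmod z ^ n))"
    unfolding der_def by (intro norm_suminf_le s le)
  also have "\<dots> = C * (\<Sum>n. real (Suc n) * cmod z ^ n)"
    using assms(2) by (intro suminf_mult summable_Suc_power) auto
  finally show "norm (der a z) \<le> C * (\<Sum>n. real (Suc n) * cmod z ^ n)" .
qed

text \<open>Dominated convergence for series: the M-test gives convergence of the partial sums
  uniformly in \<open>j\<close>, which permits exchanging the two limits.\<close>

lemma dominated_series_tendsto:
  fixes u :: "nat \<Rightarrow> nat \<Rightarrow> 'a::banach"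
  assumes "\<And>k. (\<lambda>j. u j k) \<longlonglongrightarrow> v k" "\<And>j k. norm (u j k) \<le> M k" "summable M"
  shows "(\<lambda>j. \<Sum>k. u j k) \<longlonglongrightarrow> (\<Sum>k. v k)"
proof (rule swap_uniform_limit'[where f = "\<lambda>n j. \<Sum>k<n. u j k" and S = UNIV and F = sequentially])
  have "norm (v k) \<le> M k" for k
    by (rule LIMSEQ_le_const2[OF tendsto_norm[OF assms(1)]]) (use assms(2) in blast)
  then have "summable v" by (intro summable_comparison_test'[OF assms(3), of 0]) auto
  then show "(\<lambda>n. \<Sum>k<n. v k) \<longlonglongrightarrow> (\<Sum>k. v k)" by (rule summable_LIMSEQ)
  show "uniform_limit UNIV (\<lambda>n j. \<Sum>k<n. u j k) (\<lambda>j. \<Sum>k. u j k) sequentially"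
    by (rule Weierstrass_m_test) (use assms in auto)
  show "\<forall>\<^sub>F n in sequentially. (\<lambda>j. \<Sum>k<n. u j k) \<longlonglongrightarrow> (\<Sum>k<n. v k)"
    by (intro always_eventually allI tendsto_sum assms(1))
qed auto

lemma der_tendsto:
  assumes a: "\<And>j. bdd_coeffs C (a j)" "\<And>k. (\<lambda>j. a j k) \<longlonglongrightarrow> b k" and z: "cmod z < 1"
  shows "(\<lambda>j. der (a j) z) \<longlonglongrightarrow> der b z"
  unfolding der_def
proof (rule dominated_series_tendsto)
  show "(\<lambda>j. (of_nat (Suc k) * z ^ k) *\<^sub>C a j (Suc k)) \<longlonglongrightarrow> (of_nat (Suc k) * z ^ k) *\<^sub>C b (Suc k)" for k
    by (intro scaleC.tendsto tendsto_const a(2))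
  show "norm ((of_nat (Suc n) * z ^ n) *\<^sub>C a j (Suc n)) \<le> C * (real (Suc n) * cmod z ^ n)" for j n
  proof -
    have "cmod (of_nat (Suc n) * z ^ n) * norm (a j (Suc n)) \<le> cmod (of_nat (Suc n) * z ^ n) * C"
      using a(1) by (intro mult_left_mono) (auto simp: bdd_coeffs_def)
    then show ?thesis
      unfolding norm_scaleC norm_mult norm_of_nat norm_power by (simp only: mult_ac)
  qed
  show "summable (\<lambda>n. C * (real (Suc n) * cmod z ^ n))"
    using z by (intro summable_mult summable_Suc_power) auto
qed

lemma pser_tendsto:
  assumes a: "\<And>j. bdd_coeffs C (a j)" "\<And>k. (\<lambda>j. a j k) \<longlonglongrightarrow> b k" and z: "cmod z < 1"
  shows "(\<lambda>j. pser (a j) z) \<longlonglongrightarrow> pser b z"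
  unfolding pser_def
proof (rule dominated_series_tendsto)
  show "(\<lambda>j. z ^ k *\<^sub>C a j k) \<longlonglongrightarrow> z ^ k *\<^sub>C b k" for k
    by (intro scaleC.tendsto tendsto_const a(2))
  show "norm (z ^ k *\<^sub>C a j k) \<le> C * cmod z ^ k" for j k
    using a(1)[of j] mult_left_mono[of "norm (a j k)" C "cmod z ^ k"]
    by (simp add: bdd_coeffs_def norm_scaleC norm_power mult.commute)
  show "summable (\<lambda>k. C * cmod z ^ k)"
    using z by (intro summable_mult summable_geometric) simp
qed

lemma pser_shift:
  assumes "bdd_coeffs C a" "cmod z < 1"
  shows "pser a z = a 0 + z *\<^sub>C pser (\<lambda>k. a (Suc k)) z"
proof -
  have "bdd_coeffs C (\<lambda>k. a (Suc k))" using assms(1) by (simp add: bdd_coeffs_def)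
  from pser_sums(1)[OF this assms(2)]
  have "(\<lambda>k. z *\<^sub>C z ^ k *\<^sub>C a (Suc k)) sums (z *\<^sub>C pser (\<lambda>k. a (Suc k)) z)"
    by (rule bounded_linear.sums[OF scaleC.bounded_linear_right])
  then have "(\<lambda>k. z ^ Suc k *\<^sub>C a (Suc k)) sums (z *\<^sub>C pser (\<lambda>k. a (Suc k)) z)"
    by (simp add: scaleC_scaleC)
  then have "(\<lambda>k. z ^ k *\<^sub>C a k) sums (z *\<^sub>C pser (\<lambda>k. a (Suc k)) z + a 0)"
    by (subst (asm) sums_Suc_iff) simp
  then show ?thesis using pser_sums(1)[OF assms] sums_unique2 by fastforce
qed

text \<open>Bounded coefficients make the tails \<open>pser (\<lambda>k. a j (k + m))\<close> uniformly Lipschitz at 0, which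
  transports convergence from punctured discs to the centre.\<close>

lemma pser_convergent_imp_coeffs_convergent:
  assumes a: "\<And>j. bdd_coeffs C (a j)"
    and conv: "\<And>z. cmod z < 1 \<Longrightarrow> convergent (\<lambda>j. pser (a j) z)"
  shows "convergent (\<lambda>j. a j m)"
proof -
  define S where "S m j z = pser (\<lambda>k. a j (k + m)) z" for m j z
  have bm: "bdd_coeffs C (\<lambda>k. a j (k + m))" for j m using a by (simp add: bdd_coeffs_def)
  have rec: "S m j z = a j m + z *\<^sub>C S (Suc m) j z" if "cmod z < 1" for m j z
    using pser_shift[OF bm[of j m] that] by (simp add: S_def)
  have S0: "S m j 0 = a j m" for m j using rec[of 0 m j] by simp
  have bS: "norm (S m j z) \<le> C / (1 - cmod z)" if "cmod z < 1" for m j z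
    using pser_sums(2)[OF bm that] by (simp add: S_def)
  have C: "0 \<le> C" using bdd_coeffs_nonneg[OF a] .
  have "\<forall>z. cmod z < 1 \<longrightarrow> convergent (\<lambda>j. S m j z)"
  proof (induction m)
    case 0
    then show ?case using conv by (simp add: S_def)
  next
    case (Suc m)
    \<comment> \<open>Away from 0 the recursion \<open>rec\<close> can be solved for the next
      tail.\<close>
    have ne: "convergent (\<lambda>j. S (Suc m) j z)" if "cmod z < 1" "z \<noteq> 0" for z
    proof -
      have "S (Suc m) j z = inverse z *\<^sub>C (S m j z - S m j 0)" for j
        using rec[OF that(1), of m j] that(2) by (simp add: S0 scaleC_scaleC)
      moreover have "convergent (\<lambda>j. inverse z *\<^sub>C (S m j z - S m j 0))"
      proof -
        have "convergent (\<lambda>j. S m j z)" "convergent (\<lambda>j. S m j 0)"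
          using Suc that by auto
        then obtain p q where "(\<lambda>j. S m j z) \<longlonglongrightarrow> p" "(\<lambda>j. S m j 0) \<longlonglongrightarrow> q"
          by (auto simp: convergent_def)
        then have "(\<lambda>j. inverse z *\<^sub>C (S m j z - S m j 0)) \<longlonglongrightarrow> inverse z *\<^sub>C (p - q)"
          by (intro scaleC.tendsto tendsto_intros)
        then show ?thesis by (auto simp: convergent_def)
      qed
      ultimately show ?thesis by simp
    qed
    \<comment> \<open>At 0 the recursion gives nothing, so the value there is compared with the
      value at a nearby nonzero point.\<close>
    have "Cauchy (\<lambda>j. S (Suc m) j 0)"
    proof (rule metric_CauchyI)
      fix e :: real assume e: "e > 0"
      \<comment> \<open>The bound 1/2 keeps \<open>1 - cmod w\<close> away from 0, and
        \<open>e / (8 * C + 8)\<close> then makes each comparison error at most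
        \<open>e / 4\<close>; two of them and the \<open>e / 2\<close> at \<open>w\<close> add up to
        \<open>e\<close>.\<close>
      define w :: complex where "w = of_real (min (1/2) (e / (8 * C + 8)))"
      have w: "cmod w \<le> 1/2" "w \<noteq> 0" "cmod w \<le> e / (8 * C + 8)"
        using e C by (auto simp: w_def min_def)
      then have w1: "cmod w < 1" by simp
      have near: "dist (S (Suc m) j 0) (S (Suc m) j w) \<le> e / 4" for j
      proof -
        have "dist (S (Suc m) j 0) (S (Suc m) j w) = cmod w * norm (S (Suc (Suc m)) j w)"
          using rec[OF w1, of "Suc m" j] by (simp add: S0 dist_norm norm_scaleC)
        also have "\<dots> \<le> cmod w * (C / (1 - cmod w))" by (intro mult_left_mono bS w1) auto
        also have "\<dots> \<le> cmod w * (C / (1/2))"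
          using w C by (intro mult_left_mono divide_left_mono) auto
        also have "\<dots> \<le> e / (8 * C + 8) * (C / (1/2))"
          using w C by (intro mult_right_mono) auto
        also have "\<dots> \<le> e / 4" using e C by (simp add: field_simps)
        finally show ?thesis .
      qed
      have "Cauchy (\<lambda>j. S (Suc m) j w)"
        using ne[OF w1 w(2)] by (rule convergent_Cauchy)
      then obtain M where M: "\<And>i j. i \<ge> M \<Longrightarrow> j \<ge> M \<Longrightarrow> dist (S (Suc m) i w) (S (Suc m) j w) < e / 2"
        using e metric_CauchyD[of "\<lambda>j. S (Suc m) j w" "e / 2"] by auto
      have "dist (S (Suc m) i 0) (S (Suc m) j 0) < e" if "i \<ge> M" "j \<ge> M" for i j
        using near[of i] near[of j] M[OF that]
          dist_triangle[of "S (Suc m) i 0" "S (Suc m) j 0" "S (Suc m) i w"]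
          dist_triangle[of "S (Suc m) i w" "S (Suc m) j 0" "S (Suc m) j w"]
        by (simp add: dist_commute)
      then show "\<exists>M. \<forall>i\<ge>M. \<forall>j\<ge>M. dist (S (Suc m) i 0) (S (Suc m) j 0) < e" by blast
    qed
    then show ?case using ne by (metis Cauchy_convergent)
  qed
  then have "convergent (\<lambda>j. S m j 0)" by simp
  then show ?thesis by (simp add: S0)
qed

text \<open>Alternating between \<open>a\<close> and the zero sequence does not change the values on
  the disc, so the coefficients of the alternating sequence converge; hence \<open>a k\<close>
  equals 0.\<close>

lemma pser_zero_imp_coeffs_zero:
  assumes "bdd_coeffs C a" "\<And>z. cmod z < 1 \<Longrightarrow> pser a z = 0"
  shows "a k = 0"
proof -
  define u where "u j = (if even j then a else (\<lambda>_. 0))" for j :: nat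
  have 1: "bdd_coeffs C (u j)" for j
    using assms(1) bdd_coeffs_nonneg[OF assms(1)] by (auto simp: u_def bdd_coeffs_def)
  have 2: "(\<lambda>j. pser (u j) z) = (\<lambda>j. 0)" if "cmod z < 1" for z
    using assms(2)[OF that] by (auto simp: u_def pser_def)
  have "convergent (\<lambda>j. u j k)"
    by (rule pser_convergent_imp_coeffs_convergent[OF 1]) (simp only: 2 convergent_const)
  then obtain l where l: "(\<lambda>j. u j k) \<longlonglongrightarrow> l" by (auto simp: convergent_def)
  have "(\<lambda>j. u (2 * j) k) \<longlonglongrightarrow> l" "(\<lambda>j. u (2 * j + 1) k) \<longlonglongrightarrow> l"
    using LIMSEQ_subseq_LIMSEQ[OF l, of "\<lambda>j. 2 * j"] LIMSEQ_subseq_LIMSEQ[OF l, of "\<lambda>j. 2 * j + 1"]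
    by (simp_all add: strict_mono_def o_def)
  then have "(\<lambda>j. a k) \<longlonglongrightarrow> l" "(\<lambda>j. 0) \<longlonglongrightarrow> l" by (simp_all add: u_def)
  then show ?thesis using LIMSEQ_unique tendsto_const by metis
qed

lemma has_taylor_unique:
  assumes "has_taylor f a" "has_taylor f b"
  shows "a = b"
proof -
  \<comment> \<open>Rescaling by 1/2 moves the point 1 inside the disc of convergence, which makes
    the coefficients of the difference bounded.\<close>
  define c where "c k = (1/2 :: complex) ^ k *\<^sub>C (a k - b k)" for k
  have s: "(\<lambda>k. z ^ k *\<^sub>C c k) sums 0" if "cmod z < 2" for z
  proof -
    have "z / 2 \<in> disc" using that by (simp add: norm_divide)
    then have "(\<lambda>k. (z / 2) ^ k *\<^sub>C a k - (z / 2) ^ k *\<^sub>C b k) sums (f (z / 2) - f (z / 2))"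
      using assms unfolding has_taylor_def by (intro sums_diff) auto
    moreover have "(z / 2) ^ k *\<^sub>C a k - (z / 2) ^ k *\<^sub>C b k = z ^ k *\<^sub>C c k" for k
      by (simp add: c_def scaleC_scaleC power_mult_distrib[symmetric] scaleC_diff_right[symmetric])
    ultimately show ?thesis by simp
  qed
  have "summable (\<lambda>k. 1 ^ k *\<^sub>C c k)" using s[of 1] by (simp add: sums_iff)
  then have "Bseq c" using summable_LIMSEQ_zero convergent_imp_Bseq by (simp add: convergent_def) blast
  then obtain C where "bdd_coeffs C c" by (auto simp: Bseq_def bdd_coeffs_def)
  then have "c k = 0" for k
    by (rule pser_zero_imp_coeffs_zero) (use s in \<open>simp add: pser_def sums_iff\<close>)
  then have "2 ^ k *\<^sub>C (1/2 :: complex) ^ k *\<^sub>C (a k - b k) = 0" for k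
    unfolding c_def by simp
  then show ?thesis
    unfolding scaleC_scaleC power_mult_distrib[symmetric] by (intro ext) simp
qed

lemma taylor_coeff_eq: "has_taylor f a \<Longrightarrow> taylor_coeff f = a"
  unfolding taylor_coeff_def by (blast intro: has_taylor_unique)

text \<open>The second-order remainder of each \<open>z ^ n\<close> is bounded by \<open>h\<close>
  times a term of a convergent series with ratio \<open>K\<close>, so the difference quotients
  converge to the termwise derivative.\<close>

lemma cderiv_eq_der:
  assumes f: "has_taylor f a" and a: "bdd_coeffs C a" and z: "cmod z < 1"
  shows "cderiv f z = der a z"
proof -
  \<comment> \<open>Halfway between \<open>cmod z\<close> and 1, to leave room for the increment
    \<open>h\<close> inside the open disc.\<close>
  define K where "K = (1 + cmod z) / 2"
  have K: "cmod z < K" "K < 1" "0 \<le> K" using z by (auto simp: K_def add_nonneg_nonneg)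
  define M where "M = (\<Sum>n. real (Suc n) * real (Suc (Suc n)) * K ^ n)"
  have C: "0 \<le> C" using a by (rule bdd_coeffs_nonneg)
  have est: "norm (inverse h *\<^sub>C (f (z + h) - f z) - der a z) \<le> C * M * cmod h"
    if h: "h \<noteq> 0" "cmod h < K - cmod z" for h
  proof -
    have zh: "cmod (z + h) < K" using norm_triangle_ineq[of z h] h(2) by simp
    define q where "q n = ((z + h) ^ n - z ^ n) / h - of_nat n * z ^ (n - Suc 0)" for n
    have fz: "(\<lambda>n. z ^ n *\<^sub>C a n) sums f z" "(\<lambda>n. (z + h) ^ n *\<^sub>C a n) sums f (z + h)"
      using f z zh K by (auto simp: has_taylor_def)
    have 1: "(\<lambda>n. inverse h *\<^sub>C ((z + h) ^ n *\<^sub>C a n - z ^ n *\<^sub>C a n)) sums (inverse h *\<^sub>C (f (z + h) - f z))"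
      by (intro bounded_linear.sums[OF scaleC.bounded_linear_right] sums_diff fz)
    have 2: "(\<lambda>n. (of_nat n * z ^ (n - Suc 0)) *\<^sub>C a n) sums der a z"
      using der_bound(1)[OF a z] sums_Suc_iff[of "\<lambda>n. (of_nat n * z ^ (n - Suc 0)) *\<^sub>C a n" "der a z"] by simp
    have "inverse h *\<^sub>C ((z + h) ^ n *\<^sub>C a n - z ^ n *\<^sub>C a n) - (of_nat n * z ^ (n - Suc 0)) *\<^sub>C a n
        = q n *\<^sub>C a n" for n
      by (simp add: q_def scaleC_diff_left scaleC_diff_right scaleC_scaleC divide_inverse mult.commute
          right_diff_distrib)
    with sums_diff[OF 1 2]
    have s: "(\<lambda>n. q n *\<^sub>C a n) sums (inverse h *\<^sub>C (f (z + h) - f z) - der a z)" by simp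
    have q: "norm (q (n + 2) *\<^sub>C a (n + 2)) \<le> (C * cmod h) * (real (Suc n) * real (Suc (Suc n)) * K ^ n)" for n
    proof -
      have "cmod (q (n + 2)) \<le> real (n + 2) * real (n + 2 - Suc 0) * K ^ (n + 2 - 2) * cmod h"
        unfolding q_def using h(1) K zh lemma_termdiff3[of h z K "n + 2"] by simp
      moreover have "norm (a (n + 2)) \<le> C" using a by (simp add: bdd_coeffs_def)
      ultimately have "cmod (q (n + 2)) * norm (a (n + 2))
          \<le> (real (n + 2) * real (n + 2 - Suc 0) * K ^ (n + 2 - 2) * cmod h) * C"
        using K by (intro mult_mono) auto
      then show ?thesis by (simp add: norm_scaleC mult_ac)
    qed
    have sm: "summable (\<lambda>n. real (Suc n) * real (Suc (Suc n)) * K ^ n)"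
      using K by (intro summable_Suc_Suc_power)
    \<comment> \<open>The remainders of constant and linear terms vanish; dropping them matches the
      index shift by 2 in the majorant.\<close>
    have "q 0 = 0" "q 1 = 0" using h by (simp_all add: q_def)
    then have "(\<lambda>n. q (n + 2) *\<^sub>C a (n + 2)) sums (inverse h *\<^sub>C (f (z + h) - f z) - der a z)"
      using s by (subst sums_iff_shift) (simp add: numeral_2_eq_2)
    then have "norm (inverse h *\<^sub>C (f (z + h) - f z) - der a z)
        = norm (\<Sum>n. q (n + 2) *\<^sub>C a (n + 2))" by (simp add: sums_iff)
    also have "\<dots> \<le> (\<Sum>n. (C * cmod h) * (real (Suc n) * real (Suc (Suc n)) * K ^ n))"
      by (intro norm_suminf_le q summable_mult sm)
    also have "\<dots> = C * M * cmod h" unfolding M_def by (subst suminf_mult[OF sm]) (simp add: mult_ac)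
    finally show ?thesis .
  qed
  have "((\<lambda>h. inverse h *\<^sub>C (f (z + h) - f z) - der a z) \<longlongrightarrow> 0) (at 0)"
  proof (rule Lim_null_comparison)
    show "\<forall>\<^sub>F h in at 0. norm (inverse h *\<^sub>C (f (z + h) - f z) - der a z) \<le> C * M * cmod h"
      unfolding eventually_at using K est by (intro exI[of _ "K - cmod z"]) auto
    show "((\<lambda>h. C * M * cmod h) \<longlongrightarrow> 0) (at 0)"
      by (rule tendsto_eq_intros refl tendsto_ident_at)+ auto
  qed
  then have "((\<lambda>w. inverse (w - z) *\<^sub>C (f w - f z) - der a z) \<longlongrightarrow> 0) (at z)"
    by (subst LIM_offset_zero_iff[of z]) auto
  then have "((\<lambda>w. inverse (w - z) *\<^sub>C (f w - f z)) \<longlongrightarrow> der a z) (at z)"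
    by (simp add: LIM_zero_iff)
  then show ?thesis unfolding cderiv_def by (rule tendsto_Lim[rotated]) simp
qed

section \<open>The weighted Dirichlet integral over discs\<close>

lemma disc_integrable:
  fixes f :: "complex \<Rightarrow> 'b::{banach, second_countable_topology}"
  assumes "(\<lambda>z. indicator (ball 0 R) z *\<^sub>R f z) \<in> borel_measurable lborel"
    and "\<And>z. cmod z < R \<Longrightarrow> norm (f z) \<le> B"
  shows "integrable lborel (\<lambda>z. indicator (ball (0::complex) R) z *\<^sub>R f z)"
proof (rule integrableI_bounded_set[where A = "ball 0 R" and B = B])
  show "emeasure lborel (ball (0::complex) R) < \<infinity>"
    using emeasure_lborel_ball_finite by (simp add: less_top)
qed (use assms in auto)

lemma disc_dominated:
  fixes f :: "nat \<Rightarrow> complex \<Rightarrow> 'b::{banach, second_countable_topology}"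
  assumes m: "\<And>j. (\<lambda>z. indicator (ball 0 R) z *\<^sub>R f j z) \<in> borel_measurable lborel"
    and b: "\<And>j z. cmod z < R \<Longrightarrow> norm (f j z) \<le> B"
    and l: "\<And>z. cmod z < R \<Longrightarrow> (\<lambda>j. f j z) \<longlonglongrightarrow> g z"
  shows "(\<lambda>z. indicator (ball (0::complex) R) z *\<^sub>R g z) \<in> borel_measurable lborel"
    "(\<lambda>j. LINT z|lborel. indicator (ball (0::complex) R) z *\<^sub>R f j z)
       \<longlonglongrightarrow> (LINT z|lborel. indicator (ball (0::complex) R) z *\<^sub>R g z)"
proof -
  have l': "(\<lambda>j. indicator (ball (0::complex) R) z *\<^sub>R f j z) \<longlonglongrightarrow> indicator (ball (0::complex) R) z *\<^sub>R g z" for z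
    using l[of z] by (auto simp: indicator_def)
  show m': "(\<lambda>z. indicator (ball (0::complex) R) z *\<^sub>R g z) \<in> borel_measurable lborel"
    by (rule borel_measurable_LIMSEQ_metric[OF m l'])
  show "(\<lambda>j. LINT z|lborel. indicator (ball (0::complex) R) z *\<^sub>R f j z)
       \<longlonglongrightarrow> (LINT z|lborel. indicator (ball (0::complex) R) z *\<^sub>R g z)"
  proof (rule integral_dominated_convergence[where w = "\<lambda>z. indicator (ball 0 R) z *\<^sub>R B"])
    show "integrable lborel (\<lambda>z. indicator (ball (0::complex) R) z *\<^sub>R B)"
      by (rule disc_integrable[where B = "\<bar>B\<bar>"])
        (auto intro!: borel_measurable_times borel_measurable_indicator)
    show "AE z in lborel. norm (indicator (ball (0::complex) R) z *\<^sub>R f j z) \<le> indicator (ball 0 R) z *\<^sub>R B" for j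
      using b by (intro AE_I2) (auto simp: indicator_def)
  qed (use m m' l' in auto)
qed

lemma disc_monomial_measurable:
  "(\<lambda>z :: complex. indicator (ball 0 R) z *\<^sub>R (z ^ m * cnj z ^ n)) \<in> borel_measurable lborel"
proof -
  have "cnj \<in> borel_measurable borel"
    by (intro borel_measurable_continuous_onI continuous_intros)
  then show ?thesis
    unfolding measurable_lborel1
    by (intro borel_measurable_scaleR borel_measurable_indicator borel_measurable_times
        borel_measurable_power) auto
qed

context op_measure begin

definition poisson_kernel :: "complex \<Rightarrow> complex \<Rightarrow> complex" where
  "poisson_kernel z \<zeta> = complex_of_real ((1 - (cmod z)\<^sup>2) / (cmod (\<zeta> - z))\<^sup>2)"

definition PZ :: "complex \<Rightarrow> 'e \<Rightarrow> 'e \<Rightarrow> complex" where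
  "PZ z x y = cinner (poisson_ext \<mu> z x) y"

lemma bdd_poisson:
  assumes "cmod z < 1"
  shows "bdd_fun (poisson_kernel z)"
  unfolding bdd_fun_def
proof (intro conjI exI ballI)
  show "poisson_kernel z \<in> borel_measurable CB"
    unfolding poisson_kernel_def by (intro measurable_restrict_space1) measurable
  fix \<zeta> assume "\<zeta> \<in> circle"
  then have "1 - cmod z \<le> cmod (\<zeta> - z)" using norm_triangle_ineq2[of \<zeta> z] by simp
  then have "(1 - cmod z)\<^sup>2 \<le> (cmod (\<zeta> - z))\<^sup>2" using assms by (intro power_mono) auto
  moreover have "0 < (1 - cmod z)\<^sup>2" using assms by simp
  moreover have "0 \<le> 1 - (cmod z)\<^sup>2" using assms by (simp add: abs_square_le_1)
  ultimately show "cmod (poisson_kernel z \<zeta>) \<le> (1 - (cmod z)\<^sup>2) / (1 - cmod z)\<^sup>2"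
    unfolding poisson_kernel_def norm_of_real by (simp add: frac_le)
qed

lemma PZ_operator:
  assumes "cmod z < 1"
  shows "bounded_linear (poisson_ext \<mu> z)" "PZ z x y = of_real (1 / (2 * pi)) * J (poisson_kernel z) x y"
proof -
  have eq: "poisson_ext \<mu> z = (\<lambda>x. of_real (1 / (2 * pi)) *\<^sub>C operator_integral \<mu> (poisson_kernel z) x)"
    unfolding poisson_ext_def scaleC_fun_def poisson_kernel_def ..
  obtain M where M: "poisson_kernel z \<in> borel_measurable CB"
     "\<And>\<zeta>. \<zeta> \<in> circle \<Longrightarrow> cmod (poisson_kernel z \<zeta>) \<le> M"
    using bddE[OF bdd_poisson[OF assms]] by blast
  have "bounded_linear (operator_integral \<mu> (poisson_kernel z))"
    using operator_integral(1)[OF M] by (simp add: bounded_clinear_def)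
  then show "bounded_linear (poisson_ext \<mu> z)"
    unfolding eq by (rule bounded_linear_compose[OF scaleC.bounded_linear_right])
  show "PZ z x y = of_real (1 / (2 * pi)) * J (poisson_kernel z) x y"
    using operator_integral(2)[OF M, of x y] by (simp only: PZ_def eq cinner_scaleC_left)
qed

lemma PZ_lin:
  assumes "cmod z < 1"
  shows "PZ z (x + x') y = PZ z x y + PZ z x' y" "PZ z x (y + y') = PZ z x y + PZ z x y'"
    "PZ z (a *\<^sub>C x) y = a * PZ z x y" "PZ z x (a *\<^sub>C y) = cnj a * PZ z x y"
  using bdd_op_integrable[OF bdd_poisson[OF assms]]
  by (simp_all add: PZ_operator[OF assms] J_add_left J_add_right J_scaleC_left J_scaleC_right algebra_simps)

lemma PZ_sum_left: "cmod z < 1 \<Longrightarrow> PZ z (\<Sum>i\<in>I. f i) y = (\<Sum>i\<in>I. PZ z (f i) y)"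
  unfolding PZ_def using PZ_operator(1)[of z]
  by (simp add: bounded_linear.linear linear_sum cinner.sum_left)

lemma PZ_sum_right: "PZ z x (\<Sum>i\<in>I. f i) = (\<Sum>i\<in>I. PZ z x (f i))"
  unfolding PZ_def by (rule cinner.sum_right)

lemma PZ_sym:
  assumes "cmod z < 1"
  shows "PZ z y x = cnj (PZ z x y)"
proof -
  have "(\<lambda>\<zeta>. cnj (poisson_kernel z \<zeta>)) = poisson_kernel z"
    by (rule ext) (simp only: poisson_kernel_def complex_cnj_complex_of_real)
  then show ?thesis
    using J_cnj[of "poisson_kernel z" y x] bdd_op_integrable[OF bdd_poisson[OF assms]]
    by (simp add: PZ_operator[OF assms])
qed

lemma PZ_pos:
  assumes "cmod z < 1"
  shows "0 \<le> Re (PZ z x x)"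
proof -
  have "J (poisson_kernel z) x x = (\<integral>\<zeta>. complex_of_real ((1 - (cmod z)\<^sup>2) / (cmod (\<zeta> - z))\<^sup>2) \<partial>dm x)"
    unfolding J_diag[OF bdd_op_integrable[OF bdd_poisson[OF assms]]]
    by (rule Bochner_Integration.integral_cong) (simp_all only: poisson_kernel_def)
  also have "\<dots> = of_real (\<integral>\<zeta>. (1 - (cmod z)\<^sup>2) / (cmod (\<zeta> - z))\<^sup>2 \<partial>dm x)"
    by (rule integral_complex_of_real)
  finally have "J (poisson_kernel z) x x = of_real (\<integral>\<zeta>. (1 - (cmod z)\<^sup>2) / (cmod (\<zeta> - z))\<^sup>2 \<partial>dm x)" .
  moreover have "0 \<le> (\<integral>\<zeta>. (1 - (cmod z)\<^sup>2) / (cmod (\<zeta> - z))\<^sup>2 \<partial>dm x)"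
    using assms by (intro Bochner_Integration.integral_nonneg) (simp add: abs_square_le_1)
  ultimately show ?thesis by (simp add: PZ_operator(2)[OF assms])
qed

text \<open>Partial sums of the expansion of the Poisson extension in powers of \<open>z\<close> and
  \<open>cnj z\<close>.\<close>

definition PN :: "nat \<Rightarrow> complex \<Rightarrow> 'e \<Rightarrow> 'e \<Rightarrow> complex" where
  "PN N z x y = mf 0 x y + (\<Sum>n<N. z ^ Suc n * mf (int (Suc n)) x y + cnj z ^ Suc n * mf (- int (Suc n)) x y)"

lemma sum_power_le: "0 \<le> r \<Longrightarrow> r < 1 \<Longrightarrow> (\<Sum>n<N. r ^ Suc n) \<le> 1 / (1 - (r::real))"
proof -
  assume r: "0 \<le> r" "r < 1"
  have "(\<Sum>n<N. r ^ Suc n) \<le> (\<Sum>n<N. r ^ n)"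
    using r by (intro sum_mono power_decreasing) auto
  also have "\<dots> \<le> (\<Sum>n. r ^ n)" using r by (intro sum_le_suminf summable_geometric) auto
  also have "\<dots> = 1 / (1 - r)" using r by (intro suminf_geometric) simp
  finally show ?thesis .
qed

lemma PN_bound:
  assumes "cmod z < 1"
  shows "cmod (PN N z x y) \<le> mf_const * norm x * norm y * (1 + 2 / (1 - cmod z))"
proof -
  define K where "K = mf_const * norm x * norm y"
  have K: "cmod (mf n x y) \<le> K" for n unfolding K_def by (rule mf_bound)
  have "0 \<le> K" using order_trans[OF norm_ge_zero K[of 0]] .
  have "cmod (z ^ Suc n * mf (int (Suc n)) x y + cnj z ^ Suc n * mf (- int (Suc n)) x y)
      \<le> cmod z ^ Suc n * K + cmod z ^ Suc n * K" for n
    by (intro order_trans[OF norm_triangle_ineq] add_mono; simp only: norm_mult norm_power complex_mod_cnj)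
      (intro mult_left_mono K zero_le_power norm_ge_zero)+
  then have "cmod (PN N z x y) \<le> K + (\<Sum>n<N. cmod z ^ Suc n * K + cmod z ^ Suc n * K)"
    unfolding PN_def by (intro norm_triangle_mono[OF K] sum_norm_le)
  also have "\<dots> = K + 2 * K * (\<Sum>n<N. cmod z ^ Suc n)"
    by (simp add: sum.distrib sum_distrib_left sum_distrib_right mult_ac)
  also have "\<dots> \<le> K + 2 * K * (1 / (1 - cmod z))"
    using \<open>0 \<le> K\<close> assms by (intro add_left_mono mult_left_mono sum_power_le) auto
  finally show ?thesis by (simp add: K_def algebra_simps)
qed

text \<open>With \<open>w = z * cnj \<zeta>\<close> the Poisson kernel on the circle is 1 plus the
  geometric series of \<open>w\<close> and of its conjugate. Their partial sums are bounded
  uniformly in \<open>\<zeta>\<close>, so bounded convergence applies under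
  \<open>J\<close>.\<close>

lemma PN_tendsto:
  assumes z: "cmod z < 1"
  shows "(\<lambda>N. PN N z x y) \<longlonglongrightarrow> PZ z x y"
proof -
  define f where "f n \<zeta> = z ^ Suc n * cnj (\<zeta> powi int (Suc n)) + cnj z ^ Suc n * cnj (\<zeta> powi (- int (Suc n)))" for n \<zeta>
  define s where "s N \<zeta> = cnj (\<zeta> powi 0) + (\<Sum>n<N. f n \<zeta>)" for N \<zeta>
  have bf: "bdd_fun (f n)" for n
    unfolding f_def by (intro bdd_add bdd_mult bdd_const bdd_cnj bdd_powi)
  have bs: "bdd_fun (s N)" for N
    unfolding s_def by (intro bdd_add bdd_sum bdd_cnj bdd_powi bf)
  have PN: "PN N z x y = of_real (1 / (2 * pi)) * J (s N) x y" for N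
  proof -
    have "J (f n) x y = z ^ Suc n * J (\<lambda>\<zeta>. cnj (\<zeta> powi int (Suc n))) x y
        + cnj z ^ Suc n * J (\<lambda>\<zeta>. cnj (\<zeta> powi (- int (Suc n)))) x y" for n
      unfolding f_def
      by (subst J_add; (intro bdd_op_integrable bdd_mult bdd_const bdd_cnj bdd_powi)?)
        (simp only: J_cmult[OF bdd_op_integrable[OF bdd_cnj[OF bdd_powi]]])
    moreover have "J (s N) x y = J (\<lambda>\<zeta>. cnj (\<zeta> powi 0)) x y + (\<Sum>n<N. J (f n) x y)"
      unfolding s_def
      by (subst J_add; (intro bdd_op_integrable bdd_sum bdd_cnj bdd_powi bf)?)
        (simp only: J_sum[OF finite_lessThan bf])
    ultimately show ?thesis
      unfolding PN_def mf_J by (simp add: sum_distrib_left distrib_left mult_ac)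
  qed
  have fw: "f n \<zeta> = (z * cnj \<zeta>) ^ Suc n + cnj (z * cnj \<zeta>) ^ Suc n" if "\<zeta> \<in> circle" for n \<zeta>
  proof -
    have "\<zeta> powi (- int (Suc n)) = cnj \<zeta> ^ Suc n"
      using circle_inverse[OF that] by (simp only: power_int_minus power_int_of_nat power_inverse[symmetric])
    moreover have "\<zeta> powi int (Suc n) = \<zeta> ^ Suc n" by (rule power_int_of_nat)
    ultimately show ?thesis unfolding f_def by (simp add: power_mult_distrib)
  qed
  have "(\<lambda>N. J (s N) x y) \<longlonglongrightarrow> J (poisson_kernel z) x y"
  proof (rule J_bounded_convergence[OF bs bdd_poisson[OF z]])
    fix \<zeta> assume \<zeta>: "\<zeta> \<in> circle"
    define w where "w = z * cnj \<zeta>"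
    have w: "cmod w = cmod z" using \<zeta> by (simp add: w_def norm_mult)
    have "w \<noteq> 1" using w z by auto
    show "cmod (s N \<zeta>) \<le> 1 + 2 * (1 / (1 - cmod z))" for N
    proof -
      have "cmod (f n \<zeta>) \<le> cmod z ^ Suc n + cmod z ^ Suc n" for n
        using norm_triangle_ineq[of "w ^ Suc n" "cnj w ^ Suc n"] w
        unfolding fw[OF \<zeta>] w_def[symmetric] by (simp only: norm_power complex_mod_cnj)
      then have "cmod (s N \<zeta>) \<le> 1 + (\<Sum>n<N. cmod z ^ Suc n + cmod z ^ Suc n)"
        unfolding s_def by (intro order_trans[OF norm_triangle_ineq] add_mono sum_norm_le) auto
      also have "\<dots> \<le> 1 + 2 * (1 / (1 - cmod z))"
        using sum_power_le[of "cmod z" N] z by (simp add: sum_distrib_left[symmetric] flip: mult_2)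
      finally show ?thesis .
    qed
    have geo: "(\<lambda>N. \<Sum>n<N. u ^ Suc n) \<longlonglongrightarrow> u / (1 - u)" if "cmod u < 1" for u
      using sums_mult[OF geometric_sums[OF that], of u] by (simp add: sums_def)
    have "(\<lambda>N. 1 + ((\<Sum>n<N. w ^ Suc n) + (\<Sum>n<N. cnj w ^ Suc n))) \<longlonglongrightarrow> 1 + (w / (1 - w) + cnj w / (1 - cnj w))"
      using z w by (intro tendsto_intros geo) auto
    moreover have "s N \<zeta> = 1 + ((\<Sum>n<N. w ^ Suc n) + (\<Sum>n<N. cnj w ^ Suc n))" for N
      unfolding s_def fw[OF \<zeta>] w_def[symmetric] sum.distrib[symmetric] by simp
    moreover have "1 + (w / (1 - w) + cnj w / (1 - cnj w)) = poisson_kernel z \<zeta>"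
    proof -
      have nz: "1 - w \<noteq> 0" "1 - cnj w \<noteq> 0"
        using \<open>w \<noteq> 1\<close> by (auto simp: complex_eq_iff)
      have "\<zeta> * (1 - w) = \<zeta> - z * (\<zeta> * cnj \<zeta>)" by (simp add: w_def algebra_simps)
      then have "\<zeta> * (1 - w) = \<zeta> - z" using \<zeta> by (simp add: complex_norm_square[symmetric])
      then have "cmod (\<zeta> - z) = cmod (1 - w)" using \<zeta> by (metis norm_mult mem_sphere_0 mult_1)
      then have "poisson_kernel z \<zeta> = (1 - w * cnj w) / ((1 - w) * cnj (1 - w))"
        unfolding poisson_kernel_def complex_norm_square[symmetric] by (simp add: w)
      also have "\<dots> = 1 + (w / (1 - w) + cnj w / (1 - cnj w))"
        using nz by (simp add: divide_simps) (simp add: algebra_simps)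
      finally show ?thesis by simp
    qed
    ultimately show "(\<lambda>N. s N \<zeta>) \<longlonglongrightarrow> poisson_kernel z \<zeta>" by simp
  qed
  then show ?thesis unfolding PN PZ_operator(2)[OF z] by (intro tendsto_intros)
qed

lemma PZ_bound:
  assumes "cmod z < 1"
  shows "cmod (PZ z x y) \<le> mf_const * norm x * norm y * (1 + 2 / (1 - cmod z))"
  by (rule LIMSEQ_le_const2[OF tendsto_norm[OF PN_tendsto[OF assms]]]) (use PN_bound[OF assms] in blast)

text \<open>Of the expansion of the Poisson extension, orthogonality of monomials on the disc
  retains only the term that raises the smaller of the two exponents to the larger one; hence the
  moment at \<open>max n m\<close> and the Fourier index \<open>int m - int n\<close>.\<close>

lemma PZ_moment:
  assumes R: "0 < R" "R < 1"
  shows "(\<lambda>z. indicator (ball 0 R) z *\<^sub>R (z ^ n * cnj z ^ m * PZ z x y)) \<in> borel_measurable lborel"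
    "(LINT z|lborel. indicator (ball 0 R) z *\<^sub>R (z ^ n * cnj z ^ m * PZ z x y))
      = of_real (pi * R ^ (2 * max n m + 2) / (real (max n m) + 1)) * mf (int m - int n) x y"
proof -
  define I where "I z = indicat_real (ball (0::complex) R) z" for z
  define c where "c k = complex_of_real (pi * R ^ (2 * k + 2) / (real k + 1))" for k
  have mom: "(LINT z|lborel. I z *\<^sub>R (z ^ i * cnj z ^ j)) = (if i = j then c i else 0)" for i j
    using disc_moment[OF R(1), of i j] by (simp add: I_def c_def)
  have int: "integrable lborel (\<lambda>z. I z *\<^sub>R (z ^ i * cnj z ^ j))" for i j
    unfolding I_def
  proof (rule disc_integrable[where B = 1])
    show "norm (z ^ i * cnj z ^ j) \<le> 1" if "cmod z < R" for z
      using that R by (auto simp: norm_mult norm_power intro!: mult_le_one power_le_one)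
  qed (rule disc_monomial_measurable)
  have hb: "has_bochner_integral lborel (\<lambda>z. I z *\<^sub>R (z ^ i * cnj z ^ j)) (if i = j then c i else 0)" for i j
    using int mom by (simp add: has_bochner_integral_iff)
  have expand: "I z *\<^sub>R (z ^ n * cnj z ^ m * PN N z x y) = mf 0 x y * (I z *\<^sub>R (z ^ n * cnj z ^ m)) +
      (\<Sum>i<N. mf (int (Suc i)) x y * (I z *\<^sub>R (z ^ (n + Suc i) * cnj z ^ m))
        + mf (- int (Suc i)) x y * (I z *\<^sub>R (z ^ n * cnj z ^ (m + Suc i))))" for N z
    unfolding PN_def power_add
    by (simp add: scaleR_conv_of_real sum_distrib_left algebra_simps)
  have meas: "(\<lambda>z. I z *\<^sub>R (z ^ n * cnj z ^ m * PN N z x y)) \<in> borel_measurable lborel" for N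
    unfolding expand using int by (intro borel_measurable_add borel_measurable_sum borel_measurable_times
        borel_measurable_const borel_measurable_integrable)
  \<comment> \<open>For \<open>N \<ge> n + m\<close> the single surviving term is already among
    those of \<open>PN N\<close>, so the integrals are constant from there on.\<close>
  have val: "(LINT z|lborel. I z *\<^sub>R (z ^ n * cnj z ^ m * PN N z x y)) = c (max n m) * mf (int m - int n) x y"
    if "N \<ge> n + m" for N
  proof -
    have "(LINT z|lborel. I z *\<^sub>R (z ^ n * cnj z ^ m * PN N z x y)) =
      mf 0 x y * (if n = m then c n else 0) +
      (\<Sum>i<N. mf (int (Suc i)) x y * (if n + Suc i = m then c (n + Suc i) else 0)
        + mf (- int (Suc i)) x y * (if n = m + Suc i then c n else 0))"
      unfolding expand
      by (intro has_bochner_integral_integral_eq has_bochner_integral_add has_bochner_integral_sum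
          has_bochner_integral_mult_right hb)
    also have "\<dots> = c (max n m) * mf (int m - int n) x y"
    proof (cases n m rule: linorder_cases)
      case less
      have "(\<Sum>i<N. mf (int (Suc i)) x y * (if n + Suc i = m then c (n + Suc i) else 0)
        + mf (- int (Suc i)) x y * (if n = m + Suc i then c n else 0))
        = (\<Sum>i<N. if i = m - n - 1 then mf (int m - int n) x y * c m else 0)"
        using less by (intro sum.cong refl) auto
      then show ?thesis using less that by (simp add: max_def)
    next
      case greater
      have "(\<Sum>i<N. mf (int (Suc i)) x y * (if n + Suc i = m then c (n + Suc i) else 0)
        + mf (- int (Suc i)) x y * (if n = m + Suc i then c n else 0))
        = (\<Sum>i<N. if i = n - m - 1 then mf (int m - int n) x y * c n else 0)"
        using greater by (intro sum.cong refl) auto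
      then show ?thesis using greater that by (simp add: max_def)
    next
      case equal
      then show ?thesis by simp
    qed
    finally show ?thesis .
  qed
  define B where "B = mf_const * norm x * norm y * (1 + 2 / (1 - R))"
  have bound: "cmod (z ^ n * cnj z ^ m * PN N z x y) \<le> B" if "cmod z < R" for N z
  proof -
    have z: "cmod z < 1" using that R by simp
    have "cmod (z ^ n * cnj z ^ m * PN N z x y) = cmod z ^ n * cmod z ^ m * cmod (PN N z x y)"
      by (simp add: norm_mult norm_power)
    also have "\<dots> \<le> 1 * cmod (PN N z x y)"
      using z by (intro mult_right_mono mult_le_one power_le_one) auto
    also have "\<dots> \<le> mf_const * norm x * norm y * (1 + 2 / (1 - cmod z))"
      using PN_bound[OF z] by simp
    also have "\<dots> \<le> B"
      unfolding B_def using that R mass by (intro mult_left_mono add_left_mono divide_left_mono) (auto simp: mf_const_def)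
    finally show ?thesis .
  qed
  have lim: "(\<lambda>N. z ^ n * cnj z ^ m * PN N z x y) \<longlonglongrightarrow> z ^ n * cnj z ^ m * PZ z x y" if "cmod z < R" for z
    using that R by (intro tendsto_intros PN_tendsto) auto
  \<comment> \<open>The same limit gives measurability in \<open>z\<close> of the Poisson extension
    and the value of the integral.\<close>
  note dom = disc_dominated[OF meas[unfolded I_def] bound lim]
  show "(\<lambda>z. indicator (ball 0 R) z *\<^sub>R (z ^ n * cnj z ^ m * PZ z x y)) \<in> borel_measurable lborel"
    by (rule dom(1))
  have "(\<lambda>N. LINT z|lborel. I z *\<^sub>R (z ^ n * cnj z ^ m * PN N z x y)) \<longlonglongrightarrow> c (max n m) * mf (int m - int n) x y"
    by (rule tendsto_eventually) (use val in \<open>auto simp: eventually_sequentially\<close>)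
  from LIMSEQ_unique[OF dom(2)[folded I_def] this]
  show "(LINT z|lborel. indicator (ball 0 R) z *\<^sub>R (z ^ n * cnj z ^ m * PZ z x y))
      = of_real (pi * R ^ (2 * max n m + 2) / (real (max n m) + 1)) * mf (int m - int n) x y"
    by (simp add: I_def c_def)
qed

end

section \<open>The Dirichlet form over smaller discs\<close>

definition trunc :: "nat \<Rightarrow> (nat \<Rightarrow> 'e::complex_hilbert_space) \<Rightarrow> nat \<Rightarrow> 'e" where
  "trunc N a k = (if k < N then a k else 0)"

lemma bdd_trunc: "bdd_coeffs C a \<Longrightarrow> bdd_coeffs C (trunc N a)"
  using bdd_coeffs_nonneg[of C a] by (auto simp: bdd_coeffs_def trunc_def)

lemma trunc_tendsto: "(\<lambda>N. trunc N a k) \<longlonglongrightarrow> a k"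
  by (rule tendsto_eventually) (auto simp: trunc_def eventually_sequentially intro!: exI[of _ "Suc k"])

lemma bdd_coeffs_add: "bdd_coeffs C a \<Longrightarrow> bdd_coeffs C' b \<Longrightarrow> bdd_coeffs (C + C') (\<lambda>k. a k + b k)"
  by (auto simp: bdd_coeffs_def intro: norm_triangle_mono)

lemma bdd_coeffs_scaleC: "bdd_coeffs C a \<Longrightarrow> bdd_coeffs (cmod c * C) (\<lambda>k. c *\<^sub>C a k)"
  by (auto simp: bdd_coeffs_def norm_scaleC intro: mult_left_mono)

lemma der_add:
  assumes "bdd_coeffs C a" "bdd_coeffs C' b" "cmod z < 1"
  shows "der (\<lambda>k. a k + b k) z = der a z + der b z"
proof -
  have "(\<lambda>n. (of_nat (Suc n) * z ^ n) *\<^sub>C a (Suc n) + (of_nat (Suc n) * z ^ n) *\<^sub>C b (Suc n)) sums (der a z + der b z)"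
    by (intro sums_add der_bound(1)[OF assms(1,3)] der_bound(1)[OF assms(2,3)])
  then show ?thesis unfolding der_def by (simp only: scaleC_add_right sums_iff)
qed

lemma der_scaleC:
  assumes "bdd_coeffs C a" "cmod z < 1"
  shows "der (\<lambda>k. c *\<^sub>C a k) z = c *\<^sub>C der a z"
proof -
  have "(\<lambda>n. c *\<^sub>C (of_nat (Suc n) * z ^ n) *\<^sub>C a (Suc n)) sums (c *\<^sub>C der a z)"
    by (intro bounded_linear.sums[OF scaleC.bounded_linear_right] der_bound(1)[OF assms])
  then show ?thesis unfolding der_def by (simp only: scaleC_commute[of c] sums_iff)
qed

lemma der_trunc: "der (trunc N a) z = (\<Sum>n<N. (of_nat (Suc n) * z ^ n) *\<^sub>C trunc N a (Suc n))"
  unfolding der_def by (rule suminf_finite) (auto simp: trunc_def)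

lemma der_bound_disc:
  assumes "bdd_coeffs C a" "cmod z \<le> R" "R < 1"
  shows "norm (der a z) \<le> C * (\<Sum>n. real (Suc n) * R ^ n)"
proof -
  have z: "cmod z < 1" and R: "0 \<le> R" using assms order_trans[OF norm_ge_zero assms(2)] by auto
  have "(\<Sum>n. real (Suc n) * cmod z ^ n) \<le> (\<Sum>n. real (Suc n) * R ^ n)"
    using assms z R by (intro suminf_le summable_Suc_power mult_left_mono power_mono) auto
  then show ?thesis
    using order_trans[OF der_bound(2)[OF assms(1) z]] bdd_coeffs_nonneg[OF assms(1)]
    by (meson mult_left_mono)
qed

context op_measure begin

definition Fd :: "(nat \<Rightarrow> 'e) \<Rightarrow> (nat \<Rightarrow> 'e) \<Rightarrow> complex \<Rightarrow> complex" where
  "Fd a b z = PZ z (der a z) (der b z)"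

text \<open>Used for \<open>R < 1\<close>, where the integrands are bounded; the Dirichlet integral
  over the whole disc is recovered as a supremum over \<open>R\<close>.\<close>

definition Q :: "real \<Rightarrow> (nat \<Rightarrow> 'e) \<Rightarrow> (nat \<Rightarrow> 'e) \<Rightarrow> real" where
  "Q R a b = Re (LINT z|lborel. indicator (ball 0 R) z *\<^sub>R Fd a b z) / pi"

lemma mf_const_nonneg: "0 \<le> mf_const" using mass(1) by (simp add: mf_const_def)

lemma Fd_bound:
  assumes "bdd_coeffs C a" "bdd_coeffs C' b" "cmod z < R" "R < 1"
  shows "cmod (Fd a b z) \<le> mf_const * (C * (\<Sum>n. real (Suc n) * R ^ n)) * (C' * (\<Sum>n. real (Suc n) * R ^ n)) * (1 + 2 / (1 - R))"
proof -
  have z: "cmod z < 1" using assms by simp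
  note d = der_bound_disc[OF assms(1) less_imp_le[OF assms(3)] assms(4)]
    der_bound_disc[OF assms(2) less_imp_le[OF assms(3)] assms(4)]
  have "cmod (Fd a b z) \<le> mf_const * norm (der a z) * norm (der b z) * (1 + 2 / (1 - cmod z))"
    unfolding Fd_def by (rule PZ_bound[OF z])
  also have "\<dots> \<le> mf_const * (C * (\<Sum>n. real (Suc n) * R ^ n)) * (C' * (\<Sum>n. real (Suc n) * R ^ n)) * (1 + 2 / (1 - R))"
    using assms z mf_const_nonneg d order_trans[OF norm_ge_zero d(1)] order_trans[OF norm_ge_zero d(2)]
    by (intro mult_mono add_left_mono divide_left_mono) (auto intro!: mult_nonneg_nonneg add_nonneg_nonneg)
  finally show ?thesis .
qed

lemma Fd_tendsto:
  assumes "\<And>j. bdd_coeffs C (a j)" "\<And>k. (\<lambda>j. a j k) \<longlonglongrightarrow> a' k"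
    "\<And>j. bdd_coeffs C' (b j)" "\<And>k. (\<lambda>j. b j k) \<longlonglongrightarrow> b' k" "cmod z < 1"
  shows "(\<lambda>j. Fd (a j) (b j) z) \<longlonglongrightarrow> Fd a' b' z"
  unfolding Fd_def PZ_def
  by (intro cinner.tendsto bounded_linear.tendsto[OF PZ_operator(1)] der_tendsto[OF assms(1,2)]
      der_tendsto[OF assms(3,4)] assms(5))

lemma Fd_trunc:
  assumes "cmod z < 1"
  shows "Fd (trunc N a) (trunc N b) z = (\<Sum>n<N. \<Sum>m<N. of_nat (Suc n) * of_nat (Suc m) *
     (z ^ n * cnj z ^ m * PZ z (trunc N a (Suc n)) (trunc N b (Suc m))))"
  unfolding Fd_def der_trunc PZ_sum_left[OF assms] PZ_sum_right PZ_lin(3,4)[OF assms] sum_distrib_left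
  by (subst sum.swap) (intro sum.cong refl, simp add: mult_ac)

lemma PZ_moment_integral:
  assumes R: "0 < R" "R < 1"
  shows "has_bochner_integral lborel (\<lambda>z. indicator (ball 0 R) z *\<^sub>R (z ^ n * cnj z ^ m * PZ z x y))
    (of_real (pi * R ^ (2 * max n m + 2) / (real (max n m) + 1)) * mf (int m - int n) x y)"
  unfolding has_bochner_integral_iff
proof
  show "integrable lborel (\<lambda>z. indicator (ball 0 R) z *\<^sub>R (z ^ n * cnj z ^ m * PZ z x y))"
  proof (rule disc_integrable[where B = "mf_const * norm x * norm y * (1 + 2 / (1 - R))"])
    fix z assume "cmod z < R"
    then have z: "cmod z < 1" "cmod z < R" using R by auto
    have "cmod (z ^ n * cnj z ^ m * PZ z x y) \<le> 1 * cmod (PZ z x y)"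
      unfolding norm_mult norm_power complex_mod_cnj
      using z by (intro mult_right_mono mult_le_one power_le_one) auto
    also have "\<dots> \<le> mf_const * norm x * norm y * (1 + 2 / (1 - cmod z))"
      using PZ_bound[OF z(1)] by simp
    also have "\<dots> \<le> mf_const * norm x * norm y * (1 + 2 / (1 - R))"
      using z R mf_const_nonneg by (intro mult_left_mono add_left_mono divide_left_mono) auto
    finally show "cmod (z ^ n * cnj z ^ m * PZ z x y) \<le> mf_const * norm x * norm y * (1 + 2 / (1 - R))" .
  qed (rule PZ_moment(1)[OF R])
qed (rule PZ_moment(2)[OF R])

lemma Fd_trunc_integral:
  assumes R: "0 < R" "R < 1"
  shows "has_bochner_integral lborel (\<lambda>z. indicator (ball 0 R) z *\<^sub>R Fd (trunc N a) (trunc N b) z)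
    (\<Sum>n<N. \<Sum>m<N. of_nat (Suc n) * of_nat (Suc m) *
      (of_real (pi * R ^ (2 * max n m + 2) / (real (max n m) + 1)) * mf (int m - int n) (trunc N a (Suc n)) (trunc N b (Suc m))))"
proof -
  have "has_bochner_integral lborel (\<lambda>z. \<Sum>n<N. \<Sum>m<N. of_nat (Suc n) * of_nat (Suc m) *
      (indicator (ball 0 R) z *\<^sub>R (z ^ n * cnj z ^ m * PZ z (trunc N a (Suc n)) (trunc N b (Suc m)))))
    (\<Sum>n<N. \<Sum>m<N. of_nat (Suc n) * of_nat (Suc m) *
      (of_real (pi * R ^ (2 * max n m + 2) / (real (max n m) + 1)) * mf (int m - int n) (trunc N a (Suc n)) (trunc N b (Suc m))))"
    by (intro has_bochner_integral_sum has_bochner_integral_mult_right PZ_moment_integral[OF R])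
  moreover have "indicator (ball 0 R) z *\<^sub>R Fd (trunc N a) (trunc N b) z = (\<Sum>n<N. \<Sum>m<N. of_nat (Suc n) * of_nat (Suc m) *
      (indicator (ball 0 R) z *\<^sub>R (z ^ n * cnj z ^ m * PZ z (trunc N a (Suc n)) (trunc N b (Suc m)))))" for z
  proof (cases "z \<in> ball 0 R")
    case True
    then have "cmod z < 1" using R by simp
    from Fd_trunc[OF this] True show ?thesis by simp
  qed simp
  ultimately show ?thesis by simp
qed

lemma mf_zero: "mf n 0 y = 0" "mf n x 0 = 0"
  using mf_scaleC_left[of n 0 0 y] mf_scaleC_right[of n x 0 0] by simp_all

text \<open>The factors \<open>Suc n\<close> and \<open>Suc m\<close> of the derivatives, divided by
  the \<open>max n m + 1\<close> of the disc moment, leave \<open>min (Suc n) (Suc m)\<close>. This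
  is the origin of the kernel \<open>min k l\<close> on which the later estimates rest.\<close>

lemma Q_trunc:
  assumes R: "0 < R" "R < 1"
  shows "Q R (trunc N a) (trunc N b) =
    (\<Sum>k<N. \<Sum>l<N. real (min k l) * R ^ (2 * max k l) * Re (mf (int l - int k) (a k) (b l)))"
proof -
  define g where "g k l = real (min k l) * R ^ (2 * max k l) * Re (mf (int l - int k) (trunc N a k) (trunc N b l))" for k l
  have "Q R (trunc N a) (trunc N b) = (\<Sum>n<N. \<Sum>m<N. g (Suc n) (Suc m))"
    unfolding Q_def has_bochner_integral_integral_eq[OF Fd_trunc_integral[OF R]] Re_sum sum_divide_distrib
  proof (intro sum.cong refl)
    fix n m
    have "real (Suc n) * real (Suc m) / (real (max n m) + 1) = real (min (Suc n) (Suc m))"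
      by (cases "n \<le> m") (auto simp: max_def min_def field_simps)
    moreover have "Re (complex_of_nat (Suc n) * complex_of_nat (Suc m) * (complex_of_real (pi * R ^ (2 * max n m + 2) /
      (real (max n m) + 1)) * w)) / pi = (real (Suc n) * real (Suc m) / (real (max n m) + 1)) * R ^ (2 * max n m + 2) * Re w" for w
    proof -
      have "complex_of_nat (Suc n) * complex_of_nat (Suc m) * (complex_of_real (pi * R ^ (2 * max n m + 2) /
      (real (max n m) + 1)) * w) = complex_of_real (real (Suc n) * real (Suc m) * (pi * R ^ (2 * max n m + 2) / (real (max n m) + 1))) * w"
        by simp
      moreover have "Re (complex_of_real s * w) = s * Re w" for s by simp
      ultimately show ?thesis by simp
    qed
    moreover have "R ^ (2 * max n m + 2) = R ^ (2 * max (Suc n) (Suc m))" by simp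
    ultimately show "Re (complex_of_nat (Suc n) * complex_of_nat (Suc m) * (complex_of_real (pi * R ^ (2 * max n m + 2) /
      (real (max n m) + 1)) * mf (int m - int n) (trunc N a (Suc n)) (trunc N b (Suc m)))) / pi = g (Suc n) (Suc m)"
      unfolding g_def by simp
  qed
  \<comment> \<open>Index 0, lost in the derivative, may be added since \<open>min k l\<close>
    vanishes there; the top index \<open>N\<close> is removed next because \<open>trunc N\<close> is
    0 at it.\<close>
  also have "\<dots> = (\<Sum>k<Suc N. \<Sum>l<Suc N. g k l)"
    unfolding sum.lessThan_Suc_shift by (simp add: g_def)
  also have "\<dots> = (\<Sum>k<N. \<Sum>l<N. g k l)"
    by (simp add: g_def trunc_def mf_zero)
  also have "\<dots> = (\<Sum>k<N. \<Sum>l<N. real (min k l) * R ^ (2 * max k l) * Re (mf (int l - int k) (a k) (b l)))"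
    by (intro sum.cong refl) (auto simp: g_def trunc_def)
  finally show ?thesis .
qed

text \<open>Boundedness on the smaller disc is known; measurability is inherited from the
  truncations, whose integrands are finite sums of measurable moments.\<close>

lemma Fd_integrable:
  assumes R: "0 < R" "R < 1" and a: "bdd_coeffs C a" and b: "bdd_coeffs C' b"
  shows "integrable lborel (\<lambda>z. indicator (ball 0 R) z *\<^sub>R Fd a b z)"
proof (rule disc_integrable[OF _ Fd_bound[OF a b _ R(2)]])
  show "(\<lambda>z. indicator (ball 0 R) z *\<^sub>R Fd a b z) \<in> borel_measurable lborel"
  proof (rule disc_dominated(1)[where f = "\<lambda>N. Fd (trunc N a) (trunc N b)"])
    show "(\<lambda>z. indicator (ball 0 R) z *\<^sub>R Fd (trunc N a) (trunc N b) z) \<in> borel_measurable lborel" for N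
      using Fd_trunc_integral[OF R, of N a b] unfolding has_bochner_integral_iff
      by (blast intro: borel_measurable_integrable)
    show "cmod (Fd (trunc N a) (trunc N b) z) \<le> mf_const * (C * (\<Sum>n. real (Suc n) * R ^ n)) * (C' * (\<Sum>n. real (Suc n) * R ^ n)) * (1 + 2 / (1 - R))"
      if "cmod z < R" for N z
      using Fd_bound[OF bdd_trunc[OF a] bdd_trunc[OF b] that R(2)] .
    show "(\<lambda>N. Fd (trunc N a) (trunc N b) z) \<longlonglongrightarrow> Fd a b z" if "cmod z < R" for z
      using that R by (intro Fd_tendsto[where C = C and C' = C'] bdd_trunc a b trunc_tendsto) auto
  qed
qed

lemma Q_tendsto:
  assumes R: "0 < R" "R < 1" and a: "\<And>j. bdd_coeffs C (a j)" "\<And>k. (\<lambda>j. a j k) \<longlonglongrightarrow> a' k"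
    and b: "\<And>j. bdd_coeffs C' (b j)" "\<And>k. (\<lambda>j. b j k) \<longlonglongrightarrow> b' k"
  shows "(\<lambda>j. Q R (a j) (b j)) \<longlonglongrightarrow> Q R a' b'"
  unfolding Q_def
proof (intro tendsto_divide tendsto_Re tendsto_const disc_dominated(2))
  show "(\<lambda>z. indicator (ball 0 R) z *\<^sub>R Fd (a j) (b j) z) \<in> borel_measurable lborel" for j
    using Fd_integrable[OF R a(1) b(1)] by auto
  show "cmod (Fd (a j) (b j) z) \<le> mf_const * (C * (\<Sum>n. real (Suc n) * R ^ n)) * (C' * (\<Sum>n. real (Suc n) * R ^ n)) * (1 + 2 / (1 - R))"
      if "cmod z < R" for j z
    using Fd_bound[OF a(1) b(1) that R(2)] .
  show "(\<lambda>j. Fd (a j) (b j) z) \<longlonglongrightarrow> Fd a' b' z" if "cmod z < R" for z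
    using that R by (intro Fd_tendsto[where C = C and C' = C'] a b) auto
qed simp

lemma Q_sym:
  assumes "R \<le> 1"
  shows "Q R b a = Q R a b"
proof -
  have "indicator (ball 0 R) z *\<^sub>R Fd b a z = cnj (indicator (ball 0 R) z *\<^sub>R Fd a b z)" for z
    using PZ_sym[of z "der b z" "der a z"] assms by (auto simp: Fd_def indicator_def)
  then show ?thesis unfolding Q_def by (simp del: complex_cnj_scaleR)
qed

lemma Q_add_left:
  assumes R: "0 < R" "R < 1" and a: "bdd_coeffs C a" "bdd_coeffs C' a'" and b: "bdd_coeffs C'' b"
  shows "Q R (\<lambda>k. a k + a' k) b = Q R a b + Q R a' b"
proof -
  have "indicator (ball 0 R) z *\<^sub>R Fd (\<lambda>k. a k + a' k) b z
     = indicator (ball 0 R) z *\<^sub>R Fd a b z + indicator (ball 0 R) z *\<^sub>R Fd a' b z" for z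
    using R der_add[OF a, of z] by (auto simp: Fd_def indicator_def PZ_lin)
  then show ?thesis
    unfolding Q_def using Fd_integrable[OF R a(1) b] Fd_integrable[OF R a(2) b]
    by (simp add: Bochner_Integration.integral_add add_divide_distrib)
qed

lemma Q_scaleR_left:
  assumes R: "0 < R" "R < 1" and a: "bdd_coeffs C a"
  shows "Q R (\<lambda>k. of_real r *\<^sub>C a k) b = r * Q R a b"
proof -
  have eq: "indicator (ball 0 R) z *\<^sub>R Fd (\<lambda>k. of_real r *\<^sub>C a k) b z
     = of_real r * (indicator (ball 0 R) z *\<^sub>R Fd a b z)" for z
    using R der_scaleC[OF a, of z] by (auto simp: Fd_def indicator_def PZ_lin)
  show ?thesis unfolding Q_def eq integral_mult_right_zero by simp
qed

lemma Q_scaleC_diag: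
  assumes R: "0 < R" "R < 1" and a: "bdd_coeffs C a"
  shows "Q R (\<lambda>k. c *\<^sub>C a k) (\<lambda>k. c *\<^sub>C a k) = (cmod c)\<^sup>2 * Q R a a"
proof -
  have n: "(complex_of_real (cmod c))\<^sup>2 = c * cnj c" using complex_norm_square[of c] by simp
  have eq: "indicator (ball 0 R) z *\<^sub>R Fd (\<lambda>k. c *\<^sub>C a k) (\<lambda>k. c *\<^sub>C a k) z
     = of_real ((cmod c)\<^sup>2) * (indicator (ball 0 R) z *\<^sub>R Fd a a z)" for z
    using R der_scaleC[OF a, of z]
    by (auto simp: Fd_def indicator_def PZ_lin n mult_ac)
  show ?thesis unfolding Q_def eq integral_mult_right_zero by (simp del: of_real_power)
qed

lemma Q_mono:
  assumes R: "0 < R" "R \<le> R'" "R' < 1" and a: "bdd_coeffs C a"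
  shows "Q R a a \<le> Q R' a a" "0 \<le> Q R a a"
proof -
  have pos: "0 \<le> Re (Fd a a z)" if "cmod z < 1" for z
    using PZ_pos[OF that] by (simp add: Fd_def)
  have i: "integrable lborel (\<lambda>z. Re (indicator (ball 0 R) z *\<^sub>R Fd a a z))"
    "integrable lborel (\<lambda>z. Re (indicator (ball 0 R') z *\<^sub>R Fd a a z))"
    using Fd_integrable[OF _ _ a a] R by (intro integrable_Re; simp)+
  have eq: "Re (LINT z|lborel. indicator (ball 0 s) z *\<^sub>R Fd a a z) = (LINT z|lborel. Re (indicator (ball 0 s) z *\<^sub>R Fd a a z))"
    if "0 < s" "s < 1" for s
    using Fd_integrable[OF that a a] by (simp only: integral_Re)
  have "(LINT z|lborel. Re (indicator (ball 0 R) z *\<^sub>R Fd a a z)) \<le> (LINT z|lborel. Re (indicator (ball 0 R') z *\<^sub>R Fd a a z))"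
    using pos R by (intro integral_mono i) (auto simp: indicator_def)
  then show "Q R a a \<le> Q R' a a"
    unfolding Q_def using R by (subst (1 2) eq) (auto intro: divide_right_mono)
  have "0 \<le> (LINT z|lborel. Re (indicator (ball 0 R) z *\<^sub>R Fd a a z))"
    using pos R by (intro Bochner_Integration.integral_nonneg) (auto simp: indicator_def)
  then show "0 \<le> Q R a a" unfolding Q_def using R by (subst eq) auto
qed

text \<open>Any increasing sequence in (0, 1) with limit 1 would do; the shift by 2 keeps
  \<open>radius 0\<close> positive.\<close>

definition radius :: "nat \<Rightarrow> real" where "radius n = 1 - 1 / (real n + 2)"

lemma radius: "0 < radius n" "radius n < 1" "m \<le> n \<Longrightarrow> radius m \<le> radius n" "radius \<longlonglongrightarrow> 1"
proof -
  have "(\<lambda>n. 1 - 1 / (real (n + 2))) \<longlonglongrightarrow> 1 - 0"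
    by (intro tendsto_intros LIMSEQ_ignore_initial_segment[OF lim_1_over_n])
  then show "radius \<longlonglongrightarrow> 1" by (simp add: radius_def[abs_def] add.commute)
qed (auto simp: radius_def field_simps)

text \<open>The Poisson extension is positive, so the integrals over growing discs increase and
  monotone convergence exhausts the disc. From here on \<open>dirichlet_integral\<close> is
  evaluated only through this formula.\<close>

lemma dirichlet_integral_eq_SUP:
  assumes f: "has_taylor f a" and a: "bdd_coeffs C a"
  shows "dirichlet_integral \<mu> f = (SUP n. ennreal (Q (radius n) a a))"
proof -
  have pos: "0 \<le> Re (Fd a a z)" if "cmod z < 1" for z
    using PZ_pos[OF that] by (simp add: Fd_def)
  have i: "integrable lborel (\<lambda>z. Re (indicator (ball 0 (radius n)) z *\<^sub>R Fd a a z))" for n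
    using Fd_integrable[OF _ _ a a] radius by (intro integrable_Re) simp
  have "(\<integral>\<^sup>+z\<in>disc. ennreal (Re (cinner (poisson_ext \<mu> z (cderiv f z)) (cderiv f z))) \<partial>lborel)
      = (\<integral>\<^sup>+z. (SUP n. ennreal (Re (indicator (ball 0 (radius n)) z *\<^sub>R Fd a a z))) \<partial>lborel)"
  proof (rule nn_integral_cong)
    fix z :: complex
    show "ennreal (Re (cinner (poisson_ext \<mu> z (cderiv f z)) (cderiv f z))) * indicator disc z
      = (SUP n. ennreal (Re (indicator (ball 0 (radius n)) z *\<^sub>R Fd a a z)))"
    proof (cases "cmod z < 1")
      case True
      have "eventually (\<lambda>n. cmod z < radius n) sequentially"
        using order_tendstoD(1)[OF radius(4) True] .
      then obtain n where n: "cmod z < radius n" by (auto simp: eventually_sequentially)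
      have "(SUP n. ennreal (Re (indicator (ball 0 (radius n)) z *\<^sub>R Fd a a z))) = ennreal (Re (Fd a a z))"
      proof (rule antisym)
        show "(SUP n. ennreal (Re (indicator (ball 0 (radius n)) z *\<^sub>R Fd a a z))) \<le> ennreal (Re (Fd a a z))"
          using pos[OF True] by (intro SUP_least) (auto simp: indicator_def)
        show "ennreal (Re (Fd a a z)) \<le> (SUP n. ennreal (Re (indicator (ball 0 (radius n)) z *\<^sub>R Fd a a z)))"
          by (rule SUP_upper2[of n]) (use n in auto)
      qed
      then show ?thesis
        using True by (simp add: cderiv_eq_der[OF f a True] Fd_def PZ_def)
    next
      case False
      then have "z \<notin> ball 0 (radius n)" for n using radius(2)[of n] by auto
      then show ?thesis using False by simp
    qed
  qed
  also have "\<dots> = (SUP n. \<integral>\<^sup>+z. ennreal (Re (indicator (ball 0 (radius n)) z *\<^sub>R Fd a a z)) \<partial>lborel)"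
  proof (rule nn_integral_monotone_convergence_SUP)
    show "incseq (\<lambda>n z. ennreal (Re (indicator (ball 0 (radius n)) z *\<^sub>R Fd a a z)))"
    proof (rule incseq_SucI, rule le_funI)
      fix n and z :: complex
      show "ennreal (Re (indicator (ball 0 (radius n)) z *\<^sub>R Fd a a z))
        \<le> ennreal (Re (indicator (ball 0 (radius (Suc n))) z *\<^sub>R Fd a a z))"
        using radius(3)[of n "Suc n"] pos[of z] radius(2)[of n] radius(2)[of "Suc n"]
        by (intro ennreal_leI) (auto simp: indicator_def)
    qed
    show "(\<lambda>z. ennreal (Re (indicator (ball 0 (radius n)) z *\<^sub>R Fd a a z))) \<in> borel_measurable lborel" for n
      using i by (intro measurable_compose[OF borel_measurable_integrable measurable_ennreal])
  qed
  also have "\<dots> = (SUP n. ennreal (pi * Q (radius n) a a))"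
  proof (rule SUP_cong[OF refl])
    fix n
    have "(\<integral>\<^sup>+z. ennreal (Re (indicator (ball 0 (radius n)) z *\<^sub>R Fd a a z)) \<partial>lborel)
      = ennreal (LINT z|lborel. Re (indicator (ball 0 (radius n)) z *\<^sub>R Fd a a z))"
      using i pos radius(2)[of n] by (intro nn_integral_eq_integral AE_I2) (auto simp: indicator_def)
    also have "(LINT z|lborel. Re (indicator (ball 0 (radius n)) z *\<^sub>R Fd a a z)) = pi * Q (radius n) a a"
      unfolding Q_def using Fd_integrable[OF radius(1,2) a a] by (simp only: integral_Re) simp
    finally show "(\<integral>\<^sup>+z. ennreal (Re (indicator (ball 0 (radius n)) z *\<^sub>R Fd a a z)) \<partial>lborel)
      = ennreal (pi * Q (radius n) a a)" .
  qed
  finally have "dirichlet_integral \<mu> f = ennreal (1 / pi) * (SUP n. ennreal (pi * Q (radius n) a a))"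
    by (simp add: dirichlet_integral_def)
  also have "\<dots> = (SUP n. ennreal (1 / pi) * ennreal (pi * Q (radius n) a a))"
    by (rule SUP_mult_left_ennreal)
  also have "\<dots> = (SUP n. ennreal (Q (radius n) a a))"
    using Q_mono(2)[OF radius(1) order_refl radius(2) a] by (simp add: ennreal_mult[symmetric])
  finally show ?thesis .
qed

end

section \<open>Dilations and the norm as a monotone limit\<close>

definition dil :: "real \<Rightarrow> (nat \<Rightarrow> 'e::complex_hilbert_space) \<Rightarrow> nat \<Rightarrow> 'e" where
  "dil r a k = complex_of_real (r ^ k) *\<^sub>C a k"

lemma norm_dil_le: "0 \<le> r \<Longrightarrow> r \<le> 1 \<Longrightarrow> norm (dil r a k) \<le> norm (a k)"
  by (simp add: dil_def norm_scaleC norm_power mult_left_le_one_le power_le_one)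

lemma bdd_dil: "0 \<le> r \<Longrightarrow> r \<le> 1 \<Longrightarrow> bdd_coeffs C a \<Longrightarrow> bdd_coeffs C (dil r a)"
  unfolding bdd_coeffs_def using norm_dil_le order_trans by blast

lemma dil_trunc: "dil r (trunc N a) = trunc N (dil r a)"
  by (auto simp: dil_def trunc_def)

context op_measure begin

text \<open>Positivity of the entrywise product of \<open>\<kappa>\<close> with the block Toeplitz
  matrix of \<open>\<mu>\<close>. The kernels that occur are assembled from rank-one kernels, for
  which a change of the vectors \<open>a k\<close> suffices, so the closure rules below do the work
  of a Schur product theorem.\<close>

definition kernel_pos :: "nat \<Rightarrow> (nat \<Rightarrow> nat \<Rightarrow> real) \<Rightarrow> bool" where
  "kernel_pos N \<kappa> \<longleftrightarrow> (\<forall>a. 0 \<le> (\<Sum>k<N. \<Sum>l<N. \<kappa> k l * Re (mf (int l - int k) (a k) (a l))))"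

lemma kernel_pos_one: "kernel_pos N (\<lambda>k l. 1)"
  using mf_psd by (simp add: kernel_pos_def)

lemma kernel_pos_rank_one:
  assumes "kernel_pos N \<kappa>"
  shows "kernel_pos N (\<lambda>k l. u k * u l * \<kappa> k l)"
  unfolding kernel_pos_def
proof
  fix a
  have "0 \<le> (\<Sum>k<N. \<Sum>l<N. \<kappa> k l * Re (mf (int l - int k) (complex_of_real (u k) *\<^sub>C a k) (complex_of_real (u l) *\<^sub>C a l)))"
    using assms by (simp add: kernel_pos_def)
  then show "0 \<le> (\<Sum>k<N. \<Sum>l<N. u k * u l * \<kappa> k l * Re (mf (int l - int k) (a k) (a l)))"
    by (simp add: mf_scaleC_left mf_scaleC_right mult_ac)
qed

lemma kernel_pos_add: "kernel_pos N \<kappa> \<Longrightarrow> kernel_pos N \<kappa>' \<Longrightarrow> kernel_pos N (\<lambda>k l. \<kappa> k l + \<kappa>' k l)"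
  by (simp add: kernel_pos_def distrib_right sum.distrib add_nonneg_nonneg)

lemma kernel_pos_zero: "kernel_pos N (\<lambda>k l. 0)"
  by (simp add: kernel_pos_def)

lemma kernel_pos_cmult: "0 \<le> c \<Longrightarrow> kernel_pos N \<kappa> \<Longrightarrow> kernel_pos N (\<lambda>k l. c * \<kappa> k l)"
  by (simp add: kernel_pos_def mult.assoc flip: sum_distrib_left)

lemma kernel_pos_sum: "(\<And>j. j \<in> I \<Longrightarrow> kernel_pos N (\<kappa> j)) \<Longrightarrow> kernel_pos N (\<lambda>k l. \<Sum>j\<in>I. \<kappa> j k l)"
  by (induction I rule: infinite_finite_induct) (simp_all add: kernel_pos_zero kernel_pos_add)

lemma kernel_pos_cong:
  "(\<And>k l. k < N \<Longrightarrow> l < N \<Longrightarrow> \<kappa> k l = \<kappa>' k l) \<Longrightarrow> kernel_pos N \<kappa> \<Longrightarrow> kernel_pos N \<kappa>'"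
  unfolding kernel_pos_def by simp

text \<open>\<open>min k l\<close> counts the \<open>j\<close> with both \<open>j < k\<close> and
  \<open>j < l\<close>, which makes it a sum of rank-one kernels.\<close>

lemma kernel_pos_min:
  assumes "kernel_pos N \<kappa>"
  shows "kernel_pos N (\<lambda>k l. real (min k l) * \<kappa> k l)"
proof (rule kernel_pos_cong)
  show "kernel_pos N (\<lambda>k l. \<Sum>j<N. of_bool (j < k) * of_bool (j < l) * \<kappa> k l)"
    by (rule kernel_pos_sum) (rule kernel_pos_rank_one[OF assms])
  fix k l assume kl: "k < N" "l < N"
  have "(\<Sum>j<N. of_bool (j < k) * of_bool (j < l)) = (\<Sum>j<min k l. (1::real))"
    by (rule sum.mono_neutral_cong_right) (use kl in auto)
  then show "(\<Sum>j<N. of_bool (j < k) * of_bool (j < l) * \<kappa> k l) = real (min k l) * \<kappa> k l"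
    by (simp flip: sum_distrib_right)
qed

text \<open>Telescoping: \<open>R ^ (2 * max k l)\<close> is \<open>R ^ (2 * N)\<close> plus the
  drops \<open>R ^ (2 * j) - R ^ (2 * Suc j)\<close> for \<open>max k l \<le> j < N\<close>. The
  drops are nonnegative, and the condition on \<open>j\<close> is a product of one in
  \<open>k\<close> and one in \<open>l\<close>.\<close>

lemma kernel_pos_max_power:
  assumes "kernel_pos N \<kappa>" "0 \<le> R" "R \<le> 1"
  shows "kernel_pos N (\<lambda>k l. R ^ (2 * max k l) * \<kappa> k l)"
proof (rule kernel_pos_cong)
  let ?w = "\<lambda>j. R ^ (2 * j) - R ^ (2 * Suc j)"
  show "kernel_pos N (\<lambda>k l. R ^ (2 * N) * \<kappa> k l + (\<Sum>j<N. ?w j * (of_bool (k \<le> j) * of_bool (l \<le> j) * \<kappa> k l)))"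
  proof (intro kernel_pos_add kernel_pos_sum kernel_pos_cmult kernel_pos_rank_one assms(1))
    show "0 \<le> ?w j" for j
      using power_decreasing[of "2 * j" "2 * Suc j" R] assms(2,3) by simp
  qed (use assms in auto)
  fix k l assume kl: "k < N" "l < N"
  have "(\<Sum>j<N. ?w j * (of_bool (k \<le> j) * of_bool (l \<le> j))) = (\<Sum>j = max k l..<N. ?w j)"
    by (rule sum.mono_neutral_cong_right) auto
  also have "\<dots> = R ^ (2 * max k l) - R ^ (2 * N)"
    using kl sum_Suc_diff'[of "max k l" N "\<lambda>j. - (R ^ (2 * j))"] by simp
  finally have "(\<Sum>j<N. ?w j * (of_bool (k \<le> j) * of_bool (l \<le> j) * \<kappa> k l)) = (R ^ (2 * max k l) - R ^ (2 * N)) * \<kappa> k l"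
    by (simp only: mult.assoc[symmetric] sum_distrib_right[symmetric])
  then show "R ^ (2 * N) * \<kappa> k l + (\<Sum>j<N. ?w j * (of_bool (k \<le> j) * of_bool (l \<le> j) * \<kappa> k l)) = R ^ (2 * max k l) * \<kappa> k l"
    by (simp add: left_diff_distrib)
qed

text \<open>The derivative of the dilated form in \<open>r\<close> is nonnegative because
  \<open>(k + l) min(k, l) = k l + min(k, l)\<^sup>2\<close> is again a positive kernel.\<close>

lemma Q_dil_trunc_le:
  assumes R: "0 < R" "R < 1" and r: "0 < r" "r \<le> 1"
  shows "Q R (dil r (trunc N a)) (dil r (trunc N a)) \<le> Q R (trunc N a) (trunc N a)"
proof -
  define G where "G k l = Re (mf (int l - int k) (a k) (a l))" for k l
  define g where "g \<rho> = (\<Sum>k<N. \<Sum>l<N. real (min k l) * R ^ (2 * max k l) * (\<rho> ^ (k + l) * G k l))" for \<rho> :: real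
  have Qg: "Q R (dil \<rho> (trunc N a)) (dil \<rho> (trunc N a)) = g \<rho>" for \<rho>
    unfolding dil_trunc Q_trunc[OF R] g_def G_def dil_def
    by (simp add: mf_scaleC_left mf_scaleC_right power_add mult_ac flip: of_real_power)
  define g' where "g' \<rho> = (\<Sum>k<N. \<Sum>l<N. real (min k l) * R ^ (2 * max k l) * ((real (k + l) * \<rho> ^ (k + l - 1)) * G k l))" for \<rho> :: real
  have "g r \<le> g 1"
  proof (rule DERIV_nonneg_imp_nondecreasing[OF r(2)])
    fix x assume x: "r \<le> x" "x \<le> 1"
    have "(g has_real_derivative g' x) (at x)"
      unfolding g_def[abs_def] g'_def
    proof (intro DERIV_sum DERIV_cmult DERIV_cmult_right)
      show "((\<lambda>\<rho>. \<rho> ^ (k + l)) has_real_derivative real (k + l) * x ^ (k + l - 1)) (at x)" for k l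
        using DERIV_pow[of "k + l" x UNIV] by simp
    qed
    moreover have "0 \<le> g' x"
    proof -
      \<comment> \<open>The factor \<open>1 / x\<close> reconciles the exponent
        \<open>k + l - 1\<close> of the derivative with the rank-one kernel
        \<open>x ^ k * x ^ l\<close>; it is positive because \<open>0 < r \<le> x\<close>.\<close>
      have "kernel_pos N (\<lambda>k l. (1 / x) * (x ^ k * x ^ l * (R ^ (2 * max k l) * (real k * real l * 1 + real (min k l) * (real (min k l) * 1)))))"
        using R r x by (intro kernel_pos_cmult kernel_pos_rank_one kernel_pos_max_power kernel_pos_add kernel_pos_min
            kernel_pos_one) auto
      then have "0 \<le> (\<Sum>k<N. \<Sum>l<N. (1 / x) * (x ^ k * x ^ l * (R ^ (2 * max k l) * (real k * real l * 1 + real (min k l) * (real (min k l) * 1)))) * G k l)"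
        unfolding kernel_pos_def G_def by blast
      also have "\<dots> = g' x"
        unfolding g'_def
      proof (intro sum.cong refl)
        fix k l
        have mm: "real k * real l * 1 + real (min k l) * (real (min k l) * 1) = real (min k l) * real (k + l)"
          by (cases "k \<le> l") (auto simp: min_def algebra_simps)
        have pp: "real (k + l) * x ^ (k + l - 1) = (1 / x) * (x ^ k * x ^ l) * real (k + l)"
        proof (cases "k + l")
          case (Suc m)
          then have "x ^ k * x ^ l = x * x ^ m" by (metis power_Suc power_add)
          then show ?thesis using Suc r x by simp
        qed simp
        show "(1 / x) * (x ^ k * x ^ l * (R ^ (2 * max k l) * (real k * real l * 1 + real (min k l) * (real (min k l) * 1)))) * G k l
          = real (min k l) * R ^ (2 * max k l) * ((real (k + l) * x ^ (k + l - 1)) * G k l)"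
          unfolding mm pp by simp
      qed
      finally show ?thesis .
    qed
    ultimately show "\<exists>y. (g has_real_derivative y) (at x) \<and> 0 \<le> y" by blast
  qed
  moreover have "dil 1 (trunc N a) = trunc N a" by (auto simp: dil_def)
  ultimately show ?thesis using Qg[of r] Qg[of 1] by simp
qed

lemma Q_dil_le:
  assumes R: "0 < R" "R < 1" and r: "0 < r" "r \<le> 1" and a: "bdd_coeffs C a"
  shows "Q R (dil r a) (dil r a) \<le> Q R a a"
proof (rule LIMSEQ_le)
  have d: "bdd_coeffs C (dil r a)" using r a by (intro bdd_dil) auto
  show "(\<lambda>N. Q R (dil r (trunc N a)) (dil r (trunc N a))) \<longlonglongrightarrow> Q R (dil r a) (dil r a)"
    unfolding dil_trunc by (intro Q_tendsto[OF R, where C = C and C' = C] bdd_trunc d trunc_tendsto)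
  show "(\<lambda>N. Q R (trunc N a) (trunc N a)) \<longlonglongrightarrow> Q R a a"
    by (intro Q_tendsto[OF R, where C = C and C' = C] bdd_trunc a trunc_tendsto)
qed (use Q_dil_trunc_le[OF R r] in auto)

text \<open>The crude estimate \<open>min k l \<le> k * l\<close> factorises the double sum into a
  square. It suffices for tails of dilated sequences, which decay geometrically.\<close>

lemma Q_summable_bound:
  assumes R: "0 < R" "R < 1" and a: "bdd_coeffs C a" and s: "summable (\<lambda>k. real k * norm (a k))"
  shows "Q R a a \<le> mf_const * (\<Sum>k. real k * norm (a k))\<^sup>2"
proof (rule LIMSEQ_le_const2)
  show "(\<lambda>N. Q R (trunc N a) (trunc N a)) \<longlonglongrightarrow> Q R a a"
    by (intro Q_tendsto[OF R, where C = C and C' = C] bdd_trunc a trunc_tendsto)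
  have "Q R (trunc N a) (trunc N a) \<le> mf_const * (\<Sum>k. real k * norm (a k))\<^sup>2" for N
  proof -
    have "Q R (trunc N a) (trunc N a) \<le> (\<Sum>k<N. \<Sum>l<N. (real k * real l) * 1 * (mf_const * norm (a k) * norm (a l)))"
      unfolding Q_trunc[OF R]
    proof (intro sum_mono)
      fix k l
      have "real (min k l) \<le> real k * real l"
      proof (cases "k = 0 \<or> l = 0")
        case False
        then have "1 * min k l \<le> k * l"
          by (metis Suc_leI le_trans min.cobounded1 mult_1 mult_le_mono2 nat_mult_1_right neq0_conv One_nat_def)
        then show ?thesis by (metis mult_1 of_nat_mono of_nat_mult)
      qed auto
      moreover have "R ^ (2 * max k l) \<le> 1" using R by (intro power_le_one) auto
      moreover have "\<bar>Re (mf (int l - int k) (a k) (a l))\<bar> \<le> mf_const * norm (a k) * norm (a l)"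
        using abs_Re_le_cmod mf_bound order_trans by blast
      ultimately have "real (min k l) * R ^ (2 * max k l) * \<bar>Re (mf (int l - int k) (a k) (a l))\<bar>
          \<le> (real k * real l) * 1 * (mf_const * norm (a k) * norm (a l))"
        using R by (intro mult_mono) (auto intro: order_trans[OF abs_ge_zero])
      moreover have "real (min k l) * R ^ (2 * max k l) * Re (mf (int l - int k) (a k) (a l))
        \<le> real (min k l) * R ^ (2 * max k l) * \<bar>Re (mf (int l - int k) (a k) (a l))\<bar>"
        using R by (intro mult_left_mono) auto
      ultimately show "real (min k l) * R ^ (2 * max k l) * Re (mf (int l - int k) (a k) (a l))
          \<le> (real k * real l) * 1 * (mf_const * norm (a k) * norm (a l))" by linarith
    qed
    also have "\<dots> = mf_const * (\<Sum>k<N. real k * norm (a k))\<^sup>2"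
      unfolding power2_eq_square sum_product by (simp add: sum_distrib_left mult_ac)
    also have "\<dots> \<le> mf_const * (\<Sum>k. real k * norm (a k))\<^sup>2"
      using mf_const_nonneg by (intro mult_left_mono power_mono sum_le_suminf s sum_nonneg) auto
    finally show ?thesis .
  qed
  then show "\<exists>N. \<forall>n\<ge>N. Q R (trunc n a) (trunc n a) \<le> mf_const * (\<Sum>k. real k * norm (a k))\<^sup>2" by blast
qed

text \<open>Increasing in \<open>n\<close> on the diagonal, with limit the squared Dirichlet norm.\<close>

definition E :: "nat \<Rightarrow> (nat \<Rightarrow> 'e) \<Rightarrow> (nat \<Rightarrow> 'e) \<Rightarrow> real" where
  "E n a b = (\<Sum>k<n. a k \<bullet> b k) + Q (radius n) a b"

lemma E_tendsto:
  assumes "\<And>j. bdd_coeffs C (a j)" "\<And>k. (\<lambda>j. a j k) \<longlonglongrightarrow> a' k" "\<And>j. bdd_coeffs C' (b j)" "\<And>k. (\<lambda>j. b j k) \<longlonglongrightarrow> b' k"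
  shows "(\<lambda>j. E n (a j) (b j)) \<longlonglongrightarrow> E n a' b'"
  unfolding E_def by (intro tendsto_add tendsto_sum tendsto_inner assms(2,4) Q_tendsto[OF radius(1,2) assms])

lemma E_sym: "E n b a = E n a b"
  unfolding E_def using Q_sym[of "radius n" a b] radius(2)[of n] by (simp add: inner_commute less_imp_le)

lemma E_add_left:
  assumes "bdd_coeffs C a" "bdd_coeffs C' a'" "bdd_coeffs C'' b"
  shows "E n (\<lambda>k. a k + a' k) b = E n a b + E n a' b"
  unfolding E_def using Q_add_left[OF radius(1,2) assms] by (simp add: inner_add_left sum.distrib)

lemma E_scaleR_left: "bdd_coeffs C a \<Longrightarrow> E n (\<lambda>k. of_real r *\<^sub>C a k) b = r * E n a b"
  unfolding E_def using Q_scaleR_left[OF radius(1,2)]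
  by (simp add: scaleR_scaleC[symmetric] sum_distrib_left distrib_left)

lemma E_scaleC_diag: "bdd_coeffs C a \<Longrightarrow> E n (\<lambda>k. c *\<^sub>C a k) (\<lambda>k. c *\<^sub>C a k) = (cmod c)\<^sup>2 * E n a a"
  unfolding E_def using Q_scaleC_diag[OF radius(1,2)]
  by (simp add: power2_norm_eq_inner[symmetric] norm_scaleC power_mult_distrib sum_distrib_left distrib_left)

lemma E_mono:
  assumes a: "bdd_coeffs C a"
  shows "m \<le> n \<Longrightarrow> E m a a \<le> E n a a" "0 \<le> E n a a" "(norm (a k))\<^sup>2 \<le> E (Suc k) a a"
proof -
  show "E m a a \<le> E n a a" if "m \<le> n"
    unfolding E_def using that Q_mono(1)[OF radius(1) radius(3) radius(2) a]
    by (intro add_mono sum_mono2) auto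
  have Q: "0 \<le> Q (radius n) a a" for n using Q_mono(2)[OF radius(1) order_refl radius(2) a] .
  show "0 \<le> E n a a" unfolding E_def using Q by (intro add_nonneg_nonneg sum_nonneg) auto
  have "0 \<le> (\<Sum>i<k. a i \<bullet> a i)" by (intro sum_nonneg) auto
  then show "(norm (a k))\<^sup>2 \<le> E (Suc k) a a"
    unfolding E_def using Q[of "Suc k"] by (simp add: power2_norm_eq_inner)
qed

lemma E_dil_le:
  assumes r: "0 < r" "r \<le> 1" and a: "bdd_coeffs C a"
  shows "E n (dil r a) (dil r a) \<le> E n a a"
  unfolding E_def using norm_dil_le[of r a] r
  by (intro add_mono sum_mono Q_dil_le[OF radius(1,2) r a]) (auto simp: power2_norm_eq_inner[symmetric] intro!: power_mono)

end

section \<open>The harmonically weighted Dirichlet space\<close>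

lemma minus_as_scale: "a - b = a + of_real (-1) *\<^sub>C (b :: 'v::complex_vector)"
  by (simp add: scaleC_minus_left)

context op_measure begin

definition BD :: "(nat \<Rightarrow> 'e) set" where "BD = {a. \<exists>C. bdd_coeffs C a}"

text \<open>The coefficient sequences of the Dirichlet space, since \<open>E n a a\<close> increases
  to the squared norm.\<close>

definition Xs :: "(nat \<Rightarrow> 'e) set" where
  "Xs = {a \<in> BD. \<exists>K. \<forall>n. E n a a \<le> K}"

text \<open>The real part of the inner product of the Dirichlet space, on coefficient sequences;
  only real parts are used, because all claims concern norms.\<close>

definition Bs :: "(nat \<Rightarrow> 'e) \<Rightarrow> (nat \<Rightarrow> 'e) \<Rightarrow> real" where
  "Bs a b = lim (\<lambda>n. E n a b)"

lemma BD_add: "a \<in> BD \<Longrightarrow> b \<in> BD \<Longrightarrow> a + b \<in> BD"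
  unfolding BD_def plus_fun_def using bdd_coeffs_add by blast

lemma BD_scaleC: "a \<in> BD \<Longrightarrow> c *\<^sub>C a \<in> BD"
  unfolding BD_def scaleC_fun_def using bdd_coeffs_scaleC by blast

lemma E_add: "a \<in> BD \<Longrightarrow> a' \<in> BD \<Longrightarrow> b \<in> BD \<Longrightarrow> E n (a + a') b = E n a b + E n a' b"
  unfolding BD_def plus_fun_def using E_add_left by blast

lemma E_add': "a \<in> BD \<Longrightarrow> a' \<in> BD \<Longrightarrow> b \<in> BD \<Longrightarrow> E n b (a + a') = E n b a + E n b a'"
  using E_add by (metis E_sym)

lemma E_scale: "a \<in> BD \<Longrightarrow> E n (of_real r *\<^sub>C a) b = r * E n a b"
  unfolding BD_def scaleC_fun_def using E_scaleR_left by blast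

lemma E_scale': "a \<in> BD \<Longrightarrow> E n b (of_real r *\<^sub>C a) = r * E n b a"
  using E_scale by (metis E_sym)

lemma E_add_diag:
  assumes "a \<in> BD" "b \<in> BD"
  shows "E n (a + b) (a + b) = E n a a + 2 * E n a b + E n b b"
  using E_add[OF assms BD_add[OF assms]] E_add'[OF assms assms(1)] E_add'[OF assms assms(2)] E_sym[of n b a]
  by simp

lemma E_diff_diag:
  assumes "a \<in> BD" "b \<in> BD"
  shows "E n (a - b) (a - b) = E n a a - 2 * E n a b + E n b b"
proof -
  define m where "m = of_real (-1) *\<^sub>C b"
  have eq: "a - b = a + m" unfolding m_def by (rule minus_as_scale)
  have m: "m \<in> BD" unfolding m_def by (rule BD_scaleC[OF assms(2)])
  have "E n a m = -1 * E n a b" "E n m m = -1 * E n m b" "E n m b = -1 * E n b b"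
    using E_scale'[OF assms(2), of n _ "-1"] E_scale[OF assms(2), of n "-1"] unfolding m_def by blast+
  then show ?thesis
    unfolding eq E_add_diag[OF assms(1) m] by linarith
qed

lemma E_nonneg: "a \<in> BD \<Longrightarrow> 0 \<le> E n a a"
  unfolding BD_def using E_mono(2) by blast

lemma E_incseq: "a \<in> BD \<Longrightarrow> incseq (\<lambda>n. E n a a)"
  unfolding BD_def incseq_def using E_mono(1) by blast

lemma Xs_BD: "a \<in> Xs \<Longrightarrow> a \<in> BD" by (simp add: Xs_def)

lemma BD_diff: "a \<in> BD \<Longrightarrow> b \<in> BD \<Longrightarrow> a - b \<in> BD"
  unfolding minus_as_scale by (intro BD_add BD_scaleC)

lemma Xs_add:
  assumes "a \<in> Xs" "b \<in> Xs"
  shows "a + b \<in> Xs"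
proof -
  note bd = Xs_BD[OF assms(1)] Xs_BD[OF assms(2)]
  obtain K K' where K: "\<And>n. E n a a \<le> K" "\<And>n. E n b b \<le> K'" using assms by (auto simp: Xs_def)
  have "E n (a + b) (a + b) \<le> 2 * K + 2 * K'" for n
    using E_add_diag[OF bd, of n] E_diff_diag[OF bd, of n] E_nonneg[OF BD_diff[OF bd], of n] K[of n]
    by simp
  then show ?thesis using BD_add[OF bd] by (auto simp: Xs_def)
qed

lemma E_scaleC: "a \<in> BD \<Longrightarrow> E n (c *\<^sub>C a) (c *\<^sub>C a) = (cmod c)\<^sup>2 * E n a a"
  unfolding BD_def scaleC_fun_def using E_scaleC_diag by blast

lemma Xs_scaleC: "a \<in> Xs \<Longrightarrow> c *\<^sub>C a \<in> Xs"
proof -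
  assume a: "a \<in> Xs"
  then obtain K where K: "\<And>n. E n a a \<le> K" by (auto simp: Xs_def)
  have "E n (c *\<^sub>C a) (c *\<^sub>C a) \<le> (cmod c)\<^sup>2 * K" for n
    unfolding E_scaleC[OF Xs_BD[OF a]] using K by (intro mult_left_mono) auto
  then show ?thesis using BD_scaleC[OF Xs_BD[OF a]] by (auto simp: Xs_def)
qed

lemma Xs_diff: "a \<in> Xs \<Longrightarrow> b \<in> Xs \<Longrightarrow> a - b \<in> Xs"
  unfolding minus_as_scale by (intro Xs_add Xs_scaleC)

lemma E_diag_convergent: "a \<in> Xs \<Longrightarrow> convergent (\<lambda>n. E n a a)"
proof -
  assume a: "a \<in> Xs"
  then obtain K where "\<forall>n. E n a a \<le> K" by (auto simp: Xs_def)
  then show ?thesis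
    using incseq_convergent[OF E_incseq[OF Xs_BD[OF a]]] unfolding convergent_def by metis
qed

text \<open>Only the diagonal sequences are monotone; the mixed ones converge by real
  polarization.\<close>

lemma E_LIMSEQ:
  assumes "a \<in> Xs" "b \<in> Xs"
  shows "(\<lambda>n. E n a b) \<longlonglongrightarrow> Bs a b"
proof -
  note bd = Xs_BD[OF assms(1)] Xs_BD[OF assms(2)]
  obtain l l' where "(\<lambda>n. E n (a + b) (a + b)) \<longlonglongrightarrow> l" "(\<lambda>n. E n (a - b) (a - b)) \<longlonglongrightarrow> l'"
    using E_diag_convergent[OF Xs_add[OF assms]] E_diag_convergent[OF Xs_diff[OF assms]]
    by (auto simp: convergent_def)
  then have "(\<lambda>n. (E n (a + b) (a + b) - E n (a - b) (a - b)) / 4) \<longlonglongrightarrow> (l - l') / 4"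
    by (intro tendsto_intros) auto
  moreover have "(E n (a + b) (a + b) - E n (a - b) (a - b)) / 4 = E n a b" for n
    unfolding E_add_diag[OF bd] E_diff_diag[OF bd] by simp
  ultimately have "convergent (\<lambda>n. E n a b)" by (auto simp: convergent_def)
  then show ?thesis unfolding Bs_def by (simp add: convergent_LIMSEQ_iff)
qed

lemma E_le_Bs: "a \<in> Xs \<Longrightarrow> E n a a \<le> Bs a a"
  using incseq_le[OF E_incseq[OF Xs_BD] E_LIMSEQ] .

lemma Bs_le: "a \<in> Xs \<Longrightarrow> (\<And>n. E n a a \<le> K) \<Longrightarrow> Bs a a \<le> K"
  using LIMSEQ_le_const2[OF E_LIMSEQ] by blast

lemma Bs_add:
  assumes "a \<in> Xs" "a' \<in> Xs" "b \<in> Xs"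
  shows "Bs (a + a') b = Bs a b + Bs a' b"
  by (rule LIMSEQ_unique[OF E_LIMSEQ[OF Xs_add[OF assms(1,2)] assms(3)]])
    (unfold E_add[OF assms[THEN Xs_BD]], intro tendsto_add E_LIMSEQ assms)

lemma Bs_scale:
  assumes "a \<in> Xs" "b \<in> Xs"
  shows "Bs (of_real r *\<^sub>C a) b = r * Bs a b"
  by (rule LIMSEQ_unique[OF E_LIMSEQ[OF Xs_scaleC[OF assms(1)] assms(2)]])
    (unfold E_scale[OF Xs_BD[OF assms(1)]], intro tendsto_mult_left E_LIMSEQ assms)

lemma Bs_sym: "Bs a b = Bs b a" unfolding Bs_def by (subst E_sym) simp

lemma Bs_scaleC:
  assumes "a \<in> Xs"
  shows "Bs (c *\<^sub>C a) (c *\<^sub>C a) = (cmod c)\<^sup>2 * Bs a a"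
  by (rule LIMSEQ_unique[OF E_LIMSEQ[OF Xs_scaleC[OF assms] Xs_scaleC[OF assms]]])
    (unfold E_scaleC[OF Xs_BD[OF assms]], intro tendsto_mult_left E_LIMSEQ assms)

lemma Bs_nonneg: "a \<in> Xs \<Longrightarrow> 0 \<le> Bs a a"
  using E_le_Bs E_nonneg[OF Xs_BD] order_trans by blast

lemma Bs_diff_diag:
  assumes "a \<in> Xs" "b \<in> Xs"
  shows "Bs (a - b) (a - b) = Bs a a - 2 * Bs a b + Bs b b"
proof -
  have "(\<lambda>n. E n a a - 2 * E n a b + E n b b) \<longlonglongrightarrow> Bs a a - 2 * Bs a b + Bs b b"
    by (intro tendsto_intros E_LIMSEQ assms)
  then show ?thesis
    using LIMSEQ_unique[OF E_LIMSEQ[OF Xs_diff[OF assms] Xs_diff[OF assms]]] E_diff_diag[OF Xs_BD Xs_BD] assms by simp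
qed

lemma Bs_add_diag:
  assumes "a \<in> Xs" "b \<in> Xs"
  shows "Bs (a + b) (a + b) = Bs a a + 2 * Bs a b + Bs b b"
proof -
  have "(\<lambda>n. E n a a + 2 * E n a b + E n b b) \<longlonglongrightarrow> Bs a a + 2 * Bs a b + Bs b b"
    by (intro tendsto_intros E_LIMSEQ assms)
  then show ?thesis
    using LIMSEQ_unique[OF E_LIMSEQ[OF Xs_add[OF assms] Xs_add[OF assms]]] E_add_diag[OF Xs_BD Xs_BD] assms by simp
qed

lemma coeff_le_Bs: "a \<in> Xs \<Longrightarrow> (norm (a k))\<^sup>2 \<le> Bs a a"
  using E_mono(3) E_le_Bs[of a "Suc k"] order_trans unfolding Xs_def BD_def by blast

lemma bdd_Bs: "a \<in> Xs \<Longrightarrow> Bs a a \<le> K \<Longrightarrow> bdd_coeffs (sqrt K) a"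
  unfolding bdd_coeffs_def by (intro allI real_le_rsqrt order_trans[OF coeff_le_Bs])

text \<open>Each \<open>E n\<close> is continuous under coefficientwise convergence with a common
  bound, which \<open>coeff_le_Bs\<close> supplies; the squared norm is the supremum of these
  functionals and hence lower semicontinuous.\<close>

lemma Xs_fatou:
  assumes "\<And>j. a j \<in> Xs" "\<And>j. Bs (a j) (a j) \<le> K" "\<And>k. (\<lambda>j. a j k) \<longlonglongrightarrow> b k"
  shows "b \<in> Xs" "Bs b b \<le> K"
proof -
  have bd: "bdd_coeffs (sqrt K) (a j)" for j by (rule bdd_Bs[OF assms(1,2)])
  have "norm (b k) \<le> sqrt K" for k
    by (rule LIMSEQ_le_const2[OF tendsto_norm[OF assms(3)]]) (use bd in \<open>auto simp: bdd_coeffs_def\<close>)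
  then have "b \<in> BD" by (auto simp: BD_def bdd_coeffs_def)
  have le: "E n b b \<le> K" for n
    by (rule LIMSEQ_le_const2[OF E_tendsto[OF bd assms(3) bd assms(3)]])
      (use E_le_Bs[OF assms(1)] assms(2) order_trans in blast)
  then show "b \<in> Xs" using \<open>b \<in> BD\<close> by (auto simp: Xs_def)
  then show "Bs b b \<le> K" by (rule Bs_le) (rule le)
qed

lemma trunc_in_Xs:
  shows "trunc N a \<in> Xs"
    and Bs_trunc: "Bs (trunc N a) (trunc N a) = (\<Sum>k<N. (norm (a k))\<^sup>2) +
      (\<Sum>k<N. \<Sum>l<N. real (min k l) * Re (mf (int l - int k) (a k) (a l)))"
proof -
  let ?D = "(\<Sum>k<N. \<Sum>l<N. real (min k l) * Re (mf (int l - int k) (a k) (a l)))"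
  have "bdd_coeffs (\<Sum>k<N. norm (a k)) (trunc N a)"
    by (auto simp: bdd_coeffs_def trunc_def intro!: member_le_sum sum_nonneg)
  then have bd: "trunc N a \<in> BD" by (auto simp: BD_def)
  have "(\<lambda>n. \<Sum>k<N. \<Sum>l<N. real (min k l) * radius n ^ (2 * max k l) * Re (mf (int l - int k) (a k) (a l)))
     \<longlonglongrightarrow> (\<Sum>k<N. \<Sum>l<N. real (min k l) * 1 ^ (2 * max k l) * Re (mf (int l - int k) (a k) (a l)))"
    by (intro tendsto_intros radius)
  then have Q: "(\<lambda>n. Q (radius n) (trunc N a) (trunc N a)) \<longlonglongrightarrow> ?D"
    by (simp add: Q_trunc[OF radius(1,2)])
  have S: "(\<lambda>n. \<Sum>k<n. trunc N a k \<bullet> trunc N a k) \<longlonglongrightarrow> (\<Sum>k<N. (norm (a k))\<^sup>2)"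
  proof (rule tendsto_eventually, rule eventually_sequentiallyI)
    fix n assume "N \<le> n"
    then have "(\<Sum>k<n. trunc N a k \<bullet> trunc N a k) = (\<Sum>k<N. trunc N a k \<bullet> trunc N a k)"
      by (intro sum.mono_neutral_right) (auto simp: trunc_def)
    then show "(\<Sum>k<n. trunc N a k \<bullet> trunc N a k) = (\<Sum>k<N. (norm (a k))\<^sup>2)"
      by (simp add: trunc_def power2_norm_eq_inner)
  qed
  have lim: "(\<lambda>n. E n (trunc N a) (trunc N a)) \<longlonglongrightarrow> (\<Sum>k<N. (norm (a k))\<^sup>2) + ?D"
    unfolding E_def by (intro tendsto_add S Q)
  then have "Bseq (\<lambda>n. E n (trunc N a) (trunc N a))"
    by (intro convergent_imp_Bseq) (auto simp: convergent_def)
  then obtain K where "\<And>n. \<bar>E n (trunc N a) (trunc N a)\<bar> \<le> K" by (auto simp: Bseq_def)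
  then show x: "trunc N a \<in> Xs" using bd abs_le_D1 by (fastforce simp: Xs_def)
  show "Bs (trunc N a) (trunc N a) = (\<Sum>k<N. (norm (a k))\<^sup>2) + ?D"
    by (rule LIMSEQ_unique[OF E_LIMSEQ[OF x x] lim])
qed

section \<open>Density of polynomials\<close>

lemma dil_in_Xs:
  assumes a: "a \<in> Xs" and r: "0 < r" "r \<le> 1"
  shows "dil r a \<in> Xs" "Bs (dil r a) (dil r a) \<le> Bs a a"
proof -
  obtain C where C: "bdd_coeffs C a" using Xs_BD[OF a] by (auto simp: BD_def)
  have le: "E n (dil r a) (dil r a) \<le> Bs a a" for n
    by (rule order_trans[OF E_dil_le[OF r C] E_le_Bs[OF a]])
  moreover have "dil r a \<in> BD" using bdd_dil[OF _ r(2) C] r by (auto simp: BD_def)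
  ultimately show "dil r a \<in> Xs" by (auto simp: Xs_def)
  then show "Bs (dil r a) (dil r a) \<le> Bs a a" by (rule Bs_le) (rule le)
qed

text \<open>Dilations tend to the identity coefficientwise and do not increase the norm. By the
  parallelogram law it is enough that the norm of \<open>a + d j\<close> is asymptotically at least
  twice that of \<open>a\<close>, and this can be seen at one fixed \<open>E n\<close>.\<close>

lemma dil_approx:
  assumes a: "a \<in> Xs" and e: "0 < e"
  shows "\<exists>r. 0 < r \<and> r < 1 \<and> Bs (a - dil r a) (a - dil r a) < e"
proof -
  define d where "d j = dil (radius j) a" for j
  have d: "d j \<in> Xs" "Bs (d j) (d j) \<le> Bs a a" for j
    unfolding d_def using dil_in_Xs[OF a] radius less_imp_le by blast+
  have bd: "bdd_coeffs (sqrt (Bs a a)) (d j)" "bdd_coeffs (sqrt (Bs a a)) a" for j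
    using bdd_Bs[OF d] bdd_Bs[OF a] by auto
  \<comment> \<open>This error enters four times and contributes \<open>e / 2\<close>; the other
    half comes from the choice of \<open>j\<close>.\<close>
  obtain n where n: "Bs a a - e / 8 < E n a a"
    using order_tendstoD(1)[OF E_LIMSEQ[OF a a], of "Bs a a - e / 8"] e by (auto simp: eventually_sequentially)
  have dt: "(\<lambda>j. d j k) \<longlonglongrightarrow> a k" for k
  proof -
    have "(\<lambda>j. complex_of_real (radius j ^ k) *\<^sub>C a k) \<longlonglongrightarrow> complex_of_real (1 ^ k) *\<^sub>C a k"
      by (intro scaleC.tendsto tendsto_intros radius)
    then show ?thesis by (simp add: d_def dil_def)
  qed
  have "(\<lambda>j. E n (a + d j) (a + d j)) \<longlonglongrightarrow> E n (a + a) (a + a)"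
    unfolding plus_fun_def
    by (intro E_tendsto[where C = "sqrt (Bs a a) + sqrt (Bs a a)" and C' = "sqrt (Bs a a) + sqrt (Bs a a)"]
        bdd_coeffs_add bd tendsto_add dt tendsto_const)
  moreover have "E n (a + a) (a + a) = 4 * E n a a"
    using E_add_diag[OF Xs_BD[OF a] Xs_BD[OF a]] by simp
  ultimately have "\<forall>\<^sub>F j in sequentially. 4 * E n a a - e / 2 < E n (a + d j) (a + d j)"
    using order_tendstoD(1)[of _ "E n (a + a) (a + a)" _ "4 * E n a a - e / 2"] e by simp
  then obtain j where j: "4 * E n a a - e / 2 < E n (a + d j) (a + d j)" by (auto simp: eventually_sequentially)
  have "Bs (a - d j) (a - d j) = 2 * Bs a a + 2 * Bs (d j) (d j) - Bs (a + d j) (a + d j)"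
    using Bs_diff_diag[OF a d(1)] Bs_add_diag[OF a d(1)] by simp
  also have "\<dots> \<le> 4 * Bs a a - E n (a + d j) (a + d j)"
    using d(2)[of j] E_le_Bs[OF Xs_add[OF a d(1)], of n j] by simp
  also have "\<dots> < e" using j n by simp
  finally show ?thesis unfolding d_def using radius by blast
qed

text \<open>Dilation gives the coefficients geometric decay, which is summable even against the
  factor \<open>real k\<close> of the Dirichlet part.\<close>

lemma trunc_dil_approx:
  assumes a: "a \<in> Xs" and r: "0 < r" "r < 1" and e: "0 < e"
  shows "\<exists>N. Bs (dil r a - trunc N (dil r a)) (dil r a - trunc N (dil r a)) < e"
proof -
  obtain C where C: "bdd_coeffs C a" using Xs_BD[OF a] by (auto simp: BD_def)
  have C0: "0 \<le> C" by (rule bdd_coeffs_nonneg[OF C])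
  \<comment> \<open>Beyond \<open>N\<close> this majorises both \<open>norm (b k)\<close> and
    \<open>real k * norm (b k)\<close>, so that one tail controls the Hardy part and the Dirichlet
    part.\<close>
  define s where "s k = (real k + 1) * r ^ k * C" for k
  have s_sum: "summable s"
    using summable_mult2[OF summable_Suc_power[of r], of C] r unfolding s_def by (simp add: add.commute)
  have s0: "0 \<le> s k" for k using r C0 by (simp add: s_def)
  define t where "t N = (\<Sum>k. s (k + N))" for N
  have "(\<lambda>N. (mf_const + 1) * (t N)\<^sup>2) \<longlonglongrightarrow> (mf_const + 1) * 0\<^sup>2"
    unfolding t_def by (intro tendsto_intros suminf_exist_split2 s_sum)
  then obtain N where N: "(mf_const + 1) * (t N)\<^sup>2 < e"
    using order_tendstoD(2)[of _ "(mf_const + 1) * 0\<^sup>2" sequentially e] e by (auto simp: eventually_sequentially)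
  define b where "b = dil r a - trunc N (dil r a)"
  have dx: "dil r a \<in> Xs" using dil_in_Xs[OF a] r by simp
  have bX: "b \<in> Xs" unfolding b_def by (intro Xs_diff trunc_in_Xs dx)
  have nb: "(real k + 1) * norm (b k) \<le> (if k < N then 0 else s k)" for k
  proof (cases "k < N")
    case False
    have "norm (a k) \<le> C" using C by (simp add: bdd_coeffs_def)
    then have "(real k + 1) * (r ^ k * norm (a k)) \<le> (real k + 1) * (r ^ k * C)"
      using r by (intro mult_left_mono) auto
    then show ?thesis using False r by (simp add: b_def trunc_def dil_def norm_scaleC norm_power s_def mult_ac)
  qed (simp add: b_def trunc_def)
  have tail: "(\<lambda>k. if k < N then 0 else s k) sums t N"
  proof -
    have "(\<lambda>k. s (k + N)) sums t N"
      unfolding t_def by (intro summable_sums summable_ignore_initial_segment s_sum)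
    then have "(\<lambda>k. if k + N < N then 0 else s (k + N)) sums t N" by simp
    then show ?thesis by (subst (asm) sums_iff_shift[of "\<lambda>k. if k < N then 0 else s k"]) simp
  qed
  have le1: "norm (b k) \<le> (if k < N then 0 else s k)" "real k * norm (b k) \<le> (if k < N then 0 else s k)" for k
    using nb[of k] mult_right_mono[of 1 "real k + 1" "norm (b k)"] mult_right_mono[of "real k" "real k + 1" "norm (b k)"]
    by (simp_all split: if_splits)
  have sm: "summable (\<lambda>k. norm (b k))" "summable (\<lambda>k. real k * norm (b k))"
    by (rule summable_comparison_test'[OF sums_summable[OF tail], of 0], use le1 in simp)+
  have sums: "(\<Sum>k. norm (b k)) \<le> t N" "(\<Sum>k. real k * norm (b k)) \<le> t N"
    unfolding sums_unique[OF tail] by (intro suminf_le le1 sm sums_summable[OF tail])+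
  obtain C' where C': "bdd_coeffs C' b" using Xs_BD[OF bX] by (auto simp: BD_def)
  have "E n b b \<le> (mf_const + 1) * (t N)\<^sup>2" for n
  proof -
    have "(\<Sum>k<n. b k \<bullet> b k) \<le> (\<Sum>k<n. norm (b k) * (\<Sum>k. norm (b k)))"
    proof (rule sum_mono)
      fix k
      have "norm (b k) \<le> (\<Sum>k. norm (b k))"
        using sum_le_suminf[OF sm(1), of "{k}"] by simp
      then show "b k \<bullet> b k \<le> norm (b k) * (\<Sum>k. norm (b k))"
        by (simp add: power2_norm_eq_inner[symmetric] power2_eq_square mult_left_mono)
    qed
    also have "\<dots> = (\<Sum>k<n. norm (b k)) * (\<Sum>k. norm (b k))" by (simp add: sum_distrib_right)
    also have "\<dots> \<le> t N * t N"
      using sums(1) sm(1) s0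
      by (intro mult_mono order_trans[OF sum_le_suminf[OF sm(1)]]) (auto intro!: suminf_nonneg sum_nonneg simp: t_def summable_ignore_initial_segment s_sum)
    finally have 1: "(\<Sum>k<n. b k \<bullet> b k) \<le> (t N)\<^sup>2" by (simp add: power2_eq_square)
    have "Q (radius n) b b \<le> mf_const * (\<Sum>k. real k * norm (b k))\<^sup>2"
      by (rule Q_summable_bound[OF radius(1,2) C' sm(2)])
    also have "\<dots> \<le> mf_const * (t N)\<^sup>2"
      using sums(2) mf_const_nonneg by (intro mult_left_mono power_mono suminf_nonneg sm) auto
    finally show ?thesis unfolding E_def using 1 by (simp add: algebra_simps)
  qed
  then have "Bs b b \<le> (mf_const + 1) * (t N)\<^sup>2" by (rule Bs_le[OF bX])
  then show ?thesis using N unfolding b_def by (intro exI[of _ N]) simp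
qed

lemma polys_dense_Xs:
  assumes a: "a \<in> Xs" and e: "0 < e"
  shows "\<exists>N c. Bs (a - trunc N c) (a - trunc N c) < e"
proof -
  \<comment> \<open>By the parallelogram law the squared norm of a sum is at most twice the sum of
    the squared norms, hence \<open>e / 4\<close> for each of the two errors.\<close>
  obtain r where r: "0 < r" "r < 1" "Bs (a - dil r a) (a - dil r a) < e / 4"
    using dil_approx[OF a, of "e / 4"] e by auto
  obtain N where N: "Bs (dil r a - trunc N (dil r a)) (dil r a - trunc N (dil r a)) < e / 4"
    using trunc_dil_approx[OF a r(1,2), of "e / 4"] e by auto
  let ?u = "a - dil r a" and ?v = "dil r a - trunc N (dil r a)"
  have u: "?u \<in> Xs" "?v \<in> Xs"
    using dil_in_Xs[OF a r(1)] r a by (auto intro!: Xs_diff trunc_in_Xs)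
  have "?u + ?v = a - trunc N (dil r a)" by simp
  moreover have "Bs (?u + ?v) (?u + ?v) + Bs (?u - ?v) (?u - ?v) = 2 * Bs ?u ?u + 2 * Bs ?v ?v"
    using Bs_add_diag[OF u] Bs_diff_diag[OF u] by simp
  moreover have "0 \<le> Bs (?u - ?v) (?u - ?v)" by (intro Bs_nonneg Xs_diff u)
  ultimately have "Bs (a - trunc N (dil r a)) (a - trunc N (dil r a)) < e" using r N by simp
  then show ?thesis by blast
qed

end

section \<open>From coefficient sequences to functions on the disc\<close>

lemma taylor_add:
  assumes "has_taylor f a" "has_taylor g b"
  shows "has_taylor (f + g) (a + b)"
  using assms unfolding has_taylor_def plus_fun_def by (auto simp: scaleC_add_right intro: sums_add)

lemma taylor_scaleC:
  assumes "has_taylor f a"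
  shows "has_taylor (c *\<^sub>C f) (c *\<^sub>C a)"
  unfolding has_taylor_def scaleC_fun_def
proof
  fix z :: complex assume "z \<in> disc"
  then have "(\<lambda>k. c *\<^sub>C z ^ k *\<^sub>C a k) sums (c *\<^sub>C f z)"
    using assms by (intro bounded_linear.sums[OF scaleC.bounded_linear_right]) (auto simp: has_taylor_def)
  then show "(\<lambda>k. z ^ k *\<^sub>C c *\<^sub>C a k) sums (c *\<^sub>C f z)" by (simp add: scaleC_commute[of c])
qed

lemma taylor_poly_fun: "has_taylor (poly_fun p) (coeff p)"
  unfolding has_taylor_def
proof
  fix z :: complex assume z: "z \<in> disc"
  have "(\<lambda>k. z ^ k *\<^sub>C coeff p k) sums (\<Sum>k\<le>degree p. z ^ k *\<^sub>C coeff p k)"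
    by (rule sums_finite) (auto simp: coeff_eq_0)
  then show "(\<lambda>k. z ^ k *\<^sub>C coeff p k) sums poly_fun p z" using z by (simp add: poly_fun_def)
qed

lemma coeff_eq_trunc: "degree p < N \<Longrightarrow> coeff p = trunc N (coeff p)"
  by (auto simp: trunc_def coeff_eq_0)

lemma coeff_sum_monom: "coeff (\<Sum>k<N. monom (c k) k) = trunc N c"
proof
  fix i
  have "coeff (\<Sum>k<N. monom (c k) k) i = (\<Sum>k<N. if k = i then c k else 0)"
    by (simp add: coeff_sum)
  then show "coeff (\<Sum>k<N. monom (c k) k) i = trunc N c i"
    by (simp add: trunc_def)
qed

lemma poly_fun_eqI:
  assumes "has_taylor f (coeff p)" "\<And>z. z \<notin> disc \<Longrightarrow> f z = 0"
  shows "f = poly_fun p"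
proof
  fix z
  show "f z = poly_fun p z"
  proof (cases "z \<in> disc")
    case True
    then show ?thesis using assms(1) taylor_poly_fun[of p] unfolding has_taylor_def by (metis sums_unique2)
  qed (use assms(2) in \<open>simp add: poly_fun_def\<close>)
qed

abbreviation mz :: "(complex \<Rightarrow> 'e::complex_hilbert_space) \<Rightarrow> complex \<Rightarrow> 'e" where
  "mz \<equiv> mult_op (\<lambda>z. z)"

lemma mz_poly_fun: "mz (poly_fun p) = poly_fun (pCons 0 p)"
proof (rule poly_fun_eqI)
  show "has_taylor (mz (poly_fun p)) (coeff (pCons 0 p))"
    unfolding has_taylor_def mult_op_def
  proof
    fix z :: complex assume "z \<in> disc"
    then have "(\<lambda>k. z ^ k *\<^sub>C coeff p k) sums poly_fun p z"
      using taylor_poly_fun[of p] unfolding has_taylor_def by blast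
    then have "(\<lambda>k. z *\<^sub>C z ^ k *\<^sub>C coeff p k) sums (z *\<^sub>C poly_fun p z)"
      by (rule bounded_linear.sums[OF scaleC.bounded_linear_right])
    then have "(\<lambda>k. z ^ Suc k *\<^sub>C coeff (pCons 0 p) (Suc k)) sums (z *\<^sub>C poly_fun p z)"
      by (simp add: scaleC_scaleC)
    then show "(\<lambda>k. z ^ k *\<^sub>C coeff (pCons 0 p) k) sums (z *\<^sub>C poly_fun p z)"
      by (subst (asm) sums_Suc_iff) simp
  qed
qed (simp add: mult_op_def poly_fun_def)

context op_measure begin

lemma BD_trunc_coeffs: "coeff p \<in> Xs"
  using trunc_in_Xs[of "Suc (degree p)" "coeff p"] coeff_eq_trunc[of p "Suc (degree p)"] by simp

text \<open>\<open>E n\<close> adds a partial sum of the Hardy norm and a truncated Dirichlet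
  integral, so its limit is the squared norm. Together with \<open>dirichlet_spaceE\<close>, the
  converse, this transfers the results on sequences to functions.\<close>

lemma Xs_dirichlet:
  assumes f: "has_taylor f a" and out: "\<And>z. z \<notin> disc \<Longrightarrow> f z = 0" and a: "a \<in> Xs"
  shows "f \<in> dirichlet_space \<mu>" "dirichlet_norm \<mu> f = sqrt (Bs a a)"
proof -
  obtain C where C: "bdd_coeffs C a" using Xs_BD[OF a] by (auto simp: BD_def)
  have Q0: "0 \<le> Q (radius n) a a" for n using Q_mono(2)[OF radius(1) order_refl radius(2) C] .
  have S: "(\<Sum>k<n. (norm (a k))\<^sup>2) \<le> Bs a a" "Q (radius n) a a \<le> Bs a a" for n
  proof -
    have "0 \<le> (\<Sum>k<n. a k \<bullet> a k)" by (intro sum_nonneg) auto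
    then show "(\<Sum>k<n. (norm (a k))\<^sup>2) \<le> Bs a a" "Q (radius n) a a \<le> Bs a a"
      using E_le_Bs[OF a, of n] Q0[of n] by (auto simp: E_def power2_norm_eq_inner)
  qed
  have sm: "summable (\<lambda>k. (norm (a k))\<^sup>2)"
    by (rule summableI_nonneg_bounded[OF _ S(1)]) simp
  have D: "dirichlet_integral \<mu> f = (SUP n. ennreal (Q (radius n) a a))"
    by (rule dirichlet_integral_eq_SUP[OF f C])
  have Dfin: "dirichlet_integral \<mu> f \<le> ennreal (Bs a a)"
    unfolding D using S(2) by (intro SUP_least ennreal_leI)
  then have Dlt: "dirichlet_integral \<mu> f < \<infinity>" using le_less_trans ennreal_less_top by (metis infinity_ennreal_def)
  show "f \<in> dirichlet_space \<mu>"
    using f out sm Dlt unfolding dirichlet_space_def hardy_def by blast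
  have "(\<lambda>n. ennreal (Q (radius n) a a)) \<longlonglongrightarrow> dirichlet_integral \<mu> f"
    unfolding D using Q_mono(1)[OF radius(1) radius(3) radius(2) C]
    by (intro LIMSEQ_SUP) (auto simp: incseq_def intro: ennreal_leI)
  then have "(\<lambda>n. enn2real (ennreal (Q (radius n) a a))) \<longlonglongrightarrow> enn2real (dirichlet_integral \<mu> f)"
    using Dlt by (intro tendsto_enn2real) auto
  then have "(\<lambda>n. (\<Sum>k<n. (norm (a k))\<^sup>2) + Q (radius n) a a) \<longlonglongrightarrow> (\<Sum>k. (norm (a k))\<^sup>2) + enn2real (dirichlet_integral \<mu> f)"
    using Q0 by (intro tendsto_add summable_LIMSEQ sm) simp
  moreover have "(\<lambda>n. (\<Sum>k<n. (norm (a k))\<^sup>2) + Q (radius n) a a) = (\<lambda>n. E n a a)"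
    by (simp add: E_def power2_norm_eq_inner)
  ultimately have "Bs a a = (\<Sum>k. (norm (a k))\<^sup>2) + enn2real (dirichlet_integral \<mu> f)"
    using LIMSEQ_unique[OF E_LIMSEQ[OF a a]] by simp
  then show "dirichlet_norm \<mu> f = sqrt (Bs a a)"
    using sm by (simp add: dirichlet_norm_def hardy_norm_def taylor_coeff_eq[OF f] suminf_nonneg)
qed

lemma dirichlet_spaceE:
  assumes "f \<in> dirichlet_space \<mu>"
  obtains a where "has_taylor f a" "\<And>z. z \<notin> disc \<Longrightarrow> f z = 0" "a \<in> Xs"
proof -
  obtain a where a: "has_taylor f a" "\<And>z. z \<notin> disc \<Longrightarrow> f z = 0" "summable (\<lambda>k. (norm (a k))\<^sup>2)"
    and D: "dirichlet_integral \<mu> f < \<infinity>"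
    using assms by (auto simp: dirichlet_space_def hardy_def)
  have "(norm (a k))\<^sup>2 \<le> (\<Sum>k. (norm (a k))\<^sup>2)" for k
    using sum_le_suminf[OF a(3), of "{k}"] by simp
  then have C: "bdd_coeffs (sqrt (\<Sum>k. (norm (a k))\<^sup>2)) a"
    unfolding bdd_coeffs_def using real_le_rsqrt by blast
  define K where "K = enn2real (dirichlet_integral \<mu> f)"
  have K: "dirichlet_integral \<mu> f = ennreal K" "0 \<le> K" using D by (simp_all add: K_def)
  have "ennreal (Q (radius n) a a) \<le> ennreal K" for n
    unfolding K(1)[symmetric] dirichlet_integral_eq_SUP[OF a(1) C] by (rule SUP_upper) simp
  then have "Q (radius n) a a \<le> K" for n using K(2) by (simp add: ennreal_le_iff)
  moreover have "(\<Sum>k<n. a k \<bullet> a k) \<le> (\<Sum>k. (norm (a k))\<^sup>2)" for n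
    unfolding power2_norm_eq_inner[symmetric] by (rule sum_le_suminf[OF a(3)]) auto
  ultimately have "E n a a \<le> (\<Sum>k. (norm (a k))\<^sup>2) + K" for n unfolding E_def by (intro add_mono)
  then have "a \<in> Xs" using C by (auto simp: Xs_def BD_def)
  then show thesis using that a by blast
qed

definition B :: "(complex \<Rightarrow> 'e) \<Rightarrow> (complex \<Rightarrow> 'e) \<Rightarrow> real" where
  "B f g = Bs (taylor_coeff f) (taylor_coeff g)"

lemma B_eq: "has_taylor f a \<Longrightarrow> has_taylor g b \<Longrightarrow> B f g = Bs a b"
  by (simp add: B_def taylor_coeff_eq)

lemma dirichlet_norm_eq: "f \<in> dirichlet_space \<mu> \<Longrightarrow> dirichlet_norm \<mu> f = sqrt (B f f)"
  using Xs_dirichlet(2) B_eq dirichlet_spaceE by metis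

lemma dirichlet_add:
  assumes "f \<in> dirichlet_space \<mu>" "g \<in> dirichlet_space \<mu>"
  shows "f + g \<in> dirichlet_space \<mu>"
  using assms
  by (elim dirichlet_spaceE) (rule Xs_dirichlet(1)[OF taylor_add], auto intro: Xs_add)

lemma dirichlet_scaleC:
  assumes "f \<in> dirichlet_space \<mu>"
  shows "c *\<^sub>C f \<in> dirichlet_space \<mu>" "B (c *\<^sub>C f) (c *\<^sub>C f) = (cmod c)\<^sup>2 * B f f"
proof -
  obtain a where a: "has_taylor f a" "\<And>z. z \<notin> disc \<Longrightarrow> f z = 0" "a \<in> Xs"
    using dirichlet_spaceE[OF assms] by blast
  show "c *\<^sub>C f \<in> dirichlet_space \<mu>"
    by (rule Xs_dirichlet(1)[OF taylor_scaleC[OF a(1)] _ Xs_scaleC[OF a(3)]]) (simp add: scaleC_fun_def a(2))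
  show "B (c *\<^sub>C f) (c *\<^sub>C f) = (cmod c)\<^sup>2 * B f f"
    using Bs_scaleC[OF a(3)] by (simp add: B_eq[OF a(1) a(1)] B_eq[OF taylor_scaleC[OF a(1)] taylor_scaleC[OF a(1)]])
qed

lemma dirichlet_B_add:
  assumes "f \<in> dirichlet_space \<mu>" "f' \<in> dirichlet_space \<mu>" "g \<in> dirichlet_space \<mu>"
  shows "B (f + f') g = B f g + B f' g"
proof -
  obtain a a' b where "has_taylor f a" "a \<in> Xs" "has_taylor f' a'" "a' \<in> Xs" "has_taylor g b" "b \<in> Xs"
    using assms dirichlet_spaceE by metis
  then show ?thesis
    using B_eq[OF taylor_add, of f a f' a' g b] Bs_add[of a a' b] by (simp add: B_eq)
qed

lemma dirichlet_B_scaleR: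
  assumes "f \<in> dirichlet_space \<mu>" "g \<in> dirichlet_space \<mu>"
  shows "B (of_real r *\<^sub>C f) g = r * B f g"
proof -
  obtain a b where "has_taylor f a" "a \<in> Xs" "has_taylor g b" "b \<in> Xs"
    using assms dirichlet_spaceE by metis
  then show ?thesis
    using B_eq[OF taylor_scaleC, of f a g b "of_real r"] Bs_scale[of a b r] by (simp add: B_eq)
qed

lemma dirichlet_B_nonneg: "f \<in> dirichlet_space \<mu> \<Longrightarrow> 0 \<le> B f f"
  by (erule dirichlet_spaceE) (simp add: B_eq Bs_nonneg)

lemma dirichlet_eval:
  assumes "f \<in> dirichlet_space \<mu>" "z \<in> disc"
  shows "norm (f z) \<le> sqrt (B f f) / (1 - cmod z)"
proof -
  obtain a where a: "has_taylor f a" "a \<in> Xs" using dirichlet_spaceE[OF assms(1)] by blast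
  show ?thesis
    using pser_sums(2)[OF bdd_Bs[OF a(2) order_refl]] assms(2) has_taylor_eq_pser[OF a(1) assms(2)]
    by (simp add: B_eq[OF a(1) a(1)])
qed

text \<open>Bounded norms bound the coefficients uniformly, and then convergence of the values on
  the disc forces convergence of each coefficient; semicontinuity for sequences finishes the
  proof.\<close>

lemma dirichlet_fatou:
  assumes F: "\<And>j. F j \<in> dirichlet_space \<mu>" "\<And>j. B (F j) (F j) \<le> K"
    and lim: "\<And>z. z \<in> disc \<Longrightarrow> (\<lambda>j. F j z) \<longlonglongrightarrow> f z" and out: "\<And>z. z \<notin> disc \<Longrightarrow> f z = 0"
  shows "f \<in> dirichlet_space \<mu>" "B f f \<le> K"
proof -
  have "\<exists>a. has_taylor (F j) a \<and> a \<in> Xs" for j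
    using dirichlet_spaceE[OF F(1)] by metis
  then obtain a where a: "\<And>j. has_taylor (F j) (a j)" "\<And>j. a j \<in> Xs" by metis
  have le: "Bs (a j) (a j) \<le> K" for j using F(2)[of j] by (simp add: B_eq[OF a(1) a(1)])
  have bd: "bdd_coeffs (sqrt K) (a j)" for j by (rule bdd_Bs[OF a(2) le])
  have "convergent (\<lambda>j. pser (a j) z)" if "cmod z < 1" for z
  proof -
    have "(\<lambda>j. pser (a j) z) = (\<lambda>j. F j z)" using has_taylor_eq_pser[OF a(1), of z] that by auto
    then show ?thesis using lim[of z] that by (auto simp: convergent_def)
  qed
  then have "convergent (\<lambda>j. a j k)" for k
    by (rule pser_convergent_imp_coeffs_convergent[OF bd])
  then obtain b where b: "\<And>k. (\<lambda>j. a j k) \<longlonglongrightarrow> b k" unfolding convergent_def by metis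
  note X = Xs_fatou[OF a(2) le b]
  obtain C where C: "bdd_coeffs C b" using Xs_BD[OF X(1)] by (auto simp: BD_def)
  have "f z = pser b z" if z: "z \<in> disc" for z
  proof -
    have "(\<lambda>j. pser (a j) z) \<longlonglongrightarrow> pser b z" using z by (intro pser_tendsto[OF bd b]) simp
    moreover have "(\<lambda>j. pser (a j) z) = (\<lambda>j. F j z)" using has_taylor_eq_pser[OF a(1) z] by auto
    ultimately show ?thesis using lim[OF z] LIMSEQ_unique by metis
  qed
  then have t: "has_taylor f b" using has_taylor_pser[OF C] by (simp add: has_taylor_def)
  show "f \<in> dirichlet_space \<mu>" by (rule Xs_dirichlet(1)[OF t out X(1)])
  show "B f f \<le> K" using X(2) by (simp add: B_eq[OF t t])
qed

lemma poly_fun_dirichlet: "poly_fun p \<in> dirichlet_space \<mu>"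
  by (rule Xs_dirichlet(1)[OF taylor_poly_fun _ BD_trunc_coeffs]) (simp add: poly_fun_def)

lemma polys_dense:
  assumes "f \<in> dirichlet_space \<mu>" "0 < e"
  shows "\<exists>p. B (f - poly_fun p) (f - poly_fun p) < e"
proof -
  obtain a where a: "has_taylor f a" "a \<in> Xs" using dirichlet_spaceE[OF assms(1)] by blast
  obtain N c where c: "Bs (a - trunc N c) (a - trunc N c) < e" using polys_dense_Xs[OF a(2) assms(2)] by blast
  define p where "p = (\<Sum>k<N. monom (c k) k)"
  have "has_taylor (f - poly_fun p) (a - trunc N c)"
    using taylor_add[OF a(1) taylor_scaleC[OF taylor_poly_fun, of "of_real (-1)" p]]
    unfolding minus_as_scale[symmetric] by (simp add: p_def coeff_sum_monom)
  then show ?thesis using c by (intro exI[of _ p]) (simp add: B_eq)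
qed

section \<open>The shift on polynomials\<close>

definition qf :: "nat \<Rightarrow> (nat \<Rightarrow> 'e) \<Rightarrow> real" where
  "qf N a = (\<Sum>k<N. \<Sum>l<N. Re (mf (int l - int k) (a k) (a l)))"

lemma B_poly: "degree p < N \<Longrightarrow> B (poly_fun p) (poly_fun p) = (\<Sum>k<N. (norm (coeff p k))\<^sup>2) +
      (\<Sum>k<N. \<Sum>l<N. real (min k l) * Re (mf (int l - int k) (coeff p k) (coeff p l)))"
  using Bs_trunc[of N "coeff p"] coeff_eq_trunc[of p N] by (simp add: B_eq[OF taylor_poly_fun taylor_poly_fun])

text \<open>Shifting both indices turns \<open>min k l\<close> into \<open>min k l + 1\<close>; the
  extra kernel 1 is the form of \<open>\<mu>\<close>, and the Hardy part is unchanged.\<close>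

lemma B_shift_poly:
  assumes "degree p < N"
  shows "B (mz (poly_fun p)) (mz (poly_fun p)) = B (poly_fun p) (poly_fun p) + qf N (coeff p)"
proof -
  have "degree (pCons 0 p) < Suc N" using assms degree_pCons_le[of 0 p] by simp
  from B_poly[OF this] show ?thesis
    unfolding mz_poly_fun B_poly[OF assms] qf_def sum.lessThan_Suc_shift
    by (simp add: mf_zero distrib_right sum.distrib)
qed

text \<open>The entries depend on \<open>l - k\<close> only. This Toeplitz structure is the reason
  why the shift is a 2-isometry.\<close>

lemma qf_shift: "qf (Suc N) (coeff (pCons 0 p)) = qf N (coeff p)"
  unfolding qf_def sum.lessThan_Suc_shift by (simp add: mf_zero)

lemma qf_nonneg: "0 \<le> qf N a"
  unfolding qf_def by (rule mf_psd)

lemma qf_measure_form: "Re (measure_form \<mu> p p) = qf (Suc (degree p)) (coeff p)"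
  unfolding qf_def measure_form_def mf_def lessThan_Suc_atMost by simp

text \<open>In the order of positive kernels, 1 is at most twice \<open>min k l\<close> plus twice
  the corner entry at \<open>k = l = 0\<close>. The corner is paid for with \<open>mf_bound\<close>,
  as the Dirichlet part does not see the constant coefficient.\<close>

lemma qf_bound:
  assumes "degree p < N"
  shows "qf N (coeff p) \<le> (2 * mf_const + 2) * B (poly_fun p) (poly_fun p)"
proof -
  define a where "a = coeff p"
  define G where "G k l = Re (mf (int l - int k) (a k) (a l))" for k l
  have N: "0 < N" using assms by simp
  \<comment> \<open>The rank-one kernel of this vector is 1 except for the entries with exactly one
    index 0, where it is -1; adding \<open>2 * (min k l - 1)\<close> for \<open>k, l \<ge> 1\<close>
    gives exactly the kernel compared below.\<close>
  let ?v = "\<lambda>k :: nat. if k = 0 then 1 else - 1 :: real"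
  have "kernel_pos N (\<lambda>k l. ?v k * ?v l * 1 +
     (\<Sum>j\<in>{1..<N}. 2 * (of_bool (j < k) * of_bool (j < l) * 1)))"
    by (intro kernel_pos_add kernel_pos_rank_one kernel_pos_sum kernel_pos_cmult kernel_pos_one) auto
  then have "0 \<le> (\<Sum>k<N. \<Sum>l<N. (?v k * ?v l * 1 + (\<Sum>j\<in>{1..<N}. 2 * (of_bool (j < k) * of_bool (j < l) * 1))) * G k l)"
    unfolding kernel_pos_def G_def by blast
  also have "\<dots> = (\<Sum>k<N. \<Sum>l<N. (2 * of_bool (k = 0 \<and> l = 0) + 2 * real (min k l) - 1) * G k l)"
  proof (intro sum.cong refl)
    fix k l assume kl: "k \<in> {..<N}" "l \<in> {..<N}"
    have "(\<Sum>j\<in>{1..<N}. 2 * (of_bool (j < k) * of_bool (j < l) * 1)) = (\<Sum>j\<in>{1..<min k l}. 2 :: real)"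
      by (rule sum.mono_neutral_cong_right) (use kl in auto)
    then have "(\<Sum>j\<in>{1..<N}. 2 * (of_bool (j < k) * of_bool (j < l) * 1)) = 2 * real (min k l - 1)" by simp
    then have "?v k * ?v l * 1 + (\<Sum>j\<in>{1..<N}. 2 * (of_bool (j < k) * of_bool (j < l) * 1))
      = 2 * of_bool (k = 0 \<and> l = 0) + 2 * real (min k l) - 1"
      by (cases k; cases l) (auto simp: of_nat_diff)
    then show "(?v k * ?v l * 1 + (\<Sum>j\<in>{1..<N}. 2 * (of_bool (j < k) * of_bool (j < l) * 1))) * G k l
       = (2 * of_bool (k = 0 \<and> l = 0) + 2 * real (min k l) - 1) * G k l" by simp
  qed
  also have "\<dots> = (\<Sum>k<N. \<Sum>l<N. 2 * (if k = 0 then if l = 0 then G k l else 0 else 0)) + 2 * (\<Sum>k<N. \<Sum>l<N. real (min k l) * G k l) - (\<Sum>k<N. \<Sum>l<N. G k l)"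
    unfolding sum_distrib_left sum.distrib[symmetric] sum_subtractf[symmetric]
    by (intro sum.cong refl) (simp add: algebra_simps)
  also have "(\<Sum>k<N. \<Sum>l<N. 2 * (if k = 0 then if l = 0 then G k l else 0 else 0)) = 2 * G 0 0"
  proof -
    have "(\<Sum>l<N. 2 * (if k = 0 then if l = 0 then G k l else 0 else 0)) = (if k = 0 then 2 * G 0 0 else 0)" for k
      using N by (auto simp: sum.delta sum_distrib_left[symmetric])
    then show ?thesis using N by (simp add: sum.delta)
  qed
  finally have 1: "qf N a \<le> 2 * G 0 0 + 2 * (\<Sum>k<N. \<Sum>l<N. real (min k l) * G k l)"
    by (simp add: qf_def G_def)
  have D: "0 \<le> (\<Sum>k<N. \<Sum>l<N. real (min k l) * G k l)"
    using kernel_pos_min[OF kernel_pos_one, of N] unfolding kernel_pos_def G_def by simp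
  have "G 0 0 \<le> mf_const * norm (a 0) * norm (a 0)"
    unfolding G_def by (rule order_trans[OF complex_Re_le_cmod mf_bound])
  also have "\<dots> = mf_const * (norm (a 0))\<^sup>2" by (simp add: power2_eq_square)
  also have "\<dots> \<le> mf_const * (\<Sum>k<N. (norm (a k))\<^sup>2)"
    using N mf_const_nonneg by (intro mult_left_mono member_le_sum) auto
  finally have 2: "G 0 0 \<le> mf_const * (\<Sum>k<N. (norm (a k))\<^sup>2)" .
  define s where "s = (\<Sum>k<N. (norm (a k))\<^sup>2)"
  define d where "d = (\<Sum>k<N. \<Sum>l<N. real (min k l) * G k l)"
  have "B (poly_fun p) (poly_fun p) = s + d"
    unfolding B_poly[OF assms] s_def d_def G_def a_def ..
  moreover have "0 \<le> s" unfolding s_def by (intro sum_nonneg) simp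
  moreover have "0 \<le> d" using D by (simp add: d_def)
  moreover have "qf N a \<le> 2 * (mf_const * s) + 2 * d" using 1 2 by (simp add: s_def d_def)
  moreover have "0 \<le> mf_const * d" using mf_const_nonneg \<open>0 \<le> d\<close> by simp
  ultimately show ?thesis unfolding a_def by (simp add: algebra_simps)
qed

end

section \<open>Spaces of functions with the Fatou property\<close>

lemma mult_op_add: "mult_op \<phi> (f + g) = mult_op \<phi> f + mult_op \<phi> g"
  by (simp add: mult_op_def plus_fun_def scaleC_add_right)

lemma mult_op_scaleC: "mult_op \<phi> (c *\<^sub>C f) = c *\<^sub>C mult_op \<phi> f"
  by (simp add: mult_op_def scaleC_fun_def scaleC_commute)

lemma mult_op_diff: "mult_op \<phi> (f - g) = mult_op \<phi> f - mult_op \<phi> g"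
  by (simp add: mult_op_def fun_diff_def scaleC_diff_right)

lemma mult_op_mult_op: "mult_op \<phi> (mult_op \<psi> f) = mult_op (\<lambda>z. \<phi> z * \<psi> z) f"
  by (simp add: mult_op_def scaleC_scaleC)

text \<open>Collects what the operator theory uses of the Dirichlet space. \<open>B\<close> is the
  real part of its inner product and \<open>P\<close> stands for the polynomials, where the shift is
  known to be expansive, bounded and 2-isometric. The Fatou property allows limits to be formed
  pointwise on the disc, and \<open>eval\<close> links them to the norm.\<close>

locale fatou_space =
  fixes X :: "(complex \<Rightarrow> 'e::complex_hilbert_space) set"
    and B :: "(complex \<Rightarrow> 'e) \<Rightarrow> (complex \<Rightarrow> 'e) \<Rightarrow> real"
    and P :: "(complex \<Rightarrow> 'e) set" and C :: real
  assumes zero_closed: "0 \<in> X"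
    and add_closed: "f \<in> X \<Longrightarrow> g \<in> X \<Longrightarrow> f + g \<in> X"
    and scaleC_closed: "f \<in> X \<Longrightarrow> c *\<^sub>C f \<in> X"
    and B_add: "f \<in> X \<Longrightarrow> f' \<in> X \<Longrightarrow> g \<in> X \<Longrightarrow> B (f + f') g = B f g + B f' g"
    and B_scaleR: "f \<in> X \<Longrightarrow> g \<in> X \<Longrightarrow> B (complex_of_real r *\<^sub>C f) g = r * B f g"
    and B_sym: "B f g = B g f"
    and B_nonneg: "f \<in> X \<Longrightarrow> 0 \<le> B f f"
    and B_scaleC: "f \<in> X \<Longrightarrow> B (c *\<^sub>C f) (c *\<^sub>C f) = (cmod c)\<^sup>2 * B f f"
    and outside: "f \<in> X \<Longrightarrow> z \<notin> disc \<Longrightarrow> f z = 0"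
    and eval: "f \<in> X \<Longrightarrow> z \<in> disc \<Longrightarrow> norm (f z) \<le> sqrt (B f f) / (1 - cmod z)"
    and fatou: "(\<And>j :: nat. F j \<in> X) \<Longrightarrow> (\<And>j. B (F j) (F j) \<le> K) \<Longrightarrow>
      (\<And>z. z \<in> disc \<Longrightarrow> (\<lambda>j. F j z) \<longlonglongrightarrow> f z) \<Longrightarrow> (\<And>z. z \<notin> disc \<Longrightarrow> f z = 0) \<Longrightarrow>
      f \<in> X \<and> B f f \<le> K"
    and P_subset: "P \<subseteq> X"
    and P_dense: "f \<in> X \<Longrightarrow> 0 < e \<Longrightarrow> \<exists>p\<in>P. B (f - p) (f - p) < e"
    and P_shift: "p \<in> P \<Longrightarrow> mz p \<in> P"
    and shift_ge: "p \<in> P \<Longrightarrow> B p p \<le> B (mz p) (mz p)"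
    and shift_bound: "p \<in> P \<Longrightarrow> B (mz p) (mz p) \<le> C * B p p"
    and shift_two: "p \<in> P \<Longrightarrow> B (mz (mz p)) (mz (mz p)) - 2 * B (mz p) (mz p) + B p p = 0"
begin

definition N :: "(complex \<Rightarrow> 'e) \<Rightarrow> real" where "N f = sqrt (B f f)"

lemma N_sq: "f \<in> X \<Longrightarrow> (N f)\<^sup>2 = B f f" by (simp add: N_def B_nonneg)
lemma N_nonneg [simp]: "f \<in> X \<Longrightarrow> 0 \<le> N f" by (simp add: N_def B_nonneg)

lemma N_scaleC: "f \<in> X \<Longrightarrow> N (c *\<^sub>C f) = cmod c * N f"
  by (simp add: N_def B_scaleC real_sqrt_mult)

lemma diff_closed: "f \<in> X \<Longrightarrow> g \<in> X \<Longrightarrow> f - g \<in> X"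
  unfolding minus_as_scale by (intro add_closed scaleC_closed)

lemma sum_closed: "(\<And>i. i \<in> I \<Longrightarrow> F i \<in> X) \<Longrightarrow> sum F I \<in> X"
  by (induction I rule: infinite_finite_induct) (auto simp: zero_closed add_closed)

lemma B_add_right: "f \<in> X \<Longrightarrow> f' \<in> X \<Longrightarrow> g \<in> X \<Longrightarrow> B g (f + f') = B g f + B g f'"
  using B_add B_sym by metis

lemma B_scaleR_right: "f \<in> X \<Longrightarrow> g \<in> X \<Longrightarrow> B g (complex_of_real r *\<^sub>C f) = r * B g f"
  using B_scaleR B_sym by metis

lemma B_diff: "f \<in> X \<Longrightarrow> f' \<in> X \<Longrightarrow> g \<in> X \<Longrightarrow> B (f - f') g = B f g - B f' g"
  using B_add[of "f - f'" f' g] diff_closed by simp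

lemma B_diff_right: "f \<in> X \<Longrightarrow> f' \<in> X \<Longrightarrow> g \<in> X \<Longrightarrow> B g (f - f') = B g f - B g f'"
  using B_diff B_sym by metis

lemmas closed = zero_closed add_closed scaleC_closed diff_closed sum_closed
lemmas B_lin = B_add B_add_right B_scaleR B_scaleR_right B_diff B_diff_right

lemma cauchy_schwarz:
  assumes f: "f \<in> X" and g: "g \<in> X"
  shows "\<bar>B f g\<bar> \<le> N f * N g"
proof -
  have "(B f g)\<^sup>2 \<le> B f f * B g g"
  proof -
    have *: "0 \<le> B f f + 2 * t * B f g + t\<^sup>2 * B g g" for t
      using B_nonneg[of "f + of_real t *\<^sub>C g"] f g B_sym[of g f]
      by (simp add: closed B_lin power2_eq_square algebra_simps)
    show ?thesis
    proof (cases "B g g = 0")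
      case True
      have "B f g = 0"
      proof (rule ccontr)
        assume "B f g \<noteq> 0"
        \<comment> \<open>Makes the affine function of \<open>t\<close> left over when
          \<open>B g g = 0\<close> equal to -1.\<close>
        define t where "t = - (B f f + 1) / (2 * B f g)"
        have "2 * t * B f g = - (B f f + 1)" using \<open>B f g \<noteq> 0\<close> by (simp add: t_def field_simps)
        then show False using *[of t] True by simp
      qed
      then show ?thesis using True by simp
    next
      case False
      then have pos: "0 < B g g" using B_nonneg[OF g] by simp
      have "0 \<le> B f f - (B f g)\<^sup>2 / B g g"
        using *[of "- B f g / B g g"] pos by (simp add: power2_eq_square field_simps)
      then show ?thesis using pos by (simp add: field_simps)
    qed
  qed
  then have "sqrt ((B f g)\<^sup>2) \<le> sqrt (B f f * B g g)" by (rule real_sqrt_le_mono)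
  then show ?thesis by (simp add: N_def real_sqrt_mult)
qed

lemma N_triangle:
  assumes f: "f \<in> X" and g: "g \<in> X"
  shows "N (f + g) \<le> N f + N g"
proof -
  have "(N (f + g))\<^sup>2 \<le> (N f + N g)\<^sup>2"
    using cauchy_schwarz[OF f g] B_sym[of g f] f g
    by (simp add: N_sq closed B_lin power2_sum)
  then show ?thesis using f g by (simp add: power2_le_iff_abs_le abs_le_square_iff[symmetric] closed)
qed

lemma N_diff_commute: "f \<in> X \<Longrightarrow> g \<in> X \<Longrightarrow> N (f - g) = N (g - f)"
  using N_scaleC[of "g - f" "-1"] by (simp add: scaleC_minus_left closed)

lemma N_triangle_diff: "f \<in> X \<Longrightarrow> g \<in> X \<Longrightarrow> h \<in> X \<Longrightarrow> N (f - h) \<le> N (f - g) + N (g - h)"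
  using N_triangle[of "f - g" "g - h"] by (simp add: closed)

lemma N_triangle_minus: "f \<in> X \<Longrightarrow> g \<in> X \<Longrightarrow> \<bar>N f - N g\<bar> \<le> N (f - g)"
  using N_triangle[of "f - g" g] N_triangle[of "g - f" f] N_diff_commute[of f g] by (simp add: closed abs_le_iff)

lemma N_zero: "N 0 = 0"
  using N_scaleC[OF zero_closed, of 0] by simp

lemma N_sum: "(\<And>i. i \<in> I \<Longrightarrow> F i \<in> X) \<Longrightarrow> N (sum F I) \<le> (\<Sum>i\<in>I. N (F i))"
proof (induction I rule: infinite_finite_induct)
  case (insert i I)
  then have "N (sum F I) \<le> (\<Sum>i\<in>I. N (F i))" "N (F i + sum F I) \<le> N (F i) + N (sum F I)"
    by (auto intro!: N_triangle closed)
  then show ?case unfolding sum.insert[OF insert(1,2)] by linarith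
qed (simp_all add: N_zero)

lemma N_eval: "f \<in> X \<Longrightarrow> z \<in> disc \<Longrightarrow> norm (f z) \<le> N f / (1 - cmod z)"
  using eval by (simp add: N_def)

lemma N_eq_0: "f \<in> X \<Longrightarrow> N f = 0 \<Longrightarrow> f = 0"
  using N_eval outside by (intro ext) (metis div_0 norm_le_zero_iff zero_fun_apply)

lemma N_fatou:
  assumes F: "\<And>j :: nat. F j \<in> X" "\<forall>\<^sub>F j in sequentially. N (F j) \<le> K"
    and lim: "\<And>z. z \<in> disc \<Longrightarrow> (\<lambda>j. F j z) \<longlonglongrightarrow> f z" "\<And>z. z \<notin> disc \<Longrightarrow> f z = 0"
  shows "f \<in> X" "N f \<le> K"
proof -
  obtain J where J: "\<And>j. j \<ge> J \<Longrightarrow> N (F j) \<le> K" using F(2) by (auto simp: eventually_sequentially)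
  have "0 \<le> K" using J[of J] N_nonneg[OF F(1), of J] by simp
  have "B (F (j + J)) (F (j + J)) \<le> K\<^sup>2" for j
    using J[of "j + J"] N_nonneg[OF F(1)] power_mono[of "N (F (j + J))" K 2] N_sq[OF F(1)] by simp
  then have *: "f \<in> X \<and> B f f \<le> K\<^sup>2"
    by (intro fatou[of "\<lambda>j. F (j + J)"] F LIMSEQ_ignore_initial_segment lim)
  then show "f \<in> X" ..
  show "N f \<le> K" using * \<open>0 \<le> K\<close> unfolding N_def by (simp add: real_le_lsqrt)
qed

lemma N_fatou_tendsto:
  assumes F: "\<And>j :: nat. F j \<in> X" "\<And>j. N (F j) \<le> c j" "c \<longlonglongrightarrow> K"
    and lim: "\<And>z. z \<in> disc \<Longrightarrow> (\<lambda>j. F j z) \<longlonglongrightarrow> f z" "\<And>z. z \<notin> disc \<Longrightarrow> f z = 0"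
  shows "f \<in> X" "N f \<le> K"
proof -
  have ev: "\<forall>\<^sub>F j in sequentially. N (F j) \<le> K + e" if "e > 0" for e
    using order_tendstoD(2)[OF F(3), of "K + e"] that
    by (auto elim!: eventually_mono intro: order_trans[OF F(2)] less_imp_le)
  show "f \<in> X" by (rule N_fatou(1)[OF F(1) ev[of 1] lim]) auto
  show "N f \<le> K" by (rule field_le_epsilon) (rule N_fatou(2)[OF F(1) ev lim])
qed

lemma N_conv_pointwise:
  assumes "\<And>j. F j \<in> X" "f \<in> X" "((\<lambda>j. N (F j - f)) \<longlongrightarrow> 0) G" "z \<in> disc"
  shows "((\<lambda>j. F j z) \<longlongrightarrow> f z) G"
proof (rule LIM_zero_cancel, rule Lim_null_comparison)
  show "\<forall>\<^sub>F j in G. norm (F j z - f z) \<le> N (F j - f) / (1 - cmod z)"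
    using N_eval[OF diff_closed[OF assms(1,2)] assms(4)] by (simp add: fun_diff_def)
  show "((\<lambda>j. N (F j - f) / (1 - cmod z)) \<longlongrightarrow> 0) G"
    using tendsto_divide_zero[OF assms(3)] .
qed

lemma N_tendsto:
  assumes "\<forall>\<^sub>F j in G. F j \<in> X" "f \<in> X" "((\<lambda>j. N (F j - f)) \<longlongrightarrow> 0) G"
  shows "((\<lambda>j. N (F j)) \<longlongrightarrow> N f) G"
proof (rule LIM_zero_cancel, rule Lim_null_comparison[OF _ assms(3)])
  show "\<forall>\<^sub>F j in G. norm (N (F j) - N f) \<le> N (F j - f)"
    using assms(1) by eventually_elim (simp add: N_triangle_minus assms(2))
qed

text \<open>Completeness enters only through the Fatou property.\<close>

lemma series_converges:
  assumes F: "\<And>n. F n \<in> X" and s: "summable (\<lambda>n. N (F n))"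
  shows "\<exists>f\<in>X. \<forall>M. N (f - (\<Sum>n<M. F n)) \<le> (\<Sum>n. N (F (n + M)))"
proof -
  define S where "S M = (\<Sum>n<M. F n)" for M
  have S: "S M \<in> X" for M unfolding S_def using F by (intro closed)
  have d: "N (S (M + j) - S M) \<le> (\<Sum>n. N (F (n + M)))" for M j
  proof -
    have "S (M + j) = S M + (\<Sum>n<j. F (n + M))"
      unfolding S_def by (induction j) (simp_all add: add_ac)
    then have "N (S (M + j) - S M) = N (\<Sum>n<j. F (n + M))" by simp
    also have "\<dots> \<le> (\<Sum>n<j. N (F (n + M)))" by (rule N_sum) (rule F)
    also have "\<dots> \<le> (\<Sum>n. N (F (n + M)))"
      using F by (intro sum_le_suminf summable_ignore_initial_segment s) auto
    finally show ?thesis .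
  qed
  have tail: "(\<lambda>M. \<Sum>n. N (F (n + M))) \<longlonglongrightarrow> 0" by (rule suminf_exist_split2[OF s])
  have cauchy: "Cauchy (\<lambda>M. S M z)" if z: "z \<in> disc" for z
  proof (rule metric_CauchyI)
    fix e :: real assume e: "0 < e"
    have "0 < e / 2 * (1 - cmod z)" using e z by simp
    then obtain M where M: "(\<Sum>n. N (F (n + M))) < e / 2 * (1 - cmod z)"
      using order_tendstoD(2)[OF tail] by (meson eventually_happens' sequentially_bot)
    have "dist (S i z) (S M z) < e / 2" if "i \<ge> M" for i
    proof -
      have "norm ((S i - S M) z) \<le> N (S i - S M) / (1 - cmod z)"
        by (rule N_eval[OF diff_closed[OF S S] z])
      also have "\<dots> \<le> (\<Sum>n. N (F (n + M))) / (1 - cmod z)"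
        using d[of M "i - M"] that z by (intro divide_right_mono) auto
      also have "\<dots> < e / 2" using M z by (simp add: pos_divide_less_eq)
      finally show ?thesis by (simp add: dist_norm fun_diff_def)
    qed
    then show "\<exists>M. \<forall>m\<ge>M. \<forall>n\<ge>M. dist (S m z) (S n z) < e"
      by (intro exI[of _ M] allI impI) (metis dist_triangle_half_r dist_commute)
  qed
  define f where "f z = (if z \<in> disc then lim (\<lambda>M. S M z) else 0)" for z
  have lim: "(\<lambda>M. S M z) \<longlonglongrightarrow> f z" if "z \<in> disc" for z
    using cauchy[OF that] that by (simp add: f_def Cauchy_convergent_iff convergent_LIMSEQ_iff)
  have fX: "f \<in> X"
  proof (rule N_fatou(1)[OF S _ lim])
    show "\<forall>\<^sub>F M in sequentially. N (S M) \<le> (\<Sum>n. N (F (n + 0)))"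
      using d[of 0] by (intro always_eventually allI) (simp add: S_def)
  qed (auto simp: f_def)
  have "N (f - S M) \<le> (\<Sum>n. N (F (n + M)))" for M
  proof (rule N_fatou(2)[of "\<lambda>j. S (M + j) - S M"])
    show "(\<lambda>j. (S (M + j) - S M) z) \<longlonglongrightarrow> (f - S M) z" if "z \<in> disc" for z
      using LIMSEQ_ignore_initial_segment[OF lim[OF that], of M]
      unfolding fun_diff_def by (intro tendsto_diff tendsto_const) (simp add: add.commute)
    show "(f - S M) z = 0" if "z \<notin> disc" for z
      using outside[OF fX that] outside[OF S that] by (simp add: fun_diff_def)
  qed (use S d in \<open>auto intro: closed\<close>)
  then show ?thesis using fX unfolding S_def by blast
qed

text \<open>Sokal's gliding hump: each summand is added or subtracted so that \<open>T n\<close> of the partial sum is large.\<close>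

lemma uniform_boundedness:
  fixes T :: "nat \<Rightarrow> (complex \<Rightarrow> 'e) \<Rightarrow> complex \<Rightarrow> 'e"
  assumes T: "\<And>n f. f \<in> X \<Longrightarrow> T n f \<in> X" and lin: "\<And>n f g. T n (f - g) = T n f - T n g"
    and sc: "\<And>n c f. T n (c *\<^sub>C f) = c *\<^sub>C T n f"
    and cont: "\<And>n. \<exists>L. \<forall>f\<in>X. N (T n f) \<le> L * N f"
    and unb: "\<And>n. \<exists>f\<in>X. N (T n f) > 4 ^ n * N f"
    and bd: "\<And>f. f \<in> X \<Longrightarrow> \<exists>K. \<forall>n. N (T n f) \<le> K"
  shows False
proof -
  have T0: "T n 0 = 0" for n using sc[of n 0 0] by simp
  \<comment> \<open>\<open>L\<close> is the operator norm of \<open>T n\<close>, a supremum over the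
    unit ball, and \<open>h\<close> is a vector of size at most \<open>(1/3) ^ n\<close> at which it
    is attained up to the factor 3/4.\<close>
  have "\<exists>L h. (\<forall>f\<in>X. N (T n f) \<le> L * N f) \<and> h \<in> X \<and> N h \<le> (1/3) ^ n \<and> N (T n h) \<ge> (3/4) * L * (1/3) ^ n \<and> 4 ^ n \<le> L" for n
  proof -
    define S where "S = (\<lambda>f. N (T n f)) ` {f \<in> X. N f \<le> 1}"
    obtain K where K: "\<And>f. f \<in> X \<Longrightarrow> N (T n f) \<le> K * N f" using cont by metis
    have "x \<le> \<bar>K\<bar>" if x: "x \<in> S" for x
    proof -
      obtain f where f: "f \<in> X" "N f \<le> 1" "x = N (T n f)" using x by (auto simp: S_def)
      have "K * N f \<le> \<bar>K\<bar> * 1" using f by (intro mult_mono) auto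
      then show ?thesis using K[OF f(1)] f(3) by simp
    qed
    then have bdd: "bdd_above S" by (auto simp: bdd_above_def)
    define L where "L = Sup S"
    have norm1: "\<exists>g\<in>X. N g = 1 \<and> N (T n f) = N f * N (T n g)" if f: "f \<in> X" "N f \<noteq> 0" for f
    proof -
      have pos: "0 < N f" using f N_nonneg[OF f(1)] by (metis less_eq_real_def)
      define c where "c = complex_of_real (1 / N f)"
      have "cmod c = 1 / N f" using pos unfolding c_def norm_of_real by simp
      then have "N (c *\<^sub>C f) = 1" "N (T n f) = N f * N (T n (c *\<^sub>C f))"
        using f pos by (simp_all add: N_scaleC sc T)
      then show ?thesis using f by (intro bexI[of _ "c *\<^sub>C f"]) (auto intro: closed)
    qed
    have L: "N (T n f) \<le> L * N f" if f: "f \<in> X" for f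
    proof (cases "N f = 0")
      case True
      then show ?thesis using N_eq_0[OF f True] by (simp add: T0 N_zero)
    next
      case False
      then obtain g where g: "g \<in> X" "N g = 1" "N (T n f) = N f * N (T n g)" using norm1[OF f] by blast
      have "N (T n g) \<le> L" unfolding L_def by (rule cSup_upper[OF _ bdd]) (use g in \<open>auto simp: S_def\<close>)
      then show ?thesis using g(3) mult_left_mono[of "N (T n g)" L "N f"] N_nonneg[OF f] by (simp add: mult.commute)
    qed
    obtain f0 where f0: "f0 \<in> X" "N (T n f0) > 4 ^ n * N f0" using unb by blast
    then have "4 ^ n * N f0 < L * N f0" using L[of f0] by simp
    then have L4: "4 ^ n < L" using N_nonneg[OF f0(1)] by (simp add: mult_less_cancel_right)
    have L0: "0 < L" using L4 zero_less_power[of "4::real" n] by linarith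
    have "\<exists>x\<in>S. 3/4 * L < x"
    proof (rule less_cSupD)
      show "S \<noteq> {}" using zero_closed by (auto simp: S_def N_zero intro!: exI[of _ 0])
      show "3/4 * L < Sup S" using L0 by (simp add: L_def[symmetric])
    qed
    then obtain h0 where h0: "h0 \<in> X" "N h0 \<le> 1" "3/4 * L < N (T n h0)" by (auto simp: S_def)
    define h where "h = complex_of_real ((1/3) ^ n) *\<^sub>C h0"
    have "cmod (complex_of_real ((1/3) ^ n)) = (1/3) ^ n" unfolding norm_of_real by simp
    then have "N h = (1/3) ^ n * N h0" "N (T n h) = (1/3) ^ n * N (T n h0)"
      using h0 by (simp_all only: h_def N_scaleC sc T)
    moreover have "(1/3) ^ n * (3/4 * L) \<le> (1/3) ^ n * N (T n h0)"
      using h0(3) by (intro mult_left_mono) auto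
    ultimately have "h \<in> X" "N h \<le> (1/3) ^ n" "N (T n h) \<ge> (3/4) * L * (1/3) ^ n"
      using h0 by (auto simp: h_def closed mult_left_le mult_ac)
    then show ?thesis using L L4 by (intro exI[of _ L] exI[of _ h]) auto
  qed
  then obtain L h where L: "\<And>n f. f \<in> X \<Longrightarrow> N (T n f) \<le> L n * N f" and h: "\<And>n. h n \<in> X" "\<And>n. N (h n) \<le> (1/3) ^ n"
    "\<And>n. N (T n (h n)) \<ge> (3/4) * L n * (1/3) ^ n" and L4: "\<And>n. 4 ^ n \<le> L n" by metis
  define g where "g = rec_nat (0 :: complex \<Rightarrow> 'e) (\<lambda>n s. if N (T n (s - h n)) \<ge> N (T n (h n)) then s - h n else s + h n)"
  have g0: "g 0 = 0" and gS: "\<And>n. g (Suc n) = (if N (T n (g n - h n)) \<ge> N (T n (h n)) then g n - h n else g n + h n)"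
    by (simp_all add: g_def)
  have gX: "g n \<in> X" for n
  proof (induction n)
    case 0
    show ?case unfolding g0 by (rule zero_closed)
  qed (auto simp: gS intro: closed h)
  have big: "N (T n (g (Suc n))) \<ge> N (T n (h n))" for n
  proof (cases "N (T n (g n - h n)) \<ge> N (T n (h n))")
    case False
    \<comment> \<open>The images of \<open>g n + h n\<close> and \<open>g n - h n\<close> differ by
      twice that of \<open>h n\<close>, so at least one of them is as large as
      \<open>N (T n (h n))\<close>.\<close>
    have "(2 :: complex) *\<^sub>C h n = (g n + h n) - (g n - h n)"
      using scaleC_add_left[of 1 1 "h n"] by simp
    then have "T n (2 *\<^sub>C h n) = T n (g n + h n) - T n (g n - h n)" by (simp only: lin)
    then have "2 * N (T n (h n)) = N (T n (g n + h n) - T n (g n - h n))"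
      using N_scaleC[OF T[OF h(1)[of n], of n], of 2] by (simp add: sc)
    also have "\<dots> \<le> N (T n (g n + h n)) + N (T n (g n - h n))"
      using N_triangle_diff[of "T n (g n + h n)" 0 "T n (g n - h n)"] N_diff_commute[of 0 "T n (g n - h n)"]
      by (simp add: T gX h closed)
    finally show ?thesis using False by (simp add: gS)
  qed (simp add: gS)
  define F where "F n = g (Suc n) - g n" for n
  have FX: "F n \<in> X" for n unfolding F_def by (intro closed gX)
  have Fn: "N (F n) \<le> (1/3) ^ n" for n
    using h(2)[of n] N_diff_commute[OF zero_closed h(1)] by (auto simp: F_def gS)
  have geo: "summable (\<lambda>n. (1/3 :: real) ^ n)" by (intro summable_geometric) simp
  have Fs: "summable (\<lambda>n. N (F n))"
    by (rule summable_comparison_test'[OF geo, of 0]) (use Fn FX in auto)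
  have Sg: "(\<Sum>n<M. F n) = g M" for M unfolding F_def by (induction M) (auto simp: g0)
  obtain f where f: "f \<in> X" "\<And>M. N (f - g M) \<le> (\<Sum>n. N (F (n + M)))"
    using series_converges[OF FX Fs] unfolding Sg by blast
  obtain K where K: "\<And>n. N (T n f) \<le> K" using bd[OF f(1)] by blast
  \<comment> \<open>The terms after step \<open>n\<close> move the sum by at most
    \<open>(1/3) ^ n / 2\<close>. Of the 3/4 secured at step \<open>n\<close> a quarter survives,
    and \<open>4 ^ n \<le> L n\<close> lets it outgrow every \<open>K\<close>.\<close>
  have "(4/3) ^ n / 4 \<le> K" for n
  proof -
    have "N (f - g (Suc n)) \<le> (\<Sum>k. N (F (k + Suc n)))" by (rule f(2))
    also have "\<dots> \<le> (\<Sum>k. (1/3) ^ Suc n * (1/3) ^ k)"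
      using Fn geo by (intro suminf_le summable_ignore_initial_segment[OF Fs] summable_mult)
        (auto simp: power_add[symmetric] add.commute simp del: power_Suc)
    also have "\<dots> = (1/3) ^ Suc n * (3/2)"
      using geo by (subst suminf_mult) (simp_all add: suminf_geometric)
    finally have t: "N (f - g (Suc n)) \<le> (1/3) ^ n / 2" by simp
    have "0 \<le> L n" using L4[of n] zero_le_power[of "4::real" n] by linarith
    then have "N (T n (f - g (Suc n))) \<le> L n * ((1/3) ^ n / 2)"
      using order_trans[OF L[OF diff_closed[OF f(1) gX[of "Suc n"]], of n] mult_left_mono[OF t]] by blast
    moreover have "N (T n (g (Suc n))) \<le> N (T n f) + N (T n (f - g (Suc n)))"
      using N_triangle_minus[OF T[OF f(1), of n] T[OF gX[of "Suc n"], of n]] by (simp only: lin)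
    ultimately have "3/4 * L n * (1/3) ^ n - L n * ((1/3) ^ n / 2) \<le> N (T n f)"
      using big[of n] h(3)[of n] by linarith
    then have "L n * (1/3) ^ n / 4 \<le> K" using K[of n] by simp
    moreover have "4 ^ n * (1/3) ^ n \<le> L n * (1/3 :: real) ^ n" using L4 by (intro mult_right_mono) auto
    moreover have "(4/3 :: real) ^ n = 4 ^ n * (1/3) ^ n" by (simp flip: power_mult_distrib)
    ultimately show ?thesis by linarith
  qed
  moreover have "\<exists>n. 4 * K < (4/3) ^ n" using real_arch_pow[of "4/3" "4 * K"] by simp
  ultimately show False by (metis divide_le_eq_numeral1(1) mult.commute not_less)
qed

end

section \<open>The shift and its Cayley-type transforms\<close>

text \<open>The sign is such that zeros \<open>\<alpha>\<close> close to 1 give values close to 1 at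
  each point of the disc, so that high powers can converge to \<open>phi t\<close>.\<close>

definition blaschke :: "real \<Rightarrow> complex \<Rightarrow> complex" where
  "blaschke \<alpha> z = (of_real \<alpha> - z) / (1 - of_real \<alpha> * z)"

context fatou_space begin

lemma mz_continuation:
  assumes f: "f \<in> X"
  obtains p where "\<And>j. p j \<in> P" "\<And>j. N (f - p j) \<le> 1 / real (Suc j)"
proof -
  have "\<exists>p\<in>P. N (f - p) \<le> 1 / real (Suc j)" for j
  proof -
    obtain p where p: "p \<in> P" "B (f - p) (f - p) < (1 / real (Suc j))\<^sup>2"
      using P_dense[OF f, of "(1 / real (Suc j))\<^sup>2"] by (auto simp del: of_nat_Suc)
    have "sqrt (B (f - p) (f - p)) \<le> sqrt ((1 / real (Suc j))\<^sup>2)"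
      using p(2) by (intro real_sqrt_le_mono) simp
    then show ?thesis using p(1) by (auto simp: N_def simp del: of_nat_Suc)
  qed
  then show thesis using that by metis
qed

lemma C_ge_1: "p \<in> P \<Longrightarrow> N (mz p) \<le> sqrt C * N p"
  unfolding N_def real_sqrt_mult[symmetric] using shift_bound by (intro real_sqrt_le_mono)

text \<open>The shift is bounded on the dense set \<open>P\<close>. For general \<open>f\<close> the
  images of approximants converge pointwise to \<open>mz f\<close>, and the Fatou property places
  this function in \<open>X\<close> with the right bound.\<close>

lemma shift_X:
  assumes f: "f \<in> X"
  shows "mz f \<in> X" "N (mz f) \<le> \<bar>sqrt C\<bar> * N f"
proof -
  obtain p where p: "\<And>j. p j \<in> P" "\<And>j. N (f - p j) \<le> 1 / real (Suc j)"
    using mz_continuation[OF f] by blast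
  have pX: "p j \<in> X" "mz (p j) \<in> X" for j using p P_shift P_subset by auto
  have c0: "(\<lambda>j. 1 / real (Suc j)) \<longlonglongrightarrow> 0" by (rule LIMSEQ_Suc[OF lim_1_over_n])
  have z: "(\<lambda>j. N (p j - f)) \<longlonglongrightarrow> 0"
    using N_diff_commute[OF f pX(1)] p(2) pX f
    by (intro tendsto_sandwich[OF _ _ tendsto_const c0] always_eventually allI) (auto intro!: N_nonneg closed)
  have "N (mz (p j)) \<le> \<bar>sqrt C\<bar> * (N f + 1 / real (Suc j))" for j
  proof -
    have "N (mz (p j)) \<le> \<bar>sqrt C\<bar> * N (p j)"
      using C_ge_1[OF p(1)[of j]] mult_right_mono[OF abs_ge_self, of "N (p j)" "sqrt C"] pX(1)[of j] by force
    also have "\<dots> \<le> \<bar>sqrt C\<bar> * (N f + 1 / real (Suc j))"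
      using N_triangle_minus[OF pX(1) f, of j] p(2)[of j] N_diff_commute[OF f pX(1), of j]
      by (intro mult_left_mono) (auto simp del: of_nat_Suc)
    finally show ?thesis .
  qed
  moreover have "(\<lambda>j. \<bar>sqrt C\<bar> * (N f + 1 / real (Suc j))) \<longlonglongrightarrow> \<bar>sqrt C\<bar> * (N f + 0)"
    by (intro tendsto_intros c0)
  moreover have "(\<lambda>j. mz (p j) w) \<longlonglongrightarrow> mz f w" if "w \<in> disc" for w
    unfolding mult_op_def by (intro scaleC.tendsto tendsto_const N_conv_pointwise[OF pX(1) f z that])
  moreover have "mz f w = 0" if "w \<notin> disc" for w using outside[OF f that] by (simp add: mult_op_def)
  ultimately show "mz f \<in> X" "N (mz f) \<le> \<bar>sqrt C\<bar> * N f"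
    using N_fatou_tendsto[where F = "\<lambda>j. mz (p j)" and K = "\<bar>sqrt C\<bar> * (N f + 0)"
        and c = "\<lambda>j. \<bar>sqrt C\<bar> * (N f + 1 / real (Suc j))" and f = "mz f"] pX(2)
    by auto
qed

text \<open>One sequence serves \<open>f\<close> and its first two shifts at once, as the three-term
  identity \<open>shift_two\<close> requires.\<close>

lemma shift_approx:
  assumes f: "f \<in> X"
  obtains p where "\<And>j. p j \<in> P" "(\<lambda>j. N (p j - f)) \<longlonglongrightarrow> 0" "(\<lambda>j. N (mz (p j) - mz f)) \<longlonglongrightarrow> 0"
    "(\<lambda>j. N (mz (mz (p j)) - mz (mz f))) \<longlonglongrightarrow> 0"
proof -
  obtain p where p: "\<And>j. p j \<in> P" "\<And>j. N (f - p j) \<le> 1 / real (Suc j)"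
    using mz_continuation[OF f] by blast
  have pX: "p j \<in> X" for j using p P_subset by auto
  have c0: "(\<lambda>j. 1 / real (Suc j)) \<longlonglongrightarrow> 0" by (rule LIMSEQ_Suc[OF lim_1_over_n])
  have z: "(\<lambda>j. N (p j - f)) \<longlonglongrightarrow> 0"
    using N_diff_commute[OF f pX(1)] p(2) pX f
    by (intro tendsto_sandwich[OF _ _ tendsto_const c0] always_eventually allI) (auto intro!: N_nonneg closed)
  have step: "(\<lambda>j. N (mz (h j) - mz h')) \<longlonglongrightarrow> 0"
    if "\<And>j. h j \<in> X" "h' \<in> X" "(\<lambda>j. N (h j - h')) \<longlonglongrightarrow> 0" for h h'
  proof (rule tendsto_sandwich[OF _ _ tendsto_const])
    show "(\<lambda>j. \<bar>sqrt C\<bar> * N (h j - h')) \<longlonglongrightarrow> 0" using tendsto_mult_right_zero[OF that(3)] .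
    show "\<forall>\<^sub>F j in sequentially. N (mz (h j) - mz h') \<le> \<bar>sqrt C\<bar> * N (h j - h')"
      unfolding mult_op_diff[symmetric] using that by (intro always_eventually allI shift_X closed)
    show "\<forall>\<^sub>F j in sequentially. 0 \<le> N (mz (h j) - mz h')"
      using that by (intro always_eventually allI N_nonneg closed shift_X)
  qed
  show thesis
    by (rule that[of p]) (auto intro!: p z step pX f shift_X)
qed

text \<open>In the Dirichlet space and for a polynomial \<open>p\<close>, \<open>q p p\<close> is $\frac{1}{2\pi}\int\langle d\mu\,p,p\rangle$.\<close>

definition q :: "(complex \<Rightarrow> 'e) \<Rightarrow> (complex \<Rightarrow> 'e) \<Rightarrow> real" where
  "q f g = B (mz f) (mz g) - B f g"

lemma B_tendsto_diag:
  assumes "\<And>j. F j \<in> X" "f \<in> X" "(\<lambda>j. N (F j - f)) \<longlonglongrightarrow> 0"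
  shows "(\<lambda>j. B (F j) (F j)) \<longlonglongrightarrow> B f f"
proof -
  have "(\<lambda>j. (N (F j))\<^sup>2) \<longlonglongrightarrow> (N f)\<^sup>2"
    by (intro tendsto_power N_tendsto[OF _ assms(2,3)] always_eventually allI assms(1))
  then show ?thesis using assms by (simp add: N_sq)
qed

text \<open>Both facts are the axioms for \<open>P\<close> carried over by density; the second is
  the 2-isometry identity rewritten in terms of \<open>q\<close>.\<close>

lemma q_diag:
  assumes f: "f \<in> X"
  shows "0 \<le> q f f" "q (mz f) (mz f) = q f f"
proof -
  obtain p where p: "\<And>j. p j \<in> P" and l: "(\<lambda>j. N (p j - f)) \<longlonglongrightarrow> 0" "(\<lambda>j. N (mz (p j) - mz f)) \<longlonglongrightarrow> 0"
    "(\<lambda>j. N (mz (mz (p j)) - mz (mz f))) \<longlonglongrightarrow> 0"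
    using shift_approx[OF f] by blast
  have pX: "p j \<in> X" "mz (p j) \<in> X" "mz (mz (p j)) \<in> X" for j using p P_subset P_shift by auto
  note lim = B_tendsto_diag[OF pX(1) f l(1)] B_tendsto_diag[OF pX(2) shift_X(1)[OF f] l(2)]
    B_tendsto_diag[OF pX(3) shift_X(1)[OF shift_X(1)[OF f]] l(3)]
  have "B f f \<le> B (mz f) (mz f)"
    by (rule LIMSEQ_le[OF lim(1,2)]) (use shift_ge[OF p] in blast)
  then show "0 \<le> q f f" by (simp add: q_def)
  have "(\<lambda>j. B (mz (mz (p j))) (mz (mz (p j))) - 2 * B (mz (p j)) (mz (p j)) + B (p j) (p j))
     \<longlonglongrightarrow> B (mz (mz f)) (mz (mz f)) - 2 * B (mz f) (mz f) + B f f"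
    by (intro tendsto_intros lim)
  then have "(\<lambda>j :: nat. 0) \<longlonglongrightarrow> B (mz (mz f)) (mz (mz f)) - 2 * B (mz f) (mz f) + B f f"
    by (simp only: shift_two[OF p])
  then have "B (mz (mz f)) (mz (mz f)) - 2 * B (mz f) (mz f) + B f f = 0"
    by (rule LIMSEQ_unique[OF _ tendsto_const])
  then show "q (mz f) (mz f) = q f f" by (simp add: q_def)
qed

lemma q_sym: "q f g = q g f" by (simp add: q_def B_sym)

lemma q_lin:
  assumes "f \<in> X" "f' \<in> X" "g \<in> X"
  shows "q (f + f') g = q f g + q f' g" "q g (f + f') = q g f + q g f'"
    "q (f - f') g = q f g - q f' g" "q g (f - f') = q g f - q g f'"
    "q (complex_of_real r *\<^sub>C f) g = r * q f g" "q g (complex_of_real r *\<^sub>C f) = r * q g f"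
  using assms shift_X(1) by (simp_all add: q_def mult_op_add mult_op_diff mult_op_scaleC B_lin algebra_simps)

lemma q_abs_bound:
  assumes "f \<in> X" "g \<in> X"
  shows "\<bar>q f g\<bar> \<le> (\<bar>C\<bar> + 1) * N f * N g"
proof -
  have s: "\<bar>sqrt C\<bar> * \<bar>sqrt C\<bar> = \<bar>C\<bar>" by (simp add: abs_mult[symmetric] real_sqrt_mult[symmetric])
  have "\<bar>B (mz f) (mz g)\<bar> \<le> N (mz f) * N (mz g)" by (intro cauchy_schwarz shift_X assms)
  also have "\<dots> \<le> (\<bar>sqrt C\<bar> * N f) * (\<bar>sqrt C\<bar> * N g)"
    using assms by (intro mult_mono shift_X N_nonneg) auto
  also have "\<dots> = \<bar>C\<bar> * N f * N g" unfolding s[symmetric] by (simp add: mult_ac)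
  finally have "\<bar>B (mz f) (mz g)\<bar> \<le> \<bar>C\<bar> * N f * N g" .
  then show ?thesis using cauchy_schwarz[OF assms] unfolding q_def by (simp add: algebra_simps)
qed

definition mzp :: "nat \<Rightarrow> (complex \<Rightarrow> 'e) \<Rightarrow> complex \<Rightarrow> 'e" where
  "mzp m = mult_op (\<lambda>z. z ^ m)"

lemma mzp_Suc: "mzp (Suc m) f = mz (mzp m f)"
  by (simp add: mzp_def mult_op_mult_op)

lemma mzp_0: "mzp 0 f = f" by (simp add: mzp_def mult_op_def)

text \<open>Since \<open>q\<close> is invariant under the shift, every further power adds the same
  \<open>q f f\<close> to the squared norm. Growth of the powers is therefore at most linear, which
  is what the Neumann series needs.\<close>

lemma mzp_X:
  assumes f: "f \<in> X"
  shows "mzp m f \<in> X" "N (mzp m f) \<le> (1 + real m * (\<bar>C\<bar> + 1)) * N f"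
proof -
  have *: "mzp m f \<in> X \<and> q (mzp m f) (mzp m f) = q f f \<and> B (mzp m f) (mzp m f) = B f f + real m * q f f" for m
  proof (induction m)
    case (Suc m)
    then show ?case using q_diag(2)[of "mzp m f"] shift_X(1)[of "mzp m f"]
      by (auto simp: mzp_Suc q_def algebra_simps)
  qed (simp add: mzp_0 f)
  then show "mzp m f \<in> X" by blast
  let ?K = "real m * (\<bar>C\<bar> + 1)"
  have "q f f \<le> (\<bar>C\<bar> + 1) * (N f)\<^sup>2" using q_abs_bound[OF f f] by (simp add: power2_eq_square)
  then have "real m * q f f \<le> real m * ((\<bar>C\<bar> + 1) * (N f)\<^sup>2)" by (intro mult_left_mono) auto
  then have "(N (mzp m f))\<^sup>2 \<le> (1 + ?K) * (N f)\<^sup>2"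
    using * f by (simp add: N_sq algebra_simps)
  also have "\<dots> \<le> (1 + ?K)\<^sup>2 * (N f)\<^sup>2"
    by (intro mult_right_mono) (auto simp: power2_eq_square algebra_simps)
  finally have "(N (mzp m f))\<^sup>2 \<le> ((1 + ?K) * N f)\<^sup>2" by (simp add: power_mult_distrib)
  then show "N (mzp m f) \<le> (1 + ?K) * N f"
    by (rule power2_le_imp_le) (use f in simp)
qed

definition res :: "real \<Rightarrow> (complex \<Rightarrow> 'e) \<Rightarrow> complex \<Rightarrow> 'e" where
  "res \<alpha> = mult_op (\<lambda>z. 1 / (1 - of_real \<alpha> * z))"

definition res_sum :: "real \<Rightarrow> nat \<Rightarrow> (complex \<Rightarrow> 'e) \<Rightarrow> complex \<Rightarrow> 'e" where
  "res_sum \<alpha> M f = (\<Sum>m<M. complex_of_real (\<alpha> ^ m) *\<^sub>C mzp m f)"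

lemma sum_fun_apply: "(\<Sum>i\<in>I. F i) z = (\<Sum>i\<in>I. F i z :: 'a::comm_monoid_add)"
  by (induction I rule: infinite_finite_induct) auto

text \<open>Linear growth of the powers is beaten by \<open>\<bar>\<alpha>\<bar> ^ m\<close>, so the
  Neumann series converges in norm; evaluation at points identifies its sum with division by
  \<open>1 - \<alpha> z\<close>.\<close>

lemma res_X:
  assumes f: "f \<in> X" and \<alpha>: "\<bar>\<alpha>\<bar> < 1"
  shows "res \<alpha> f \<in> X" "(\<lambda>M. N (res_sum \<alpha> M f - res \<alpha> f)) \<longlonglongrightarrow> 0"
proof -
  define F where "F m = complex_of_real (\<alpha> ^ m) *\<^sub>C mzp m f" for m
  have FX: "F m \<in> X" for m unfolding F_def by (intro closed mzp_X f)
  have Fn: "N (F m) \<le> ((\<bar>C\<bar> + 1) * N f) * (real (Suc m) * \<bar>\<alpha>\<bar> ^ m)" for m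
  proof -
    have "1 + real m * (\<bar>C\<bar> + 1) \<le> real (Suc m) * (\<bar>C\<bar> + 1)" by (simp add: algebra_simps)
    then have "N (mzp m f) \<le> real (Suc m) * (\<bar>C\<bar> + 1) * N f"
      using mzp_X(2)[OF f, of m] mult_right_mono[OF _ N_nonneg[OF f]] order_trans by blast
    then have "\<bar>\<alpha>\<bar> ^ m * N (mzp m f) \<le> \<bar>\<alpha>\<bar> ^ m * (real (Suc m) * (\<bar>C\<bar> + 1) * N f)"
      by (intro mult_left_mono) auto
    moreover have "N (F m) = \<bar>\<alpha>\<bar> ^ m * N (mzp m f)"
      unfolding F_def N_scaleC[OF mzp_X(1)[OF f]] norm_of_real by (simp add: power_abs)
    ultimately show ?thesis by (simp only: mult_ac)
  qed
  have s: "summable (\<lambda>m. N (F m))"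
    by (rule summable_comparison_test'[of "\<lambda>m. ((\<bar>C\<bar> + 1) * N f) * (real (Suc m) * \<bar>\<alpha>\<bar> ^ m)" 0])
      (use Fn FX \<alpha> in \<open>auto intro!: summable_mult summable_Suc_power simp del: of_nat_Suc\<close>)
  obtain h where h: "h \<in> X" "\<And>M. N (h - (\<Sum>m<M. F m)) \<le> (\<Sum>n. N (F (n + M)))"
    using series_converges[OF FX s] by blast
  have SX: "res_sum \<alpha> M f \<in> X" for M unfolding res_sum_def F_def[symmetric] by (intro closed FX)
  have conv: "(\<lambda>M. N (res_sum \<alpha> M f - h)) \<longlonglongrightarrow> 0"
  proof (rule tendsto_sandwich[OF _ _ tendsto_const suminf_exist_split2[OF s]])
    show "\<forall>\<^sub>F M in sequentially. N (res_sum \<alpha> M f - h) \<le> (\<Sum>n. N (F (n + M)))"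
      using h(2) N_diff_commute[OF h(1) SX] by (simp add: res_sum_def F_def)
    show "\<forall>\<^sub>F M in sequentially. 0 \<le> N (res_sum \<alpha> M f - h)"
      using SX h(1) by (intro always_eventually allI N_nonneg closed)
  qed
  have "h = res \<alpha> f"
  proof
    fix z
    show "h z = res \<alpha> f z"
    proof (cases "z \<in> disc")
      case True
      have "cmod (of_real \<alpha> * z) < 1"
        using True \<alpha> mult_right_mono[of "\<bar>\<alpha>\<bar>" 1 "cmod z"] by (simp add: norm_mult)
      then have "(\<lambda>M. (\<Sum>m<M. (of_real \<alpha> * z) ^ m)) \<longlonglongrightarrow> 1 / (1 - of_real \<alpha> * z)"
        using geometric_sums by (simp add: sums_def)
      then have "(\<lambda>M. (\<Sum>m<M. (of_real \<alpha> * z) ^ m) *\<^sub>C f z) \<longlonglongrightarrow> (1 / (1 - of_real \<alpha> * z)) *\<^sub>C f z"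
        by (intro scaleC.tendsto tendsto_const)
      moreover have "(\<Sum>m<M. (of_real \<alpha> * z) ^ m) *\<^sub>C f z = res_sum \<alpha> M f z" for M
        unfolding res_sum_def sum_fun_apply scaleC.sum_left
        by (simp add: mzp_def mult_op_def scaleC_fun_def scaleC_scaleC power_mult_distrib)
      ultimately have "(\<lambda>M. res_sum \<alpha> M f z) \<longlonglongrightarrow> res \<alpha> f z" by (simp add: res_def mult_op_def)
      then show ?thesis using N_conv_pointwise[OF SX h(1) conv True] LIMSEQ_unique by blast
    qed (use outside[OF h(1)] outside[OF f] in \<open>simp add: res_def mult_op_def\<close>)
  qed
  then show "res \<alpha> f \<in> X" "(\<lambda>M. N (res_sum \<alpha> M f - res \<alpha> f)) \<longlonglongrightarrow> 0" using h(1) conv by auto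
qed

lemma one_minus_ne_zero:
  assumes "\<bar>\<alpha>\<bar> \<le> 1" "z \<in> disc"
  shows "1 - complex_of_real \<alpha> * z \<noteq> 0"
proof
  assume "1 - complex_of_real \<alpha> * z = 0"
  then have "cmod (complex_of_real \<alpha> * z) = 1" by simp
  then have "\<bar>\<alpha>\<bar> * cmod z = 1" by (simp add: norm_mult)
  moreover have "\<bar>\<alpha>\<bar> * cmod z \<le> 1 * cmod z" using assms by (intro mult_right_mono) auto
  ultimately show False using assms by simp
qed

lemma res_inverse:
  assumes f: "f \<in> X" and \<alpha>: "\<bar>\<alpha>\<bar> < 1"
  shows "res \<alpha> f - complex_of_real \<alpha> *\<^sub>C mz (res \<alpha> f) = f"
    "mult_op (blaschke \<alpha>) f = complex_of_real \<alpha> *\<^sub>C res \<alpha> f - mz (res \<alpha> f)"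
proof -
  have nz: "1 - complex_of_real \<alpha> * z \<noteq> 0" if "z \<in> disc" for z using one_minus_ne_zero[of \<alpha> z] that \<alpha> by simp
  show "res \<alpha> f - complex_of_real \<alpha> *\<^sub>C mz (res \<alpha> f) = f"
  proof
    fix z
    show "(res \<alpha> f - complex_of_real \<alpha> *\<^sub>C mz (res \<alpha> f)) z = f z"
    proof (cases "z \<in> disc")
      case True
      have "1 / (1 - complex_of_real \<alpha> * z) - complex_of_real \<alpha> * z / (1 - complex_of_real \<alpha> * z) = 1"
        using nz[OF True] by (simp add: diff_divide_distrib[symmetric])
      moreover have "(res \<alpha> f - complex_of_real \<alpha> *\<^sub>C mz (res \<alpha> f)) z
          = (1 / (1 - complex_of_real \<alpha> * z) - complex_of_real \<alpha> * z / (1 - complex_of_real \<alpha> * z)) *\<^sub>C f z"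
        by (simp add: res_def mult_op_def fun_diff_def scaleC_fun_def scaleC_scaleC scaleC_diff_left)
      ultimately show ?thesis by simp
    qed (simp add: res_def mult_op_def fun_diff_def scaleC_fun_def outside[OF f])
  qed
  show "mult_op (blaschke \<alpha>) f = complex_of_real \<alpha> *\<^sub>C res \<alpha> f - mz (res \<alpha> f)"
    by (rule ext) (simp add: res_def mult_op_def fun_diff_def scaleC_fun_def scaleC_scaleC blaschke_def
        diff_divide_distrib scaleC_diff_left)
qed

text \<open>For \<open>h = res \<alpha> f\<close> one has \<open>f\<close> equal to h - \<alpha> zh
  and its Blaschke image equal to \<alpha> h - zh. The cross terms of the two squared norms
  coincide, and what remains of the difference is \<open>1 - \<alpha>\<^sup>2\<close> times
  \<open>q h h\<close>. The same expansion of \<open>q\<close> shows its invariance, as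
  \<open>q\<close> takes equal values at \<open>h\<close> and \<open>mz h\<close>.\<close>

lemma blaschke_step:
  assumes f: "f \<in> X" and \<alpha>: "\<bar>\<alpha>\<bar> < 1"
  shows "mult_op (blaschke \<alpha>) f \<in> X"
    "B (mult_op (blaschke \<alpha>) f) (mult_op (blaschke \<alpha>) f) = B f f + (1 - \<alpha>\<^sup>2) * q (res \<alpha> f) (res \<alpha> f)"
    "q (mult_op (blaschke \<alpha>) f) (mult_op (blaschke \<alpha>) f) = q f f"
proof -
  define h where "h = res \<alpha> f"
  have h: "h \<in> X" "mz h \<in> X" unfolding h_def using res_X(1)[OF f \<alpha>] shift_X(1) by auto
  note e = res_inverse[OF f \<alpha>, folded h_def]
  show "mult_op (blaschke \<alpha>) f \<in> X" unfolding e(2) using h by (intro closed)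
  have "B f f = B h h - 2 * \<alpha> * B h (mz h) + \<alpha>\<^sup>2 * B (mz h) (mz h)"
    by (subst (1 2) e(1)[symmetric]) (use h B_sym[of "mz h" h] in \<open>simp add: closed B_lin power2_eq_square algebra_simps\<close>)
  moreover have "B (mult_op (blaschke \<alpha>) f) (mult_op (blaschke \<alpha>) f) = \<alpha>\<^sup>2 * B h h - 2 * \<alpha> * B h (mz h) + B (mz h) (mz h)"
    unfolding e(2) using h B_sym[of "mz h" h] by (simp add: closed B_lin power2_eq_square algebra_simps)
  ultimately show "B (mult_op (blaschke \<alpha>) f) (mult_op (blaschke \<alpha>) f) = B f f + (1 - \<alpha>\<^sup>2) * q (res \<alpha> f) (res \<alpha> f)"
    unfolding q_def h_def[symmetric] by (simp add: algebra_simps)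
  have "q f f = q h h - 2 * \<alpha> * q h (mz h) + \<alpha>\<^sup>2 * q (mz h) (mz h)"
    by (subst (1 2) e(1)[symmetric]) (use h q_sym[of "mz h" h] in \<open>simp add: closed q_lin power2_eq_square algebra_simps\<close>)
  moreover have "q (mult_op (blaschke \<alpha>) f) (mult_op (blaschke \<alpha>) f) = \<alpha>\<^sup>2 * q h h - 2 * \<alpha> * q h (mz h) + q (mz h) (mz h)"
    unfolding e(2) using h q_sym[of "mz h" h] by (simp add: closed q_lin power2_eq_square algebra_simps)
  ultimately show "q (mult_op (blaschke \<alpha>) f) (mult_op (blaschke \<alpha>) f) = q f f"
    using q_diag(2)[OF h(1)] by (simp add: algebra_simps)
qed

text \<open>\<open>res \<alpha>\<close> commutes with the Blaschke factor, which preserves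
  \<open>q\<close>; so every factor contributes the same increment and the squared norm grows
  exactly linearly in \<open>n\<close>.\<close>

lemma blaschke_power:
  assumes f: "f \<in> X" and \<alpha>: "\<bar>\<alpha>\<bar> < 1"
  shows "mult_op (\<lambda>z. blaschke \<alpha> z ^ n) f \<in> X \<and>
    B (mult_op (\<lambda>z. blaschke \<alpha> z ^ n) f) (mult_op (\<lambda>z. blaschke \<alpha> z ^ n) f)
      = B f f + real n * ((1 - \<alpha>\<^sup>2) * q (res \<alpha> f) (res \<alpha> f)) \<and>
    q (res \<alpha> (mult_op (\<lambda>z. blaschke \<alpha> z ^ n) f)) (res \<alpha> (mult_op (\<lambda>z. blaschke \<alpha> z ^ n) f)) = q (res \<alpha> f) (res \<alpha> f)"
proof (induction n)
  case 0
  have "mult_op (\<lambda>z. blaschke \<alpha> z ^ 0) f = f" by (simp add: mult_op_def)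
  then show ?case using f by simp
next
  case (Suc n)
  define g where "g = mult_op (\<lambda>z. blaschke \<alpha> z ^ n) f"
  have g: "g \<in> X" using Suc by (simp add: g_def)
  have S: "mult_op (\<lambda>z. blaschke \<alpha> z ^ Suc n) f = mult_op (blaschke \<alpha>) g"
    by (simp add: g_def mult_op_mult_op)
  have "res \<alpha> (mult_op (blaschke \<alpha>) g) = mult_op (blaschke \<alpha>) (res \<alpha> g)"
    by (simp add: res_def mult_op_mult_op mult.commute)
  then show ?case
    unfolding S using Suc blaschke_step[OF g \<alpha>] blaschke_step(3)[OF res_X(1)[OF g \<alpha>] \<alpha>]
    by (simp add: g_def[symmetric] algebra_simps)
qed

text \<open>Condition (ii) on the whole space. The predicates for the three constants will all be
  identified with this one.\<close>

definition dominated :: "real \<Rightarrow> bool" where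
  "dominated w \<longleftrightarrow> 0 \<le> w \<and> (\<forall>g\<in>X. q g g \<le> w * B (g - mz g) (g - mz g))"

text \<open>For \<open>h = res \<alpha> f\<close> the choice of \<open>\<alpha>\<close> gives (1 +
  c) f = (h - zh) + c (h + zh). The cross term of the squared norm is
  \<open>- 2 * c * q h h\<close>; dropping the last square and absorbing the cross term by
  domination bounds h - zh, hence \<open>q h h\<close>, in terms of \<open>f\<close>.\<close>

lemma res_dominated:
  assumes w: "dominated w" and f: "f \<in> X" and c: "0 < c" "c < 1" "2 * c * w < 1" and \<alpha>: "\<alpha> = (1 - c) / (1 + c)"
  shows "q (res \<alpha> f) (res \<alpha> f) \<le> w * (1 + c)\<^sup>2 / (1 - 2 * c * w) * B f f"
proof -
  have \<alpha>1: "\<bar>\<alpha>\<bar> < 1" using c by (simp add: \<alpha> field_simps)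
  define h where "h = res \<alpha> f"
  have h: "h \<in> X" "mz h \<in> X" unfolding h_def using res_X(1)[OF f \<alpha>1] shift_X(1) by auto
  note e = res_inverse(1)[OF f \<alpha>1, folded h_def]
  have "B f f = B h h - 2 * \<alpha> * B h (mz h) + \<alpha>\<^sup>2 * B (mz h) (mz h)"
    by (subst (1 2) e[symmetric]) (use h B_sym[of "mz h" h] in \<open>simp add: closed B_lin power2_eq_square algebra_simps\<close>)
  then have "(1 + c)\<^sup>2 * B f f = (1 + c)\<^sup>2 * (B h h - 2 * \<alpha> * B h (mz h) + \<alpha>\<^sup>2 * B (mz h) (mz h))"
    by simp
  then have "(1 + c)\<^sup>2 * B f f = (1 + c)\<^sup>2 * B h h - 2 * ((1 + c) * ((1 + c) * \<alpha>)) * B h (mz h) + ((1 + c) * \<alpha>)\<^sup>2 * B (mz h) (mz h)"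
    by (simp add: power2_eq_square algebra_simps)
  moreover have "(1 + c) * \<alpha> = 1 - c" using c by (simp add: \<alpha>)
  ultimately have 1: "(1 + c)\<^sup>2 * B f f = (1 + c)\<^sup>2 * B h h - 2 * ((1 + c) * (1 - c)) * B h (mz h) + (1 - c)\<^sup>2 * B (mz h) (mz h)"
    by simp
  have u: "B (h - mz h) (h - mz h) = B h h - 2 * B h (mz h) + B (mz h) (mz h)"
    and v: "B (h + mz h) (h + mz h) = B h h + 2 * B h (mz h) + B (mz h) (mz h)"
    using h B_sym[of "mz h" h] by (simp_all add: closed B_lin algebra_simps)
  have v0: "0 \<le> c\<^sup>2 * B (h + mz h) (h + mz h)" using h by (intro mult_nonneg_nonneg B_nonneg closed) auto
  have id: "(1 + c)\<^sup>2 * B f f = B (h - mz h) (h - mz h) - 2 * c * q h h + c\<^sup>2 * B (h + mz h) (h + mz h)"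
    unfolding 1 u v q_def by (simp add: power2_eq_square algebra_simps)
  define U where "U = B (h - mz h) (h - mz h)"
  have U: "0 \<le> U" unfolding U_def using h by (intro B_nonneg closed)
  have qU: "q h h \<le> w * U" using w h by (simp add: dominated_def U_def)
  have w0: "0 \<le> w" using w by (simp add: dominated_def)
  have "2 * c * q h h \<le> 2 * c * (w * U)" using qU c by (intro mult_left_mono) auto
  then have "(1 - 2 * c * w) * U \<le> (1 + c)\<^sup>2 * B f f"
    using id v0 by (simp add: U_def[symmetric] algebra_simps)
  then have "U \<le> (1 + c)\<^sup>2 * B f f / (1 - 2 * c * w)" using c by (simp add: field_simps)
  then have "w * U \<le> w * ((1 + c)\<^sup>2 * B f f / (1 - 2 * c * w))" using w0 by (rule mult_left_mono)
  then show ?thesis using qU by (simp add: h_def)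
qed

end

section \<open>The semigroup of singular inner functions\<close>

text \<open>The Cayley map of the disc onto the left half plane; multiplication by it is the
  generator of the semigroup.\<close>

definition cay :: "complex \<Rightarrow> complex" where "cay z = (z + 1) / (z - 1)"

lemma phi_cay: "phi t z = exp (of_real t * cay z)"
  by (simp add: phi_def cay_def)

lemma phi_add: "phi (s + t) z = phi s z * phi t z"
  by (simp add: phi_cay distrib_right exp_add)

lemma phi_0: "phi 0 z = 1" by (simp add: phi_def)

lemma disc_ne: "z \<in> disc \<Longrightarrow> z \<noteq> 1" "z \<in> disc \<Longrightarrow> z \<noteq> -1"
  by auto

lemma cay_ne_0: "z \<in> disc \<Longrightarrow> cay z \<noteq> 0"
  using disc_ne[of z] by (auto simp: cay_def eq_neg_iff_add_eq_0)

lemma Re_cay: "z \<in> disc \<Longrightarrow> Re (cay z) \<le> 0"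
proof -
  assume "z \<in> disc"
  then have "(cmod z)\<^sup>2 \<le> 1" by (simp add: abs_square_le_1)
  then have "Re ((z + 1) * cnj (z - 1)) \<le> 0"
    unfolding cmod_power2 by (simp add: algebra_simps power2_eq_square)
  then show ?thesis unfolding cay_def by (simp only: Re_complex_div_le_0)
qed

lemma norm_cayley_le: "Re u \<le> 0 \<Longrightarrow> cmod ((1 + u) / (1 - u)) \<le> 1"
proof -
  assume u: "Re u \<le> 0"
  then have "u \<noteq> 1" by auto
  have "(cmod (1 + u))\<^sup>2 \<le> (cmod (1 - u))\<^sup>2"
    unfolding cmod_power2 using u by (simp add: power2_eq_square algebra_simps)
  then have "cmod (1 + u) \<le> cmod (1 - u)" by (rule power2_le_imp_le) simp
  then show ?thesis using \<open>u \<noteq> 1\<close> by (simp add: norm_divide)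
qed

lemma blaschke_cayley:
  assumes c: "0 < c" and z: "z \<in> disc"
  shows "blaschke ((1 - c) / (1 + c)) z = (1 + of_real c * cay z) / (1 - of_real c * cay z)"
proof -
  have z1: "z - 1 \<noteq> 0" using disc_ne(1)[OF z] by simp
  have c1: "complex_of_real (1 + c) \<noteq> 0" using c by (metis add_pos_pos of_real_eq_0_iff less_irrefl zero_less_one)
  have e: "of_real (1 + c) * of_real ((1 - c) / (1 + c)) = complex_of_real (1 - c)"
    using c by (simp only: of_real_mult[symmetric]) simp
  have "blaschke ((1 - c) / (1 + c)) z = (of_real (1 + c) * (of_real ((1 - c) / (1 + c)) - z)) / (of_real (1 + c) * (1 - of_real ((1 - c) / (1 + c)) * z))"
    unfolding blaschke_def using c1 by simp
  also have "of_real (1 + c) * (of_real ((1 - c) / (1 + c)) - z) = of_real (1 - c) - of_real (1 + c) * z"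
    by (simp only: right_diff_distrib mult.assoc[symmetric] mult_1_right e)
  also have "of_real (1 + c) * (1 - of_real ((1 - c) / (1 + c)) * z) = of_real (1 + c) - of_real (1 - c) * z"
    by (simp only: right_diff_distrib mult.assoc[symmetric] mult_1_right e)
  also have "of_real (1 - c) - of_real (1 + c) * z = - (z - 1) * (1 + of_real c * cay z)"
    using z1 by (simp add: cay_def field_simps)
  also have "of_real (1 + c) - of_real (1 - c) * z = - (z - 1) * (1 - of_real c * cay z)"
    using z1 by (simp add: cay_def field_simps)
  also have "- (z - 1) * (1 + of_real c * cay z) / (- (z - 1) * (1 - of_real c * cay z))
      = (1 + of_real c * cay z) / (1 - of_real c * cay z)"
    by (rule nonzero_mult_divide_mult_cancel_left) (use z1 in simp)
  finally show ?thesis .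
qed

lemma filterlim_scaled_at_0: "x \<noteq> 0 \<Longrightarrow> filterlim (\<lambda>n. x / of_nat n) (at (0 :: complex)) sequentially"
  by (intro filterlim_atI tendsto_divide_0[OF tendsto_const] tendsto_of_nat)
    (auto simp: eventually_sequentially intro!: exI[of _ 1])

text \<open>For numbers of modulus at most 1 the n-th powers differ by at most \<open>n\<close>
  times the difference. The Cayley quotient at \<open>u = x / n\<close> agrees with
  \<open>exp u\<close> to first order, so this product tends to 0.\<close>

lemma blaschke_power_tendsto:
  assumes t: "0 < t" and z: "z \<in> disc"
  shows "(\<lambda>n. blaschke ((1 - t / (2 * real n)) / (1 + t / (2 * real n))) z ^ n) \<longlonglongrightarrow> phi t z"
proof -
  define x where "x = of_real t * cay z"
  have x: "x \<noteq> 0" "Re x \<le> 0" using t cay_ne_0[OF z] Re_cay[OF z] by (auto simp: x_def mult_nonneg_nonpos)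
  define g where "g u = (1 + u / 2) / (1 - u / 2) - exp u" for u :: complex
  have "(g has_field_derivative 0) (at 0)"
    unfolding g_def[abs_def] by (auto intro!: derivative_eq_intros)
  then have "((\<lambda>u. g u / u) \<longlongrightarrow> 0) (at 0)"
    by (simp add: has_field_derivative_iff g_def)
  then have "(\<lambda>n. g (x / of_nat n) / (x / of_nat n)) \<longlonglongrightarrow> 0"
    by (rule filterlim_compose[OF _ filterlim_scaled_at_0[OF x(1)]])
  then have lim: "(\<lambda>n. cmod x * cmod (g (x / of_nat n) / (x / of_nat n))) \<longlonglongrightarrow> 0"
    by (rule tendsto_mult_right_zero[OF tendsto_norm_zero])
  have "(\<lambda>n. blaschke ((1 - t / (2 * real n)) / (1 + t / (2 * real n))) z ^ n - phi t z) \<longlonglongrightarrow> 0"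
  proof (rule Lim_null_comparison[OF _ lim], rule eventually_sequentiallyI[of 1])
    fix n :: nat assume n: "1 \<le> n"
    define c where "c = t / (2 * real n)"
    have c: "0 < c" using t n by (simp add: c_def)
    have cx: "of_real c * cay z = x / of_nat n / 2" using n by (simp add: c_def x_def)
    have b: "blaschke ((1 - c) / (1 + c)) z = (1 + x / of_nat n / 2) / (1 - x / of_nat n / 2)"
      unfolding blaschke_cayley[OF c z] cx ..
    have "Re (x / of_nat n) \<le> 0" using x n by (simp add: Re_divide_of_nat divide_nonpos_nonneg)
    then have 1: "cmod (blaschke ((1 - c) / (1 + c)) z) \<le> 1" "cmod (exp (x / of_nat n)) \<le> 1"
      unfolding b by (auto intro!: norm_cayley_le simp: norm_exp_eq_Re)
    have "phi t z = exp (x / of_nat n) ^ n"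
      using n by (simp add: phi_cay x_def exp_of_nat_mult[symmetric])
    then have "cmod (blaschke ((1 - c) / (1 + c)) z ^ n - phi t z) \<le> real n * cmod (blaschke ((1 - c) / (1 + c)) z - exp (x / of_nat n))"
      using norm_power_diff[OF 1] by simp
    also have "\<dots> = real n * cmod (g (x / of_nat n))" unfolding b g_def ..
    also have "\<dots> = cmod x * cmod (g (x / of_nat n) / (x / of_nat n))"
      using x n by (simp add: norm_divide norm_mult)
    finally show "norm (blaschke ((1 - t / (2 * real n)) / (1 + t / (2 * real n))) z ^ n - phi t z)
      \<le> cmod x * cmod (g (x / of_nat n) / (x / of_nat n))" unfolding c_def .
  qed
  then show ?thesis by (rule LIM_zero_cancel)
qed

text \<open>The symbol of $\frac1t\int_0^t M_{\phi_s}\,ds$.\<close>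

definition avg :: "real \<Rightarrow> complex \<Rightarrow> complex" where
  "avg t z = (phi t z - 1) / (of_real t * cay z)"

text \<open>At equidistant times the values of \<open>phi\<close> are powers of
  \<open>exp (x / n)\<close>, so the Riemann sum is geometric; the derivative of \<open>exp\<close>
  at 0 yields the limit of its closed form.\<close>

lemma avg_tendsto:
  assumes t: "0 < t" and z: "z \<in> disc"
  shows "(\<lambda>n. (\<Sum>i<n. phi (real i * t / real n) z) / of_nat n) \<longlonglongrightarrow> avg t z"
proof -
  define x where "x = of_real t * cay z"
  have x: "x \<noteq> 0" using t cay_ne_0[OF z] by (auto simp: x_def)
  have "((\<lambda>u. (exp u - 1) / u) \<longlongrightarrow> 1) (at (0 :: complex))"
    using DERIV_exp[of "0 :: complex"] by (simp add: has_field_derivative_iff)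
  then have r: "(\<lambda>n. (exp (x / of_nat n) - 1) / (x / of_nat n)) \<longlonglongrightarrow> 1"
    by (rule filterlim_compose[OF _ filterlim_scaled_at_0[OF x]])
  then have "\<forall>\<^sub>F n in sequentially. (exp (x / of_nat n) - 1) / (x / of_nat n) \<noteq> 0"
    by (rule tendsto_imp_eventually_ne) simp
  then have ev: "\<forall>\<^sub>F n in sequentially. (\<Sum>i<n. phi (real i * t / real n) z) / of_nat n
      = (exp x - 1) / x * inverse ((exp (x / of_nat n) - 1) / (x / of_nat n))"
    using eventually_gt_at_top[of 0]
  proof eventually_elim
    case (elim n)
    then have ne: "exp (x / of_nat n) \<noteq> 1" by auto
    have "phi (real i * t / real n) z = exp (x / of_nat n) ^ i" for i
      by (simp add: phi_cay x_def exp_of_nat_mult[symmetric] mult_ac)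
    then have "(\<Sum>i<n. phi (real i * t / real n) z) = (exp (x / of_nat n) ^ n - 1) / (exp (x / of_nat n) - 1)"
      using geometric_sum[OF ne] by simp
    also have "exp (x / of_nat n) ^ n = exp x" using elim by (simp add: exp_of_nat_mult[symmetric])
    finally have sum: "(\<Sum>i<n. phi (real i * t / real n) z) = (exp x - 1) / (exp (x / of_nat n) - 1)" .
    define e where "e = exp (x / of_nat n) - 1"
    have "e \<noteq> 0" using ne by (simp add: e_def)
    then show ?case unfolding sum e_def[symmetric] using elim x by (simp add: field_simps)
  qed
  have "(\<lambda>n. (exp x - 1) / x * inverse ((exp (x / of_nat n) - 1) / (x / of_nat n))) \<longlonglongrightarrow> (exp x - 1) / x * inverse 1"
    by (intro tendsto_mult tendsto_const tendsto_inverse r) simp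
  moreover have "avg t z = (exp x - 1) / x" by (simp add: avg_def phi_cay x_def)
  ultimately show ?thesis using tendsto_cong[OF ev] by (simp only: inverse_1 mult_1_right)
qed

context fatou_space begin

abbreviation S :: "real \<Rightarrow> (complex \<Rightarrow> 'e) \<Rightarrow> complex \<Rightarrow> 'e" where "S t \<equiv> mult_op (phi t)"
abbreviation rs :: "real \<Rightarrow> (complex \<Rightarrow> 'e) \<Rightarrow> complex \<Rightarrow> 'e" where "rs r f \<equiv> complex_of_real r *\<^sub>C f"

lemma S_0: "S 0 f = f" by (simp add: mult_op_def phi_0)
lemma S_add: "S (s + t) f = S s (S t f)" by (simp add: mult_op_mult_op flip: phi_add)
lemma S_mz: "S t (mz f) = mz (S t f)" by (simp add: mult_op_mult_op mult.commute)
lemma S_diff_mz: "S t (f - mz f) = S t f - mz (S t f)" by (simp add: mult_op_diff S_mz)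

text \<open>Invariance of \<open>X\<close> and strong continuity at 0. Bounds on the operators near
  0 are kept apart, in \<open>loc_bounded\<close>, because one direction has to derive them.\<close>

definition semi :: bool where
  "semi \<longleftrightarrow> (\<forall>t\<ge>0. \<forall>f\<in>X. S t f \<in> X) \<and> (\<forall>f\<in>X. ((\<lambda>t. N (S t f - f)) \<longlongrightarrow> 0) (at_right 0))"

lemma semi_X: "semi \<Longrightarrow> 0 \<le> t \<Longrightarrow> f \<in> X \<Longrightarrow> S t f \<in> X" by (simp add: semi_def)

text \<open>Pointwise convergence without gain of norm is norm convergence: by the parallelogram law
  it suffices to bound \<open>F n + f\<close> from below, and that is the Fatou property.\<close>

lemma weak_to_strong:
  assumes F: "\<And>n :: nat. F n \<in> X" and f: "f \<in> X" and le: "\<And>n. B (F n) (F n) \<le> c n" "c \<longlonglongrightarrow> B f f"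
    and lim: "\<And>z. z \<in> disc \<Longrightarrow> (\<lambda>n. F n z) \<longlonglongrightarrow> f z"
  shows "(\<lambda>n. N (F n - f)) \<longlonglongrightarrow> 0"
proof -
  have par: "B (F n - f) (F n - f) = 2 * B (F n) (F n) + 2 * B f f - B (F n + f) (F n + f)" for n
    using F f B_sym[of "F n" f] by (simp add: closed B_lin)
  have four: "B (f + f) (f + f) = 4 * B f f" using f by (simp add: closed B_lin)
  \<comment> \<open>If it failed, the Fatou property along a subsequence would bound
    \<open>B (f + f) (f + f)\<close> by less than its value \<open>4 * B f f\<close>.\<close>
  have lower: "\<forall>\<^sub>F n in sequentially. 4 * B f f - e < B (F n + f) (F n + f)" if e: "0 < e" for e
  proof (rule ccontr)
    assume "\<not> ?thesis"
    from not_eventually_sequentiallyD[OF this]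
    obtain r :: "nat \<Rightarrow> nat" where r: "strict_mono r" "\<And>n. \<not> 4 * B f f - e < B (F (r n) + f) (F (r n) + f)" by blast
    have "(\<lambda>n. (F (r n) + f) z) \<longlonglongrightarrow> (f + f) z" if "z \<in> disc" for z
      unfolding plus_fun_apply
      using LIMSEQ_subseq_LIMSEQ[OF lim[OF that] r(1)] by (intro tendsto_add tendsto_const) (simp add: o_def)
    then have "B (f + f) (f + f) \<le> 4 * B f f - e"
      using fatou[of "\<lambda>n. F (r n) + f" "4 * B f f - e" "f + f"] r(2) F f outside[OF f]
      by (auto simp: closed not_less)
    then show False using four e by simp
  qed
  have "(\<lambda>n. B (F n - f) (F n - f)) \<longlonglongrightarrow> 0"
  proof (rule tendstoI)
    fix e :: real assume e: "0 < e"
    then have "0 < e / 4" by simp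
    have "\<forall>\<^sub>F n in sequentially. c n < B f f + e / 4"
      using order_tendstoD(2)[OF le(2), of "B f f + e / 4"] e by simp
    with lower[OF \<open>0 < e / 4\<close>] show "\<forall>\<^sub>F n in sequentially. dist (B (F n - f) (F n - f)) 0 < e"
    proof eventually_elim
      case (elim n)
      then show ?case using par[of n] le(1)[of n] B_nonneg[OF diff_closed[OF F f], of n] by simp
    qed
  qed
  then have "(\<lambda>n. sqrt (B (F n - f) (F n - f))) \<longlonglongrightarrow> sqrt 0" by (rule tendsto_real_sqrt)
  then show ?thesis by (simp add: N_def)
qed

text \<open>\<open>phi t\<close> is the limit of the \<open>n\<close>-th powers of Blaschke factors with zeros
  $(1-c_n)/(1+c_n)$, $c_n = t/(2n)$, and each factor increases the form by a multiple of the defect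
  form at a resolvent.\<close>

lemma dominated_bound:
  assumes w: "dominated w" and t: "0 \<le> t" and f: "f \<in> X"
  shows "S t f \<in> X" "B (S t f) (S t f) \<le> (1 + 2 * t * w) * B f f"
proof -
  have w0: "0 \<le> w" using w by (simp add: dominated_def)
  have "S t f \<in> X \<and> B (S t f) (S t f) \<le> (1 + 2 * t * w) * B f f"
  proof (cases "t = 0")
    case True
    then show ?thesis using f by (simp add: S_0)
  next
    case False
    then have t: "0 < t" using t by simp
    \<comment> \<open>For \<open>n \<ge> m\<close> both \<open>t\<close> and \<open>t * w\<close>
      are below \<open>n\<close>, which gives the hypotheses \<open>c n < 1\<close> and
      \<open>2 * c n * w < 1\<close> of \<open>res_dominated\<close>.\<close>
    obtain m :: nat where m: "t + t * w + 1 < real m" using reals_Archimedean2 by blast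
    define c where "c n = t / (2 * real n)" for n
    define \<alpha> where "\<alpha> n = (1 - c n) / (1 + c n)" for n
    define F where "F n = mult_op (\<lambda>z. blaschke (\<alpha> n) z ^ n) f" for n
    have main: "F n \<in> X \<and> B (F n) (F n) \<le> (1 + 2 * t * w / (1 - t * w / real n)) * B f f" if n: "m \<le> n" for n
    proof -
      have n': "t + t * w + 1 < real n" using m n by linarith
      have tw: "0 \<le> t * w" using t w0 by simp
      have n0: "0 < real n" "t < real n" "t * w < real n" using n' t tw by linarith+
      have c: "0 < c n" "c n < 1" "2 * c n * w < 1" using n0 t by (simp_all add: c_def field_simps)
      have \<alpha>1: "\<bar>\<alpha> n\<bar> < 1" using c by (simp add: \<alpha>_def field_simps)
      have "(1 + c n)\<^sup>2 \<noteq> 0" using c by simp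
      then have "(1 - (\<alpha> n)\<^sup>2) * (1 + c n)\<^sup>2 = (1 + c n)\<^sup>2 - (1 - c n)\<^sup>2"
        by (simp add: \<alpha>_def power_divide left_diff_distrib)
      \<comment> \<open>With \<open>c n = t / (2 * n)\<close> the \<open>n\<close> increments
        together carry the factor \<open>n * (4 * c n) * w = 2 * t * w\<close>.\<close>
      then have a: "(1 - (\<alpha> n)\<^sup>2) * (1 + c n)\<^sup>2 = 4 * c n" by (simp add: power2_eq_square algebra_simps)
      have "0 \<le> 1 - (\<alpha> n)\<^sup>2" using \<alpha>1 by (simp add: abs_square_le_1)
      then have "real n * ((1 - (\<alpha> n)\<^sup>2) * q (res (\<alpha> n) f) (res (\<alpha> n) f))
          \<le> real n * ((1 - (\<alpha> n)\<^sup>2) * (w * (1 + c n)\<^sup>2 / (1 - 2 * c n * w) * B f f))"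
        using res_dominated[OF w f c \<alpha>_def[of n]] by (intro mult_left_mono) auto
      also have "\<dots> = real n * (w * ((1 - (\<alpha> n)\<^sup>2) * (1 + c n)\<^sup>2) / (1 - 2 * c n * w) * B f f)"
        by simp
      also have "\<dots> = 2 * t * w / (1 - t * w / real n) * B f f"
        unfolding a using n0 by (simp add: c_def)
      finally show ?thesis
        using blaschke_power[OF f \<alpha>1, of n] by (simp add: F_def distrib_right)
    qed
    have "(\<lambda>n. (1 + 2 * t * w / (1 - t * w / real n)) * B f f) \<longlonglongrightarrow> (1 + 2 * t * w / (1 - 0)) * B f f"
      by (intro tendsto_intros tendsto_divide_0[OF tendsto_const] filterlim_real_sequentially
          filterlim_mono[OF filterlim_real_sequentially at_top_le_at_infinity order_refl]) auto
    then have "(\<lambda>n. (1 + 2 * t * w / (1 - t * w / real (n + m))) * B f f) \<longlonglongrightarrow> (1 + 2 * t * w) * B f f"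
      using LIMSEQ_ignore_initial_segment by fastforce
    then have lim: "(\<lambda>n. sqrt ((1 + 2 * t * w / (1 - t * w / real (n + m))) * B f f)) \<longlonglongrightarrow> sqrt ((1 + 2 * t * w) * B f f)"
      by (rule tendsto_real_sqrt)
    have pw: "(\<lambda>n. F (n + m) z) \<longlonglongrightarrow> S t f z" if "z \<in> disc" for z
      using LIMSEQ_ignore_initial_segment[OF scaleC.tendsto[OF blaschke_power_tendsto[OF t that] tendsto_const[of "f z"]], where k = m]
      unfolding F_def \<alpha>_def c_def mult_op_def .
    have le: "N (F (n + m)) \<le> sqrt ((1 + 2 * t * w / (1 - t * w / real (n + m))) * B f f)" for n
      unfolding N_def using main[of "n + m"] by (intro real_sqrt_le_mono) simp
    have out: "S t f z = 0" if "z \<notin> disc" for z using outside[OF f that] by (simp add: mult_op_def)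
    note FT = N_fatou_tendsto[where F = "\<lambda>n. F (n + m)" and f = "S t f", OF _ le lim pw out]
    have X: "S t f \<in> X" using FT(1) main by auto
    have "N (S t f) \<le> sqrt ((1 + 2 * t * w) * B f f)" using FT(2) main by auto
    then show ?thesis using X by (simp add: N_def)
  qed
  then show "S t f \<in> X" "B (S t f) (S t f) \<le> (1 + 2 * t * w) * B f f" by auto
qed

lemma phi_tendsto: "t \<longlonglongrightarrow> 0 \<Longrightarrow> (\<lambda>n. phi (t n) z) \<longlonglongrightarrow> 1"
proof -
  assume t: "t \<longlonglongrightarrow> 0"
  have "(\<lambda>n. exp (of_real (t n) * cay z)) \<longlonglongrightarrow> exp (of_real 0 * cay z)"
    by (intro tendsto_intros t)
  then show ?thesis by (simp add: phi_cay)
qed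

text \<open>The bound \<open>1 + 2 * t * w\<close> tends to 1 with \<open>t\<close>, so that
  pointwise convergence of the orbit upgrades to norm convergence.\<close>

lemma dominated_semi:
  assumes w: "dominated w"
  shows semi
  unfolding semi_def
proof (intro conjI allI impI ballI)
  show "S t f \<in> X" if "0 \<le> t" "f \<in> X" for t f using dominated_bound(1)[OF w that] .
  fix f assume f: "f \<in> X"
  show "((\<lambda>t. N (S t f - f)) \<longlongrightarrow> 0) (at_right 0)"
    unfolding tendsto_at_iff_sequentially
  proof (intro allI impI)
    fix t :: "nat \<Rightarrow> real" assume t: "\<forall>i. t i \<in> {0<..} - {0}" "t \<longlonglongrightarrow> 0"
    have t0: "0 \<le> t i" for i using t(1) by (auto intro: less_imp_le)
    have "(\<lambda>n. N (S (t n) f - f)) \<longlonglongrightarrow> 0"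
    proof (rule weak_to_strong)
      show "(\<lambda>n. (1 + 2 * t n * w) * B f f) \<longlonglongrightarrow> B f f"
        using tendsto_mult[OF tendsto_add[OF tendsto_const[of 1] tendsto_mult[OF tendsto_mult[OF tendsto_const[of 2] t(2)] tendsto_const[of w]]] tendsto_const[of "B f f"]]
        by simp
      show "(\<lambda>n. S (t n) f z) \<longlonglongrightarrow> f z" for z
        using scaleC.tendsto[OF phi_tendsto[OF t(2)] tendsto_const[of "f z"]] by (simp add: mult_op_def)
    qed (use dominated_bound[OF w t0 f] f in auto)
    then show "((\<lambda>t. N (S t f - f)) \<circ> t) \<longlonglongrightarrow> 0" by (simp add: o_def)
  qed
qed

text \<open>The averaged operator is a pointwise limit of Riemann sums, and the Fatou property keeps
  both membership in \<open>X\<close> and the bound; this takes the place of an integral with values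
  in \<open>X\<close>.\<close>

lemma averaging:
  assumes t: "0 < t" and u: "u \<in> X" and s: "\<And>s. 0 \<le> s \<Longrightarrow> s < t \<Longrightarrow> S s u \<in> X \<and> N (S s u - u) \<le> e"
  shows "mult_op (avg t) u \<in> X" "N (mult_op (avg t) u - u) \<le> e"
proof -
  \<comment> \<open>Averaging the differences \<open>S s u - u\<close> instead of
    \<open>S s u\<close> lets the bound \<open>e\<close> pass directly to the limit.\<close>
  define F where "F n = rs (1 / real (Suc n)) (\<Sum>i<Suc n. S (real i * t / real (Suc n)) u - u)" for n
  have st: "0 \<le> real i * t / real (Suc n)" "real i * t / real (Suc n) < t" if "i < Suc n" for i n
  proof -
    have "real i * t < real (Suc n) * t" using that t by (intro mult_strict_right_mono) auto
    then show "real i * t / real (Suc n) < t" by (simp add: pos_divide_less_eq mult.commute del: of_nat_Suc)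
  qed (use t in auto)
  have X: "S (real i * t / real (Suc n)) u - u \<in> X" if "i < Suc n" for i n
    using s[OF st[OF that]] u by (auto intro: closed)
  have sX: "(\<Sum>i<Suc n. S (real i * t / real (Suc n)) u - u) \<in> X" for n
    by (rule sum_closed, rule X) (simp only: lessThan_iff)
  have FX: "F n \<in> X" for n unfolding F_def by (intro scaleC_closed sX)
  have Fe: "N (F n) \<le> e" for n
  proof -
    have "N (\<Sum>i<Suc n. S (real i * t / real (Suc n)) u - u) \<le> (\<Sum>i<Suc n. N (S (real i * t / real (Suc n)) u - u))"
      by (rule N_sum, rule X) (simp only: lessThan_iff)
    also have "\<dots> \<le> (\<Sum>i<Suc n. e)" by (intro sum_mono conjunct2[OF s] st) (simp_all only: lessThan_iff)
    finally have "N (\<Sum>i<Suc n. S (real i * t / real (Suc n)) u - u) \<le> real (Suc n) * e" by simp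
    moreover have "cmod (complex_of_real (1 / real (Suc n))) = 1 / real (Suc n)" unfolding norm_of_real by simp
    then have "N (F n) = 1 / real (Suc n) * N (\<Sum>i<Suc n. S (real i * t / real (Suc n)) u - u)"
      unfolding F_def N_scaleC[OF sX] by simp
    ultimately show ?thesis by (simp add: pos_divide_le_eq mult.commute del: of_nat_Suc)
  qed
  have lim: "(\<lambda>n. F n z) \<longlonglongrightarrow> (mult_op (avg t) u - u) z" if z: "z \<in> disc" for z
  proof -
    have "(\<lambda>n. ((\<Sum>i<Suc n. phi (real i * t / real (Suc n)) z) / of_nat (Suc n)) *\<^sub>C u z - u z) \<longlonglongrightarrow> avg t z *\<^sub>C u z - u z"
      by (intro tendsto_intros scaleC.tendsto LIMSEQ_Suc[OF avg_tendsto[OF t z]])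
    moreover have "F n z = ((\<Sum>i<Suc n. phi (real i * t / real (Suc n)) z) / of_nat (Suc n)) *\<^sub>C u z - u z" for n
    proof -
      have sum: "(\<Sum>i<m. c i *\<^sub>C v - v) = (\<Sum>i<m. c i) *\<^sub>C v - of_nat m *\<^sub>C (v :: 'e)" for m :: nat and c v
        by (induction m) (simp_all add: scaleC_add_left algebra_simps)
      define m where "m = Suc n"
      have m: "m \<noteq> 0" by (simp add: m_def)
      have "F n z = complex_of_real (1 / real m) *\<^sub>C ((\<Sum>i<m. phi (real i * t / real m) z) *\<^sub>C u z - of_nat m *\<^sub>C u z)"
        by (simp only: F_def m_def scaleC_fun_def sum_fun_apply fun_diff_def mult_op_def sum)
      also have "\<dots> = ((\<Sum>i<m. phi (real i * t / real m) z) / of_nat m) *\<^sub>C u z - u z"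
        using m by (simp add: scaleC_diff_right scaleC_scaleC)
      finally have "F n z = ((\<Sum>i<m. phi (real i * t / real m) z) / of_nat m) *\<^sub>C u z - u z" .
      then show ?thesis by (simp only: m_def)
    qed
    ultimately show ?thesis by (simp add: mult_op_def fun_diff_def)
  qed
  have out: "(mult_op (avg t) u - u) z = 0" if "z \<notin> disc" for z
    using outside[OF u that] by (simp add: mult_op_def fun_diff_def)
  note ft = N_fatou[OF FX always_eventually[OF allI[OF Fe]] lim out]
  show "N (mult_op (avg t) u - u) \<le> e" using ft(2) .
  have "(mult_op (avg t) u - u) + u \<in> X" by (intro add_closed u ft(1))
  then show "mult_op (avg t) u \<in> X" by simp
qed

lemma semi_small:
  assumes semi "u \<in> X" "0 < e"
  obtains d where "0 < d" "\<And>s. 0 \<le> s \<Longrightarrow> s < d \<Longrightarrow> S s u \<in> X \<and> N (S s u - u) \<le> e"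
proof -
  have "\<forall>\<^sub>F s in at_right 0. N (S s u - u) < e"
    using assms order_tendstoD(2) unfolding semi_def by blast
  then obtain d where d: "0 < d" "\<And>s. 0 < s \<Longrightarrow> s < d \<Longrightarrow> N (S s u - u) < e"
    unfolding eventually_at_right_field by auto
  show thesis
  proof (rule that[OF d(1)])
    fix s :: real assume s: "0 \<le> s" "s < d"
    show "S s u \<in> X \<and> N (S s u - u) \<le> e"
      using semi_X[OF assms(1) s(1) assms(2)] d(2)[of s] s assms(3)
      by (cases "s = 0") (auto simp: S_0 N_zero)
  qed
qed

lemma semi_avg:
  assumes semi "u \<in> X"
  shows "((\<lambda>t. N (mult_op (avg t) u - u)) \<longlongrightarrow> 0) (at_right 0)" "\<forall>\<^sub>F t in at_right 0. mult_op (avg t) u \<in> X"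
proof -
  have *: "\<forall>\<^sub>F t in at_right 0. mult_op (avg t) u \<in> X \<and> N (mult_op (avg t) u - u) \<le> e" if e: "0 < e" for e
  proof -
    obtain d where d: "0 < d" "\<And>s. 0 \<le> s \<Longrightarrow> s < d \<Longrightarrow> S s u \<in> X \<and> N (S s u - u) \<le> e"
      using semi_small[OF assms e] by blast
    have "mult_op (avg t) u \<in> X \<and> N (mult_op (avg t) u - u) \<le> e" if t: "0 < t" "t < d" for t
    proof -
      have "S s u \<in> X \<and> N (S s u - u) \<le> e" if "0 \<le> s" "s < t" for s
        using d(2)[of s] that t by simp
      then show ?thesis using averaging[OF t(1) assms(2), of e] by blast
    qed
    then show ?thesis unfolding eventually_at_right_field using d(1) by blast
  qed
  show "\<forall>\<^sub>F t in at_right 0. mult_op (avg t) u \<in> X" using *[of 1] by (auto elim: eventually_mono)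
  show "((\<lambda>t. N (mult_op (avg t) u - u)) \<longlongrightarrow> 0) (at_right 0)"
  proof (rule tendstoI)
    fix e :: real assume "0 < e"
    then have "\<forall>\<^sub>F t in at_right 0. mult_op (avg t) u \<in> X \<and> N (mult_op (avg t) u - u) \<le> e / 2" by (intro *) simp
    then show "\<forall>\<^sub>F t in at_right 0. dist (N (mult_op (avg t) u - u)) 0 < e"
    proof eventually_elim
      case (elim t)
      then show ?case using N_nonneg[OF diff_closed[of "mult_op (avg t) u" u]] assms(2) \<open>0 < e\<close> by simp
    qed
  qed
qed

text \<open>The generator multiplies by \<open>cay\<close>, hence maps \<open>g - mz g\<close> to \<open>gen g\<close>.\<close>

definition gen :: "(complex \<Rightarrow> 'e) \<Rightarrow> complex \<Rightarrow> 'e" where "gen g = rs (-1) (g + mz g)"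

lemma gen_X: "g \<in> X \<Longrightarrow> gen g \<in> X" unfolding gen_def by (intro closed shift_X)

lemma S_gen: "S t (gen g) = gen (S t g)"
  by (simp only: gen_def mult_op_scaleC mult_op_add S_mz)

lemma avg_cay:
  assumes "z \<in> disc" "0 < t"
  shows "of_real (1 / t) * (phi t z - 1) = avg t z * cay z" "cay z * (1 - z) = - (1 + z)"
proof -
  have "avg t z * (of_real t * cay z) = phi t z - 1"
    using cay_ne_0[OF assms(1)] assms(2) by (simp add: avg_def)
  then show "of_real (1 / t) * (phi t z - 1) = avg t z * cay z"
    using assms(2) by (metis (no_types, opaque_lifting) mult.left_commute mult.commute nonzero_mult_div_cancel_left of_real_divide of_real_1 of_real_eq_0_iff less_irrefl times_divide_eq_left mult_1)
  show "cay z * (1 - z) = - (1 + z)"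
    using disc_ne(1)[OF assms(1)] by (simp add: cay_def field_simps)
qed

text \<open>Multiplication by \<open>cay\<close> cancels the factor \<open>1 - z\<close> of
  \<open>g - mz g\<close>. The difference quotient is thus an average along the orbit of
  \<open>gen g\<close>, and its convergence becomes a statement about averages.\<close>

lemma difference_quotient:
  assumes g: "g \<in> X" and t: "0 < t"
  shows "rs (1 / t) (S t (g - mz g) - (g - mz g)) = mult_op (avg t) (gen g)"
proof
  fix z
  show "rs (1 / t) (S t (g - mz g) - (g - mz g)) z = mult_op (avg t) (gen g) z"
  proof (cases "z \<in> disc")
    case True
    have "of_real (1 / t) * (phi t z - 1) * (1 - z) = avg t z * (cay z * (1 - z))"
      unfolding avg_cay(1)[OF True t] by simp
    then have "avg t z * (- 1 * (1 + z)) = of_real (1 / t) * (phi t z - 1) * (1 - z)"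
      unfolding avg_cay(2)[OF True t] by simp
    moreover have "rs (1 / t) (S t (g - mz g) - (g - mz g)) z = (of_real (1 / t) * (phi t z - 1) * (1 - z)) *\<^sub>C g z"
    proof -
      have "g z - z *\<^sub>C g z = (1 - z) *\<^sub>C g z" by (simp add: scaleC_diff_left)
      then have "rs (1 / t) (S t (g - mz g) - (g - mz g)) z = of_real (1 / t) *\<^sub>C (phi t z *\<^sub>C (1 - z) *\<^sub>C g z - (1 - z) *\<^sub>C g z)"
        by (simp only: mult_op_def fun_diff_def scaleC_fun_def)
      also have "\<dots> = (of_real (1 / t) * (phi t z * (1 - z) - (1 - z))) *\<^sub>C g z"
        by (simp only: scaleC_scaleC scaleC_diff_left[symmetric])
      also have "of_real (1 / t) * (phi t z * (1 - z) - (1 - z)) = of_real (1 / t) * (phi t z - 1) * (1 - z)"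
        by (simp only: mult.assoc left_diff_distrib mult_1_left)
      finally show ?thesis .
    qed
    moreover have "mult_op (avg t) (gen g) z = (avg t z * (- 1 * (1 + z))) *\<^sub>C g z"
    proof -
      have "g z + z *\<^sub>C g z = (1 + z) *\<^sub>C g z" by (simp add: scaleC_add_left)
      then show ?thesis
        by (simp only: gen_def mult_op_def scaleC_fun_def plus_fun_def scaleC_scaleC of_real_minus of_real_1 mult.assoc)
    qed
    ultimately show ?thesis by simp
  qed (simp add: gen_def mult_op_def fun_diff_def scaleC_fun_def outside[OF g])
qed

lemma semi_generator:
  assumes semi "g \<in> X"
  shows "((\<lambda>t. N (rs (1 / t) (S t (g - mz g) - (g - mz g)) - gen g)) \<longlongrightarrow> 0) (at_right 0)"
proof (rule Lim_transform_eventually[OF semi_avg(1)[OF assms(1) gen_X[OF assms(2)]]])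
  show "\<forall>\<^sub>F t in at_right 0. N (mult_op (avg t) (gen g) - gen g) = N (rs (1 / t) (S t (g - mz g) - (g - mz g)) - gen g)"
    unfolding eventually_at_right_field using difference_quotient[OF assms(2)] by (intro exI[of _ 1]) simp
qed

text \<open>Averages of \<open>u\<close> approximate \<open>u\<close>, and they are divisible by
  \<open>1 - z\<close> inside \<open>X\<close> because averaging maps into the domain of the
  generator.\<close>

lemma range_dense:
  assumes semi "u \<in> X" "0 < e"
  shows "\<exists>k\<in>X. N (u - (k - mz k)) < e"
proof -
  have "\<forall>\<^sub>F t in at_right 0. N (mult_op (avg t) u - u) < e"
    using order_tendstoD(2)[OF semi_avg(1)[OF assms(1,2)] assms(3)] .
  then have "\<forall>\<^sub>F t in at_right 0. N (mult_op (avg t) u - u) < e \<and> mult_op (avg t) u \<in> X \<and> 0 < t"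
    using semi_avg(2)[OF assms(1,2)] eventually_at_right_less by eventually_elim auto
  then obtain t where t: "N (mult_op (avg t) u - u) < e" "mult_op (avg t) u \<in> X" "0 < t"
    using eventually_happens'[OF trivial_limit_at_right_real] by blast
  \<comment> \<open>As \<open>1 - cay z = 2 / (1 - z)\<close>, this is the average divided by
    \<open>1 - z\<close>, expressed through functions already known to lie in \<open>X\<close>:
    \<open>cay\<close> times the average is the difference quotient of \<open>u\<close>.\<close>
  define k where "k = rs (1 / 2) (mult_op (avg t) u - rs (1 / t) (S t u - u))"
  have kX: "k \<in> X" unfolding k_def using t(2) assms(2) semi_X[OF assms(1) less_imp_le[OF t(3)] assms(2)] by (intro closed)
  have "k - mz k = mult_op (avg t) u"
  proof
    fix z
    show "(k - mz k) z = mult_op (avg t) u z"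
    proof (cases "z \<in> disc")
      case True
      have "(1 - z) * (1 / 2 * (avg t z - of_real (1 / t) * (phi t z - 1)))
        = 1 / 2 * avg t z * ((1 - z) - cay z * (1 - z))"
        unfolding avg_cay(1)[OF True t(3)] by (simp add: field_simps)
      then have "(1 - z) * (1 / 2 * (avg t z - of_real (1 / t) * (phi t z - 1))) = avg t z"
        unfolding avg_cay(2)[OF True t(3)] by simp
      moreover have "(k - mz k) z = ((1 - z) * (1 / 2 * (avg t z - of_real (1 / t) * (phi t z - 1)))) *\<^sub>C u z"
      proof -
        have "k z = complex_of_real (1 / 2) *\<^sub>C (avg t z *\<^sub>C u z - of_real (1 / t) *\<^sub>C (phi t z *\<^sub>C u z - 1 *\<^sub>C u z))"
          by (simp add: k_def mult_op_def fun_diff_def scaleC_fun_def)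
        also have "\<dots> = (1 / 2 * (avg t z - of_real (1 / t) * (phi t z - 1))) *\<^sub>C u z"
          by (simp only: scaleC_scaleC scaleC_diff_left[symmetric]) simp
        finally have k: "k z = (1 / 2 * (avg t z - of_real (1 / t) * (phi t z - 1))) *\<^sub>C u z" .
        have "(k - mz k) z = (1 - z) *\<^sub>C k z" by (simp add: mult_op_def fun_diff_def scaleC_diff_left)
        then show ?thesis unfolding k scaleC_scaleC .
      qed
      ultimately show ?thesis by (simp add: mult_op_def)
    qed (simp add: k_def mult_op_def fun_diff_def scaleC_fun_def outside[OF assms(2)])
  qed
  then show ?thesis
    using t(1) N_diff_commute[OF assms(2) t(2)] kX by (intro bexI[of _ k]) simp_all
qed

section \<open>Growth of the semigroup\<close>

definition loc_bounded :: "real \<Rightarrow> real \<Rightarrow> bool" where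
  "loc_bounded T M \<longleftrightarrow> 0 < T \<and> 0 \<le> M \<and> (\<forall>s x. 0 \<le> s \<longrightarrow> s \<le> T \<longrightarrow> x \<in> X \<longrightarrow> N (S s x) \<le> M * N x)"

text \<open>Otherwise there are times \<open>s n\<close> tending to 0 at which the operators exceed
  \<open>4 ^ n\<close>, while strong continuity at 0 keeps each sequence \<open>S (s n) f\<close>
  bounded. Uniform boundedness excludes this.\<close>

lemma semi_loc_bounded:
  assumes semi and bd: "\<And>t. 0 \<le> t \<Longrightarrow> \<exists>L. \<forall>f\<in>X. N (S t f) \<le> L * N f"
  shows "\<exists>T M. loc_bounded T M"
proof (rule ccontr)
  assume no: "\<not> ?thesis"
  have "\<exists>s. 0 \<le> s \<and> s \<le> 1 / real (Suc n) \<and> (\<exists>f\<in>X. N (S s f) > 4 ^ n * N f)" for n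
  proof -
    have "\<not> loc_bounded (1 / real (Suc n)) (4 ^ n)" using no by blast
    then show ?thesis by (auto simp: loc_bounded_def not_le simp del: of_nat_Suc)
  qed
  then obtain s where s: "\<And>n. 0 \<le> s n" "\<And>n. s n \<le> 1 / real (Suc n)" "\<And>n. \<exists>f\<in>X. N (S (s n) f) > 4 ^ n * N f"
    by metis
  show False
  proof (rule uniform_boundedness[of "\<lambda>n. S (s n)"])
    show "S (s n) f \<in> X" if "f \<in> X" for n f using semi_X[OF assms(1) s(1) that] .
    show "\<exists>L. \<forall>f\<in>X. N (S (s n) f) \<le> L * N f" for n by (rule bd[OF s(1)])
    fix f assume f: "f \<in> X"
    obtain d where d: "0 < d" "\<And>t. 0 \<le> t \<Longrightarrow> t < d \<Longrightarrow> S t f \<in> X \<and> N (S t f - f) \<le> 1"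
      using semi_small[OF assms(1) f, of 1] by auto
    obtain n0 where n0: "1 / real (Suc n0) < d" using d(1) nat_approx_posE by blast
    have X: "S (s n) f \<in> X" for n using semi_X[OF assms(1) s(1) f] .
    have "N (S (s n) f) \<le> (N f + 1) + (\<Sum>i<n0. N (S (s i) f))" for n
    proof (cases "n < n0")
      case True
      have "N (S (s n) f) \<le> (\<Sum>i<n0. N (S (s i) f))"
        using True X by (intro member_le_sum) auto
      then show ?thesis using N_nonneg[OF f] by linarith
    next
      case False
      then have "1 / real (Suc n) \<le> 1 / real (Suc n0)" by (intro divide_left_mono) auto
      then have "s n < d" using s(2)[of n] n0 by linarith
      then have "N (S (s n) f - f) \<le> 1" using d(2) s(1) by blast
      then have "N (S (s n) f) \<le> N f + 1" using N_triangle_minus[OF X f, of n] by linarith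
      moreover have "0 \<le> (\<Sum>i<n0. N (S (s i) f))" using X by (intro sum_nonneg) auto
      ultimately show ?thesis by linarith
    qed
    then show "\<exists>K. \<forall>n. N (S (s n) f) \<le> K" by blast
  qed (use s(3) in \<open>auto simp: mult_op_diff mult_op_scaleC\<close>)
qed

lemma q_tendsto_diag:
  assumes F: "\<And>j :: nat. F j \<in> X" "f \<in> X" "(\<lambda>j. N (F j - f)) \<longlonglongrightarrow> 0"
  shows "(\<lambda>j. q (F j) (F j)) \<longlonglongrightarrow> q f f"
proof -
  have "(\<lambda>j. N (mz (F j) - mz f)) \<longlonglongrightarrow> 0"
  proof (rule tendsto_sandwich[OF _ _ tendsto_const tendsto_mult_right_zero[OF F(3)]])
    show "\<forall>\<^sub>F j in sequentially. N (mz (F j) - mz f) \<le> \<bar>sqrt C\<bar> * N (F j - f)"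
      unfolding mult_op_diff[symmetric] using F by (intro always_eventually allI shift_X closed)
    show "\<forall>\<^sub>F j in sequentially. 0 \<le> N (mz (F j) - mz f)"
      using F by (intro always_eventually allI N_nonneg closed shift_X)
  qed
  then show ?thesis unfolding q_def
    using F shift_X(1) by (intro tendsto_diff B_tendsto_diag) auto
qed

section \<open>Differentiation along orbits\<close>

context
  fixes T M :: real
  assumes semi: semi and lb: "loc_bounded T M"
begin

lemma T_pos: "0 < T" and M_nonneg: "0 \<le> M" using lb by (auto simp: loc_bounded_def)

lemma S_le: "s \<in> {0..T} \<Longrightarrow> x \<in> X \<Longrightarrow> N (S s x) \<le> M * N x"
  using lb by (simp add: loc_bounded_def)

lemma S_in: "s \<in> {0..T} \<Longrightarrow> x \<in> X \<Longrightarrow> S s x \<in> X" using semi_X[OF semi] by simp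

lemma filterlim_gap: "filterlim (\<lambda>s. \<bar>s - t\<bar>) (at_right 0) (at t within {0..T})"
  unfolding filterlim_at
proof
  show "\<forall>\<^sub>F s in at t within {0..T}. \<bar>s - t\<bar> \<in> {0<..} \<and> \<bar>s - t\<bar> \<noteq> 0"
    by (auto simp: eventually_at_filter)
  have "((\<lambda>s. \<bar>s - t\<bar>) \<longlongrightarrow> \<bar>t - t\<bar>) (at t within {0..T})" by (intro tendsto_intros)
  then show "((\<lambda>s. \<bar>s - t\<bar>) \<longlongrightarrow> 0) (at t within {0..T})" by simp
qed

text \<open>Factoring out the operator at the earlier of the two times reduces continuity from both
  sides to continuity at 0, at the price of the local bound \<open>M\<close>.\<close>

lemma S_continuous:
  assumes x: "x \<in> X" and t: "t \<in> {0..T}"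
  shows "((\<lambda>s. N (S s x - S t x)) \<longlongrightarrow> 0) (at t within {0..T})"
proof (rule tendsto_sandwich[OF _ _ tendsto_const])
  have "((\<lambda>h. N (S h x - x)) \<longlongrightarrow> 0) (at_right 0)" using semi x by (simp add: semi_def)
  then show "((\<lambda>s. M * N (S \<bar>s - t\<bar> x - x)) \<longlongrightarrow> 0) (at t within {0..T})"
    by (intro tendsto_mult_right_zero filterlim_compose[OF _ filterlim_gap])
  have key: "N (S b x - S a x) \<le> M * N (S (b - a) x - x)" if "a \<in> {0..T}" "b \<in> {0..T}" "a \<le> b" for a b
  proof -
    have "S b x - S a x = S a (S (b - a) x - x)"
      using S_add[of a "b - a" x] by (simp add: mult_op_diff)
    then show ?thesis using S_le[OF that(1)] semi_X[OF semi, of "b - a" x] that x by (simp add: closed)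
  qed
  have "N (S s x - S t x) \<le> M * N (S \<bar>s - t\<bar> x - x)" if "s \<in> {0..T}" for s
    using key[of s t] key[of t s] that t N_diff_commute[OF S_in[OF that x] S_in[OF t x]]
    by (cases "s \<le> t") auto
  then show "\<forall>\<^sub>F s in at t within {0..T}. N (S s x - S t x) \<le> M * N (S \<bar>s - t\<bar> x - x)"
    by (auto simp: eventually_at_filter)
  show "\<forall>\<^sub>F s in at t within {0..T}. 0 \<le> N (S s x - S t x)"
    using S_in x t by (auto simp: eventually_at_filter intro!: always_eventually N_nonneg closed)
qed

text \<open>The difference quotient is again based at the earlier time. For \<open>s < t\<close>
  this produces the derivative at \<open>s\<close> instead of \<open>t\<close>, which is corrected
  by the continuity of the orbit of \<open>gen g\<close>.\<close>

lemma S_differentiable: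
  assumes g: "g \<in> X" and t: "t \<in> {0..T}"
  shows "((\<lambda>s. N (rs (1 / (s - t)) (S s (g - mz g) - S t (g - mz g)) - S t (gen g))) \<longlongrightarrow> 0) (at t within {0..T})"
proof (rule tendsto_sandwich[OF _ _ tendsto_const])
  define f v where "f = g - mz g" and "v = gen g"
  have X: "f \<in> X" "v \<in> X" unfolding f_def v_def using g by (auto intro: closed shift_X gen_X)
  define r where "r h = N (rs (1 / h) (S h f - f) - v)" for h
  have "(r \<longlongrightarrow> 0) (at_right 0)" using semi_generator[OF semi g] unfolding r_def f_def v_def .
  then have "((\<lambda>s. M * r \<bar>s - t\<bar> + N (S s v - S t v)) \<longlongrightarrow> M * 0 + 0) (at t within {0..T})"
    by (intro tendsto_add tendsto_mult tendsto_const filterlim_compose[OF _ filterlim_gap] S_continuous X t)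
  then show "((\<lambda>s. M * r \<bar>s - t\<bar> + N (S s v - S t v)) \<longlongrightarrow> 0) (at t within {0..T})" by simp
  have quot: "rs (1 / (b - a)) (S b f - S a f) - S a v = S a (rs (1 / (b - a)) (S (b - a) f - f) - v)" for a b
    using S_add[of a "b - a" f] by (simp add: mult_op_diff mult_op_scaleC)
  have bound: "N (S a (rs (1 / h) (S h f - f) - v)) \<le> M * r h" if "a \<in> {0..T}" "0 \<le> h" for a h
    unfolding r_def using that X semi_X[OF semi that(2) X(1)] by (intro S_le) (auto intro: closed)
  have "N (rs (1 / (s - t)) (S s f - S t f) - S t v) \<le> M * r \<bar>s - t\<bar> + N (S s v - S t v)" if s: "s \<in> {0..T}" for s
  proof (cases "t \<le> s")
    case True
    have "0 \<le> N (S s v - S t v)" using S_in s t X by (intro N_nonneg closed) auto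
    then show ?thesis unfolding quot using bound[OF t, of "s - t"] True by simp
  next
    case False
    have flip: "rs (1 / (s - t)) (S s f - S t f) = rs (1 / (t - s)) (S t f - S s f)"
    proof -
      have "complex_of_real (1 / (s - t)) = - complex_of_real (1 / (t - s))"
        using False by (simp flip: of_real_minus add: minus_divide_left[symmetric] minus_divide_right)
      then have "rs (1 / (s - t)) (S s f - S t f) = - (rs (1 / (t - s)) (S s f - S t f))"
        by (simp only: scaleC_minus_left)
      also have "\<dots> = rs (1 / (t - s)) (S t f - S s f)"
        by (simp only: scaleC_minus_right[symmetric] minus_diff_eq)
      finally show ?thesis .
    qed
    define u where "u = rs (1 / (t - s)) (S t f - S s f)"
    have m: "u - S s v \<in> X" "S s v - S t v \<in> X"
      unfolding u_def using S_in[OF s X(1)] S_in[OF t X(1)] S_in[OF s X(2)] S_in[OF t X(2)] by (simp_all add: diff_closed scaleC_closed)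
    have b: "N (u - S s v) \<le> M * r (t - s)"
      unfolding u_def quot[of t s] by (rule bound[OF s]) (use False in simp)
    have ab: "\<bar>s - t\<bar> = t - s" using False by simp
    have "N (u - S t v) \<le> N (u - S s v) + N (S s v - S t v)"
      using N_triangle[OF m] by simp
    then show ?thesis unfolding flip u_def[symmetric] ab using b by linarith
  qed
  then show "\<forall>\<^sub>F s in at t within {0..T}. N (rs (1 / (s - t)) (S s (g - mz g) - S t (g - mz g)) - S t (gen g))
     \<le> M * r \<bar>s - t\<bar> + N (S s v - S t v)"
    unfolding f_def[symmetric] v_def[symmetric] by (auto simp: eventually_at_filter)
  show "\<forall>\<^sub>F s in at t within {0..T}. 0 \<le> N (rs (1 / (s - t)) (S s (g - mz g) - S t (g - mz g)) - S t (gen g))"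
    unfolding f_def[symmetric] v_def[symmetric] using S_in X t
    by (auto simp: eventually_at_filter intro!: always_eventually N_nonneg closed)
qed

text \<open>Product rule for a bounded symmetric form, from \<beta>(x, x) - \<beta>(y, y) =
  \<beta>(x - y, x + y). The form stays abstract because the rule is applied to \<open>q\<close>,
  where it yields invariance, and to \<open>B\<close>, where it yields the growth.\<close>

lemma form_derivative:
  assumes add: "\<And>x y z. x \<in> X \<Longrightarrow> y \<in> X \<Longrightarrow> z \<in> X \<Longrightarrow> \<beta> (x + y) z = \<beta> x z + \<beta> y z"
    and diff: "\<And>x y z. x \<in> X \<Longrightarrow> y \<in> X \<Longrightarrow> z \<in> X \<Longrightarrow> \<beta> (x - y) z = \<beta> x z - \<beta> y z"
    and scale: "\<And>r x y. x \<in> X \<Longrightarrow> y \<in> X \<Longrightarrow> \<beta> (rs r x) y = r * \<beta> x y"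
    and sym: "\<And>x y. \<beta> x y = \<beta> y x"
    and bnd: "\<And>x y. x \<in> X \<Longrightarrow> y \<in> X \<Longrightarrow> \<bar>\<beta> x y\<bar> \<le> K * N x * N y"
    and K: "0 \<le> K" and g: "g \<in> X" and t: "t \<in> {0..T}"
  shows "((\<lambda>s. \<beta> (S s (g - mz g)) (S s (g - mz g))) has_real_derivative 2 * \<beta> (S t (gen g)) (S t (g - mz g))) (at t within {0..T})"
  unfolding has_field_derivative_iff
proof (rule LIM_zero_cancel, rule Lim_null_comparison)
  define f v where "f = g - mz g" and "v = gen g"
  have X: "f \<in> X" "v \<in> X" unfolding f_def v_def using g by (auto intro: closed shift_X gen_X)
  define d where "d s = rs (1 / (s - t)) (S s f - S t f) - S t v" for s
  define bd where "bd s = K * N (d s) * (2 * M * N f) + K * N (S t v) * N (S s f - S t f)" for s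
  have "((\<lambda>s. N (d s)) \<longlongrightarrow> 0) (at t within {0..T})"
    unfolding d_def f_def v_def by (rule S_differentiable[OF g t])
  then have "(bd \<longlongrightarrow> K * 0 * (2 * M * N f) + K * N (S t v) * 0) (at t within {0..T})"
    unfolding bd_def[abs_def] by (intro tendsto_intros S_continuous X t)
  then show "(bd \<longlongrightarrow> 0) (at t within {0..T})" by simp
  have "norm ((\<beta> (S s f) (S s f) - \<beta> (S t f) (S t f)) / (s - t) - 2 * \<beta> (S t v) (S t f)) \<le> bd s"
    if s: "s \<in> {0..T}" "s \<noteq> t" for s
  proof -
    have m: "S s f \<in> X" "S t f \<in> X" "S t v \<in> X" using S_in s t X by auto
    have dX: "d s \<in> X" unfolding d_def using m by (intro closed)
    define p where "p = S s f + S t f"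
    have pX: "p \<in> X" unfolding p_def using m by (intro closed)
    have addr: "\<beta> x (y + z) = \<beta> x y + \<beta> x z" if "x \<in> X" "y \<in> X" "z \<in> X" for x y z
      using add[OF that(2,3,1)] sym by metis
    have diffr: "\<beta> x (y - z) = \<beta> x y - \<beta> x z" if "x \<in> X" "y \<in> X" "z \<in> X" for x y z
      using diff[OF that(2,3,1)] sym by metis
    have dd: "\<beta> (S s f - S t f) p = \<beta> (S s f) (S s f) - \<beta> (S t f) (S t f)"
      unfolding p_def using m sym[of "S s f" "S t f"] by (simp add: add addr diff closed)
    have sc: "\<beta> (rs (1 / (s - t)) (S s f - S t f)) p = 1 / (s - t) * \<beta> (S s f - S t f) p"
      using m pX by (intro scale closed)
    have "(\<beta> (S s f) (S s f) - \<beta> (S t f) (S t f)) / (s - t) = \<beta> (rs (1 / (s - t)) (S s f - S t f)) p"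
      unfolding sc dd by simp
    also have "rs (1 / (s - t)) (S s f - S t f) = d s + S t v" by (simp add: d_def)
    also have "\<beta> (d s + S t v) p = \<beta> (d s) p + (\<beta> (S t v) (S s f - S t f) + 2 * \<beta> (S t v) (S t f))"
      using m dX pX by (simp add: add p_def addr diffr closed)
    finally have "(\<beta> (S s f) (S s f) - \<beta> (S t f) (S t f)) / (s - t) - 2 * \<beta> (S t v) (S t f)
        = \<beta> (d s) p + \<beta> (S t v) (S s f - S t f)" by simp
    then have "norm ((\<beta> (S s f) (S s f) - \<beta> (S t f) (S t f)) / (s - t) - 2 * \<beta> (S t v) (S t f))
       \<le> \<bar>\<beta> (d s) p\<bar> + \<bar>\<beta> (S t v) (S s f - S t f)\<bar>" by simp
    also have "\<dots> \<le> K * N (d s) * N p + K * N (S t v) * N (S s f - S t f)"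
      using m dX pX by (intro add_mono bnd closed)
    also have "\<dots> \<le> bd s"
    proof -
      have "N p \<le> N (S s f) + N (S t f)" unfolding p_def by (rule N_triangle[OF m(1,2)])
      also have "\<dots> \<le> M * N f + M * N f" using s t X by (intro add_mono S_le)
      finally have "N p \<le> 2 * M * N f" by simp
      then show ?thesis unfolding bd_def using K dX m(3) by (intro add_mono mult_left_mono order_refl mult_nonneg_nonneg) auto
    qed
    finally show ?thesis .
  qed
  then show "\<forall>\<^sub>F s in at t within {0..T}. norm ((\<beta> (S s (g - mz g)) (S s (g - mz g)) - \<beta> (S t (g - mz g)) (S t (g - mz g))) / (s - t)
      - 2 * \<beta> (S t (gen g)) (S t (g - mz g))) \<le> bd s"
    unfolding f_def[symmetric] v_def[symmetric] by (auto simp: eventually_at_filter)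
qed

text \<open>The cross terms cancel by symmetry. For \<open>\<beta> = B\<close> the value is
  \<open>q g g\<close>; for \<open>\<beta> = q\<close> it vanishes by the 2-isometry property of the
  shift.\<close>

lemma gen_form:
  assumes add: "\<And>x y z. x \<in> X \<Longrightarrow> y \<in> X \<Longrightarrow> z \<in> X \<Longrightarrow> \<beta> (x + y) z = \<beta> x z + \<beta> y z"
    and diff: "\<And>x y z. x \<in> X \<Longrightarrow> y \<in> X \<Longrightarrow> z \<in> X \<Longrightarrow> \<beta> (x - y) z = \<beta> x z - \<beta> y z"
    and scale: "\<And>r x y. x \<in> X \<Longrightarrow> y \<in> X \<Longrightarrow> \<beta> (rs r x) y = r * \<beta> x y"
    and sym: "\<And>x y. \<beta> x y = \<beta> y x" and g: "g \<in> X"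
  shows "\<beta> (gen g) (g - mz g) = \<beta> (mz g) (mz g) - \<beta> g g"
proof -
  define m where "m = mz g"
  have m: "m \<in> X" unfolding m_def using g by (rule shift_X)
  define h where "h = g - m"
  have h: "h \<in> X" unfolding h_def using g m by (rule diff_closed)
  have "\<beta> (rs (-1) (g + m)) h = -1 * \<beta> (g + m) h"
    using g m h by (intro scale closed)
  moreover have "\<beta> (g + m) h = \<beta> h g + \<beta> h m"
    using add[OF g m h] sym by simp
  moreover have "\<beta> h g = \<beta> g g - \<beta> m g" "\<beta> h m = \<beta> g m - \<beta> m m"
    unfolding h_def by (rule diff[OF g m g], rule diff[OF g m m])
  ultimately have "\<beta> (rs (-1) (g + m)) h = \<beta> m m - \<beta> g g" using sym[of m g] by linarith
  then show ?thesis unfolding gen_def h_def m_def .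
qed

lemma S_tendsto:
  assumes F: "\<And>j :: nat. F j \<in> X" "f \<in> X" "(\<lambda>j. N (F j - f)) \<longlonglongrightarrow> 0" and s: "s \<in> {0..T}"
  shows "(\<lambda>j. N (S s (F j) - S s f)) \<longlonglongrightarrow> 0"
proof (rule tendsto_sandwich[OF _ _ tendsto_const tendsto_mult_right_zero[OF F(3)]])
  show "\<forall>\<^sub>F j in sequentially. N (S s (F j) - S s f) \<le> M * N (F j - f)"
    unfolding mult_op_diff[symmetric] using F s by (intro always_eventually allI S_le closed)
  show "\<forall>\<^sub>F j in sequentially. 0 \<le> N (S s (F j) - S s f)"
    using F s by (intro always_eventually allI N_nonneg closed S_in)
qed

lemma range_approx:
  assumes "u \<in> X"
  obtains k where "\<And>j :: nat. k j \<in> X" "(\<lambda>j. N ((k j - mz (k j)) - u)) \<longlonglongrightarrow> 0"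
proof -
  have "\<exists>k\<in>X. N (u - (k - mz k)) < 1 / real (Suc j)" for j
    by (rule range_dense[OF semi assms]) simp
  then obtain k where k: "\<And>j. k j \<in> X" "\<And>j. N (u - (k j - mz (k j))) < 1 / real (Suc j)" by metis
  have kX: "k j - mz (k j) \<in> X" for j using k(1) by (intro closed shift_X)
  have "(\<lambda>j. N ((k j - mz (k j)) - u)) \<longlonglongrightarrow> 0"
  proof (rule tendsto_sandwich[OF _ _ tendsto_const LIMSEQ_Suc[OF lim_1_over_n]])
    have "N ((k j - mz (k j)) - u) \<le> 1 / real (Suc j)" for j
      using k(2)[of j] N_diff_commute[OF assms kX[of j]] by linarith
    then show "\<forall>\<^sub>F j in sequentially. N ((k j - mz (k j)) - u) \<le> 1 / real (Suc j)"
      by (intro always_eventually allI)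
    show "\<forall>\<^sub>F j in sequentially. 0 \<le> N ((k j - mz (k j)) - u)"
      by (intro always_eventually allI N_nonneg diff_closed[OF kX assms])
  qed
  with k(1) show thesis by (rule that)
qed

text \<open>On elements \<open>k - mz k\<close> the derivative of \<open>q\<close> along the orbit
  vanishes by \<open>gen_form\<close>. These elements are dense and \<open>q\<close> is continuous,
  which gives every \<open>g\<close>.\<close>

lemma q_invariant:
  assumes g: "g \<in> X" and s: "s \<in> {0..T}"
  shows "q (S s g) (S s g) = q g g"
proof -
  have special: "q (S s (k - mz k)) (S s (k - mz k)) = q (k - mz k) (k - mz k)" if k: "k \<in> X" for k
  proof -
    have "((\<lambda>s. q (S s (k - mz k)) (S s (k - mz k))) has_real_derivative 0) (at t within {0..T})"
      if t: "t \<in> {0..T}" for t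
    proof -
      have "((\<lambda>s. q (S s (k - mz k)) (S s (k - mz k))) has_real_derivative 2 * q (S t (gen k)) (S t (k - mz k))) (at t within {0..T})"
        by (rule form_derivative[where \<beta> = q and K = "\<bar>C\<bar> + 1"])
          (use k t q_abs_bound q_lin q_sym in auto)
      moreover have "q (S t (gen k)) (S t (k - mz k)) = 0"
        unfolding S_gen S_diff_mz
        using gen_form[where \<beta> = q and g = "S t k"] q_lin q_sym q_diag(2)[OF S_in[OF t k]] S_in[OF t k] by auto
      ultimately show ?thesis by simp
    qed
    then obtain c where "\<And>x. x \<in> {0..T} \<Longrightarrow> q (S x (k - mz k)) (S x (k - mz k)) = c"
      using has_field_derivative_zero_constant[of "{0..T}" "\<lambda>s. q (S s (k - mz k)) (S s (k - mz k))"] by (auto simp: convex_real_interval)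
    from this[OF s] this[of 0] show ?thesis using T_pos by (simp add: S_0)
  qed
  obtain k where k: "\<And>j. k j \<in> X" "(\<lambda>j. N ((k j - mz (k j)) - g)) \<longlonglongrightarrow> 0"
    using range_approx[OF g] by blast
  have kX: "k j - mz (k j) \<in> X" for j using k(1) by (intro closed shift_X)
  have "(\<lambda>j. q (S s (k j - mz (k j))) (S s (k j - mz (k j)))) \<longlonglongrightarrow> q (S s g) (S s g)"
    by (rule q_tendsto_diag[OF S_in[OF s kX] S_in[OF s g] S_tendsto[OF kX g k(2) s]])
  moreover have "(\<lambda>j. q (k j - mz (k j)) (k j - mz (k j))) \<longlonglongrightarrow> q g g"
    by (rule q_tendsto_diag[OF kX g k(2)])
  ultimately show ?thesis unfolding special[OF k(1)] by (rule LIMSEQ_unique)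
qed

lemma B_affine:
  assumes g: "g \<in> X" and s: "s \<in> {0..T}"
  shows "B (S s (g - mz g)) (S s (g - mz g)) = B (g - mz g) (g - mz g) + 2 * s * q g g"
proof -
  let ?h = "\<lambda>s. B (S s (g - mz g)) (S s (g - mz g)) - 2 * s * q g g"
  have "(?h has_real_derivative 0) (at t within {0..T})" if t: "t \<in> {0..T}" for t
  proof -
    have "((\<lambda>s. B (S s (g - mz g)) (S s (g - mz g))) has_real_derivative 2 * B (S t (gen g)) (S t (g - mz g))) (at t within {0..T})"
      by (rule form_derivative[where \<beta> = B and K = 1])
        (use g t cauchy_schwarz B_lin B_sym in auto)
    moreover have "B (S t (gen g)) (S t (g - mz g)) = q g g"
      unfolding S_gen S_diff_mz q_invariant[OF g t, symmetric]
      using gen_form[where \<beta> = B and g = "S t g"] B_lin B_sym S_in[OF t g] by (auto simp: q_def)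
    ultimately show ?thesis by (auto intro!: derivative_eq_intros)
  qed
  then obtain c where "\<And>x. x \<in> {0..T} \<Longrightarrow> ?h x = c"
    using has_field_derivative_zero_constant[of "{0..T}" ?h] by (auto simp: convex_real_interval)
  from this[OF s] this[of 0] show ?thesis using T_pos by (simp add: S_0)
qed

end

lemma semi_dominated:
  assumes semi and lb: "loc_bounded T M"
  shows "\<exists>w. dominated w"
proof -
  have T: "0 < T" using lb by (simp add: loc_bounded_def)
  \<comment> \<open>From \<open>B_affine\<close> at \<open>s = T\<close>, where the squared norm on
    the left is at most \<open>M\<^sup>2\<close> times the initial one, after dropping the
    nonnegative initial term on the right.\<close>
  define w where "w = M\<^sup>2 / (2 * T)"
  have "q g g \<le> w * B (g - mz g) (g - mz g)" if g: "g \<in> X" for g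
  proof -
    have fX: "g - mz g \<in> X" using g by (intro closed shift_X)
    have "N (S T (g - mz g)) \<le> M * N (g - mz g)" using S_le[OF assms, of T] T fX by simp
    then have "(N (S T (g - mz g)))\<^sup>2 \<le> (M * N (g - mz g))\<^sup>2"
      using semi_X[OF assms(1) less_imp_le[OF T] fX] by (intro power_mono) auto
    then have "B (S T (g - mz g)) (S T (g - mz g)) \<le> M\<^sup>2 * B (g - mz g) (g - mz g)"
      using semi_X[OF assms(1) less_imp_le[OF T] fX] fX by (simp add: power_mult_distrib N_sq)
    then have "2 * T * q g g \<le> M\<^sup>2 * B (g - mz g) (g - mz g)"
      using B_affine[OF assms g, of T] T B_nonneg[OF fX] by simp
    then show ?thesis using T by (simp add: w_def field_simps)
  qed
  moreover have "0 \<le> w" using T by (simp add: w_def)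
  ultimately show ?thesis unfolding dominated_def by blast
qed

lemma dominated_loc_bounded:
  assumes w: "dominated w" and T: "0 < T"
  shows "loc_bounded T (sqrt (1 + 2 * T * w))"
  unfolding loc_bounded_def
proof (intro conjI allI impI T)
  have w0: "0 \<le> w" using w by (simp add: dominated_def)
  show "0 \<le> sqrt (1 + 2 * T * w)" using w0 T by simp
  fix s x assume s: "0 \<le> s" "s \<le> T" "x \<in> X"
  have "B (S s x) (S s x) \<le> (1 + 2 * s * w) * B x x" by (rule dominated_bound[OF w s(1,3)])
  also have "\<dots> \<le> (1 + 2 * T * w) * B x x"
    using s w0 B_nonneg[OF s(3)] by (intro mult_right_mono add_left_mono) auto
  finally show "N (S s x) \<le> sqrt (1 + 2 * T * w) * N x"
    unfolding N_def real_sqrt_mult[symmetric] by (rule real_sqrt_le_mono)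
qed

text \<open>Along orbits starting in the range of I - M_z the squared norm is affine in time, so its
  second difference vanishes; density extends this to all \<open>x\<close>.\<close>

lemma dominated_two_isometric:
  assumes w: "dominated w" and t: "0 \<le> t" and x: "x \<in> X"
  shows "B (S t (S t x)) (S t (S t x)) - 2 * B (S t x) (S t x) + B x x = 0"
proof -
  \<comment> \<open>Large enough that both \<open>t\<close> and \<open>2 * t\<close> lie in
    \<open>{0..T}\<close>.\<close>
  define T where "T = 2 * t + 1"
  have T: "0 < T" "t \<in> {0..T}" "2 * t \<in> {0..T}" using t by (auto simp: T_def)
  note sl = dominated_semi[OF w] dominated_loc_bounded[OF w T(1)]
  have SS: "S t (S t f) = S (2 * t) f" for f using S_add[of t t f] by simp
  obtain k where k: "\<And>j. k j \<in> X" "(\<lambda>j. N ((k j - mz (k j)) - x)) \<longlonglongrightarrow> 0"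
    using range_approx[OF sl x] by blast
  define u where "u j = k j - mz (k j)" for j
  have u: "u j \<in> X" for j unfolding u_def using k(1) by (intro closed shift_X)
  have ux: "(\<lambda>j. N (u j - x)) \<longlonglongrightarrow> 0" using k(2) by (simp add: u_def)
  have "B (S (2 * t) (u j)) (S (2 * t) (u j)) - 2 * B (S t (u j)) (S t (u j)) + B (u j) (u j) = 0" for j
    unfolding u_def B_affine[OF sl k(1) T(2)] B_affine[OF sl k(1) T(3)] by simp
  moreover have "(\<lambda>j. B (S (2 * t) (u j)) (S (2 * t) (u j)) - 2 * B (S t (u j)) (S t (u j)) + B (u j) (u j))
     \<longlonglongrightarrow> B (S (2 * t) x) (S (2 * t) x) - 2 * B (S t x) (S t x) + B x x"
    by (intro tendsto_intros B_tendsto_diag u x ux S_in[OF sl] S_tendsto[OF sl u x ux] T)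
  ultimately show ?thesis unfolding SS by (simp add: LIMSEQ_const_iff)
qed

text \<open>At \<open>t = 0\<close> both sides of the squared inequality agree, so their first-order
  terms are ordered: \<open>2 * B v f \<le> 2 * w * B f f\<close> with \<open>f = g - mz g\<close>
  and \<open>v = gen g\<close>, and here \<open>B v f = q g g\<close>.\<close>

lemma quasicontractive_dominated:
  assumes semi and w: "0 \<le> w" and qc: "\<And>t f. 0 \<le> t \<Longrightarrow> f \<in> X \<Longrightarrow> N (S t f) \<le> exp (w * t) * N f"
  shows "dominated w"
  unfolding dominated_def
proof (intro conjI ballI w)
  fix g assume g: "g \<in> X"
  define f v where "f = g - mz g" and "v = gen g"
  have X: "f \<in> X" "v \<in> X" unfolding f_def v_def using g by (auto intro: closed shift_X gen_X)
  define d where "d t = rs (1 / t) (S t f - f)" for t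
  have dX: "d t \<in> X" if "0 < t" for t unfolding d_def using semi_X[OF assms(1) less_imp_le[OF that] X(1)] X by (intro closed)
  have dv: "((\<lambda>t. N (d t - v)) \<longlongrightarrow> 0) (at_right 0)"
    unfolding d_def f_def v_def by (rule semi_generator[OF assms(1) g])
  have ev: "\<forall>\<^sub>F t in at_right 0. 0 < (t :: real)" by (rule eventually_at_right_less)
  have N1: "((\<lambda>t. N (d t)) \<longlongrightarrow> N v) (at_right 0)"
    using ev dX by (intro N_tendsto[OF _ X(2) dv]) (auto elim: eventually_mono)
  have B1: "((\<lambda>t. B (d t) f) \<longlongrightarrow> B v f) (at_right 0)"
  proof (rule LIM_zero_cancel, rule Lim_null_comparison)
    show "((\<lambda>t. N (d t - v) * N f) \<longlongrightarrow> 0) (at_right 0)" by (rule tendsto_mult_left_zero[OF dv])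
    show "\<forall>\<^sub>F t in at_right 0. norm (B (d t) f - B v f) \<le> N (d t - v) * N f"
      using ev
    proof eventually_elim
      case (elim t)
      then show ?case using cauchy_schwarz[OF diff_closed[OF dX[OF elim] X(2)] X(1)] dX[OF elim] X by (simp add: B_lin)
    qed
  qed
  have le: "\<forall>\<^sub>F t in at_right 0. 2 * B (d t) f + t * (N (d t))\<^sup>2 \<le> (exp (2 * w * t) - 1) / t * B f f"
    using ev
  proof eventually_elim
    case (elim t)
    have St: "S t f = f + rs t (d t)" using elim by (simp add: d_def scaleC_scaleC)
    have "(N (S t f))\<^sup>2 \<le> (exp (w * t) * N f)\<^sup>2"
      using qc[OF less_imp_le[OF elim] X(1)] semi_X[OF assms(1) less_imp_le[OF elim] X(1)] by (intro power_mono) auto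
    then have "B (S t f) (S t f) \<le> exp (2 * w * t) * B f f"
      using semi_X[OF assms(1) less_imp_le[OF elim] X(1)] X
      by (simp add: N_sq power_mult_distrib power2_eq_square[of "exp _"] exp_add[symmetric] mult_ac)
    moreover have "B (S t f) (S t f) = B f f + 2 * t * B (d t) f + t\<^sup>2 * (N (d t))\<^sup>2"
      unfolding St N_sq[OF dX[OF elim]] using dX[OF elim] X B_sym[of f "d t"]
      by (simp add: closed B_lin power2_eq_square algebra_simps)
    ultimately have "t * (2 * B (d t) f + t * (N (d t))\<^sup>2) \<le> (exp (2 * w * t) - 1) * B f f"
      by (simp add: algebra_simps power2_eq_square)
    then show ?case using elim by (simp add: field_simps)
  qed
  have "((\<lambda>t. (exp (2 * w * t) - 1) / t) \<longlongrightarrow> 2 * w) (at 0)"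
  proof -
    have "((\<lambda>t. exp (2 * w * t)) has_real_derivative 2 * w) (at 0)"
      by (auto intro!: derivative_eq_intros)
    then show ?thesis by (simp add: has_field_derivative_iff)
  qed
  then have "((\<lambda>t. (exp (2 * w * t) - 1) / t) \<longlongrightarrow> 2 * w) (at_right 0)"
    by (rule filterlim_at_split[THEN iffD1, THEN conjunct2])
  then have R: "((\<lambda>t. (exp (2 * w * t) - 1) / t * B f f) \<longlongrightarrow> 2 * w * B f f) (at_right 0)"
    by (intro tendsto_mult tendsto_const)
  have "((\<lambda>t. 2 * B (d t) f + t * (N (d t))\<^sup>2) \<longlongrightarrow> 2 * B v f + 0 * (N v)\<^sup>2) (at_right 0)"
    by (intro tendsto_intros B1 N1)
  from tendsto_le[OF trivial_limit_at_right_real R this le]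
  have "B v f \<le> w * B f f" by simp
  moreover have "B v f = q g g"
    unfolding v_def f_def gen_def using g shift_X(1)[OF g] B_sym[of "mz g" g]
    by (simp add: closed B_lin q_def B_scaleR[of _ _ "-1", simplified])
  ultimately show "q g g \<le> w * B (g - mz g) (g - mz g)" by (simp add: f_def)
qed

end

section \<open>The defect form of the shift on polynomials\<close>

text \<open>The constant is that of \<open>qf_bound\<close> plus 1, because the shift adds
  \<open>qf\<close> to the squared norm.\<close>

sublocale op_measure \<subseteq> D: fatou_space "dirichlet_space \<mu>" B "range poly_fun" "2 * mf_const + 3"
proof
  show "0 \<in> dirichlet_space \<mu>" using dirichlet_scaleC(1)[OF poly_fun_dirichlet, of 0] by simp
  show "f z = 0" if "f \<in> dirichlet_space \<mu>" "z \<notin> disc" for f z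
    using that by (elim dirichlet_spaceE) blast
  show "B f g = B g f" for f g unfolding B_def by (rule Bs_sym)
  show "f \<in> dirichlet_space \<mu> \<and> B f f \<le> K"
    if "\<And>j :: nat. F j \<in> dirichlet_space \<mu>" "\<And>j. B (F j) (F j) \<le> K" "\<And>z. z \<in> disc \<Longrightarrow> (\<lambda>j. F j z) \<longlonglongrightarrow> f z"
      "\<And>z. z \<notin> disc \<Longrightarrow> f z = 0" for F K f
    using dirichlet_fatou[OF that] by blast
  show "range poly_fun \<subseteq> dirichlet_space \<mu>" using poly_fun_dirichlet by blast
  show "\<exists>p\<in>range poly_fun. B (f - p) (f - p) < e" if "f \<in> dirichlet_space \<mu>" "0 < e" for f e
    using polys_dense[OF that] by blast
  fix p assume "p \<in> range (poly_fun :: 'e poly \<Rightarrow> _)"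
  then obtain r where p: "p = poly_fun r" by blast
  show "mz p \<in> range poly_fun" unfolding p mz_poly_fun by blast
  show "B p p \<le> B (mz p) (mz p)" unfolding p B_shift_poly[OF lessI] using qf_nonneg[of "Suc (degree r)" "coeff r"] by simp
  show "B (mz p) (mz p) \<le> (2 * mf_const + 3) * B p p"
    unfolding p B_shift_poly[OF lessI] using qf_bound[OF lessI, of r] by (simp add: algebra_simps)
  have "degree (pCons 0 r) < Suc (Suc (degree r))" using degree_pCons_le[of 0 r] by simp
  from B_shift_poly[OF this] have "B (mz (mz p)) (mz (mz p)) = B (mz p) (mz p) + qf (Suc (degree r)) (coeff r)"
    unfolding p mz_poly_fun qf_shift by simp
  then show "B (mz (mz p)) (mz (mz p)) - 2 * B (mz p) (mz p) + B p p = 0"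
    using B_shift_poly[OF lessI, of r] unfolding p by simp
qed (use dirichlet_add dirichlet_scaleC dirichlet_B_add dirichlet_B_scaleR dirichlet_B_nonneg dirichlet_eval in blast)+

context op_measure begin

lemma q_poly_fun: "degree p < N \<Longrightarrow> D.q (poly_fun p) (poly_fun p) = qf N (coeff p)"
  by (simp add: D.q_def B_shift_poly)

lemma poly_fun_add: "poly_fun (p + r) = (poly_fun p + poly_fun r :: complex \<Rightarrow> 'e)"
proof (rule sym, rule poly_fun_eqI)
  have "coeff p + coeff r = coeff (p + r)" by (simp add: fun_eq_iff)
  then show "has_taylor (poly_fun p + poly_fun r) (coeff (p + r))"
    using taylor_add[OF taylor_poly_fun[of p] taylor_poly_fun[of r]] by simp
qed (simp add: poly_fun_def)

lemma poly_fun_sum: "poly_fun (\<Sum>i\<in>I. p i) = (\<Sum>i\<in>I. poly_fun (p i) :: complex \<Rightarrow> 'e)"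
proof (induction I rule: infinite_finite_induct)
  case (insert x F)
  then show ?case by (simp add: poly_fun_add)
qed (simp_all add: poly_fun_def fun_eq_iff)

lemma poly_fun_monoms: "degree p < N \<Longrightarrow> poly_fun p = (\<Sum>k<N. poly_fun (monom (coeff p k) k) :: complex \<Rightarrow> 'e)"
  unfolding poly_fun_sum[symmetric]
  by (rule arg_cong[of _ _ poly_fun]) (simp add: poly_eq_iff coeff_sum_monom flip: coeff_eq_trunc)

lemma mf_monoms:
  assumes "k < N" "l < N"
  shows "(\<Sum>i<N. \<Sum>j<N. Re (mf (int j - int i) (coeff (monom a k) i) (coeff (monom b l) j))) = Re (mf (int l - int k) a b)"
proof -
  have "Re (mf (int j - int i) (coeff (monom a k) i) (coeff (monom b l) j)) =
      (if k = i then if l = j then Re (mf (int j - int i) a b) else 0 else 0)" for i j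
    by (simp add: mf_zero)
  then have "(\<Sum>i<N. \<Sum>j<N. Re (mf (int j - int i) (coeff (monom a k) i) (coeff (monom b l) j))) =
      (\<Sum>i<N. \<Sum>j<N. if k = i then if l = j then Re (mf (int j - int i) a b) else 0 else 0)" by (simp only:)
  also have "\<dots> = (\<Sum>i<N. if k = i then \<Sum>j<N. if l = j then Re (mf (int j - int i) a b) else 0 else 0)"
    by (intro sum.cong) auto
  also have "\<dots> = Re (mf (int l - int k) a b)" using assms by simp
  finally show ?thesis .
qed

text \<open>So far \<open>q\<close> is known on the diagonal only; the entry comes from expanding at
  \<open>monom a k + monom b l\<close>, where the two cross terms have equal real parts by
  \<open>mf_uminus\<close>.\<close>

lemma q_monom: "D.q (poly_fun (monom a k)) (poly_fun (monom b l)) = Re (mf (int l - int k) a b)"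
proof -
  define N where "N = Suc (k + l)"
  have N: "k < N" "l < N" by (auto simp: N_def)
  have d: "degree (monom a k) < N" "degree (monom b l) < N" "degree (monom a k + monom b l) < N"
    using degree_monom_le[of a k] degree_monom_le[of b l] N by (auto intro: degree_add_less)
  let ?f = "poly_fun (monom a k)" and ?g = "poly_fun (monom b l)"
  have "D.q (?f + ?g) (?f + ?g) = D.q ?f ?f + 2 * D.q ?f ?g + D.q ?g ?g"
    using poly_fun_dirichlet[of "monom a k"] poly_fun_dirichlet[of "monom b l"] D.q_sym[of ?f ?g]
    by (simp add: D.q_lin D.add_closed)
  moreover have "qf N (coeff (monom a k + monom b l)) = qf N (coeff (monom a k)) + qf N (coeff (monom b l))
     + (Re (mf (int l - int k) a b) + Re (mf (int k - int l) b a))"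
    unfolding qf_def mf_monoms[OF N, symmetric] mf_monoms[OF N(2,1), symmetric] coeff_add
    by (simp only: mf_add_left mf_add_right plus_complex.sel sum.distrib algebra_simps)
  moreover have "Re (mf (int k - int l) b a) = Re (mf (int l - int k) a b)"
    using mf_uminus[of "int l - int k" b a] by simp
  ultimately show ?thesis using q_poly_fun[OF d(1)] q_poly_fun[OF d(2)] q_poly_fun[OF d(3)] by (simp add: poly_fun_add)
qed

lemma mf_J_powers: "mf (int l - int k) x y = complex_of_real (1 / (2 * pi)) * J (\<lambda>\<zeta>. \<zeta> ^ k * cnj (\<zeta> ^ l)) x y"
proof -
  have "J (\<lambda>\<zeta>. cnj (\<zeta> powi (int l - int k))) = J (\<lambda>\<zeta>. \<zeta> ^ k * cnj (\<zeta> ^ l))"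
  proof (rule J_cong)
    fix \<zeta> :: complex assume z: "\<zeta> \<in> circle"
    then have "\<zeta> \<noteq> 0" by auto
    then have "\<zeta> powi (int l - int k) = \<zeta> ^ l * inverse \<zeta> ^ k" by (simp add: power_int_diff power_inverse divide_inverse)
    then show "cnj (\<zeta> powi (int l - int k)) = \<zeta> ^ k * cnj (\<zeta> ^ l)" by (simp add: circle_inverse[OF z])
  qed
  then show ?thesis by (simp add: mf_J)
qed

lemma mzp_monom: "D.mzp m (poly_fun (monom a k)) = poly_fun (monom a (m + k))"
  by (induction m) (simp_all add: D.mzp_0 D.mzp_Suc mz_poly_fun monom_Suc)

lemma mult_op_sum: "mult_op \<phi> (\<Sum>i\<in>I. F i) = (\<Sum>i\<in>I. mult_op \<phi> (F i) :: complex \<Rightarrow> 'e)"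
proof (induction I rule: infinite_finite_induct)
  case (insert x F)
  show ?case unfolding sum.insert[OF insert.hyps] mult_op_add insert.IH ..
qed (simp_all add: mult_op_def fun_eq_iff)

lemma q_sum_left:
  assumes "\<And>i. i \<in> I \<Longrightarrow> F i \<in> dirichlet_space \<mu>" "g \<in> dirichlet_space \<mu>"
  shows "D.q (\<Sum>i\<in>I. F i) g = (\<Sum>i\<in>I. D.q (F i) g)"
proof -
  have z: "D.q 0 g = 0" using D.q_lin(5)[OF assms(2,2,2), of 0] by simp
  show ?thesis using assms(1)
  proof (induction I rule: infinite_finite_induct)
    case (insert x I)
    have X: "F x \<in> dirichlet_space \<mu>" "(\<Sum>i\<in>I. F i) \<in> dirichlet_space \<mu>"
      using insert.prems by (auto intro!: D.sum_closed)
    have "D.q (\<Sum>i\<in>I. F i) g = (\<Sum>i\<in>I. D.q (F i) g)" by (rule insert.IH) (rule insert.prems, simp)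
    then show ?case unfolding sum.insert[OF insert.hyps] D.q_lin(1)[OF X assms(2)] by simp
  qed (simp_all add: z)
qed

lemma q_sum:
  assumes "\<And>i. i \<in> I \<Longrightarrow> F i \<in> dirichlet_space \<mu>" "\<And>j. j \<in> K \<Longrightarrow> G j \<in> dirichlet_space \<mu>"
  shows "D.q (\<Sum>i\<in>I. F i) (\<Sum>j\<in>K. G j) = (\<Sum>i\<in>I. \<Sum>j\<in>K. D.q (F i) (G j))"
proof -
  have "D.q (F i) (\<Sum>j\<in>K. G j) = (\<Sum>j\<in>K. D.q (F i) (G j))" if "i \<in> I" for i
    unfolding D.q_sym[of "F i"] using assms that by (intro q_sum_left) auto
  then show ?thesis using assms by (subst q_sum_left) (auto intro: D.sum_closed)
qed

lemma scaleC_fun_sum: "c *\<^sub>C (\<Sum>i\<in>I. F i) = (\<Sum>i\<in>I. c *\<^sub>C F i :: complex \<Rightarrow> 'e)"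
proof (induction I rule: infinite_finite_induct)
  case (insert x F)
  show ?case unfolding sum.insert[OF insert.hyps] scaleC_add_right insert.IH ..
qed (simp_all add: scaleC_fun_def fun_eq_iff)

section \<open>The defect form at a resolvent as an integral\<close>

definition geo :: "real \<Rightarrow> nat \<Rightarrow> complex \<Rightarrow> complex" where
  "geo \<alpha> M \<zeta> = (\<Sum>m<M. of_real (\<alpha> ^ m) * \<zeta> ^ m)"

text \<open>On monomials \<open>q\<close> is integration of \<zeta>^k times the conjugate of
  \<zeta>^l. The truncated Neumann series multiplies both factors by the partial sum
  \<open>geo\<close>, so its squared modulus appears as a density.\<close>

lemma q_res_sum:
  assumes N: "degree p < N"
  shows "D.q (D.res_sum \<alpha> M (poly_fun p)) (D.res_sum \<alpha> M (poly_fun p)) =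
    (\<Sum>k<N. \<Sum>l<N. Re (J (\<lambda>\<zeta>. (geo \<alpha> M \<zeta> * cnj (geo \<alpha> M \<zeta>)) * (\<zeta> ^ k * cnj (\<zeta> ^ l))) (coeff p k) (coeff p l))) / (2 * pi)"
proof -
  let ?e = "\<lambda>k m. poly_fun (monom (coeff p k) (m + k))"
  define G where "G k = (\<Sum>m<M. complex_of_real (\<alpha> ^ m) *\<^sub>C ?e k m)" for k
  have eX: "?e k m \<in> dirichlet_space \<mu>" for k m by (rule poly_fun_dirichlet)
  have "D.mzp m (poly_fun p) = (\<Sum>k<N. ?e k m)" for m
    unfolding mzp_monom[symmetric] D.mzp_def mult_op_sum[symmetric] poly_fun_monoms[OF N, symmetric] ..
  then have "D.res_sum \<alpha> M (poly_fun p) = (\<Sum>k<N. G k)"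
    unfolding D.res_sum_def G_def by (subst sum.swap) (simp only: scaleC_fun_sum)
  moreover have "D.q (G k) (G l) = Re (J (\<lambda>\<zeta>. (geo \<alpha> M \<zeta> * cnj (geo \<alpha> M \<zeta>)) * (\<zeta> ^ k * cnj (\<zeta> ^ l))) (coeff p k) (coeff p l)) / (2 * pi)" for k l
  proof -
    have "D.q (G k) (G l) = (\<Sum>m<M. \<Sum>n<M. \<alpha> ^ m * (\<alpha> ^ n * D.q (?e k m) (?e l n)))"
      unfolding G_def by (subst q_sum) (simp_all only: D.q_lin(5)[OF eX eX D.scaleC_closed[OF eX]] D.q_lin(6)[OF eX eX eX] D.scaleC_closed[OF eX])
    also have "\<dots> = Re (\<Sum>m<M. \<Sum>n<M. complex_of_real (\<alpha> ^ m * \<alpha> ^ n) * J (\<lambda>\<zeta>. \<zeta> ^ (m + k) * cnj (\<zeta> ^ (n + l))) (coeff p k) (coeff p l)) / (2 * pi)"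
      unfolding q_monom mf_J_powers by (simp add: sum_divide_distrib mult_ac)
    also have "(\<Sum>m<M. \<Sum>n<M. complex_of_real (\<alpha> ^ m * \<alpha> ^ n) * J (\<lambda>\<zeta>. \<zeta> ^ (m + k) * cnj (\<zeta> ^ (n + l))) (coeff p k) (coeff p l))
       = J (\<lambda>\<zeta>. \<Sum>m<M. \<Sum>n<M. complex_of_real (\<alpha> ^ m * \<alpha> ^ n) * (\<zeta> ^ (m + k) * cnj (\<zeta> ^ (n + l)))) (coeff p k) (coeff p l)"
    proof -
      have b: "bdd_fun (\<lambda>\<zeta>. \<zeta> ^ (m + k) * cnj (\<zeta> ^ (n + l)))" for m n by (intro bdd_mult bdd_cnj bdd_power bdd_ident)
      have b2: "bdd_fun (\<lambda>\<zeta>. complex_of_real (\<alpha> ^ m * \<alpha> ^ n) * (\<zeta> ^ (m + k) * cnj (\<zeta> ^ (n + l))))" for m n by (rule bdd_mult[OF bdd_const b])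
      show ?thesis
        by (simp only: J_sum[OF finite_lessThan bdd_sum[OF b2]] J_sum[OF finite_lessThan b2] J_cmult[OF bdd_op_integrable[OF b]])
    qed
    also have "(\<lambda>\<zeta>. \<Sum>m<M. \<Sum>n<M. complex_of_real (\<alpha> ^ m * \<alpha> ^ n) * (\<zeta> ^ (m + k) * cnj (\<zeta> ^ (n + l))))
       = (\<lambda>\<zeta>. (geo \<alpha> M \<zeta> * cnj (geo \<alpha> M \<zeta>)) * (\<zeta> ^ k * cnj (\<zeta> ^ l)))"
      unfolding geo_def cnj_sum sum_product unfolding sum_distrib_right by (simp add: power_add mult_ac)
    finally show ?thesis .
  qed
  moreover have "G k \<in> dirichlet_space \<mu>" for k unfolding G_def by (intro D.sum_closed D.scaleC_closed eX)
  ultimately show ?thesis by (simp add: q_sum sum_divide_distrib)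
qed

definition szego :: "real \<Rightarrow> complex \<Rightarrow> complex" where
  "szego \<alpha> \<zeta> = of_real (1 / (cmod (1 - of_real \<alpha> * \<zeta>))\<^sup>2)"

lemma szego_le:
  assumes "0 \<le> \<alpha>" "\<alpha> < 1" "\<zeta> \<in> circle"
  shows "1 - \<alpha> \<le> cmod (1 - of_real \<alpha> * \<zeta>)"
  using norm_triangle_ineq2[of 1 "of_real \<alpha> * \<zeta>"] assms by (simp add: norm_mult)

lemma bdd_szego:
  assumes "0 \<le> \<alpha>" "\<alpha> < 1"
  shows "bdd_fun (szego \<alpha>)"
  unfolding bdd_fun_def
proof (intro conjI exI ballI)
  show "szego \<alpha> \<in> borel_measurable CB"
    unfolding szego_def[abs_def] by (intro measurable_restrict_space1) measurable
  fix \<zeta> assume z: "\<zeta> \<in> circle"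
  have "1 / (cmod (1 - of_real \<alpha> * \<zeta>))\<^sup>2 \<le> 1 / (1 - \<alpha>)\<^sup>2"
    using szego_le[OF assms z] assms by (intro divide_left_mono power_mono mult_pos_pos zero_less_power) auto
  then show "cmod (szego \<alpha> \<zeta>) \<le> 1 / (1 - \<alpha>)\<^sup>2" by (simp add: szego_def norm_divide norm_power)
qed

text \<open>Both sides are limits in \<open>M\<close>: the left by norm convergence of the Neumann
  series, the right by bounded convergence, since the geometric sums are at most
  \<open>1 / (1 - \<alpha>)\<close> on the circle.\<close>

lemma q_res:
  assumes \<alpha>: "0 \<le> \<alpha>" "\<alpha> < 1" and N: "degree p < N"
  shows "D.q (D.res \<alpha> (poly_fun p)) (D.res \<alpha> (poly_fun p)) =
    (\<Sum>k<N. \<Sum>l<N. Re (J (\<lambda>\<zeta>. szego \<alpha> \<zeta> * (\<zeta> ^ k * cnj (\<zeta> ^ l))) (coeff p k) (coeff p l))) / (2 * pi)"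
proof -
  have a: "\<bar>\<alpha>\<bar> < 1" using \<alpha> by simp
  have lim: "(\<lambda>M. J (\<lambda>\<zeta>. (geo \<alpha> M \<zeta> * cnj (geo \<alpha> M \<zeta>)) * (\<zeta> ^ k * cnj (\<zeta> ^ l))) x y)
      \<longlonglongrightarrow> J (\<lambda>\<zeta>. szego \<alpha> \<zeta> * (\<zeta> ^ k * cnj (\<zeta> ^ l))) x y" for k l x y
  proof (rule J_bounded_convergence)
    have bp: "bdd_fun (\<lambda>\<zeta>. \<zeta> ^ k * cnj (\<zeta> ^ l))" by (intro bdd_mult bdd_cnj bdd_power bdd_ident)
    have bg: "bdd_fun (\<lambda>\<zeta>. geo \<alpha> M \<zeta>)" for M
      unfolding geo_def by (intro bdd_sum bdd_mult bdd_const bdd_power bdd_ident)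
    show "bdd_fun (\<lambda>\<zeta>. (geo \<alpha> M \<zeta> * cnj (geo \<alpha> M \<zeta>)) * (\<zeta> ^ k * cnj (\<zeta> ^ l)))" for M
      by (intro bdd_mult[OF _ bp] bdd_mult bdd_cnj bg)
    show "bdd_fun (\<lambda>\<zeta>. szego \<alpha> \<zeta> * (\<zeta> ^ k * cnj (\<zeta> ^ l)))" by (rule bdd_mult[OF bdd_szego[OF \<alpha>] bp])
    fix \<zeta> assume z: "\<zeta> \<in> circle"
    show "cmod ((geo \<alpha> M \<zeta> * cnj (geo \<alpha> M \<zeta>)) * (\<zeta> ^ k * cnj (\<zeta> ^ l))) \<le> (1 / (1 - \<alpha>)) * (1 / (1 - \<alpha>))" for M
    proof -
      have "cmod (geo \<alpha> M \<zeta>) \<le> (\<Sum>m<M. \<alpha> ^ m)"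
        unfolding geo_def using z \<alpha> by (intro order_trans[OF norm_sum] sum_mono) (simp add: norm_mult norm_power)
      also have "\<dots> \<le> (\<Sum>m. \<alpha> ^ m)" using a \<alpha> by (intro sum_le_suminf summable_geometric) auto
      also have "\<dots> = 1 / (1 - \<alpha>)" using a by (intro suminf_geometric) simp
      finally show ?thesis using z by (simp only: norm_mult norm_power complex_mod_cnj mem_sphere_0 power_one mult_1_right)
        (rule mult_mono'; simp)
    qed
    have ne: "cmod (of_real \<alpha> * \<zeta>) < 1" using z a by (simp add: norm_mult)
    have "(\<lambda>M. geo \<alpha> M \<zeta>) \<longlonglongrightarrow> 1 / (1 - of_real \<alpha> * \<zeta>)"
      using geometric_sums[OF ne] unfolding sums_def geo_def by (simp add: power_mult_distrib)
    then have "(\<lambda>M. (geo \<alpha> M \<zeta> * cnj (geo \<alpha> M \<zeta>)) * (\<zeta> ^ k * cnj (\<zeta> ^ l)))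
       \<longlonglongrightarrow> (1 / (1 - of_real \<alpha> * \<zeta>) * cnj (1 / (1 - of_real \<alpha> * \<zeta>))) * (\<zeta> ^ k * cnj (\<zeta> ^ l))"
      by (intro tendsto_intros)
    also have "1 / (1 - of_real \<alpha> * \<zeta>) * cnj (1 / (1 - of_real \<alpha> * \<zeta>)) = szego \<alpha> \<zeta>"
      unfolding szego_def complex_norm_square[symmetric] by (simp add: norm_divide power_divide)
    finally show "(\<lambda>M. (geo \<alpha> M \<zeta> * cnj (geo \<alpha> M \<zeta>)) * (\<zeta> ^ k * cnj (\<zeta> ^ l))) \<longlonglongrightarrow> szego \<alpha> \<zeta> * (\<zeta> ^ k * cnj (\<zeta> ^ l))" .
  qed
  have "(\<lambda>M. D.q (D.res_sum \<alpha> M (poly_fun p)) (D.res_sum \<alpha> M (poly_fun p)))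
     \<longlonglongrightarrow> (\<Sum>k<N. \<Sum>l<N. Re (J (\<lambda>\<zeta>. szego \<alpha> \<zeta> * (\<zeta> ^ k * cnj (\<zeta> ^ l))) (coeff p k) (coeff p l))) / (2 * pi)"
    unfolding q_res_sum[OF N] by (intro tendsto_intros lim) simp
  moreover have "(\<lambda>M. D.q (D.res_sum \<alpha> M (poly_fun p)) (D.res_sum \<alpha> M (poly_fun p))) \<longlonglongrightarrow> D.q (D.res \<alpha> (poly_fun p)) (D.res \<alpha> (poly_fun p))"
    by (intro D.q_tendsto_diag D.res_X poly_fun_dirichlet a)
      (auto simp: D.res_sum_def intro!: D.sum_closed D.scaleC_closed D.mzp_X poly_fun_dirichlet)
  ultimately show ?thesis by (rule LIMSEQ_unique[rotated])
qed

end

section \<open>The measure divided by the squared distance to 1\<close>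

text \<open>By division by zero \<open>wt 1 = 0\<close>; the integrals of \<open>wt\<close> and \<open>ewt\<close> agree once \<open>ewt\<close> is integrable.\<close>

definition wt :: "complex \<Rightarrow> real" where "wt \<zeta> = 1 / (cmod (1 - \<zeta>))\<^sup>2"

definition ewt :: "complex \<Rightarrow> ennreal" where
  "ewt \<zeta> = (if \<zeta> = 1 then \<infinity> else ennreal (1 / (cmod (1 - \<zeta>))\<^sup>2))"

lemma wt_nonneg [simp]: "0 \<le> wt \<zeta>" by (simp add: wt_def)
lemma wt_measurable [measurable]: "wt \<in> borel_measurable borel" unfolding wt_def[abs_def] by measurable
lemma ewt_measurable [measurable]: "ewt \<in> borel_measurable borel" unfolding ewt_def[abs_def] by measurable
lemma wt_le_ewt: "ennreal (wt \<zeta>) \<le> ewt \<zeta>" by (simp add: wt_def ewt_def)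

context op_measure begin

lemma borel_dm: "f \<in> borel_measurable borel \<Longrightarrow> f \<in> borel_measurable (dm x)" for f :: "complex \<Rightarrow> 'b::topological_space"
  using measurable_restrict_space1[of f borel borel circle] measurable_cong_sets[OF sets_dm refl, of x "borel :: 'b measure"] by blast

lemma CB_dm: "f \<in> borel_measurable CB \<Longrightarrow> f \<in> borel_measurable (dm x)" for f :: "complex \<Rightarrow> 'b::topological_space"
  using measurable_cong_sets[OF sets_dm refl, of x "borel :: 'b measure"] by blast

lemma CB_borel: "f \<in> borel_measurable borel \<Longrightarrow> f \<in> borel_measurable CB" for f :: "complex \<Rightarrow> 'b::topological_space"
  by (rule measurable_restrict_space1)

lemma J_cong_AE:
  assumes "f \<in> borel_measurable CB" "g \<in> borel_measurable CB" "\<And>x. AE \<zeta> in dm x. f \<zeta> = g \<zeta>"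
  shows "J f = J g"
  unfolding J_def
  by (rule arg_cong[of _ _ polar], rule ext, rule integral_cong_AE) (use assms CB_dm in auto)

text \<open>Existence of the weighted measure in quantitative form: the bound is quadratic in
  \<open>x\<close>, as for the form of a bounded operator.\<close>

definition finite_weight :: "real \<Rightarrow> bool" where
  "finite_weight K \<longleftrightarrow> 0 \<le> K \<and> (\<forall>x. (\<integral>\<^sup>+\<zeta>. ewt \<zeta> \<partial>dm x) \<le> ennreal (K * (norm x)\<^sup>2))"

text \<open>The value of the weighted measure on the whole circle is a bounded operator, and a bound
  for it serves as \<open>K\<close>.\<close>

lemma tilde_finite_weight:
  assumes "tilde_is_operator_measure \<mu>"
  shows "\<exists>K. finite_weight K"
proof -
  define T where "T = tilde_measure \<mu> circle"
  have sp: "tilde_measure_spec \<mu> circle T"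
    using assms by (simp add: tilde_is_operator_measure_def T_def)
  then have T: "bounded_clinear T" "\<And>x. ennreal (Re (cinner (T x) x)) = (\<integral>\<^sup>+\<zeta>\<in>circle. ewt \<zeta> \<partial>dm x)"
    by (auto simp: tilde_measure_spec_def positive_operator_def ewt_def)
  obtain K where K: "\<And>x. norm (T x) \<le> norm x * K" using bounded_clinearD(3)[OF T(1)] by blast
  have "(\<integral>\<^sup>+\<zeta>. ewt \<zeta> \<partial>dm x) \<le> ennreal (\<bar>K\<bar> * (norm x)\<^sup>2)" for x
  proof -
    have "(\<integral>\<^sup>+\<zeta>. ewt \<zeta> \<partial>dm x) = (\<integral>\<^sup>+\<zeta>\<in>circle. ewt \<zeta> \<partial>dm x)"
      by (intro nn_integral_cong) simp
    also have "\<dots> = ennreal (Re (cinner (T x) x))" by (rule T(2)[symmetric])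
    also have "\<dots> \<le> ennreal (\<bar>K\<bar> * (norm x)\<^sup>2)"
    proof (rule ennreal_leI)
      have "Re (cinner (T x) x) \<le> norm (T x) * norm x" unfolding Re_cinner by (rule norm_cauchy_schwarz)
      also have "\<dots> \<le> (norm x * \<bar>K\<bar>) * norm x"
        by (rule mult_right_mono[OF order_trans[OF K mult_left_mono]]) auto
      finally show "Re (cinner (T x) x) \<le> \<bar>K\<bar> * (norm x)\<^sup>2" by (simp add: power2_eq_square mult_ac)
    qed
    finally show ?thesis .
  qed
  then show ?thesis unfolding finite_weight_def by (intro exI[of _ "\<bar>K\<bar>"]) simp
qed

context
  fixes K :: real
  assumes fw: "finite_weight K"
begin

text \<open>\<open>ewt\<close> is infinite at 1, so a finite integral leaves no mass there.\<close>

lemma AE_not_1: "AE \<zeta> in dm x. \<zeta> \<noteq> 1"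
proof -
  have "(\<integral>\<^sup>+\<zeta>. ewt \<zeta> \<partial>dm x) \<le> ennreal (K * (norm x)\<^sup>2)" using fw by (simp add: finite_weight_def)
  from le_less_trans[OF this ennreal_less_top] have "(\<integral>\<^sup>+\<zeta>. ewt \<zeta> \<partial>dm x) \<noteq> \<infinity>" by simp
  then have "AE \<zeta> in dm x. ewt \<zeta> \<noteq> \<infinity>" by (intro nn_integral_PInf_AE borel_dm) auto
  then show ?thesis by (auto simp: ewt_def elim!: eventually_mono)
qed

lemma AE_ewt: "AE \<zeta> in dm x. ewt \<zeta> = ennreal (wt \<zeta>)"
  using AE_not_1[of x] by (auto simp: ewt_def wt_def elim!: eventually_mono)

lemma wt_integral: "integrable (dm x) wt" "(\<integral>\<zeta>. wt \<zeta> \<partial>dm x) \<le> K * (norm x)\<^sup>2"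
proof -
  have "(\<integral>\<^sup>+\<zeta>. ennreal (wt \<zeta>) \<partial>dm x) \<le> (\<integral>\<^sup>+\<zeta>. ewt \<zeta> \<partial>dm x)" by (intro nn_integral_mono wt_le_ewt)
  also have "\<dots> \<le> ennreal (K * (norm x)\<^sup>2)" using fw by (simp add: finite_weight_def)
  finally have le: "(\<integral>\<^sup>+\<zeta>. ennreal (wt \<zeta>) \<partial>dm x) \<le> ennreal (K * (norm x)\<^sup>2)" .
  show i: "integrable (dm x) wt"
    by (rule integrableI_nonneg) (use le in \<open>auto intro!: borel_dm elim: le_less_trans\<close>)
  have K0: "0 \<le> K * (norm x)\<^sup>2" using fw by (simp add: finite_weight_def)
  show "(\<integral>\<zeta>. wt \<zeta> \<partial>dm x) \<le> K * (norm x)\<^sup>2"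
    using le unfolding nn_integral_eq_integral[OF i AE_I2[OF wt_nonneg]] by (simp add: K0)
qed

lemma op_integrable_wt:
  assumes f: "bdd_fun f"
  shows "op_integrable (\<lambda>\<zeta>. f \<zeta> * of_real (wt \<zeta>))"
proof -
  obtain M where M: "f \<in> borel_measurable CB" "\<And>\<zeta>. \<zeta> \<in> circle \<Longrightarrow> cmod (f \<zeta>) \<le> M" using bddE[OF f] by blast
  have m: "(\<lambda>\<zeta>. f \<zeta> * of_real (wt \<zeta>)) \<in> borel_measurable CB"
    by (intro borel_measurable_times M CB_borel) measurable
  have le: "cmod (f \<zeta> * of_real (wt \<zeta>)) \<le> M * wt \<zeta>" if "\<zeta> \<in> circle" for \<zeta>
    using M(2)[OF that] by (simp add: norm_mult mult_right_mono)
  have iM: "integrable (dm x) (\<lambda>\<zeta>. M * wt \<zeta>)" for x by (intro integrable_mult_right wt_integral)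
  have i: "integrable (dm x) (\<lambda>\<zeta>. f \<zeta> * of_real (wt \<zeta>))" for x
    by (rule Bochner_Integration.integrable_bound[OF iM])
      (use le in \<open>auto intro!: CB_dm m AE_I2 intro: order_trans[OF _ abs_ge_self]\<close>)
  have "cmod (\<integral>\<zeta>. f \<zeta> * of_real (wt \<zeta>) \<partial>dm x) \<le> \<bar>M\<bar> * K * (norm x)\<^sup>2" for x
  proof -
    have "cmod (\<integral>\<zeta>. f \<zeta> * of_real (wt \<zeta>) \<partial>dm x) \<le> (\<integral>\<zeta>. cmod (f \<zeta> * of_real (wt \<zeta>)) \<partial>dm x)"
      by (rule integral_norm_bound)
    also have "\<dots> \<le> (\<integral>\<zeta>. \<bar>M\<bar> * wt \<zeta> \<partial>dm x)"
    proof (rule integral_mono)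
      show "integrable (dm x) (\<lambda>\<zeta>. cmod (f \<zeta> * of_real (wt \<zeta>)))" by (rule integrable_norm[OF i])
      show "integrable (dm x) (\<lambda>\<zeta>. \<bar>M\<bar> * wt \<zeta>)" by (intro integrable_mult_right wt_integral)
      show "cmod (f \<zeta> * of_real (wt \<zeta>)) \<le> \<bar>M\<bar> * wt \<zeta>" if "\<zeta> \<in> space (dm x)" for \<zeta>
        using le[of \<zeta>] that mult_right_mono[OF abs_ge_self[of M] wt_nonneg[of \<zeta>]] by simp
    qed
    also have "\<dots> \<le> \<bar>M\<bar> * (K * (norm x)\<^sup>2)" using wt_integral(2)[of x] by (simp add: mult_left_mono)
    finally show ?thesis by (simp add: mult_ac)
  qed
  then show ?thesis unfolding op_integrable_def using m i by blast
qed

lemma wt_indicator_integral: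
  assumes V: "V \<in> circle_borel"
  shows "(\<integral>\<zeta>. indicator V \<zeta> * of_real (wt \<zeta>) \<partial>dm x) = complex_of_real (\<integral>\<zeta>. indicator V \<zeta> * wt \<zeta> \<partial>dm x)"
    "(\<integral>\<^sup>+\<zeta>\<in>V. ewt \<zeta> \<partial>dm x) = ennreal (\<integral>\<zeta>. indicator V \<zeta> * wt \<zeta> \<partial>dm x)"
    "integrable (dm x) (\<lambda>\<zeta>. indicator V \<zeta> * wt \<zeta>)"
proof -
  have V': "V \<in> sets (dm x)" using V by (simp add: circle_borel_def)
  show i: "integrable (dm x) (\<lambda>\<zeta>. indicator V \<zeta> * wt \<zeta>)"
    using integrable_mult_indicator[OF V' wt_integral(1)] by simp
  have "(\<lambda>\<zeta>. indicator V \<zeta> * complex_of_real (wt \<zeta>)) = (\<lambda>\<zeta>. complex_of_real (indicator V \<zeta> * wt \<zeta>))"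
    by (auto simp: indicator_def)
  then show "(\<integral>\<zeta>. indicator V \<zeta> * of_real (wt \<zeta>) \<partial>dm x) = complex_of_real (\<integral>\<zeta>. indicator V \<zeta> * wt \<zeta> \<partial>dm x)"
    by (simp only: integral_complex_of_real)
  have "(\<integral>\<^sup>+\<zeta>\<in>V. ewt \<zeta> \<partial>dm x) = (\<integral>\<^sup>+\<zeta>. ennreal (indicator V \<zeta> * wt \<zeta>) \<partial>dm x)"
    using AE_ewt[of x] by (intro nn_integral_cong_AE) (auto simp: indicator_def elim!: eventually_mono)
  also have "\<dots> = ennreal (\<integral>\<zeta>. indicator V \<zeta> * wt \<zeta> \<partial>dm x)"
    by (rule nn_integral_eq_integral[OF i]) (auto simp: indicator_def)
  finally show "(\<integral>\<^sup>+\<zeta>\<in>V. ewt \<zeta> \<partial>dm x) = ennreal (\<integral>\<zeta>. indicator V \<zeta> * wt \<zeta> \<partial>dm x)" .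
qed

lemma wt_indicator_nonneg: "0 \<le> (\<integral>\<zeta>. indicator V \<zeta> * wt \<zeta> \<partial>dm x)"
  by (rule integral_nonneg_AE) (auto simp: indicator_def)

text \<open>The operator of the form with density \<open>wt\<close> meets the specification. The
  specification fixes the diagonal and therefore the operator, which resolves the
  \<open>THE\<close>.\<close>

lemma tilde_measure:
  assumes V: "V \<in> circle_borel"
  shows "tilde_measure_spec \<mu> V (tilde_measure \<mu> V)"
    "cinner (tilde_measure \<mu> V x) y = J (\<lambda>\<zeta>. indicator V \<zeta> * of_real (wt \<zeta>)) x y"
proof -
  have oi: "op_integrable (\<lambda>\<zeta>. indicator V \<zeta> * of_real (wt \<zeta>))" by (rule op_integrable_wt) (rule bdd_indicator[OF V])
  obtain T where T: "bounded_clinear T" "\<And>x y. cinner (T x) y = J (\<lambda>\<zeta>. indicator V \<zeta> * of_real (wt \<zeta>)) x y"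
    using J_operator[OF oi] by blast
  have "cinner (T x) x = complex_of_real (\<integral>\<zeta>. indicator V \<zeta> * wt \<zeta> \<partial>dm x)" for x
    by (simp only: T(2) J_diag[OF oi] wt_indicator_integral(1)[OF V])
  then have spec: "tilde_measure_spec \<mu> V T"
    using wt_indicator_integral(2)[OF V] wt_indicator_nonneg T(1)
    unfolding tilde_measure_spec_def positive_operator_def ewt_def by simp
  have "tilde_measure \<mu> V = T"
    unfolding tilde_measure_def
  proof (rule the_equality)
    show "tilde_measure_spec \<mu> V T" by (rule spec)
  next
    fix T' assume s': "tilde_measure_spec \<mu> V T'"
    have "cinner (T' x) x = cinner (T x) x" for x
    proof -
      have "ennreal (Re (cinner (T' x) x)) = ennreal (Re (cinner (T x) x))"
        using s' spec by (simp add: tilde_measure_spec_def)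
      then have "Re (cinner (T' x) x) = Re (cinner (T x) x)"
        by (subst (asm) ennreal_inj) (use s' spec in \<open>auto simp: tilde_measure_spec_def positive_operator_def\<close>)
      then show ?thesis using s' spec by (auto simp: tilde_measure_spec_def positive_operator_def complex_eq_iff)
    qed
    then show "T' = T" using s' T(1) by (intro bounded_clinear_eqI) (auto simp: tilde_measure_spec_def positive_operator_def)
  qed
  then show "tilde_measure_spec \<mu> V (tilde_measure \<mu> V)"
    "cinner (tilde_measure \<mu> V x) y = J (\<lambda>\<zeta>. indicator V \<zeta> * of_real (wt \<zeta>)) x y" using spec T(2) by auto
qed

text \<open>\<open>wt\<close> is at most \<open>real n\<close> plus a tail of small integral, and on
  the bounded part the regularity of \<open>\<mu>\<close> applies. The tail is chosen first because
  \<open>n\<close> enters the smallness required of \<open>\<mu>\<close>.\<close>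

lemma dm_regular:
  assumes V: "V \<in> circle_borel" and e: "0 < (e :: real)"
  obtains F U where "compact F" "openin (top_of_set circle) U" "F \<subseteq> V" "V \<subseteq> U"
    "\<And>A. A \<in> circle_borel \<Longrightarrow> A \<subseteq> U - F \<Longrightarrow> (\<integral>\<zeta>. indicator A \<zeta> * wt \<zeta> \<partial>dm x) < e"
proof -
  define tail where "tail n \<zeta> = wt \<zeta> - min (wt \<zeta>) (real n)" for n \<zeta>
  have "(\<lambda>n. \<integral>\<zeta>. tail n \<zeta> \<partial>dm x) \<longlonglongrightarrow> (\<integral>\<zeta>. 0 \<partial>dm x)"
  proof (rule integral_dominated_convergence[where w = wt])
    show "tail n \<in> borel_measurable (dm x)" for n unfolding tail_def[abs_def] by (rule borel_dm) measurable
    show "AE \<zeta> in dm x. (\<lambda>n. tail n \<zeta>) \<longlonglongrightarrow> 0"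
    proof (rule AE_I2)
      fix \<zeta>
      obtain n0 :: nat where "wt \<zeta> \<le> real n0" using real_arch_simple by blast
      then have "\<forall>n\<ge>n0. tail n \<zeta> = 0" by (auto simp: tail_def min_def)
      then show "(\<lambda>n. tail n \<zeta>) \<longlonglongrightarrow> 0" by (intro tendsto_eventually) (auto simp: eventually_sequentially)
    qed
    show "AE \<zeta> in dm x. norm (tail n \<zeta>) \<le> wt \<zeta>" for n by (rule AE_I2) (auto simp: tail_def min_def)
  qed (auto intro: wt_integral)
  then have "\<forall>\<^sub>F n in sequentially. (\<integral>\<zeta>. tail n \<zeta> \<partial>dm x) < e / 2" using e by (intro order_tendstoD(2)) auto
  then obtain n where n: "(\<integral>\<zeta>. tail n \<zeta> \<partial>dm x) < e / 2" using eventually_happens[of _ sequentially] by auto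
  have "complex_regular_measure (\<lambda>V. cinner (\<mu> V x) x)" using om by (simp add: operator_measure_def)
  then obtain F U where F: "compact F" "openin (top_of_set circle) U" "F \<subseteq> V" "V \<subseteq> U"
    and small: "\<And>A. A \<in> circle_borel \<Longrightarrow> A \<subseteq> U - F \<Longrightarrow> cmod (cinner (\<mu> A x) x) < e / (2 * (real n + 1))"
    using V e unfolding complex_regular_measure_def by (metis (no_types, lifting) add_nonneg_pos divide_pos_pos mult_pos_pos of_nat_0_le_iff zero_less_numeral zero_less_one)
  have "(\<integral>\<zeta>. indicator A \<zeta> * wt \<zeta> \<partial>dm x) < e" if A: "A \<in> circle_borel" "A \<subseteq> U - F" for A
  proof -
    interpret finite_measure "dm x" by (rule finite_dm)
    have A': "A \<in> sets (dm x)" using A by (simp add: circle_borel_def)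
    have ti: "integrable (dm x) (tail n)"
      by (rule Bochner_Integration.integrable_bound[OF wt_integral(1)])
        (auto simp: tail_def[abs_def] min_def intro!: borel_dm)
    have iA: "integrable (dm x) (\<lambda>\<zeta>. real n * indicator A \<zeta>)"
      by (intro integrable_mult_right integrable_real_indicator A') (simp add: emeasure_finite less_top[symmetric])
    note iB = Bochner_Integration.integrable_add[OF iA ti]
    have "(\<integral>\<zeta>. indicator A \<zeta> * wt \<zeta> \<partial>dm x) \<le> (\<integral>\<zeta>. real n * indicator A \<zeta> + tail n \<zeta> \<partial>dm x)"
    proof (rule integral_mono[OF wt_indicator_integral(3)[OF A(1)] iB])
      show "indicator A \<zeta> * wt \<zeta> \<le> real n * indicator A \<zeta> + tail n \<zeta>" for \<zeta>
        by (auto simp: tail_def min_def indicator_def)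
    qed
    also have "\<dots> = real n * measure (dm x) A + (\<integral>\<zeta>. tail n \<zeta> \<partial>dm x)"
      unfolding Bochner_Integration.integral_add[OF iA ti] by (simp add: Int_absorb2 circle_borel_subset[OF A(1)])
    also have "measure (dm x) A < e / (2 * (real n + 1))"
      using small[OF A] measure_nonneg[of "dm x" A] unfolding measure_dm[OF A(1), symmetric] by simp
    then have "real n * measure (dm x) A \<le> real n * (e / (2 * (real n + 1)))" by (intro mult_left_mono) auto
    also have "\<dots> \<le> e / 2" using e by (simp add: field_simps)
    finally show ?thesis using n by simp
  qed
  with F show thesis by (rule that)
qed

lemma tilde_operator_measure: "operator_measure (tilde_measure \<mu>)"
  unfolding operator_measure_def
proof (intro conjI ballI allI impI)
  let ?w = "\<lambda>V \<zeta>. indicator V \<zeta> * complex_of_real (wt \<zeta>)"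
  have oi: "op_integrable (?w V)" if "V \<in> circle_borel" for V by (rule op_integrable_wt) (rule bdd_indicator[OF that])
  show "positive_operator (tilde_measure \<mu> V)" if "V \<in> circle_borel" for V
    using tilde_measure(1)[OF that] by (simp add: tilde_measure_spec_def)
  have un: "V \<union> F \<in> circle_borel" if "V \<in> circle_borel" "F \<in> circle_borel" for V F
    using that unfolding circle_borel_def by (rule sets.Un)
  have J_un: "J (?w (V \<union> F)) x y = J (?w V) x y + J (?w F) x y"
    if "V \<in> circle_borel" "F \<in> circle_borel" "V \<inter> F = {}" for V F x y
  proof -
    have "?w (V \<union> F) = (\<lambda>\<zeta>. ?w V \<zeta> + ?w F \<zeta>)" using that(3) by (auto simp: indicator_def fun_eq_iff)
    then show ?thesis by (simp only: J_add[OF oi[OF that(1)] oi[OF that(2)]])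
  qed
  show "tilde_measure \<mu> (V \<union> F) = tilde_measure \<mu> V + tilde_measure \<mu> F"
    if "V \<in> circle_borel" "F \<in> circle_borel" "V \<inter> F = {}" for V F
    by (rule ext, rule cinner_eqI) (simp add: tilde_measure(2) un that J_un cinner_add_left)
  fix x y :: 'e
  show "complex_regular_measure (\<lambda>V. cinner (tilde_measure \<mu> V x) y)"
    unfolding complex_regular_measure_def
  proof (intro conjI ballI allI impI)
    fix A :: "nat \<Rightarrow> complex set" assume A: "range A \<subseteq> circle_borel" "disjoint_family A"
    have An: "A n \<in> circle_borel" for n using A by blast
    have U: "(\<Union>n. A n) \<in> circle_borel" using A(1) unfolding circle_borel_def by (rule sets.countable_UN)
    have P: "(\<Union>i<n. A i) \<in> circle_borel" for n
      unfolding circle_borel_def by (rule sets.finite_UN[OF finite_lessThan]) (rule An[unfolded circle_borel_def])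
    have part: "(\<Sum>i<n. J (?w (A i)) x y) = J (?w (\<Union>i<n. A i)) x y" for n
    proof (induction n)
      case (Suc n)
      have "A i \<inter> A n = {}" if "i < n" for i using A(2) that by (simp add: disjoint_family_on_def)
      then have "(\<Union>i<n. A i) \<inter> A n = {}" by blast
      then have "J (?w ((\<Union>i<n. A i) \<union> A n)) x y = J (?w (\<Union>i<n. A i)) x y + J (?w (A n)) x y" by (rule J_un[OF P An])
      moreover have "(\<Union>i<n. A i) \<union> A n = (\<Union>i<Suc n. A i)" by (auto simp: less_Suc_eq)
      ultimately show ?case using Suc by simp
    qed (simp add: J_zero)
    \<comment> \<open>Finite additivity has identified these terms with the partial sums of the
      series; their densities converge pointwise below the common majorant
      \<open>wt\<close>.\<close>
    have "(\<lambda>n. J (?w (\<Union>i<n. A i)) x y) \<longlonglongrightarrow> J (?w (\<Union>n. A n)) x y"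
    proof (rule J_dominated[where w = wt])
      show "?w (\<Union>i<n. A i) \<in> borel_measurable CB" for n using oi[OF P] by (simp add: op_integrable_def)
      show "?w (\<Union>n. A n) \<in> borel_measurable CB" using oi[OF U] by (simp add: op_integrable_def)
      show "AE \<zeta> in dm x. (\<lambda>n. ?w (\<Union>i<n. A i) \<zeta>) \<longlonglongrightarrow> ?w (\<Union>n. A n) \<zeta>" for x
      proof (rule AE_I2)
        fix \<zeta>
        have "(\<lambda>n. indicator (\<Union>i<n. A i) \<zeta> :: complex) \<longlonglongrightarrow> indicator (\<Union>n. A n) \<zeta>" by (rule LIMSEQ_indicator_UN)
        then show "(\<lambda>n. ?w (\<Union>i<n. A i) \<zeta>) \<longlonglongrightarrow> ?w (\<Union>n. A n) \<zeta>" by (intro tendsto_intros)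
      qed
    qed (auto simp: indicator_def intro: wt_integral)
    then show "(\<lambda>n. cinner (tilde_measure \<mu> (A n) x) y) sums cinner (tilde_measure \<mu> (\<Union>n. A n) x) y"
      unfolding sums_def tilde_measure(2)[OF An] tilde_measure(2)[OF U] part .
  next
    fix V and e :: real assume V: "V \<in> circle_borel" and e: "0 < e"
    \<comment> \<open>Regularity is known on the diagonal. Each of the four polarization vectors
      gets its own compact and open set with error \<open>e / 4\<close>; finite unions and
      intersections combine them.\<close>
    define us where "us = map snd (polar_list x y)"
    have "\<exists>F U. compact F \<and> openin (top_of_set circle) U \<and> F \<subseteq> V \<and> V \<subseteq> U \<and>
       (\<forall>A\<in>circle_borel. A \<subseteq> U - F \<longrightarrow> (\<integral>\<zeta>. indicator A \<zeta> * wt \<zeta> \<partial>dm u) < e / 4)" for u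
      using dm_regular[OF V, of "e / 4" u] e by (metis zero_less_divide_iff zero_less_numeral)
    then obtain F U where F: "\<And>u. compact (F u)" "\<And>u. openin (top_of_set circle) (U u)" "\<And>u. F u \<subseteq> V" "\<And>u. V \<subseteq> U u"
      and small: "\<And>u A. A \<in> circle_borel \<Longrightarrow> A \<subseteq> U u - F u \<Longrightarrow> (\<integral>\<zeta>. indicator A \<zeta> * wt \<zeta> \<partial>dm u) < e / 4" by metis
    let ?F = "\<Union>u\<in>set us. F u" and ?U = "\<Inter>u\<in>set us. U u"
    have ne: "set us \<noteq> {}" by (simp add: us_def polar_list_def)
    have "cmod (cinner (tilde_measure \<mu> A x) y) < e" if A: "A \<in> circle_borel" "A \<subseteq> ?U - ?F" for A
    proof -
      let ?m = "\<lambda>u. \<integral>\<zeta>. indicator A \<zeta> * wt \<zeta> \<partial>dm u"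
      have "cinner (tilde_measure \<mu> A x) y = polar (\<lambda>u. complex_of_real (?m u)) x y"
        unfolding tilde_measure(2)[OF A(1)] J_def wt_indicator_integral(1)[OF A(1)] ..
      also have "cmod \<dots> \<le> (\<Sum>u\<leftarrow>us. ?m u)"
      proof -
        have t: "cmod (a + b) \<le> c + d" if "cmod a \<le> c" "cmod b \<le> d" for a b :: complex and c d
          using that by (rule norm_triangle_mono)
        show ?thesis unfolding polar_eq_list us_def polar_list_def
          by (simp only: list.map sum_list.Cons prod.case snd_conv)
            (intro t; simp add: norm_mult wt_indicator_nonneg)
      qed
      also have "\<dots> < e"
      proof -
        have "?m u < e / 4" if "u \<in> set us" for u using small[OF A(1), of u] A(2) that by blast
        then show ?thesis by (simp add: us_def polar_list_def) (smt (verit) field_sum_of_halves)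
      qed
      finally show ?thesis .
    qed
    moreover have "compact ?F" using F(1) by (intro compact_UN) auto
    moreover have "openin (top_of_set circle) ?U" using F(2) ne by (intro openin_INT2) auto
    moreover have "?F \<subseteq> V" "V \<subseteq> ?U" using F(3,4) by auto
    ultimately show "\<exists>K U. compact K \<and> openin (top_of_set circle) U \<and> K \<subseteq> V \<and> V \<subseteq> U \<and>
        (\<forall>A\<in>circle_borel. A \<subseteq> U - K \<longrightarrow> cmod (cinner (tilde_measure \<mu> A x) y) < e)" by blast
  qed
qed

lemma tilde_is_operator: "tilde_is_operator_measure \<mu>"
  unfolding tilde_is_operator_measure_def using tilde_operator_measure tilde_measure(1) by blast

lemma tilde_op_measure: "op_measure (tilde_measure \<mu>)"
  by (rule op_measure.intro) (rule tilde_operator_measure)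

text \<open>The diagonal measures of the weighted measure have density \<open>wt\<close> with
  respect to those of \<open>\<mu>\<close>, and \<open>J\<close> is built from diagonal measures
  alone.\<close>

lemma tilde_J:
  assumes f: "f \<in> borel_measurable CB"
  shows "op_measure.J (tilde_measure \<mu>) f = J (\<lambda>\<zeta>. f \<zeta> * of_real (wt \<zeta>))"
proof -
  interpret T: op_measure "tilde_measure \<mu>" by (rule tilde_op_measure)
  have d: "T.dm x = density (dm x) (\<lambda>\<zeta>. ennreal (wt \<zeta>))" for x
  proof (rule measure_eqI)
    fix V assume "V \<in> sets (T.dm x)"
    then have V: "V \<in> circle_borel" by (simp add: circle_borel_def)
    then have V': "V \<in> sets (dm x)" by (simp add: circle_borel_def)
    have "emeasure (T.dm x) V = (\<integral>\<^sup>+\<zeta>\<in>V. ewt \<zeta> \<partial>dm x)"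
      using tilde_measure(1)[OF V] unfolding T.emeasure_dm[OF V] tilde_measure_spec_def ewt_def by simp
    also have "\<dots> = (\<integral>\<^sup>+\<zeta>\<in>V. ennreal (wt \<zeta>) \<partial>dm x)"
      using AE_ewt[of x] by (intro nn_integral_cong_AE) (auto elim!: eventually_mono)
    also have "\<dots> = emeasure (density (dm x) (\<lambda>\<zeta>. ennreal (wt \<zeta>))) V"
      by (rule emeasure_density[symmetric, OF _ V']) (rule borel_dm, measurable)
    finally show "emeasure (T.dm x) V = emeasure (density (dm x) (\<lambda>\<zeta>. ennreal (wt \<zeta>))) V" .
  qed simp
  have "(\<integral>\<zeta>. f \<zeta> \<partial>T.dm x) = (\<integral>\<zeta>. f \<zeta> * of_real (wt \<zeta>) \<partial>dm x)" for x
    unfolding d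
    by (subst integral_density[OF CB_dm[OF f] borel_dm[OF wt_measurable]]) (simp_all add: scaleR_conv_of_real mult.commute)
  then show ?thesis unfolding T.J_def J_def by simp
qed

end

section \<open>Equivalence of the two form inequalities\<close>

lemma q_measure_form: "D.q (poly_fun p) (poly_fun p) = Re (measure_form \<mu> p p)"
  unfolding qf_measure_form by (rule q_poly_fun) simp

lemma dirichlet_norm_sq: "f \<in> dirichlet_space \<mu> \<Longrightarrow> (dirichlet_norm \<mu> f)\<^sup>2 = B f f"
  by (simp add: dirichlet_norm_eq dirichlet_B_nonneg)

definition poly_bound :: "real \<Rightarrow> bool" where
  "poly_bound w \<longleftrightarrow> 0 \<le> w \<and> (\<forall>f :: 'e poly. Re (measure_form \<mu> f f)
     \<le> w * (dirichlet_norm \<mu> (poly_fun f - mult_op (\<lambda>z. z) (poly_fun f)))\<^sup>2)"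

text \<open>Polynomials can approximate \<open>g\<close> and \<open>mz g\<close> simultaneously, and
  both sides of the inequality are continuous in the norm; so it extends to the whole space with the
  same constant.\<close>

lemma poly_bound_iff: "poly_bound w \<longleftrightarrow> D.dominated w"
proof
  have X: "poly_fun f - mz (poly_fun f) \<in> dirichlet_space \<mu>" for f
    by (intro D.diff_closed poly_fun_dirichlet D.shift_X)
  show "poly_bound w" if "D.dominated w"
    unfolding poly_bound_def dirichlet_norm_sq[OF X]
    using that poly_fun_dirichlet unfolding D.dominated_def q_measure_form[symmetric] by blast
  assume pb: "poly_bound w"
  show "D.dominated w"
    unfolding D.dominated_def
  proof (intro conjI ballI)
    show "0 \<le> w" using pb by (simp add: poly_bound_def)
    fix g assume g: "g \<in> dirichlet_space \<mu>"
    obtain p where p: "\<And>j :: nat. p j \<in> range poly_fun" and l: "(\<lambda>j. D.N (p j - g)) \<longlonglongrightarrow> 0" "(\<lambda>j. D.N (mz (p j) - mz g)) \<longlonglongrightarrow> 0"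
      using D.shift_approx[OF g] by blast
    have pX: "p j \<in> dirichlet_space \<mu>" for j by (rule subsetD[OF D.P_subset p])
    have mX: "mz (p j) \<in> dirichlet_space \<mu>" "mz g \<in> dirichlet_space \<mu>" for j using pX g by (auto intro: D.shift_X)
    have dX: "p j - mz (p j) \<in> dirichlet_space \<mu>" "g - mz g \<in> dirichlet_space \<mu>" for j
      by (rule D.diff_closed[OF pX mX(1)], rule D.diff_closed[OF g mX(2)])
    have "(\<lambda>j. D.N ((p j - mz (p j)) - (g - mz g))) \<longlonglongrightarrow> 0"
    proof (rule tendsto_sandwich[OF _ _ tendsto_const])
      show "(\<lambda>j. D.N (p j - g) + D.N (mz g - mz (p j))) \<longlonglongrightarrow> 0"
        using tendsto_add[OF l] unfolding D.N_diff_commute[OF mX] by simp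
      have "D.N ((p j - mz (p j)) - (g - mz g)) \<le> D.N (p j - g) + D.N (mz g - mz (p j))" for j
        using D.N_triangle[OF D.diff_closed[OF pX[of j] g] D.diff_closed[OF mX(2) mX(1)[of j]]] by (simp add: algebra_simps)
      then show "\<forall>\<^sub>F j in sequentially. D.N ((p j - mz (p j)) - (g - mz g)) \<le> D.N (p j - g) + D.N (mz g - mz (p j))"
        by (intro always_eventually allI)
      show "\<forall>\<^sub>F j in sequentially. 0 \<le> D.N ((p j - mz (p j)) - (g - mz g))"
        by (intro always_eventually allI D.N_nonneg D.diff_closed[OF dX])
    qed
    then have "(\<lambda>j. w * B (p j - mz (p j)) (p j - mz (p j))) \<longlonglongrightarrow> w * B (g - mz g) (g - mz g)"
      by (intro tendsto_mult tendsto_const D.B_tendsto_diag dX)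
    moreover have "(\<lambda>j. D.q (p j) (p j)) \<longlonglongrightarrow> D.q g g" by (rule D.q_tendsto_diag[OF pX g l(1)])
    moreover have "D.q (p j) (p j) \<le> w * B (p j - mz (p j)) (p j - mz (p j))" for j
    proof -
      obtain f where f: "p j = poly_fun f" using p by blast
      show ?thesis using pb unfolding poly_bound_def f q_measure_form dirichlet_norm_sq[OF X] by blast
    qed
    ultimately show "D.q g g \<le> w * B (g - mz g) (g - mz g)" by (intro LIMSEQ_le) auto
  qed
qed

section \<open>Letting the resolvent parameter tend to 1\<close>

context
  fixes w :: real
  assumes dom: "D.dominated w"
begin

text \<open>The denominator exceeds both 1 and \<open>2 * w\<close>, so the hypotheses of
  \<open>res_dominated\<close> hold for every \<open>n\<close>, not only for large ones.\<close>

definition cs :: "nat \<Rightarrow> real" where "cs n = 1 / (real n + 2 + 2 * w)"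
definition al :: "nat \<Rightarrow> real" where "al n = (1 - cs n) / (1 + cs n)"

lemma w_nonneg: "0 \<le> w" using dom by (simp add: D.dominated_def)

lemma cs: "0 < cs n" "cs n < 1" "2 * cs n * w < 1"
  using w_nonneg by (auto simp: cs_def field_simps)

lemma al: "0 \<le> al n" "al n < 1"
  using cs[of n] by (auto simp: al_def field_simps)

lemma cs_lim: "cs \<longlonglongrightarrow> 0"
proof (rule tendsto_sandwich[OF _ _ tendsto_const LIMSEQ_Suc[OF lim_1_over_n]])
  show "\<forall>\<^sub>F n in sequentially. cs n \<le> 1 / real (Suc n)"
    unfolding cs_def using w_nonneg by (intro always_eventually allI divide_left_mono) auto
  show "\<forall>\<^sub>F n in sequentially. 0 \<le> cs n" using cs(1) by (auto intro!: always_eventually simp: less_imp_le)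
qed

lemma al_lim: "al \<longlonglongrightarrow> 1"
proof -
  have "al \<longlonglongrightarrow> (1 - 0) / (1 + 0)" unfolding al_def[abs_def] by (intro tendsto_intros cs_lim) simp
  then show ?thesis by simp
qed

definition rate :: "nat \<Rightarrow> real" where "rate n = w * (1 + cs n)\<^sup>2 / (1 - 2 * cs n * w)"

lemma rate_lim: "rate \<longlonglongrightarrow> w"
proof -
  have "rate \<longlonglongrightarrow> w * (1 + 0)\<^sup>2 / (1 - 2 * 0 * w)" unfolding rate_def[abs_def] by (intro tendsto_intros cs_lim) simp
  then show ?thesis by simp
qed

lemma q_res_rate: "D.q (D.res (al n) (poly_fun p)) (D.res (al n) (poly_fun p)) \<le> rate n * B (poly_fun p) (poly_fun p)"
  unfolding rate_def by (rule D.res_dominated[OF dom poly_fun_dirichlet cs al_def])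

lemma szego_lim: "\<zeta> \<noteq> 1 \<Longrightarrow> (\<lambda>n. 1 / (cmod (1 - of_real (al n) * \<zeta>))\<^sup>2) \<longlonglongrightarrow> wt \<zeta>"
proof -
  assume z: "\<zeta> \<noteq> 1"
  have "(\<lambda>n. 1 / (cmod (1 - of_real (al n) * \<zeta>))\<^sup>2) \<longlonglongrightarrow> 1 / (cmod (1 - of_real 1 * \<zeta>))\<^sup>2"
    using z by (intro tendsto_intros tendsto_of_real al_lim) auto
  then show ?thesis by (simp add: wt_def)
qed

text \<open>At \<open>\<zeta> = 1\<close> the limit is infinite, in accordance with
  \<open>ewt\<close>; this is how Fatou's lemma will also exclude an atom at 1.\<close>

lemma ewt_lim: "(\<lambda>n. ennreal (1 / (cmod (1 - of_real (al n) * \<zeta>))\<^sup>2)) \<longlonglongrightarrow> ewt \<zeta>"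
proof (cases "\<zeta> = 1")
  case True
  have "(\<lambda>n. (cmod (1 - of_real (al n) * 1))\<^sup>2) \<longlonglongrightarrow> (cmod (1 - of_real 1 * 1))\<^sup>2"
    by (intro tendsto_intros tendsto_of_real al_lim)
  then have l: "(\<lambda>n. (cmod (1 - of_real (al n)))\<^sup>2) \<longlonglongrightarrow> 0" by simp
  have ne: "1 - complex_of_real (al n) \<noteq> 0" for n
    using al(2)[of n] by (metis eq_iff_diff_eq_0 less_irrefl of_real_eq_1_iff)
  have "\<forall>\<^sub>F n in sequentially. 0 < (cmod (1 - of_real (al n)))\<^sup>2"
    using ne by (intro always_eventually allI) (simp only: zero_less_power2 norm_eq_zero not_False_eq_True)
  from filterlim_inverse_at_top[OF l this]
  have "filterlim (\<lambda>n. 1 / (cmod (1 - of_real (al n)))\<^sup>2) at_top sequentially" by (simp only: inverse_eq_divide)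
  then have "(\<lambda>n. ennreal (1 / (cmod (1 - of_real (al n)))\<^sup>2)) \<longlonglongrightarrow> top"
    by (simp only: ennreal_tendsto_top_eq_at_top)
  then show ?thesis using True by (simp add: ewt_def)
next
  case False
  then have "ewt \<zeta> = ennreal (wt \<zeta>)" by (simp add: ewt_def wt_def)
  then show ?thesis using szego_lim[OF False] by (simp add: tendsto_ennrealI)
qed

text \<open>Testing the bound on \<open>q\<close> at resolvents with the constant polynomial
  \<open>x\<close> controls the integrals of the approximating densities, and Fatou's lemma carries
  this over to \<open>ewt\<close>. The factor \<open>2 * pi\<close> undoes the normalization of the
  form.\<close>

lemma dominated_finite_weight: "finite_weight (2 * pi * w)"
  unfolding finite_weight_def
proof (intro conjI allI)
  show "0 \<le> 2 * pi * w" using w_nonneg by simp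
  fix x
  let ?s = "\<lambda>n \<zeta>. 1 / (cmod (1 - of_real (al n) * \<zeta>))\<^sup>2"
  have le: "(\<integral>\<^sup>+\<zeta>. ennreal (?s n \<zeta>) \<partial>dm x) \<le> ennreal (2 * pi * rate n * (norm x)\<^sup>2)" for n
  proof -
    have N: "degree [:x:] < 1" by simp
    have b: "bdd_fun (szego (al n))" by (rule bdd_szego[OF al])
    have i: "integrable (dm x) (\<lambda>\<zeta>. complex_of_real (?s n \<zeta>))"
      using bdd_integrable[OF b] by (simp add: szego_def[abs_def])
    then have i': "integrable (dm x) (?s n)" by (simp only: complex_of_real_integrable_eq)
    have "Re (J (szego (al n)) x x) = (\<integral>\<zeta>. ?s n \<zeta> \<partial>dm x)"
      unfolding J_diag[OF bdd_op_integrable[OF b]] unfolding szego_def[abs_def] integral_complex_of_real by simp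
    moreover have "Re (J (szego (al n)) x x) / (2 * pi) \<le> rate n * (norm x)\<^sup>2"
      using q_res_rate[of n "[:x:]"] unfolding q_res[OF al N] B_poly[OF N] by simp
    ultimately have "(\<integral>\<zeta>. ?s n \<zeta> \<partial>dm x) \<le> 2 * pi * rate n * (norm x)\<^sup>2" by (simp add: field_simps)
    then show ?thesis
      using nn_integral_eq_integral[OF i'] by (simp add: ennreal_leI)
  qed
  have "(\<integral>\<^sup>+\<zeta>. ewt \<zeta> \<partial>dm x) = (\<integral>\<^sup>+\<zeta>. liminf (\<lambda>n. ennreal (?s n \<zeta>)) \<partial>dm x)"
    using lim_imp_Liminf[OF sequentially_bot ewt_lim] by simp
  also have "\<dots> \<le> liminf (\<lambda>n. \<integral>\<^sup>+\<zeta>. ennreal (?s n \<zeta>) \<partial>dm x)"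
    by (rule nn_integral_liminf) (rule borel_dm, measurable)
  also have "\<dots> \<le> liminf (\<lambda>n. ennreal (2 * pi * rate n * (norm x)\<^sup>2))"
    by (rule Liminf_mono) (use le in simp)
  also have "\<dots> = ennreal (2 * pi * w * (norm x)\<^sup>2)"
    by (rule lim_imp_Liminf[OF sequentially_bot]) (intro tendsto_ennrealI tendsto_intros rate_lim)
  finally show "(\<integral>\<^sup>+\<zeta>. ewt \<zeta> \<partial>dm x) \<le> ennreal (2 * pi * w * (norm x)\<^sup>2)" .
qed

end

lemma tilde_mf:
  assumes fw: "finite_weight K"
  shows "op_measure.mf (tilde_measure \<mu>) (int l - int k) x y =
    complex_of_real (1 / (2 * pi)) * J (\<lambda>\<zeta>. \<zeta> ^ k * cnj (\<zeta> ^ l) * of_real (wt \<zeta>)) x y"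
proof -
  interpret T: op_measure "tilde_measure \<mu>" by (rule tilde_op_measure[OF fw])
  have "bdd_fun (\<lambda>\<zeta>. \<zeta> ^ k * cnj (\<zeta> ^ l))" by (intro bdd_mult bdd_cnj bdd_power bdd_ident)
  then show ?thesis unfolding T.mf_J_powers by (subst tilde_J[OF fw]) (simp_all add: bdd_fun_def)
qed

definition tilde_bound :: "real \<Rightarrow> bool" where
  "tilde_bound w \<longleftrightarrow> 0 \<le> w \<and> (\<forall>f :: 'e poly. Re (measure_form (tilde_measure \<mu>) f f) \<le> w * (dirichlet_norm \<mu> (poly_fun f))\<^sup>2)"

text \<open>Once \<open>wt\<close> is integrable, dominated convergence identifies the limit of
  \<open>q\<close> at the resolvents with the form of the weighted measure. Since
  \<open>rate w n\<close> tends to \<open>w\<close>, the constant survives the limit.\<close>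

lemma dominated_tilde_bound:
  assumes dom: "D.dominated w"
  shows "tilde_bound w"
  unfolding tilde_bound_def
proof (intro conjI allI)
  note fw = dominated_finite_weight[OF dom]
  interpret T: op_measure "tilde_measure \<mu>" by (rule tilde_op_measure[OF fw])
  show "0 \<le> w" using dom by (simp add: D.dominated_def)
  fix f :: "'e poly"
  define N where "N = Suc (degree f)"
  have N: "degree f < N" by (simp add: N_def)
  let ?al = "\<lambda>n. al w n"
  have lim: "(\<lambda>n. J (\<lambda>\<zeta>. szego (?al n) \<zeta> * (\<zeta> ^ k * cnj (\<zeta> ^ l))) x y) \<longlonglongrightarrow> J (\<lambda>\<zeta>. \<zeta> ^ k * cnj (\<zeta> ^ l) * of_real (wt \<zeta>)) x y" for k l x y
  proof -
    let ?g = "\<lambda>n \<zeta>. szego (?al n) \<zeta> * (\<zeta> ^ k * cnj (\<zeta> ^ l))"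
    \<comment> \<open>The majorant \<open>4 * wt\<close> is 0 at the point 1, so the integrands are
      set to 0 there; this alters no integral because 1 carries no mass.\<close>
    let ?g' = "\<lambda>n \<zeta>. (if \<zeta> = 1 then 0 else ?g n \<zeta>)"
    have bp: "bdd_fun (\<lambda>\<zeta>. \<zeta> ^ k * cnj (\<zeta> ^ l))" by (intro bdd_mult bdd_cnj bdd_power bdd_ident)
    have gm: "?g n \<in> borel_measurable CB" for n using bdd_mult[OF bdd_szego[OF al[OF dom]] bp] by (simp add: bdd_fun_def)
    have gm': "?g' n \<in> borel_measurable CB" for n
    proof -
      have "?g' n = (\<lambda>\<zeta>. indicator (- {1}) \<zeta> * ?g n \<zeta>)" by (auto simp: fun_eq_iff indicator_def)
      moreover have "\<dots> \<in> borel_measurable CB"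
        by (rule borel_measurable_times[OF CB_borel gm]) measurable
      ultimately show ?thesis by simp
    qed
    have eq: "J (?g n) = J (?g' n)" for n
      by (rule J_cong_AE[OF gm gm'], rule eventually_mono[OF AE_not_1[OF fw]]) simp
    have "(\<lambda>n. J (?g' n) x y) \<longlonglongrightarrow> J (\<lambda>\<zeta>. \<zeta> ^ k * cnj (\<zeta> ^ l) * of_real (wt \<zeta>)) x y"
    proof (rule J_dominated[where w = "\<lambda>\<zeta>. 4 * wt \<zeta>"])
      show "(\<lambda>\<zeta>. \<zeta> ^ k * cnj (\<zeta> ^ l) * complex_of_real (wt \<zeta>)) \<in> borel_measurable CB"
        using op_integrable_wt[OF fw bp] by (simp add: op_integrable_def)
      show "integrable (dm x) (\<lambda>\<zeta>. 4 * wt \<zeta>)" for x by (intro integrable_mult_right wt_integral[OF fw])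
      show "AE \<zeta> in dm x. (\<lambda>n. ?g' n \<zeta>) \<longlonglongrightarrow> \<zeta> ^ k * cnj (\<zeta> ^ l) * of_real (wt \<zeta>)" for x
        using AE_not_1[OF fw, of x]
      proof (rule eventually_mono)
        fix \<zeta> :: complex assume z: "\<zeta> \<noteq> 1"
        have "(\<lambda>n. szego (?al n) \<zeta>) \<longlonglongrightarrow> of_real (wt \<zeta>)"
          unfolding szego_def by (intro tendsto_of_real szego_lim[OF dom z])
        then show "(\<lambda>n. ?g' n \<zeta>) \<longlonglongrightarrow> \<zeta> ^ k * cnj (\<zeta> ^ l) * of_real (wt \<zeta>)"
          using z tendsto_mult[OF _ tendsto_const, of "\<lambda>n. szego (?al n) \<zeta>" "of_real (wt \<zeta>)" sequentially "\<zeta> ^ k * cnj (\<zeta> ^ l)"]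
          by (simp add: mult.commute)
      qed
      fix n and \<zeta> :: complex assume z: "\<zeta> \<in> circle"
      show "cmod (?g' n \<zeta>) \<le> 4 * wt \<zeta>"
      proof (cases "\<zeta> = 1")
        case False
        note a = al[OF dom, of n]
        have "cmod (1 - \<zeta>) \<le> cmod (1 - of_real (?al n) * \<zeta>) + cmod ((of_real (?al n) - 1) * \<zeta>)"
          using norm_triangle_ineq[of "1 - of_real (?al n) * \<zeta>" "(of_real (?al n) - 1) * \<zeta>"] by (simp add: algebra_simps)
        also have "cmod ((of_real (?al n) - 1) * \<zeta>) = 1 - ?al n"
        proof -
          have "cmod (of_real (?al n) - 1) = \<bar>?al n - 1\<bar>" by (metis norm_of_real of_real_1 of_real_diff)
          then show ?thesis using z a by (simp add: norm_mult)
        qed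
        \<comment> \<open>The remainder \<open>1 - al w n\<close> is itself at most the distance
          from 1 to the contracted point, hence the factor 2, and 4 after squaring.\<close>
        finally have le: "cmod (1 - \<zeta>) \<le> 2 * cmod (1 - of_real (?al n) * \<zeta>)" using szego_le[OF a z] by simp
        have p: "0 < cmod (1 - \<zeta>)" using False by simp
        have "(cmod (1 - \<zeta>))\<^sup>2 \<le> (2 * cmod (1 - of_real (?al n) * \<zeta>))\<^sup>2" by (rule power_mono[OF le]) simp
        moreover have "0 < (cmod (1 - of_real (?al n) * \<zeta>))\<^sup>2" using le p by (intro zero_less_power) linarith
        ultimately have "1 / (cmod (1 - of_real (?al n) * \<zeta>))\<^sup>2 \<le> 4 / (cmod (1 - \<zeta>))\<^sup>2"
          using p by (simp add: field_simps power_mult_distrib)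
        then show ?thesis using False z by (simp add: szego_def wt_def norm_mult norm_divide norm_power)
      qed simp
    qed (rule gm')
    then show ?thesis unfolding eq .
  qed
  have tl: "(\<lambda>n. D.q (D.res (?al n) (poly_fun f)) (D.res (?al n) (poly_fun f))) \<longlonglongrightarrow>
      (\<Sum>k<N. \<Sum>l<N. Re (J (\<lambda>\<zeta>. \<zeta> ^ k * cnj (\<zeta> ^ l) * of_real (wt \<zeta>)) (coeff f k) (coeff f l))) / (2 * pi)"
    unfolding q_res[OF al[OF dom] N] by (intro tendsto_intros lim) simp
  have te: "(\<Sum>k<N. \<Sum>l<N. Re (J (\<lambda>\<zeta>. \<zeta> ^ k * cnj (\<zeta> ^ l) * of_real (wt \<zeta>)) (coeff f k) (coeff f l))) / (2 * pi)
      = Re (measure_form (tilde_measure \<mu>) f f)"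
    unfolding T.qf_measure_form T.qf_def tilde_mf[OF fw] N_def[symmetric] by (simp add: sum_divide_distrib)
  have l1: "(\<lambda>n. D.q (D.res (?al n) (poly_fun f)) (D.res (?al n) (poly_fun f))) \<longlonglongrightarrow> Re (measure_form (tilde_measure \<mu>) f f)"
    using tl unfolding te .
  have l2: "(\<lambda>n. rate w n * B (poly_fun f) (poly_fun f)) \<longlonglongrightarrow> w * B (poly_fun f) (poly_fun f)"
    by (intro tendsto_intros rate_lim[OF dom])
  show "Re (measure_form (tilde_measure \<mu>) f f) \<le> w * (dirichlet_norm \<mu> (poly_fun f))\<^sup>2"
    unfolding dirichlet_norm_sq[OF poly_fun_dirichlet]
    by (rule LIMSEQ_le[OF l1 l2]) (use q_res_rate[OF dom] in blast)
qed

lemma mf_diff_left: "mf n (x - x') y = mf n x y - mf n x' y"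
  using mf_add_left[of n "x - x'" x' y] by simp

lemma mf_diff_right: "mf n x (y - y') = mf n x y - mf n x y'"
  using mf_add_right[of n x "y - y'" y'] by simp

text \<open>On the circle \<open>(cmod (1 - \<zeta>))\<^sup>2 = 2 - \<zeta> - cnj \<zeta>\<close>,
  which cancels the density away from the massless point 1; multiplication by \<open>\<zeta>\<close>
  and its conjugate shifts the Fourier index.\<close>

lemma tilde_second_difference:
  assumes fw: "finite_weight K"
  shows "mf n x y = 2 * op_measure.mf (tilde_measure \<mu>) n x y - op_measure.mf (tilde_measure \<mu>) (n - 1) x y
     - op_measure.mf (tilde_measure \<mu>) (n + 1) x y"
proof -
  interpret T: op_measure "tilde_measure \<mu>" by (rule tilde_op_measure[OF fw])
  let ?e = "\<lambda>n \<zeta>. cnj (\<zeta> powi n)"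
  have be: "bdd_fun (?e n)" for n by (intro bdd_cnj bdd_powi)
  have oT: "T.op_integrable (?e n)" for n by (rule T.bdd_op_integrable[OF be[unfolded bdd_fun_def, folded T.bdd_fun_def]])
  let ?h = "\<lambda>\<zeta>. 2 * ?e n \<zeta> + ((-1) * ?e (n - 1) \<zeta> + (-1) * ?e (n + 1) \<zeta>)"
  have bh: "bdd_fun ?h" by (intro bdd_add bdd_mult bdd_const be)
  have h: "?h \<zeta> = ?e n \<zeta> * of_real ((cmod (1 - \<zeta>))\<^sup>2)" if z: "\<zeta> \<in> circle" for \<zeta>
  proof -
    have nz: "\<zeta> \<noteq> 0" using z by auto
    have c: "cnj \<zeta> * \<zeta> = 1" using circle_inverse[OF z] nz by (metis left_inverse)
    have "\<zeta> powi (n - 1) = \<zeta> powi n * cnj \<zeta>" "\<zeta> powi (n + 1) = \<zeta> powi n * \<zeta>"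
      using nz by (simp_all add: power_int_diff power_int_add divide_inverse circle_inverse[OF z])
    then have "?h \<zeta> = ?e n \<zeta> * (2 - \<zeta> - cnj \<zeta>)" by (simp add: algebra_simps)
    also have "2 - \<zeta> - cnj \<zeta> = (1 - \<zeta>) * cnj (1 - \<zeta>)" using c by (simp add: algebra_simps)
    finally show ?thesis by (simp only: complex_norm_square)
  qed
  have "J (?e n) = J (\<lambda>\<zeta>. ?h \<zeta> * of_real (wt \<zeta>))"
  proof (rule J_cong_AE)
    show "?e n \<in> borel_measurable CB" using be by (simp add: bdd_fun_def)
    show "(\<lambda>\<zeta>. ?h \<zeta> * of_real (wt \<zeta>)) \<in> borel_measurable CB" using op_integrable_wt[OF fw bh] by (simp only: op_integrable_def)
    fix x
    show "AE \<zeta> in dm x. ?e n \<zeta> = ?h \<zeta> * of_real (wt \<zeta>)"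
    proof (rule AE_mp[OF AE_not_1[OF fw]], rule AE_I2, rule impI)
      fix \<zeta> assume "\<zeta> \<in> space (dm x)" and n1: "\<zeta> \<noteq> 1"
      then have z: "\<zeta> \<in> circle" by simp
      have "(cmod (1 - \<zeta>))\<^sup>2 * wt \<zeta> = 1" using n1 by (simp add: wt_def)
      then show "?e n \<zeta> = ?h \<zeta> * of_real (wt \<zeta>)"
        unfolding h[OF z] mult.assoc of_real_mult[symmetric] by simp
    qed
  qed
  also have "\<dots> = T.J ?h" by (rule tilde_J[OF fw, symmetric]) (use bh in \<open>simp only: bdd_fun_def\<close>)
  finally have "J (?e n) x y = T.J ?h x y" by simp
  also have "\<dots> = 2 * T.J (?e n) x y + ((-1) * T.J (?e (n - 1)) x y + (-1) * T.J (?e (n + 1)) x y)"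
  proof -
    have "T.bdd_fun f" if "bdd_fun f" for f using that by (simp only: bdd_fun_def T.bdd_fun_def)
    then have o: "T.op_integrable f" if "bdd_fun f" for f using that T.bdd_op_integrable by blast
    have b: "bdd_fun (\<lambda>\<zeta>. c * ?e m \<zeta>)" for c m by (intro bdd_mult bdd_const be)
    show ?thesis
      by (simp only: T.J_add[OF o[OF b] o[OF bdd_add[OF b b]]] T.J_add[OF o[OF b] o[OF b]] T.J_cmult[OF o[OF be]])
  qed
  finally have e: "J (?e n) x y = \<dots>" .
  show ?thesis unfolding mf_J T.mf_J e by (simp only: ring_distribs) simp
qed

text \<open>For \<open>h\<close> with values (1 - z)p(z), the weighted form at \<open>h\<close> is
  the second difference of the weighted coefficients summed against \<open>p\<close>, which is the
  form of \<open>\<mu>\<close> at \<open>p\<close>.\<close>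

lemma tilde_bound_poly_bound:
  assumes fw: "finite_weight K" and tb: "tilde_bound w"
  shows "poly_bound w"
  unfolding poly_bound_def
proof (intro conjI allI)
  interpret T: op_measure "tilde_measure \<mu>" by (rule tilde_op_measure[OF fw])
  show "0 \<le> w" using tb by (simp add: tilde_bound_def)
  fix p :: "'e poly"
  define N where "N = Suc (degree p)"
  define h where "h = p - pCons 0 p"
  define a b where "a = coeff p" and "b = coeff (pCons 0 p)"
  have N: "degree p < N" by (simp add: N_def)
  have aN: "a N = 0" unfolding a_def using N by (rule coeff_eq_0)
  have b: "b 0 = 0" "b (Suc k) = a k" for k by (simp_all add: b_def a_def)
  have dh: "degree h < Suc N"
    unfolding h_def using degree_diff_le_max[of p "pCons 0 p"] degree_pCons_le[of 0 p] N by simp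
  have hp: "poly_fun h = poly_fun p - mz (poly_fun p)"
  proof -
    have "poly_fun (h + pCons 0 p) = poly_fun h + poly_fun (pCons 0 p)" by (rule poly_fun_add)
    then show ?thesis unfolding mz_poly_fun by (simp add: h_def)
  qed
  \<comment> \<open>\<open>Suc N\<close> makes room for the top coefficient of
    \<open>pCons 0 p\<close>. Because \<open>a N = 0\<close> and \<open>b 0 = 0\<close>, all four
    sums reduce to \<open>?G\<close>, whose argument is the offset of the Fourier index.\<close>
  let ?S = "\<lambda>u v. \<Sum>k<Suc N. \<Sum>l<Suc N. Re (T.mf (int l - int k) (u k) (v l))"
  let ?G = "\<lambda>d. \<Sum>k<N. \<Sum>l<N. Re (T.mf (int l - int k + d) (a k) (a l))"
  have pt: "Re (T.mf n (u - u') (v - v')) = Re (T.mf n u v) + Re (T.mf n u' v') - Re (T.mf n u v') - Re (T.mf n u' v)" for n u u' v v'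
    by (simp add: T.mf_diff_left T.mf_diff_right)
  have drop: "sum F {..<Suc N} = sum F {..<N}" if "F N = 0" for F :: "nat \<Rightarrow> real" using that by simp
  have shift: "sum F {..<Suc N} = (\<Sum>l<N. F (Suc l))" if "F 0 = 0" for F :: "nat \<Rightarrow> real"
    unfolding sum.lessThan_Suc_shift using that by simp
  have "T.qf (Suc N) (coeff h) = ?S a a + ?S b b - ?S a b - ?S b a"
    unfolding T.qf_def h_def coeff_diff a_def[symmetric] b_def[symmetric]
    by (simp only: pt sum.distrib sum_subtractf)
  moreover have "?S a a = ?G 0"
    by (simp add: sum.lessThan_Suc aN T.mf_zero)
  moreover have "?S b b = ?G 0"
    unfolding sum.lessThan_Suc_shift b by (simp add: T.mf_zero)
  moreover have "?S a b = ?G 1"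
  proof -
    have "?S a b = (\<Sum>k<N. \<Sum>l<Suc N. Re (T.mf (int l - int k) (a k) (b l)))"
      by (rule drop) (simp add: aN T.mf_zero del: sum.lessThan_Suc)
    also have "\<dots> = (\<Sum>k<N. \<Sum>l<N. Re (T.mf (int (Suc l) - int k) (a k) (b (Suc l))))"
      by (intro sum.cong refl shift) (simp add: b T.mf_zero)
    also have "\<dots> = ?G 1" by (simp add: b algebra_simps)
    finally show ?thesis .
  qed
  moreover have "?S b a = ?G (- 1)"
  proof -
    have "?S b a = (\<Sum>k<N. \<Sum>l<Suc N. Re (T.mf (int l - int (Suc k)) (b (Suc k)) (a l)))"
      by (rule shift) (simp add: b T.mf_zero del: sum.lessThan_Suc)
    also have "\<dots> = (\<Sum>k<N. \<Sum>l<N. Re (T.mf (int l - int (Suc k)) (b (Suc k)) (a l)))"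
      by (intro sum.cong refl drop) (simp add: aN T.mf_zero)
    also have "\<dots> = ?G (- 1)" by (simp add: b algebra_simps)
    finally show ?thesis .
  qed
  ultimately have "T.qf (Suc N) (coeff h) = 2 * ?G 0 - ?G 1 - ?G (- 1)" by simp
  also have "\<dots> = qf N (coeff p)"
    unfolding qf_def a_def[symmetric] tilde_second_difference[OF fw]
    by (simp add: sum_subtractf sum_distrib_left sum.distrib algebra_simps)
  finally have eq: "Re (measure_form (tilde_measure \<mu>) h h) = Re (measure_form \<mu> p p)"
    using T.q_measure_form[of h] T.q_poly_fun[OF dh] q_measure_form[of p] q_poly_fun[OF N] by simp
  show "Re (measure_form \<mu> p p) \<le> w * (dirichlet_norm \<mu> (poly_fun p - mult_op (\<lambda>z. z) (poly_fun p)))\<^sup>2"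
    using tb unfolding tilde_bound_def eq[symmetric] hp[symmetric] by blast
qed

end

section \<open>Cogenerator and optimal constants\<close>

context fatou_space begin

text \<open>\<open>1 + 2 * t * w \<le> exp (2 * t * w)\<close> turns linear growth of the squared
  norm into quasicontractivity with the same constant.\<close>

lemma dominated_S_bound:
  assumes w: "dominated w" and t: "0 \<le> t" and f: "f \<in> X"
  shows "N (S t f) \<le> exp (w * t) * N f"
proof -
  have w0: "0 \<le> w" using w by (simp add: dominated_def)
  have "1 + 2 * t * w \<le> exp (2 * t * w)" by (rule exp_ge_add_one_self)
  also have "\<dots> = (exp (w * t))\<^sup>2" by (simp add: power2_eq_square exp_add[symmetric] mult_ac)
  finally have "1 + 2 * t * w \<le> (exp (w * t))\<^sup>2" .
  then have "B (S t f) (S t f) \<le> (exp (w * t))\<^sup>2 * B f f"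
    using dominated_bound(2)[OF w t f] B_nonneg[OF f] by (meson mult_right_mono order_trans)
  then have "sqrt (B (S t f) (S t f)) \<le> sqrt ((exp (w * t))\<^sup>2 * B f f)" by (rule real_sqrt_le_mono)
  then show ?thesis unfolding N_def real_sqrt_mult by simp
qed

text \<open>For fixed \<open>g\<close> the inequality is a closed condition on the constant, so the
  infimum of the admissible constants is again admissible.\<close>

lemma dominated_Inf:
  assumes "dominated w"
  shows "is_least dominated (Inf (Collect dominated))"
proof -
  have bd: "bdd_below (Collect dominated)" by (rule bdd_belowI[of _ 0]) (simp add: dominated_def)
  have ne: "Collect dominated \<noteq> {}" using assms by blast
  define m where "m = Inf (Collect dominated)"
  have "dominated m"
    unfolding dominated_def
  proof (intro conjI ballI)
    show "0 \<le> m" unfolding m_def by (rule cInf_greatest[OF ne]) (simp add: dominated_def)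
    fix g assume g: "g \<in> X"
    define b where "b = B (g - mz g) (g - mz g)"
    have b0: "0 \<le> b" unfolding b_def using g by (intro B_nonneg diff_closed shift_X)
    have le: "q g g \<le> v * b" if "dominated v" for v using that g by (simp add: dominated_def b_def)
    have "q g g \<le> m * b"
    \<comment> \<open>For \<open>b = 0\<close> the inequality does not depend on the constant, so
      any admissible one settles it; otherwise one can divide.\<close>
    proof (cases "b = 0")
      case True
      then show ?thesis using le[OF assms] by simp
    next
      case False
      then have b: "0 < b" using b0 by simp
      have "q g g / b \<le> m"
        unfolding m_def by (rule cInf_greatest[OF ne]) (use le b in \<open>simp add: field_simps\<close>)
      then show ?thesis using b by (simp add: field_simps)
    qed
    then show "q g g \<le> m * B (g - mz g) (g - mz g)" by (simp add: b_def)
  qed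
  then show ?thesis unfolding is_least_def m_def using cInf_lower[OF _ bd] by simp
qed

text \<open>Point evaluations are continuous, so the generator can act only as multiplication by the
  derivative of \<open>phi t z\<close> at \<open>t = 0\<close>. This covers arbitrary elements of
  its domain.\<close>

lemma generator_pointwise:
  assumes semi and f: "f \<in> X" and v: "v \<in> X" and z: "z \<in> disc"
    and lim: "((\<lambda>t. N (rs (1 / t) (S t f - f) - v)) \<longlongrightarrow> 0) (at_right 0)"
  shows "v z = ((z + 1) / (z - 1)) *\<^sub>C f z"
proof -
  define c where "c = (z + 1) / (z - 1)"
  have "((\<lambda>h. exp (h * c)) has_field_derivative c) (at 0)" by (auto intro!: derivative_eq_intros)
  then have "((\<lambda>h. (exp (h * c) - 1) / h) \<longlongrightarrow> c) (at 0)" by (simp add: has_field_derivative_iff)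
  moreover have "filterlim complex_of_real (at 0) (at_right 0)"
    by (rule filterlim_atI) (auto intro!: tendsto_eq_intros simp: eventually_at_filter)
  ultimately have "((\<lambda>t. (exp (complex_of_real t * c) - 1) / complex_of_real t) \<longlongrightarrow> c) (at_right 0)"
    by (rule filterlim_compose)
  then have l1: "((\<lambda>t. ((phi t z - 1) / complex_of_real t) *\<^sub>C f z) \<longlongrightarrow> c *\<^sub>C f z) (at_right 0)"
    unfolding phi_def c_def by (intro scaleC.tendsto tendsto_const)
  have l2: "((\<lambda>t. ((phi t z - 1) / complex_of_real t) *\<^sub>C f z) \<longlongrightarrow> v z) (at_right 0)"
  proof (rule LIM_zero_cancel, rule Lim_null_comparison)
    show "((\<lambda>t. N (rs (1 / t) (S t f - f) - v) / (1 - cmod z)) \<longlongrightarrow> 0) (at_right 0)"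
      using tendsto_divide[OF lim tendsto_const[of "1 - cmod z"]] z by simp
    have "norm (((phi t z - 1) / complex_of_real t) *\<^sub>C f z - v z) \<le> N (rs (1 / t) (S t f - f) - v) / (1 - cmod z)" if t: "0 < t" for t
    proof -
      have "S t f \<in> X" using assms(1) t f by (simp add: semi_def)
      then have "rs (1 / t) (S t f - f) - v \<in> X" using f v by (intro closed)
      from N_eval[OF this z]
      have "norm ((rs (1 / t) (S t f - f) - v) z) \<le> N (rs (1 / t) (S t f - f) - v) / (1 - cmod z)" .
      moreover have "(rs (1 / t) (S t f - f) - v) z = ((phi t z - 1) / complex_of_real t) *\<^sub>C f z - v z"
      proof -
        have "complex_of_real (1 / t) *\<^sub>C (phi t z *\<^sub>C f z - f z) = complex_of_real (1 / t) *\<^sub>C ((phi t z - 1) *\<^sub>C f z)"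
          by (simp only: scaleC_diff_left scaleC_one)
        also have "\<dots> = ((phi t z - 1) / complex_of_real t) *\<^sub>C f z" by (simp add: scaleC_scaleC)
        finally show ?thesis by (simp only: fun_diff_def scaleC_fun_def mult_op_def)
      qed
      ultimately show ?thesis by simp
    qed
    then show "\<forall>\<^sub>F t in at_right 0. norm (((phi t z - 1) / complex_of_real t) *\<^sub>C f z - v z) \<le> N (rs (1 / t) (S t f - f) - v) / (1 - cmod z)"
      by (rule eventually_mono[OF eventually_at_right_less])
  qed
  show ?thesis unfolding c_def[symmetric] by (rule tendsto_unique[OF trivial_limit_at_right_real l2 l1])
qed

end

context op_measure begin

lemma norm_eq: "f \<in> dirichlet_space \<mu> \<Longrightarrow> dirichlet_norm \<mu> f = D.N f"
  by (simp add: dirichlet_norm_eq D.N_def)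

lemma bounded_mult_op:
  assumes "\<And>f. f \<in> dirichlet_space \<mu> \<Longrightarrow> mult_op \<phi> f \<in> dirichlet_space \<mu>"
    and "\<And>f. f \<in> dirichlet_space \<mu> \<Longrightarrow> D.N (mult_op \<phi> f) \<le> L * D.N f"
  shows "bounded_operator_on (dirichlet_space \<mu>) (dirichlet_norm \<mu>) (mult_op \<phi>)"
  unfolding bounded_operator_on_def using assms
  by (intro conjI ballI allI mult_op_add mult_op_scaleC exI[of _ L]) (simp_all add: norm_eq)

abbreviation Sg :: "real \<Rightarrow> (complex \<Rightarrow> 'e) \<Rightarrow> complex \<Rightarrow> 'e" where "Sg t \<equiv> mult_op (phi t)"

lemma semigroupD:
  assumes C0: "C0_semigroup_on (dirichlet_space \<mu>) (dirichlet_norm \<mu>) Sg"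
  shows "D.semi" "0 \<le> t \<Longrightarrow> \<exists>L. \<forall>f\<in>dirichlet_space \<mu>. D.N (Sg t f) \<le> L * D.N f"
proof -
  have X: "Sg t f \<in> dirichlet_space \<mu>" if "0 \<le> t" "f \<in> dirichlet_space \<mu>" for t f
    using C0 that unfolding C0_semigroup_on_def bounded_operator_on_def by blast
  show "D.semi"
    unfolding D.semi_def
  proof (intro conjI ballI allI impI X)
    fix f assume f: "f \<in> dirichlet_space \<mu>"
    have "((\<lambda>t. dirichlet_norm \<mu> (Sg t f - f)) \<longlongrightarrow> 0) (at_right 0)"
      using C0 f unfolding C0_semigroup_on_def by blast
    moreover have "\<forall>\<^sub>F t in at_right 0. dirichlet_norm \<mu> (Sg t f - f) = D.N (Sg t f - f)"
      by (rule eventually_mono[OF eventually_at_right_less]) (intro norm_eq D.diff_closed X f less_imp_le)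
    ultimately show "((\<lambda>t. D.N (Sg t f - f)) \<longlongrightarrow> 0) (at_right 0)" by (rule Lim_transform_eventually)
  qed
  assume t: "0 \<le> t"
  then obtain L where "\<forall>f\<in>dirichlet_space \<mu>. dirichlet_norm \<mu> (Sg t f) \<le> L * dirichlet_norm \<mu> f"
    using C0 unfolding C0_semigroup_on_def bounded_operator_on_def by blast
  then show "\<exists>L. \<forall>f\<in>dirichlet_space \<mu>. D.N (Sg t f) \<le> L * D.N f" using X[OF t] norm_eq by metis
qed

lemma semigroup_dominated:
  assumes "C0_semigroup_on (dirichlet_space \<mu>) (dirichlet_norm \<mu>) Sg"
  shows "\<exists>w. D.dominated w"
  using D.semi_loc_bounded[OF semigroupD(1)[OF assms] semigroupD(2)[OF assms]] D.semi_dominated[OF semigroupD(1)[OF assms]] by blast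

lemma dominated_semigroup:
  assumes w: "D.dominated w"
  shows "C0_semigroup_on (dirichlet_space \<mu>) (dirichlet_norm \<mu>) Sg"
  unfolding C0_semigroup_on_def
proof (intro conjI allI impI ballI D.S_add D.S_0)
  show "bounded_operator_on (dirichlet_space \<mu>) (dirichlet_norm \<mu>) (Sg t)" if "0 \<le> t" for t
    by (rule bounded_mult_op[OF D.dominated_bound(1)[OF w that] D.dominated_S_bound[OF w that]])
  fix f assume f: "f \<in> dirichlet_space \<mu>"
  have "((\<lambda>t. D.N (Sg t f - f)) \<longlongrightarrow> 0) (at_right 0)" using D.dominated_semi[OF w] f by (simp add: D.semi_def)
  moreover have "\<forall>\<^sub>F t in at_right 0. D.N (Sg t f - f) = dirichlet_norm \<mu> (Sg t f - f)"
    by (rule eventually_mono[OF eventually_at_right_less], rule norm_eq[symmetric])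
      (intro D.diff_closed D.dominated_bound(1)[OF w] f less_imp_le)
  ultimately show "((\<lambda>t. dirichlet_norm \<mu> (Sg t f - f)) \<longlongrightarrow> 0) (at_right 0)" by (rule Lim_transform_eventually)
qed

text \<open>\<open>op_norm_on\<close> is a supremum of quotients, where division by zero contributes
  0 at functions of norm 0. In the converse direction boundedness of each operator is what makes
  this supremum an actual upper bound.\<close>

lemma quasicontractive_iff:
  "0 \<le> w \<and> quasicontractive_on (dirichlet_space \<mu>) (dirichlet_norm \<mu>) Sg w \<longleftrightarrow> D.dominated w"
proof (intro iffI)
  assume w: "D.dominated w"
  have "op_norm_on (dirichlet_space \<mu>) (dirichlet_norm \<mu>) (Sg t) \<le> exp (w * t)" if t: "0 \<le> t" for t
    unfolding op_norm_on_def
  proof (rule cSUP_least)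
    show "dirichlet_space \<mu> \<noteq> {}" using D.zero_closed by blast
    fix f assume f: "f \<in> dirichlet_space \<mu>"
    have "D.N (Sg t f) \<le> exp (w * t) * D.N f" by (rule D.dominated_S_bound[OF w t f])
    then show "dirichlet_norm \<mu> (Sg t f) / dirichlet_norm \<mu> f \<le> exp (w * t)"
      using D.N_nonneg[OF f] norm_eq[OF f] norm_eq[OF D.dominated_bound(1)[OF w t f]]
      by (cases "D.N f = 0") (simp_all add: divide_le_eq)
  qed
  then show "0 \<le> w \<and> quasicontractive_on (dirichlet_space \<mu>) (dirichlet_norm \<mu>) Sg w"
    using w dominated_semigroup[OF w] by (simp add: quasicontractive_on_def D.dominated_def)
next
  assume "0 \<le> w \<and> quasicontractive_on (dirichlet_space \<mu>) (dirichlet_norm \<mu>) Sg w"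
  then have w: "0 \<le> w" and C0: "C0_semigroup_on (dirichlet_space \<mu>) (dirichlet_norm \<mu>) Sg"
    and le: "\<And>t. 0 \<le> t \<Longrightarrow> op_norm_on (dirichlet_space \<mu>) (dirichlet_norm \<mu>) (Sg t) \<le> exp (w * t)"
    by (auto simp: quasicontractive_on_def)
  show "D.dominated w"
  proof (rule D.quasicontractive_dominated[OF semigroupD(1)[OF C0] w])
    fix t :: real and f assume t: "0 \<le> t" and f: "f \<in> dirichlet_space \<mu>"
    have X: "Sg t g \<in> dirichlet_space \<mu>" if "g \<in> dirichlet_space \<mu>" for g
      using semigroupD(1)[OF C0] t that by (simp add: D.semi_def)
    obtain L where L: "\<And>g. g \<in> dirichlet_space \<mu> \<Longrightarrow> D.N (Sg t g) \<le> L * D.N g" using semigroupD(2)[OF C0 t] by blast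
    show "D.N (Sg t f) \<le> exp (w * t) * D.N f"
    proof (cases "D.N f = 0")
      case True
      then show ?thesis using L[OF f] by simp
    next
      case False
      then have N0: "0 < D.N f" using D.N_nonneg[OF f] by simp
      have "D.N (Sg t g) / D.N g \<le> \<bar>L\<bar>" if "g \<in> dirichlet_space \<mu>" for g
      proof (cases "D.N g = 0")
        case False
        then have "0 < D.N g" using D.N_nonneg[OF that] by simp
        moreover have "D.N (Sg t g) \<le> \<bar>L\<bar> * D.N g"
          by (rule order_trans[OF L[OF that] mult_right_mono[OF abs_ge_self D.N_nonneg[OF that]]])
        ultimately show ?thesis by (simp add: divide_le_eq)
      qed simp
      then have "bdd_above ((\<lambda>g. dirichlet_norm \<mu> (Sg t g) / dirichlet_norm \<mu> g) ` dirichlet_space \<mu>)"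
        by (intro bdd_aboveI2[of _ _ "\<bar>L\<bar>"]) (simp add: norm_eq X)
      from cSUP_upper[OF f this] have "D.N (Sg t f) / D.N f \<le> exp (w * t)"
        using le[OF t] by (simp add: op_norm_on_def norm_eq f X)
      then show ?thesis using N0 by (simp add: divide_le_eq)
    qed
  qed
qed

lemma tilde_iff: "tilde_is_operator_measure \<mu> \<and> tilde_bound w \<longleftrightarrow> D.dominated w"
proof
  assume "D.dominated w"
  then show "tilde_is_operator_measure \<mu> \<and> tilde_bound w"
    using tilde_is_operator[OF dominated_finite_weight] dominated_tilde_bound by blast
next
  assume a: "tilde_is_operator_measure \<mu> \<and> tilde_bound w"
  then obtain K where "finite_weight K" using tilde_finite_weight by blast
  then show "D.dominated w" using tilde_bound_poly_bound a poly_bound_iff by blast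
qed

lemma dominated_two_isometric_semigroup:
  assumes w: "D.dominated w"
  shows "two_isometric_semigroup_on (dirichlet_space \<mu>) (dirichlet_norm \<mu>) Sg"
  unfolding two_isometric_semigroup_on_def two_isometry_on_def
proof (intro conjI allI impI ballI dominated_semigroup[OF w])
  fix t :: real assume t: "0 \<le> t"
  show "bounded_operator_on (dirichlet_space \<mu>) (dirichlet_norm \<mu>) (Sg t)"
    using dominated_semigroup[OF w] t by (simp add: C0_semigroup_on_def)
  fix f assume f: "f \<in> dirichlet_space \<mu>"
  note X = D.dominated_bound(1)[OF w t]
  show "(dirichlet_norm \<mu> (Sg t (Sg t f)))\<^sup>2 - 2 * (dirichlet_norm \<mu> (Sg t f))\<^sup>2 + (dirichlet_norm \<mu> f)\<^sup>2 = 0"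
    unfolding dirichlet_norm_sq[OF f] dirichlet_norm_sq[OF X[OF f]] dirichlet_norm_sq[OF X[OF X[OF f]]]
    by (rule D.dominated_two_isometric[OF w t f])
qed

lemma generator_iff:
  assumes semi: "D.semi"
  shows "(f, v) \<in> generator_on (dirichlet_space \<mu>) (dirichlet_norm \<mu>) Sg \<longleftrightarrow>
    f \<in> dirichlet_space \<mu> \<and> v \<in> dirichlet_space \<mu> \<and> ((\<lambda>t. D.N (D.rs (1 / t) (Sg t f - f) - v)) \<longlongrightarrow> 0) (at_right 0)"
proof -
  have "((\<lambda>t. dirichlet_norm \<mu> (D.rs (1 / t) (Sg t f - f) - v)) \<longlongrightarrow> 0) (at_right 0) \<longleftrightarrow>
      ((\<lambda>t. D.N (D.rs (1 / t) (Sg t f - f) - v)) \<longlongrightarrow> 0) (at_right 0)"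
    if "f \<in> dirichlet_space \<mu>" "v \<in> dirichlet_space \<mu>"
  proof (rule filterlim_cong[OF refl refl], rule eventually_mono[OF eventually_at_right_less], rule norm_eq)
    fix t :: real assume "0 < t"
    then have "Sg t f \<in> dirichlet_space \<mu>" using semi that by (simp add: D.semi_def)
    then show "D.rs (1 / t) (Sg t f - f) - v \<in> dirichlet_space \<mu>" using that by (intro D.closed)
  qed
  then show ?thesis unfolding generator_on_def by blast
qed

lemma dominated_cogenerator:
  assumes w: "D.dominated w"
  shows "is_cogenerator_on (dirichlet_space \<mu>) (dirichlet_norm \<mu>) Sg mz"
proof -
  note semi = D.dominated_semi[OF w]
  let ?A = "generator_on (dirichlet_space \<mu>) (dirichlet_norm \<mu>) Sg"
  \<comment> \<open>Since \<open>(z + 1) / (z - 1) - 1 = 2 / (z - 1)\<close>, the resolvent of the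
    generator at 1 should be multiplication by the reciprocal.\<close>
  define R :: "(complex \<Rightarrow> 'e) \<Rightarrow> complex \<Rightarrow> 'e" where "R = mult_op (\<lambda>z. (z - 1) / 2)"
  have R: "R f = D.rs (1 / 2) (mz f - f)" for f
  proof
    fix z
    have "complex_of_real (1 / 2) *\<^sub>C (z *\<^sub>C f z - f z) = complex_of_real (1 / 2) *\<^sub>C ((z - 1) *\<^sub>C f z)"
      by (simp only: scaleC_diff_left scaleC_one)
    also have "\<dots> = ((z - 1) / 2) *\<^sub>C f z" by (simp add: scaleC_scaleC)
    finally show "R f z = D.rs (1 / 2) (mz f - f) z"
      by (simp only: R_def mult_op_def fun_diff_def scaleC_fun_def)
  qed
  have RX: "R f \<in> dirichlet_space \<mu>" if "f \<in> dirichlet_space \<mu>" for f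
    unfolding R using that by (intro D.closed D.shift_X)
  have RA: "\<exists>z. (R y, z) \<in> ?A \<and> z - y = R y \<and> mz y = z + R y" if y: "y \<in> dirichlet_space \<mu>" for y
  proof -
    \<comment> \<open>Chosen so that \<open>g - mz g = R y\<close>, a function on which the
      generator is known to take the value \<open>D.gen g\<close>.\<close>
    define g where "g = D.rs (- (1 / 2)) y"
    have g: "g \<in> dirichlet_space \<mu>" unfolding g_def using y by (rule D.scaleC_closed)
    have h: "c *\<^sub>C u + c *\<^sub>C u = (c + c) *\<^sub>C u" for c and u :: "complex \<Rightarrow> 'e" by (rule scaleC_add_left[symmetric])
    have mg: "mz g = D.rs (- (1 / 2)) (mz y)" unfolding g_def by (rule mult_op_scaleC)
    have neg: "D.rs (- (1 / 2)) u = - D.rs (1 / 2) u" for u :: "complex \<Rightarrow> 'e"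
      unfolding of_real_minus by (rule scaleC_minus_left)
    have half: "D.rs (1 / 2) u + D.rs (1 / 2) u = u" for u :: "complex \<Rightarrow> 'e"
      unfolding h by (simp add: scaleC_one)
    have gR: "g - mz g = R y" unfolding R mg unfolding g_def neg scaleC_diff_right by simp
    have gg: "D.gen g = D.rs (1 / 2) y + D.rs (1 / 2) (mz y)"
    proof -
      have "D.rs (- 1) (D.rs (- (1 / 2)) u) = D.rs (1 / 2) u" for u :: "complex \<Rightarrow> 'e" by (simp add: scaleC_scaleC)
      then show ?thesis unfolding D.gen_def mg unfolding g_def scaleC_add_right by (simp only:)
    qed
    have "(R y, D.gen g) \<in> ?A"
      unfolding generator_iff[OF semi] gR[symmetric]
      using D.semi_generator[OF semi g] g by (auto intro: D.gen_X D.diff_closed D.shift_X)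
    moreover have "D.gen g + R y = mz y"
      unfolding gg R scaleC_diff_right using half[of "mz y"] by (simp add: algebra_simps)
    moreover have "D.gen g - y = R y"
    proof -
      have "D.gen g - R y = y" unfolding gg R scaleC_diff_right using half[of y] by (simp add: algebra_simps)
      then show ?thesis by (metis add.commute diff_add_cancel add_diff_cancel_left')
    qed
    ultimately show ?thesis by metis
  qed
  \<comment> \<open>An element of the domain is not yet known to have the form
    \<open>g - mz g\<close>, so the inverse property is checked pointwise.\<close>
  have inv: "R (z - x) = x" if A: "(x, z) \<in> ?A" for x z
  proof
    fix \<zeta>
    have X: "x \<in> dirichlet_space \<mu>" "z \<in> dirichlet_space \<mu>"
      and l: "((\<lambda>t. D.N (D.rs (1 / t) (Sg t x - x) - z)) \<longlongrightarrow> 0) (at_right 0)"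
      using A unfolding generator_iff[OF semi] by auto
    show "R (z - x) \<zeta> = x \<zeta>"
    proof (cases "\<zeta> \<in> disc")
      case True
      then have ne: "\<zeta> - 1 \<noteq> 0" by auto
      have "z \<zeta> - x \<zeta> = ((\<zeta> + 1) / (\<zeta> - 1) - 1) *\<^sub>C x \<zeta>"
        unfolding D.generator_pointwise[OF semi X True l] scaleC_diff_left scaleC_one ..
      then have "((\<zeta> - 1) / 2) *\<^sub>C (z \<zeta> - x \<zeta>) = ((\<zeta> - 1) / 2 * ((\<zeta> + 1) / (\<zeta> - 1) - 1)) *\<^sub>C x \<zeta>"
        by (simp only: scaleC_scaleC)
      also have "(\<zeta> - 1) / 2 * ((\<zeta> + 1) / (\<zeta> - 1) - 1) = 1" using ne by (simp add: field_simps)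
      finally show ?thesis by (simp only: R_def mult_op_def fun_diff_def scaleC_one)
    next
      case False
      then have "R (z - x) \<zeta> = 0" "x \<zeta> = 0"
        using D.outside[OF RX[OF D.diff_closed[OF X(2,1)]]] D.outside[OF X(1)] by blast+
      then show ?thesis by simp
    qed
  qed
  have "bounded_operator_on (dirichlet_space \<mu>) (dirichlet_norm \<mu>) R"
    unfolding R_def
  proof (rule bounded_mult_op)
    fix f assume f: "f \<in> dirichlet_space \<mu>"
    have m: "mz f \<in> dirichlet_space \<mu>" using f by (rule D.shift_X)
    show "mult_op (\<lambda>z. (z - 1) / 2) f \<in> dirichlet_space \<mu>" using RX[OF f] by (simp only: R_def)
    have "D.N (R f) = D.N (mz f - f) / 2"
      unfolding R D.N_scaleC[OF D.diff_closed[OF m f]] by simp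
    also have "\<dots> \<le> (D.N (mz f) + D.N f) / 2"
      using D.N_triangle_diff[OF m D.zero_closed f] D.N_diff_commute[OF D.zero_closed f] by simp
    also have "\<dots> \<le> (\<bar>sqrt (2 * mf_const + 3)\<bar> + 1) / 2 * D.N f"
      using D.shift_X(2)[OF f] by (simp add: algebra_simps)
    finally show "D.N (mult_op (\<lambda>z. (z - 1) / 2) f) \<le> (\<bar>sqrt (2 * mf_const + 3)\<bar> + 1) / 2 * D.N f"
      by (simp only: R_def)
  qed
  moreover have "z - 1 *\<^sub>C R y = y" if "z - y = R y" for y z :: "complex \<Rightarrow> 'e"
    unfolding that[symmetric] scaleC_one by simp
  ultimately have "is_resolvent_on (dirichlet_space \<mu>) (dirichlet_norm \<mu>) ?A 1 R"
    unfolding is_resolvent_on_def using RA inv by (auto simp: scaleC_one) metis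
  then show ?thesis unfolding is_cogenerator_on_def using RA by metis
qed

end

theorem theorem1p4:
  fixes \<mu> :: "complex set \<Rightarrow> 'e::complex_hilbert_space \<Rightarrow> 'e"
  assumes "operator_measure \<mu>"
  shows
    "let X = dirichlet_space \<mu>;
         N = dirichlet_norm \<mu>;
         S = (\<lambda>t. mult_op (phi t));
         I = ((\<forall>t\<ge>0. bounded_operator_on X N (S t)) \<and> C0_semigroup_on X N S);
         W = (\<lambda>w. 0 \<le> w \<and> quasicontractive_on X N S w);
         W1 = (\<lambda>w1. 0 \<le> w1 \<and> (\<forall>f :: 'e poly.
                 Re (measure_form \<mu> f f)
                   \<le> w1 * (N (poly_fun f - mult_op (\<lambda>z. z) (poly_fun f)))\<^sup>2));
         II = (\<exists>w1. W1 w1);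
         W2 = (\<lambda>w2. 0 \<le> w2 \<and> (\<forall>f :: 'e poly.
                 Re (measure_form (tilde_measure \<mu>) f f) \<le> w2 * (N (poly_fun f))\<^sup>2));
         III = (tilde_is_operator_measure \<mu> \<and> (\<exists>w2. W2 w2))
     in (I \<longleftrightarrow> II) \<and> (II \<longleftrightarrow> III) \<and>
        (I \<or> II \<or> III \<longrightarrow>
           two_isometric_semigroup_on X N S \<and>
           is_cogenerator_on X N S (mult_op (\<lambda>z. z)) \<and>
           (\<exists>w. W w) \<and>
           (\<exists>w. is_least W w \<and> is_least W1 w \<and> is_least W2 w))"
proof -
  interpret op_measure \<mu> by (rule op_measure.intro[OF assms])
  let ?X = "dirichlet_space \<mu>" and ?N = "dirichlet_norm \<mu>"
  have W: "(\<lambda>w. 0 \<le> w \<and> quasicontractive_on ?X ?N Sg w) = D.dominated"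
    by (rule ext) (rule quasicontractive_iff)
  have W1: "(\<lambda>w1. 0 \<le> w1 \<and> (\<forall>f :: 'e poly. Re (measure_form \<mu> f f)
      \<le> w1 * (?N (poly_fun f - mult_op (\<lambda>z. z) (poly_fun f)))\<^sup>2)) = D.dominated"
    by (rule ext) (rule poly_bound_iff[unfolded poly_bound_def])
  \<comment> \<open>This inequality by itself does not assert that the weighted measure exists, so
    its equivalence with \<open>D.dominated\<close> carries that assertion as a conjunct.\<close>
  define W2 where "W2 = (\<lambda>w2. 0 \<le> w2 \<and> (\<forall>f :: 'e poly.
      Re (measure_form (tilde_measure \<mu>) f f) \<le> w2 * (?N (poly_fun f))\<^sup>2))"
  have W2: "tilde_is_operator_measure \<mu> \<and> W2 w \<longleftrightarrow> D.dominated w" for w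
    unfolding W2_def by (rule tilde_iff[unfolded tilde_bound_def])
  have I: "(\<forall>t\<ge>0. bounded_operator_on ?X ?N (Sg t)) \<and> C0_semigroup_on ?X ?N Sg \<longleftrightarrow> (\<exists>w. D.dominated w)"
    using semigroup_dominated dominated_semigroup by (auto simp: C0_semigroup_on_def)
  have III: "tilde_is_operator_measure \<mu> \<and> (\<exists>w. W2 w) \<longleftrightarrow> (\<exists>w. D.dominated w)" using W2 by blast
  have "two_isometric_semigroup_on ?X ?N Sg \<and> is_cogenerator_on ?X ?N Sg mz \<and>
      (\<exists>w. is_least D.dominated w \<and> is_least W2 w)" if w: "D.dominated w" for w
  proof -
    \<comment> \<open>One dominated constant already makes the weighted set function an operator
      measure, which discharges the conjunct for all other constants; the least constants then
      coincide.\<close>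
    have "W2 = D.dominated"
      using W2 w by (auto simp: fun_eq_iff)
    then show ?thesis
      using dominated_two_isometric_semigroup[OF w] dominated_cogenerator[OF w] D.dominated_Inf[OF w] by blast
  qed
  then show ?thesis
    unfolding Let_def W W1 W2_def[symmetric] I III by blast
qed

end
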